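(* Let $s>2$. The initial value problem for the inviscid SQG equation $$\partial_t\theta+(u\cdot\nabla)\theta=0,\qquad \theta(0)=\theta_0,\qquad u=(-\mathcal R_2\theta,\mathcal R_1\theta),$$ on $\mathbb R^2$ is locally well-posed in the Sobolev space $H^s(\mathbb R^2)$. That is, for every initial value in $H^s(\mathbb R^2)$ there exists, on some time interval $[0,T]$ with $T>0$, a solution; solutions with the same initial value are unique; and the solution depends continuously on the initial value. The precise meaning is given in the context.
   Context: $H^s(\mathbb R^2)$ is the real-valued $L^2$-based Sobolev space. The Riesz transforms are $\mathcal R_k=\partial_k(-\Delta)^{-1/2}$, $k=1,2$ (Fourier multipliers with symbol $i\xi_k/|\xi|$). For $s>2$, $T>0$ and $\theta_0\in H^s(\mathbb R^2)$, a function $\theta\in C([0,T];H^s(\mathbb R^2))$ is called a solution on $[0,T]$ if, with $u=(-\mathcal R_2\theta,\mathcal R_1\theta)$, $$\theta(t)=\theta_0+\int_0^t-(u\cdot\nabla)\theta\,ds\qquad\text{for all }0\le t\le T,$$ as an equality in $H^{s-1}(\mathbb R^2)$. Locally well-posed has the usual meaning. For every $\theta_0^*\in H^s(\mathbb R^2)$ there are $T>0$ and a neighbourhood $W$ of $\theta_0^*$ in $H^s(\mathbb R^2)$ such that for every $\theta_0\in W$ there is a solution $\theta\in C([0,T];H^s(\mathbb R^2))$ with initial value $\theta_0$, and the map $W\to C([0,T];H^s(\mathbb R^2))$, $\theta_0\mapsto\theta$, is continuous. Moreover, any two solutions on a common interval with the same initial value coincide. *)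

theory Defs
  imports "HOL-Analysis.Analysis"
begin

text \<open>
  Elements of \<open>L\<^sup>2(\<real>\<^sup>2)\<close> and \<open>H\<^sup>s(\<real>\<^sup>2)\<close> are represented by Borel functions; equality in these
  spaces is equality almost everywhere (\<open>ae_eq\<close>), and \<open>sobolev_norm s\<close> is accordingly a seminorm on
  representatives whose kernel is \<open>ae_eq\<close> to zero.
\<close>

definition ae_eq :: "(real^2 \<Rightarrow> 'b) \<Rightarrow> (real^2 \<Rightarrow> 'b) \<Rightarrow> bool" where
  "ae_eq f g \<longleftrightarrow> (AE x in lborel. f x = g x)"

definition L2 :: "(real^2 \<Rightarrow> 'b::{real_normed_vector, second_countable_topology}) set" where
  "L2 = {f \<in> borel_measurable lborel. integrable lborel (\<lambda>x. (norm (f x))\<^sup>2)}"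

text \<open>
  The unitary Fourier transform on \<open>L\<^sup>2\<close>, as the \<open>L\<^sup>2\<close>-limit for \<open>R \<rightarrow> \<infinity>\<close> of the Fourier integrals
  \<open>(2\<pi>)\<^sup>-\<^sup>1 \<integral> e\<^sup>-\<^sup>i\<^sup>x\<^sup>\<xi> f(x) dx\<close> over \<open>|x| \<le> R\<close>.
\<close>

definition truncated_fourier :: "real \<Rightarrow> (real^2 \<Rightarrow> real) \<Rightarrow> real^2 \<Rightarrow> complex" where
  "truncated_fourier R f \<xi> =
     (LINT x:cball 0 R|lborel. cis (- (x \<bullet> \<xi>)) * complex_of_real (f x)) / complex_of_real (2 * pi)"

definition is_fourier :: "(real^2 \<Rightarrow> real) \<Rightarrow> (real^2 \<Rightarrow> complex) \<Rightarrow> bool" where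
  "is_fourier f F \<longleftrightarrow> F \<in> L2 \<and>
     ((\<lambda>R. \<integral>\<^sup>+ \<xi>. ennreal ((cmod (truncated_fourier R f \<xi> - F \<xi>))\<^sup>2) \<partial>lborel) \<longlongrightarrow> 0) at_top"

definition fourier :: "(real^2 \<Rightarrow> real) \<Rightarrow> real^2 \<Rightarrow> complex" where
  "fourier f = (SOME F. is_fourier f F)"

definition sobolev :: "real \<Rightarrow> (real^2 \<Rightarrow> real) set" where
  "sobolev s = {f \<in> L2.
     integrable lborel (\<lambda>\<xi>. (1 + (norm \<xi>)\<^sup>2) powr s * (cmod (fourier f \<xi>))\<^sup>2)}"
  \<comment> \<open>intended for \<open>s \<ge> 0\<close>, where \<open>H\<^sup>s\<close> is contained in \<open>L\<^sup>2\<close>\<close>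

definition sobolev_norm :: "real \<Rightarrow> (real^2 \<Rightarrow> real) \<Rightarrow> real" where
  "sobolev_norm s f =
     sqrt (LINT \<xi>|lborel. (1 + (norm \<xi>)\<^sup>2) powr s * (cmod (fourier f \<xi>))\<^sup>2)"

text \<open>
  The result is determined up to \<open>ae_eq\<close>. A real-valued result exists when the symbol \<open>m\<close> is
  Hermitian, \<open>m (-\<xi>) = cnj (m \<xi>)\<close>, and \<open>m \<cdot> fourier f\<close> is in \<open>L\<^sup>2\<close>.
\<close>

definition fourier_multiplier :: "(real^2 \<Rightarrow> complex) \<Rightarrow> (real^2 \<Rightarrow> real) \<Rightarrow> real^2 \<Rightarrow> real" where
  "fourier_multiplier m f = (SOME g. g \<in> L2 \<and> ae_eq (fourier g) (\<lambda>\<xi>. m \<xi> * fourier f \<xi>))"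

definition partial :: "2 \<Rightarrow> (real^2 \<Rightarrow> real) \<Rightarrow> real^2 \<Rightarrow> real" where
  "partial k = fourier_multiplier (\<lambda>\<xi>. \<i> * complex_of_real (\<xi> $ k))"

definition riesz :: "2 \<Rightarrow> (real^2 \<Rightarrow> real) \<Rightarrow> real^2 \<Rightarrow> real" where
  "riesz k = fourier_multiplier (\<lambda>\<xi>. \<i> * complex_of_real (\<xi> $ k / norm \<xi>))"

definition sqg_velocity :: "(real^2 \<Rightarrow> real) \<Rightarrow> real^2 \<Rightarrow> real^2" where
  "sqg_velocity \<theta> x = vector [- riesz 2 \<theta> x, riesz 1 \<theta> x]"

definition advection :: "(real^2 \<Rightarrow> real^2) \<Rightarrow> (real^2 \<Rightarrow> real) \<Rightarrow> real^2 \<Rightarrow> real" where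
  "advection u \<theta> x = (\<Sum>k\<in>UNIV. u x $ k * partial k \<theta> x)"

definition sobolev_continuous_on :: "real \<Rightarrow> real set \<Rightarrow> (real \<Rightarrow> real^2 \<Rightarrow> real) \<Rightarrow> bool" where
  "sobolev_continuous_on s I \<theta> \<longleftrightarrow> (\<forall>t\<in>I. \<theta> t \<in> sobolev s) \<and>
     (\<forall>t\<in>I. ((\<lambda>\<tau>. sobolev_norm s (\<lambda>x. \<theta> \<tau> x - \<theta> t x)) \<longlongrightarrow> 0) (at t within I))"

text \<open>
  The integral of an \<open>H\<^sup>s\<close>-valued function: \<open>has_integral\<close> on an interval, with the type class norm
  replaced by the norm of \<open>H\<^sup>s\<close>. For continuous integrands this is the Riemann integral.
\<close>

definition has_sobolev_integral ::
    "real \<Rightarrow> (real \<Rightarrow> real^2 \<Rightarrow> real) \<Rightarrow> (real^2 \<Rightarrow> real) \<Rightarrow> real \<Rightarrow> real \<Rightarrow> bool" where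
  "has_sobolev_integral s F v a b \<longleftrightarrow> (\<forall>\<tau>\<in>{a..b}. F \<tau> \<in> sobolev s) \<and> v \<in> sobolev s \<and>
     ((\<lambda>p. sobolev_norm s (\<lambda>x. (\<Sum>(\<tau>, k)\<in>p. measure lborel k * F \<tau> x) - v x)) \<longlongrightarrow> 0)
       (division_filter {a..b})"

definition sqg_solution ::
    "real \<Rightarrow> real \<Rightarrow> (real^2 \<Rightarrow> real) \<Rightarrow> (real \<Rightarrow> real^2 \<Rightarrow> real) \<Rightarrow> bool" where
  "sqg_solution s T \<theta>\<^sub>0 \<theta> \<longleftrightarrow> \<theta>\<^sub>0 \<in> sobolev s \<and> sobolev_continuous_on s {0..T} \<theta> \<and>
     (\<forall>t\<in>{0..T}. \<exists>v.
        has_sobolev_integral (s - 1) (\<lambda>\<tau> x. - advection (sqg_velocity (\<theta> \<tau>)) (\<theta> \<tau>) x) v 0 t \<and>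
        ae_eq (\<theta> t) (\<lambda>x. \<theta>\<^sub>0 x + v x))"

definition sobolev_neighbourhood :: "real \<Rightarrow> (real^2 \<Rightarrow> real) \<Rightarrow> (real^2 \<Rightarrow> real) set \<Rightarrow> bool" where
  "sobolev_neighbourhood s f W \<longleftrightarrow> W \<subseteq> sobolev s \<and>
     (\<exists>r>0. {g \<in> sobolev s. sobolev_norm s (\<lambda>x. g x - f x) < r} \<subseteq> W)"

text \<open>Continuity from \<open>W \<subseteq> H\<^sup>s\<close> to \<open>C([0,T]; H\<^sup>s)\<close> with the topology of uniform convergence.\<close>

definition continuous_solution_map ::
    "real \<Rightarrow> real \<Rightarrow> (real^2 \<Rightarrow> real) set \<Rightarrow> ((real^2 \<Rightarrow> real) \<Rightarrow> real \<Rightarrow> real^2 \<Rightarrow> real) \<Rightarrow> bool" where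
  "continuous_solution_map s T W \<Phi> \<longleftrightarrow>
     (\<forall>f\<in>W. \<forall>\<epsilon>>0. \<exists>\<delta>>0. \<forall>g\<in>W. sobolev_norm s (\<lambda>x. g x - f x) < \<delta> \<longrightarrow>
        (\<forall>t\<in>{0..T}. sobolev_norm s (\<lambda>x. \<Phi> g t x - \<Phi> f t x) < \<epsilon>))"

definition sqg_locally_well_posed :: "real \<Rightarrow> bool" where
  "sqg_locally_well_posed s \<longleftrightarrow>
     (\<forall>\<theta>s\<in>sobolev s. \<exists>T>0. \<exists>W \<Phi>. sobolev_neighbourhood s \<theta>s W \<and>
        (\<forall>\<theta>\<^sub>0\<in>W. sqg_solution s T \<theta>\<^sub>0 (\<Phi> \<theta>\<^sub>0)) \<and> continuous_solution_map s T W \<Phi>) \<and>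
     (\<forall>T>0. \<forall>\<theta>\<^sub>0 \<theta> \<theta>'. sqg_solution s T \<theta>\<^sub>0 \<theta> \<and> sqg_solution s T \<theta>\<^sub>0 \<theta>' \<longrightarrow>
        (\<forall>t\<in>{0..T}. ae_eq (\<theta> t) (\<theta>' t)))"

end

theory Submission
  imports Defs "HOL-Probability.Probability"
begin

text \<open>
  Write \<open>\<langle>\<xi>\<rangle>\<close> for \<open>sqrt (1 + \<bar>\<xi>\<bar>\<^sup>2)\<close> and \<open>F\<close> for the Fourier transform. An element \<open>f\<close> of \<open>H\<^sup>s\<close> is encoded by
  \<open>y = \<langle>\<xi>\<rangle>\<^sup>s F f\<close>, an element of the Hilbert space of square-integrable functions. In this variable the equation
  becomes \<open>\<langle>\<xi>\<rangle>\<^sup>-\<^sup>1 dy/dt = - B(y, y)\<close>, where \<open>B\<close> is a bounded convolution operator whose kernel contains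
  the factor \<open>det (\<eta>, \<xi> - \<eta>) / \<bar>\<xi> - \<eta>\<bar>\<close>; boundedness is Young's inequality together with
  \<open>\<langle>\<xi>\<rangle>\<^sup>1\<^sup>-\<^sup>s \<in> L\<^sup>2(\<real>\<^sup>2)\<close>, which is where \<open>s > 2\<close> enters. Since the velocity is divergence free the kernel is skew up to a
  commutator with the weight, and this gives \<open>(\<bar>y\<bar>\<^sup>2)' \<le> 2 C \<bar>y\<bar>\<^sup>3\<close> for the Galerkin truncations, hence a common time of
  existence, and an energy estimate in \<open>L\<^sup>2\<close> for differences of solutions, hence uniqueness and convergence in \<open>L\<^sup>2\<close>.

  The same commutator estimate holds, with a constant independent of \<open>R\<close>, for the weights \<open>\<langle>\<xi>\<rangle>\<^sup>s min(1, \<langle>\<xi>\<rangle>/R)\<close>. It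
  bounds the high frequencies of the solutions uniformly by those of the initial values, so that convergence in \<open>L\<^sup>2\<close>
  improves to convergence in \<open>H\<^sup>s\<close>, both for the truncations and for varying initial values.
\<close>

text \<open>The obstacle is the loss of one derivative. The difference \<open>d\<close> of two
  solutions \<open>y\<close>, \<open>z\<close> obeys an equation with the terms \<open>B y d\<close>
  and \<open>B d z\<close>. The first is transport of \<open>d\<close> and cancels by skewness; the
  second differentiates \<open>z\<close>, which in the norm of H^s would require \<open>z\<close> in
  H^(s+1), whereas in L^2 a bound of \<open>z\<close> in H^s is enough. So neither a contraction nor
  a Lipschitz bound of the solution map is at hand in H^s: differences are compared in L^2, and the
  rest has to come from the tails.

  This dictates the shape of the tail weight. A sharp cutoff at frequency \<open>R\<close> jumps, so
  that its commutator with the transport gains nothing. The ramp grows at most linearly, and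
  multiplying the Sobolev weight by it acts like raising the exponent by at most one.

  The cancellation also requires a real velocity, which is why Hermitian functions appear
  throughout.

  The transform \<open>fourier\<close> is a limit chosen by \<open>SOME\<close>. Its existence,
  isometry and inversion are derived from Gaussian averages and the continuity of
  translations.\<close>

section \<open>Square-integrable functions\<close>

lemma L2_measurable: "f \<in> L2 \<Longrightarrow> f \<in> borel_measurable borel"
  by (simp add: L2_def)

lemma L2_iff_nn_integral:
  fixes f :: "real^2 \<Rightarrow> 'b::{real_normed_vector, second_countable_topology}"
  shows "f \<in> L2 \<longleftrightarrow> f \<in> borel_measurable borel \<and> (\<integral>\<^sup>+x. ennreal ((norm (f x))\<^sup>2) \<partial>lborel) < \<infinity>"
proof -
  have "f \<in> borel_measurable borel \<Longrightarrow> (\<lambda>x. (norm (f x))\<^sup>2) \<in> borel_measurable borel"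
    by measurable
  then show ?thesis
    by (auto simp: L2_def integrable_iff_bounded)
qed

lemma L2_bound:
  fixes f :: "real^2 \<Rightarrow> 'b::{real_normed_vector, second_countable_topology}"
    and g :: "real^2 \<Rightarrow> 'c::{real_normed_vector, second_countable_topology}"
  assumes "f \<in> L2" "g \<in> borel_measurable borel" "AE x in lborel. norm (g x) \<le> C * norm (f x)"
  shows "g \<in> L2"
proof -
  have [measurable]: "g \<in> borel_measurable borel" "f \<in> borel_measurable borel"
    using assms by (auto simp: L2_def)
  have "integrable lborel (\<lambda>x. C\<^sup>2 * (norm (f x))\<^sup>2)"
    using assms by (auto simp: L2_def)
  then have "integrable lborel (\<lambda>x. (norm (g x))\<^sup>2)"
  proof (rule Bochner_Integration.integrable_bound)
    show "AE x in lborel. norm ((norm (g x))\<^sup>2) \<le> norm (C\<^sup>2 * (norm (f x))\<^sup>2)"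
      using assms(3)
    proof eventually_elim
      case (elim x)
      then have "(norm (g x))\<^sup>2 \<le> (C * norm (f x))\<^sup>2"
        by (intro power_mono) auto
      then show ?case by (simp add: power_mult_distrib)
    qed
  qed measurable
  then show ?thesis using assms(2) by (auto simp: L2_def)
qed

lemma L2_mult_integrable:
  fixes f :: "real^2 \<Rightarrow> 'b::{real_normed_vector, second_countable_topology}"
    and g :: "real^2 \<Rightarrow> 'c::{real_normed_vector, second_countable_topology}"
  assumes "f \<in> L2" "g \<in> L2"
  shows "integrable lborel (\<lambda>x. norm (f x) * norm (g x))"
proof -
  have [measurable]: "g \<in> borel_measurable borel" "f \<in> borel_measurable borel"
    using assms by (auto simp: L2_def)
  have "integrable lborel (\<lambda>x. (norm (f x))\<^sup>2 + (norm (g x))\<^sup>2)"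
    using assms by (auto simp: L2_def)
  then show ?thesis
  proof (rule Bochner_Integration.integrable_bound)
    have "norm (norm (f x) * norm (g x)) \<le> norm ((norm (f x))\<^sup>2 + (norm (g x))\<^sup>2)" for x
    proof -
      have "0 \<le> (norm (f x) - norm (g x))\<^sup>2" by simp
      moreover have "0 \<le> norm (f x) * norm (g x)" by simp
      ultimately have "norm (f x) * norm (g x) \<le> (norm (f x))\<^sup>2 + (norm (g x))\<^sup>2"
        unfolding power2_diff by linarith
      then show ?thesis by simp
    qed
    then show "AE x in lborel. norm (norm (f x) * norm (g x)) \<le> norm ((norm (f x))\<^sup>2 + (norm (g x))\<^sup>2)"
      by simp
  qed measurable
qed

lemma L2_add:
  fixes f g :: "real^2 \<Rightarrow> 'b::{real_normed_vector, second_countable_topology}"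
  assumes "f \<in> L2" "g \<in> L2"
  shows "(\<lambda>x. f x + g x) \<in> L2"
proof -
  have [measurable]: "g \<in> borel_measurable borel" "f \<in> borel_measurable borel"
    using assms by (auto simp: L2_def)
  have "integrable lborel (\<lambda>x. (norm (f x))\<^sup>2 + (norm (g x))\<^sup>2 + 2 * (norm (f x) * norm (g x)))"
    using assms L2_mult_integrable[OF assms] by (auto simp: L2_def)
  then have "integrable lborel (\<lambda>x. (norm (f x + g x))\<^sup>2)"
  proof (rule Bochner_Integration.integrable_bound)
    have "norm ((norm (f x + g x))\<^sup>2) \<le> norm ((norm (f x))\<^sup>2 + (norm (g x))\<^sup>2 + 2 * (norm (f x) * norm (g x)))" for x
    proof -
      have "(norm (f x + g x))\<^sup>2 \<le> (norm (f x) + norm (g x))\<^sup>2"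
        by (intro power_mono norm_triangle_ineq) simp
      then show ?thesis by (simp add: power2_sum)
    qed
    then show "AE x in lborel. norm ((norm (f x + g x))\<^sup>2) \<le> norm ((norm (f x))\<^sup>2 + (norm (g x))\<^sup>2 + 2 * (norm (f x) * norm (g x)))"
      by simp
  qed measurable
  then show ?thesis by (auto simp: L2_def)
qed

lemma L2_scaleR:
  fixes f :: "real^2 \<Rightarrow> 'b::{real_normed_vector, second_countable_topology}"
  assumes "f \<in> L2"
  shows "(\<lambda>x. c *\<^sub>R f x) \<in> L2"
  by (rule L2_bound[OF assms, where C = "\<bar>c\<bar>"]) (use assms in \<open>auto simp: L2_def\<close>)

lemma L2_diff:
  fixes f g :: "real^2 \<Rightarrow> 'b::{real_normed_vector, second_countable_topology}"
  assumes "f \<in> L2" "g \<in> L2"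
  shows "(\<lambda>x. f x - g x) \<in> L2"
  using L2_add[OF assms(1) L2_scaleR[OF assms(2), of "-1"]] by simp

lemma L2_zero: "(\<lambda>x. 0) \<in> L2"
  by (simp add: L2_def)

subsection \<open>The Hilbert space of square-integrable functions\<close>

definition l2rel :: "(real^2 \<Rightarrow> complex) \<Rightarrow> (real^2 \<Rightarrow> complex) \<Rightarrow> bool" where
  "l2rel f g \<longleftrightarrow> f \<in> L2 \<and> g \<in> L2 \<and> ae_eq f g"

\<comment> \<open>A type, rather than functions modulo \<open>ae_eq\<close>, gives access to
  everything formulated for the classes \<open>real_inner\<close> and \<open>banach\<close>:
  derivatives, integrals of vector-valued functions, bounded linear maps, the fixed point theorem.
  The relation is partial because only functions in \<open>L2\<close> have a class.\<close>
quotient_type l2 = "real^2 \<Rightarrow> complex" / partial: l2rel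
proof (rule part_equivpI)
  show "\<exists>x. l2rel x x"
    using L2_zero by (auto simp: l2rel_def ae_eq_def)
  show "symp l2rel"
    by (auto simp: symp_def l2rel_def ae_eq_def)
  show "transp l2rel"
    by (auto simp: transp_def l2rel_def ae_eq_def)
qed

lemma rep_l2_in [simp]: "rep_l2 a \<in> L2"
  using Quotient3_rel_rep[OF Quotient3_l2, of a a] by (simp add: l2rel_def)

lemma rep_l2_measurable [measurable]: "rep_l2 a \<in> borel_measurable borel"
  by (rule L2_measurable) simp

lemma abs_rep_l2 [simp]: "abs_l2 (rep_l2 a) = a"
  by (rule Quotient3_abs_rep[OF Quotient3_l2])

lemma abs_l2_eq_iff: "f \<in> L2 \<Longrightarrow> g \<in> L2 \<Longrightarrow> abs_l2 f = abs_l2 g \<longleftrightarrow> (AE x in lborel. f x = g x)"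
  using Quotient3_rel[OF Quotient3_l2, of f g] by (simp add: l2rel_def ae_eq_def)

lemma rep_abs_l2: "f \<in> L2 \<Longrightarrow> AE x in lborel. rep_l2 (abs_l2 f) x = f x"
  using abs_l2_eq_iff[of "rep_l2 (abs_l2 f)" f] by simp

lemma l2_eqI: "(AE x in lborel. rep_l2 a x = rep_l2 b x) \<Longrightarrow> a = b"
  using abs_l2_eq_iff[of "rep_l2 a" "rep_l2 b"] by simp

instantiation l2 :: real_inner
begin

definition "0 = abs_l2 (\<lambda>_. 0)"
definition "a + b = abs_l2 (\<lambda>x. rep_l2 a x + rep_l2 b x)"
definition "a - b = abs_l2 (\<lambda>x. rep_l2 a x - rep_l2 b x)"
definition "- a = abs_l2 (\<lambda>x. - rep_l2 a x)"
definition "c *\<^sub>R a = abs_l2 (\<lambda>x. c *\<^sub>R rep_l2 a x)"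
text \<open>The inner product of \<open>complex\<close> is that of a real vector space, so this is
  the real part of the Hermitian product. Reflection and conjugation, which enter below, are
  real-linear only.\<close>

definition inner_l2_def: "a \<bullet> b = (LINT x|lborel. rep_l2 a x \<bullet> rep_l2 b x)"
definition norm_l2_def: "norm (a::l2) = sqrt (a \<bullet> a)"
definition dist_l2_def: "dist (a::l2) b = norm (a - b)"
definition sgn_l2_def: "sgn (a::l2) = inverse (norm a) *\<^sub>R a"
definition uniformity_l2_def: "uniformity = (INF e\<in>{0<..}. principal {(x, y). dist x (y::l2) < e})"
definition open_l2_def: "open (U :: l2 set) \<longleftrightarrow> (\<forall>x\<in>U. eventually (\<lambda>(x', y). x' = x \<longrightarrow> y \<in> U) uniformity)"

lemma rep_zero_l2: "AE x in lborel. rep_l2 0 x = 0"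
  unfolding zero_l2_def by (rule rep_abs_l2[OF L2_zero])

lemma rep_add_l2: "AE x in lborel. rep_l2 (a + b) x = rep_l2 a x + rep_l2 b x"
  unfolding plus_l2_def by (rule rep_abs_l2) (intro L2_add rep_l2_in)

lemma rep_diff_l2: "AE x in lborel. rep_l2 (a - b) x = rep_l2 a x - rep_l2 b x"
  unfolding minus_l2_def by (rule rep_abs_l2) (intro L2_diff rep_l2_in)

lemma rep_uminus_l2: "AE x in lborel. rep_l2 (- a) x = - rep_l2 a x"
  unfolding uminus_l2_def using rep_abs_l2[OF L2_scaleR[OF rep_l2_in[of a], of "-1"]] by simp

lemma rep_scaleR_l2: "AE x in lborel. rep_l2 (c *\<^sub>R a) x = c *\<^sub>R rep_l2 a x"
  unfolding scaleR_l2_def by (rule rep_abs_l2) (intro L2_scaleR rep_l2_in)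

lemma integrable_inner_rep_l2: "integrable lborel (\<lambda>x. rep_l2 a x \<bullet> rep_l2 b x)"
  by (rule Bochner_Integration.integrable_bound[OF L2_mult_integrable[OF rep_l2_in rep_l2_in, of a b]])
     (auto intro!: Cauchy_Schwarz_ineq2)

instance
proof
  fix a b c :: l2 and r s :: real
  show "a + b + c = a + (b + c)"
    by (rule l2_eqI) (use rep_add_l2[of a b] rep_add_l2[of "a + b" c] rep_add_l2[of a "b + c"] rep_add_l2[of b c]
      in \<open>eventually_elim, simp\<close>)
  show "a + b = b + a"
    by (rule l2_eqI) (use rep_add_l2[of a b] rep_add_l2[of b a] in \<open>eventually_elim, simp\<close>)
  show "0 + a = a"
    by (rule l2_eqI) (use rep_add_l2[of 0 a] rep_zero_l2 in \<open>eventually_elim, simp\<close>)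
  show "- a + a = 0"
    by (rule l2_eqI) (use rep_add_l2[of "- a" a] rep_uminus_l2[of a] rep_zero_l2 in \<open>eventually_elim, simp\<close>)
  show "a - b = a + - b"
    by (rule l2_eqI) (use rep_diff_l2[of a b] rep_add_l2[of a "- b"] rep_uminus_l2[of b] in \<open>eventually_elim, simp\<close>)
  show "r *\<^sub>R (a + b) = r *\<^sub>R a + r *\<^sub>R b"
    by (rule l2_eqI) (use rep_scaleR_l2[of r "a + b"] rep_add_l2[of a b] rep_add_l2[of "r *\<^sub>R a" "r *\<^sub>R b"]
        rep_scaleR_l2[of r a] rep_scaleR_l2[of r b] in \<open>eventually_elim, simp add: algebra_simps\<close>)
  show "(r + s) *\<^sub>R a = r *\<^sub>R a + s *\<^sub>R a"
    by (rule l2_eqI) (use rep_scaleR_l2[of "r + s" a] rep_add_l2[of "r *\<^sub>R a" "s *\<^sub>R a"]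
        rep_scaleR_l2[of r a] rep_scaleR_l2[of s a] in \<open>eventually_elim, simp add: algebra_simps\<close>)
  show "r *\<^sub>R s *\<^sub>R a = (r * s) *\<^sub>R a"
    by (rule l2_eqI) (use rep_scaleR_l2[of r "s *\<^sub>R a"] rep_scaleR_l2[of s a] rep_scaleR_l2[of "r * s" a]
        in \<open>eventually_elim, simp\<close>)
  show "1 *\<^sub>R a = a"
    by (rule l2_eqI) (use rep_scaleR_l2[of 1 a] in \<open>eventually_elim, simp\<close>)
  show "dist a b = norm (a - b)" by (rule dist_l2_def)
  show "sgn a = inverse (norm a) *\<^sub>R a" by (rule sgn_l2_def)
  show "uniformity = (INF e\<in>{0<..}. principal {(x, y). dist x (y::l2) < e})" by (rule uniformity_l2_def)
  show "open U \<longleftrightarrow> (\<forall>x\<in>U. eventually (\<lambda>(x', y). x' = x \<longrightarrow> y \<in> U) uniformity)" for U :: "l2 set"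
    by (rule open_l2_def)
  show "a \<bullet> b = b \<bullet> a" by (simp add: inner_l2_def inner_commute)
  show "(a + b) \<bullet> c = a \<bullet> c + b \<bullet> c"
  proof -
    have "(a + b) \<bullet> c = (LINT x|lborel. rep_l2 a x \<bullet> rep_l2 c x + rep_l2 b x \<bullet> rep_l2 c x)"
      unfolding inner_l2_def
      by (rule integral_cong_AE, measurable)
         (use rep_add_l2[of a b] in \<open>eventually_elim, simp add: inner_add_left\<close>)
    then show ?thesis by (simp add: inner_l2_def integrable_inner_rep_l2)
  qed
  show "(r *\<^sub>R a) \<bullet> b = r * (a \<bullet> b)"
  proof -
    have "(r *\<^sub>R a) \<bullet> b = (LINT x|lborel. r * (rep_l2 a x \<bullet> rep_l2 b x))"
      unfolding inner_l2_def
      by (rule integral_cong_AE, measurable)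
         (use rep_scaleR_l2[of r a] in \<open>eventually_elim, simp\<close>)
    then show ?thesis by (simp add: inner_l2_def)
  qed
  show "0 \<le> a \<bullet> a" by (simp add: inner_l2_def)
  show "a \<bullet> a = 0 \<longleftrightarrow> a = 0"
  proof
    assume "a \<bullet> a = 0"
    then have "AE x in lborel. rep_l2 a x \<bullet> rep_l2 a x = 0"
      unfolding inner_l2_def by (subst (asm) integral_nonneg_eq_0_iff_AE) (auto simp: integrable_inner_rep_l2)
    then have "AE x in lborel. rep_l2 a x = 0" by simp
    with rep_zero_l2 have "AE x in lborel. rep_l2 a x = rep_l2 0 x" by eventually_elim simp
    then show "a = 0" by (rule l2_eqI)
  next
    assume "a = 0"
    have "(LINT x|lborel. rep_l2 0 x \<bullet> rep_l2 0 x) = (LINT x|(lborel::(real^2) measure). 0)"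
      by (rule integral_cong_AE, measurable) (use rep_zero_l2 in \<open>eventually_elim, simp\<close>)
    then show "a \<bullet> a = 0" by (simp add: inner_l2_def \<open>a = 0\<close>)
  qed
  show "norm a = sqrt (a \<bullet> a)" by (rule norm_l2_def)
qed

end

lemma norm_l2_sq: "(norm a)\<^sup>2 = (LINT x|lborel. (cmod (rep_l2 a x))\<^sup>2)"
  unfolding power2_norm_eq_inner inner_l2_def by (simp add: power2_norm_eq_inner)

lemma nn_integral_rep_l2: "(\<integral>\<^sup>+x. ennreal ((cmod (rep_l2 a x))\<^sup>2) \<partial>lborel) = ennreal ((norm a)\<^sup>2)"
  unfolding norm_l2_sq using rep_l2_in[of a]
  by (intro nn_integral_eq_integral) (auto simp: L2_def)

lemma nn_integral_L2_abs: "f \<in> L2 \<Longrightarrow> (\<integral>\<^sup>+x. ennreal ((cmod (f x))\<^sup>2) \<partial>lborel) = ennreal ((norm (abs_l2 f))\<^sup>2)"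
  unfolding nn_integral_rep_l2[symmetric]
  by (rule nn_integral_cong_AE) (use rep_abs_l2[of f] in \<open>auto elim!: eventually_mono\<close>)

lemma norm_abs_l2_sq:
  assumes "f \<in> L2"
  shows "(norm (abs_l2 f))\<^sup>2 = (LINT x|lborel. (cmod (f x))\<^sup>2)"
  unfolding norm_l2_sq
  by (rule integral_cong_AE) (use rep_abs_l2[OF assms] L2_measurable[OF assms] in \<open>auto elim!: eventually_mono\<close>)

lemma inner_abs_l2:
  assumes "f \<in> L2" "g \<in> L2"
  shows "abs_l2 f \<bullet> abs_l2 g = (LINT x|lborel. f x \<bullet> g x)"
  unfolding inner_l2_def
proof (rule integral_cong_AE)
  have [measurable]: "f \<in> borel_measurable borel" "g \<in> borel_measurable borel"
    using assms by (auto simp: L2_measurable)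
  show "(\<lambda>x. f x \<bullet> g x) \<in> borel_measurable lborel" by measurable
  show "AE x in lborel. rep_l2 (abs_l2 f) x \<bullet> rep_l2 (abs_l2 g) x = f x \<bullet> g x"
    using rep_abs_l2[OF assms(1)] rep_abs_l2[OF assms(2)] by eventually_elim simp
qed measurable

lemma abs_l2_add: "f \<in> L2 \<Longrightarrow> g \<in> L2 \<Longrightarrow> abs_l2 (\<lambda>x. f x + g x) = abs_l2 f + abs_l2 g"
  unfolding plus_l2_def
  by (subst abs_l2_eq_iff) (use rep_abs_l2[of f] rep_abs_l2[of g] in \<open>auto intro!: L2_add\<close>)

lemma abs_l2_diff: "f \<in> L2 \<Longrightarrow> g \<in> L2 \<Longrightarrow> abs_l2 (\<lambda>x. f x - g x) = abs_l2 f - abs_l2 g"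
  unfolding minus_l2_def
  by (subst abs_l2_eq_iff) (use rep_abs_l2[of f] rep_abs_l2[of g] in \<open>auto intro!: L2_diff\<close>)

lemma abs_l2_scaleR: "f \<in> L2 \<Longrightarrow> abs_l2 (\<lambda>x. c *\<^sub>R f x) = c *\<^sub>R abs_l2 f"
  unfolding scaleR_l2_def
  by (subst abs_l2_eq_iff) (use rep_abs_l2[of f] in \<open>auto intro!: L2_scaleR\<close>)

lemma abs_l2_sum: "finite A \<Longrightarrow> (\<And>i. i \<in> A \<Longrightarrow> f i \<in> L2) \<Longrightarrow>
   (\<lambda>x. \<Sum>i\<in>A. f i x) \<in> L2 \<and> abs_l2 (\<lambda>x. \<Sum>i\<in>A. f i x) = (\<Sum>i\<in>A. abs_l2 (f i))"
  by (induction rule: finite_induct) (auto simp: zero_l2_def L2_zero L2_add abs_l2_add)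

lemma nn_integral_L2_diff:
  assumes "f \<in> L2"
  shows "(\<integral>\<^sup>+x. ennreal ((cmod (f x - rep_l2 a x))\<^sup>2) \<partial>lborel) = ennreal ((norm (abs_l2 f - a))\<^sup>2)"
  using nn_integral_L2_abs[OF L2_diff[OF assms rep_l2_in[of a]]] assms by (simp add: abs_l2_diff)

text \<open>Fatou's lemma: a closed ball around \<open>a\<close> is stable under almost everywhere
  convergence. Membership of the limit in \<open>L2\<close> is obtained on the way, from its finite
  distance to \<open>a\<close>.\<close>

lemma L2_limit_Fatou:
  fixes f :: "nat \<Rightarrow> real^2 \<Rightarrow> complex"
  assumes f: "\<And>n. f n \<in> L2" and g [measurable]: "g \<in> borel_measurable borel"
    and lim: "AE x in lborel. (\<lambda>n. f n x) \<longlonglongrightarrow> g x"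
    and bnd: "\<forall>\<^sub>F n in sequentially. norm (abs_l2 (f n) - a) \<le> e" and e: "0 \<le> e"
  shows "g \<in> L2 \<and> norm (abs_l2 g - a) \<le> e"
proof -
  have [measurable]: "f n \<in> borel_measurable borel" for n using f L2_measurable by blast
  have "(\<integral>\<^sup>+x. ennreal ((cmod (g x - rep_l2 a x))\<^sup>2) \<partial>lborel)
      = (\<integral>\<^sup>+x. liminf (\<lambda>n. ennreal ((cmod (f n x - rep_l2 a x))\<^sup>2)) \<partial>lborel)"
  proof (rule nn_integral_cong_AE)
    show "AE x in lborel. ennreal ((cmod (g x - rep_l2 a x))\<^sup>2) = liminf (\<lambda>n. ennreal ((cmod (f n x - rep_l2 a x))\<^sup>2))"
      using lim
    proof eventually_elim
      case (elim x)
      have "(\<lambda>n. ennreal ((cmod (f n x - rep_l2 a x))\<^sup>2)) \<longlonglongrightarrow> ennreal ((cmod (g x - rep_l2 a x))\<^sup>2)"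
        by (intro tendsto_ennrealI tendsto_intros elim)
      then show ?case by (intro lim_imp_Liminf[symmetric]) auto
    qed
  qed
  also have "\<dots> \<le> liminf (\<lambda>n. \<integral>\<^sup>+x. ennreal ((cmod (f n x - rep_l2 a x))\<^sup>2) \<partial>lborel)"
    by (rule nn_integral_liminf) measurable
  also have "\<dots> = liminf (\<lambda>n. ennreal ((norm (abs_l2 (f n) - a))\<^sup>2))"
    by (simp add: nn_integral_L2_diff f)
  also have "\<dots> \<le> ennreal (e\<^sup>2)"
  proof -
    have "\<forall>\<^sub>F n in sequentially. ennreal ((norm (abs_l2 (f n) - a))\<^sup>2) \<le> ennreal (e\<^sup>2)"
      using bnd by eventually_elim (auto intro!: ennreal_leI power_mono)
    then have "limsup (\<lambda>n. ennreal ((norm (abs_l2 (f n) - a))\<^sup>2)) \<le> ennreal (e\<^sup>2)"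
      by (rule Limsup_bounded)
    then show ?thesis using Liminf_le_Limsup order_trans trivial_limit_sequentially by blast
  qed
  finally have *: "(\<integral>\<^sup>+x. ennreal ((cmod (g x - rep_l2 a x))\<^sup>2) \<partial>lborel) \<le> ennreal (e\<^sup>2)" .
  then have "(\<lambda>x. g x - rep_l2 a x) \<in> L2"
    by (subst L2_iff_nn_integral) (auto simp: top.not_eq_extremum intro: le_less_trans)
  from L2_add[OF this rep_l2_in[of a]] have g2: "g \<in> L2" by simp
  from * have "ennreal ((norm (abs_l2 g - a))\<^sup>2) \<le> ennreal (e\<^sup>2)"
    by (simp add: nn_integral_L2_diff g2)
  then have "(norm (abs_l2 g - a))\<^sup>2 \<le> e\<^sup>2" by simp
  then show ?thesis using g2 e by (auto intro: power2_le_imp_le)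
qed

lemma L2_dominated_convergence:
  fixes f :: "nat \<Rightarrow> real^2 \<Rightarrow> complex"
  assumes f: "\<And>n. f n \<in> L2" and g: "g \<in> L2" and h: "h \<in> L2"
    and lim: "AE x in lborel. (\<lambda>n. f n x) \<longlonglongrightarrow> g x"
    and dom: "\<And>n. AE x in lborel. cmod (f n x - g x) \<le> norm (h x)"
  shows "(\<lambda>n. abs_l2 (f n)) \<longlonglongrightarrow> abs_l2 g"
proof -
  have [measurable]: "f n \<in> borel_measurable borel" "g \<in> borel_measurable borel" "h \<in> borel_measurable borel" for n
    using f g h L2_measurable by blast+
  have "(\<lambda>n. LINT x|lborel. (cmod (f n x - g x))\<^sup>2) \<longlonglongrightarrow> (LINT x|(lborel::(real^2) measure). 0)"
  proof (rule integral_dominated_convergence)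
    show "integrable lborel (\<lambda>x. (norm (h x))\<^sup>2)" using h by (simp add: L2_def)
    show "AE x in lborel. (\<lambda>i. (cmod (f i x - g x))\<^sup>2) \<longlonglongrightarrow> 0"
      using lim
    proof eventually_elim
      case (elim x)
      have "(\<lambda>i. (cmod (f i x - g x))\<^sup>2) \<longlonglongrightarrow> (cmod (g x - g x))\<^sup>2"
        by (intro tendsto_intros elim)
      then show ?case by simp
    qed
    show "AE x in lborel. norm ((cmod (f i x - g x))\<^sup>2) \<le> (norm (h x))\<^sup>2" for i
      using dom[of i] by eventually_elim (simp add: power_mono)
  qed measurable
  then have "(\<lambda>n. (norm (abs_l2 (f n) - abs_l2 g))\<^sup>2) \<longlonglongrightarrow> 0"
    by (simp add: abs_l2_diff[symmetric] f g L2_diff norm_abs_l2_sq)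
  then have "(\<lambda>n. sqrt ((norm (abs_l2 (f n) - abs_l2 g))\<^sup>2)) \<longlonglongrightarrow> sqrt 0"
    by (rule tendsto_real_sqrt)
  then show ?thesis
    by (simp add: LIM_zero_iff tendsto_norm_zero_iff)
qed

text \<open>Riesz-Fischer: a rapidly convergent subsequence converges almost everywhere, and Fatou's
  lemma shows both that the pointwise limit is in \<open>L2\<close> and that the whole sequence
  approaches it.\<close>

instance l2 :: complete_space
proof
  fix X :: "nat \<Rightarrow> l2" assume C: "Cauchy X"
  have "\<exists>N. \<forall>m\<ge>N. \<forall>n\<ge>N. norm (X m - X n) < (1/2)^k" for k
    using CauchyD[OF C, of "(1/2)^k"] by auto
  then obtain N where N: "\<And>k m n. N k \<le> m \<Longrightarrow> N k \<le> n \<Longrightarrow> norm (X m - X n) < (1/2)^k"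
    by metis
  \<comment> \<open>The sum puts \<open>r k\<close> above every \<open>N j\<close> with
    \<open>j \<le> k\<close> and makes \<open>r\<close> nondecreasing; the summand \<open>k\<close>
    makes it unbounded.\<close>
  define r where "r k = k + (\<Sum>j\<le>k. N j)" for k
  have rN: "N k \<le> r k" for k
    using member_le_sum[of k "{..k}" N] by (simp add: r_def)
  have rk: "k \<le> r k" "r k \<le> r (Suc k)" for k
    by (auto simp: r_def)
  define f where "f k = rep_l2 (X (r k))" for k
  have [measurable]: "f k \<in> borel_measurable borel" for k by (simp add: f_def)
  have d: "norm (X (r (Suc k)) - X (r k)) \<le> (1/2)^k" for k
    using N[of k "r (Suc k)" "r k"] rN[of k] rk(2)[of k] by auto
  \<comment> \<open>The squared differences integrate to at most \<open>(1/4)^k\<close>, so the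
    series stays integrable with the factor \<open>2^k\<close>. Where \<open>S x\<close> is finite,
    this factor forces the differences to decay like \<open>(sqrt (1/2))^k\<close>, which is
    summable.\<close>
  define S where "S x = (\<Sum>k. ennreal (2^k * (cmod (f (Suc k) x - f k x))\<^sup>2))" for x
  have "(\<integral>\<^sup>+x. S x \<partial>lborel) = (\<Sum>k. \<integral>\<^sup>+x. ennreal (2^k * (cmod (f (Suc k) x - f k x))\<^sup>2) \<partial>lborel)"
    unfolding S_def by (rule nn_integral_suminf) measurable
  also have "\<dots> = (\<Sum>k. ennreal (2^k * (norm (X (r (Suc k)) - X (r k)))\<^sup>2))"
  proof (rule suminf_cong)
    fix k
    have "(\<integral>\<^sup>+x. ennreal (2^k * (cmod (f (Suc k) x - f k x))\<^sup>2) \<partial>lborel)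
        = ennreal (2^k) * (\<integral>\<^sup>+x. ennreal ((cmod (f (Suc k) x - f k x))\<^sup>2) \<partial>lborel)"
      by (subst nn_integral_cmult[symmetric]) (auto simp: ennreal_mult)
    also have "\<dots> = ennreal (2^k * (norm (X (r (Suc k)) - X (r k)))\<^sup>2)"
      unfolding f_def by (simp add: nn_integral_L2_diff ennreal_mult)
    finally show "(\<integral>\<^sup>+x. ennreal (2^k * (cmod (f (Suc k) x - f k x))\<^sup>2) \<partial>lborel)
        = ennreal (2^k * (norm (X (r (Suc k)) - X (r k)))\<^sup>2)" .
  qed
  also have "\<dots> \<le> (\<Sum>k. ennreal ((1/2)^k))"
  proof (intro suminf_le ennreal_leI)
    fix k
    have "2^k * (norm (X (r (Suc k)) - X (r k)))\<^sup>2 \<le> 2^k * ((1/2)^k)\<^sup>2"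
      by (intro mult_left_mono power_mono d) auto
    also have "\<dots> = (1/2::real)^k"
      by (simp add: power2_eq_square power_divide)
    finally show "2^k * (norm (X (r (Suc k)) - X (r k)))\<^sup>2 \<le> (1/2)^k" .
  qed auto
  also have "\<dots> < \<infinity>"
    by (subst suminf_ennreal2) (auto intro: summable_geometric)
  finally have fin: "(\<integral>\<^sup>+x. S x \<partial>lborel) \<noteq> \<infinity>" by simp
  have AES: "AE x in lborel. S x \<noteq> \<infinity>"
    by (rule nn_integral_noteq_infinite[OF _ fin]) (simp add: S_def)
  have conv: "AE x in lborel. (\<lambda>k. f k x) \<longlonglongrightarrow> lim (\<lambda>k. f k x)"
    using AES
  proof eventually_elim
    case (elim x)
    then obtain B where B: "S x = ennreal B" "0 \<le> B"
      by (metis ennreal_cases infinity_ennreal_def)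
    have le: "cmod (f (Suc k) x - f k x) \<le> sqrt B * (sqrt (1/2))^k" for k
    proof -
      define h where "h k = ennreal (2^k * (cmod (f (Suc k) x - f k x))\<^sup>2)" for k
      have "sum h {k} \<le> suminf h"
        by (rule sum_le_suminf) auto
      then have "ennreal (2^k * (cmod (f (Suc k) x - f k x))\<^sup>2) \<le> ennreal B"
        unfolding B(1)[symmetric] S_def h_def by simp
      then have "2^k * (cmod (f (Suc k) x - f k x))\<^sup>2 \<le> B" using B(2) by (subst (asm) ennreal_le_iff)
      then have "(cmod (f (Suc k) x - f k x))\<^sup>2 \<le> B * (1/2)^k"
        by (simp add: power_one_over field_simps)
      then have "cmod (f (Suc k) x - f k x) \<le> sqrt (B * (1/2)^k)"
        by (rule real_le_rsqrt)
      then show ?thesis by (simp add: real_sqrt_mult real_sqrt_power)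
    qed
    have "summable (\<lambda>k. sqrt B * (sqrt (1/2))^k)"
      by (intro summable_mult summable_geometric) simp
    then have "summable (\<lambda>k. f (Suc k) x - f k x)"
      by (rule summable_comparison_test'[where N = 0]) (rule le)
    then have "convergent (\<lambda>n. \<Sum>k<n. f (Suc k) x - f k x)"
      by (simp add: summable_iff_convergent)
    then have "convergent (\<lambda>n. f 0 x + (\<Sum>k<n. f (Suc k) x - f k x))"
      by (intro convergent_add convergent_const)
    then have "convergent (\<lambda>n. f n x)"
      by (simp add: sum_lessThan_telescope[of "\<lambda>k. f k x"])
    then show ?case by (simp add: convergent_LIMSEQ_iff)
  qed
  define g where "g x = lim (\<lambda>k. f k x)" for x
  have g: "g \<in> borel_measurable borel"
    unfolding g_def by measurable
  have fL: "f n \<in> L2" for n by (simp add: f_def)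
  have main: "\<exists>M. \<forall>n\<ge>M. g \<in> L2 \<and> norm (abs_l2 g - X n) \<le> e" if "e > 0" for e
  proof -
    obtain M where M: "\<And>m n. m \<ge> M \<Longrightarrow> n \<ge> M \<Longrightarrow> norm (X m - X n) < e"
      using CauchyD[OF C \<open>e > 0\<close>] by auto
    have "g \<in> L2 \<and> norm (abs_l2 g - X n) \<le> e" if "n \<ge> M" for n
    proof (rule L2_limit_Fatou[OF fL g])
      show "AE x in lborel. (\<lambda>n. f n x) \<longlonglongrightarrow> g x" using conv by (simp add: g_def)
      show "\<forall>\<^sub>F k in sequentially. norm (abs_l2 (f k) - X n) \<le> e"
        using eventually_ge_at_top[of M]
      proof eventually_elim
        case (elim k)
        then have "r k \<ge> M" using rk(1)[of k] by linarith
        then show ?case using M[of "r k" n] that by (simp add: f_def)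
      qed
    qed (use \<open>e > 0\<close> in auto)
    then show ?thesis by blast
  qed
  have "X \<longlonglongrightarrow> abs_l2 g"
  proof (rule LIMSEQ_I)
    fix e :: real assume "e > 0"
    then obtain M where "\<forall>n\<ge>M. g \<in> L2 \<and> norm (abs_l2 g - X n) \<le> e/2"
      using main[of "e/2"] by auto
    then show "\<exists>no. \<forall>n\<ge>no. norm (X n - abs_l2 g) < e"
      using \<open>e > 0\<close> by (intro exI[of _ M]) (auto simp: norm_minus_commute intro: le_less_trans)
  qed
  then show "convergent X" by (auto simp: convergent_def)
qed

instance l2 :: banach ..

subsection \<open>Reflections and translations\<close>

lemma lborel_distr_reflect:
  fixes a :: "'a::euclidean_space"
  shows "distr lborel borel (\<lambda>x. a - x) = lborel"
  using lborel_affine[of "-1" a] by (simp add: density_1)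

lemma nn_integral_lborel_reflect:
  fixes f :: "'a::euclidean_space \<Rightarrow> ennreal"
  assumes "f \<in> borel_measurable borel"
  shows "(\<integral>\<^sup>+x. f (a - x) \<partial>lborel) = (\<integral>\<^sup>+x. f x \<partial>lborel)"
  by (subst (2) lborel_distr_reflect[of a, symmetric], subst nn_integral_distr) (use assms in auto)

lemma nn_integral_lborel_translate:
  fixes f :: "'a::euclidean_space \<Rightarrow> ennreal"
  assumes "f \<in> borel_measurable borel"
  shows "(\<integral>\<^sup>+x. f (x - a) \<partial>lborel) = (\<integral>\<^sup>+x. f x \<partial>lborel)"
  by (subst (2) lborel_distr_plus[of "-a", symmetric], subst nn_integral_distr) (use assms in auto)

lemma AE_lborel_reflect:
  fixes a :: "'a::euclidean_space"
  assumes "AE x in lborel. P x"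
  shows "AE x in lborel. P (a - x)"
proof (rule AE_distrD[where f = "\<lambda>x. a - x" and M' = borel])
  show "AE x in distr lborel borel (\<lambda>x. a - x). P x"
    unfolding lborel_distr_reflect by (rule assms)
qed simp

lemma integral_lborel_reflect:
  fixes f :: "'a::euclidean_space \<Rightarrow> 'b::{banach, second_countable_topology}"
  assumes "f \<in> borel_measurable borel"
  shows "(LINT x|lborel. f (a - x)) = (LINT x|lborel. f x)"
  by (subst (2) lborel_distr_reflect[of a, symmetric], subst integral_distr) (use assms in auto)

lemma L2_uminus_arg:
  fixes f :: "real^2 \<Rightarrow> 'b::{real_normed_vector, second_countable_topology}"
  assumes "f \<in> L2"
  shows "(\<lambda>x. f (- x)) \<in> L2"
proof -
  have [measurable]: "f \<in> borel_measurable borel" by (rule L2_measurable[OF assms])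
  have "(\<integral>\<^sup>+x. ennreal ((norm (f (0 - x)))\<^sup>2) \<partial>lborel) = (\<integral>\<^sup>+x. ennreal ((norm (f x))\<^sup>2) \<partial>lborel)"
    by (rule nn_integral_lborel_reflect[of "\<lambda>x. ennreal ((norm (f x))\<^sup>2)"]) measurable
  then show ?thesis using assms by (simp add: L2_iff_nn_integral)
qed

subsection \<open>Bounded multipliers\<close>

definition bounded_weight :: "(real^2 \<Rightarrow> real) \<Rightarrow> bool" where
  "bounded_weight \<phi> \<longleftrightarrow> \<phi> \<in> borel_measurable borel \<and> (\<exists>C. \<forall>x. \<bar>\<phi> x\<bar> \<le> C)"

lemma bounded_weightI: "\<phi> \<in> borel_measurable borel \<Longrightarrow> (\<And>x. \<bar>\<phi> x\<bar> \<le> C) \<Longrightarrow> bounded_weight \<phi>"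
  by (auto simp: bounded_weight_def)

lemma bounded_weight_measurable: "bounded_weight \<phi> \<Longrightarrow> \<phi> \<in> borel_measurable borel"
  by (simp add: bounded_weight_def)

lemma bounded_weight_mult:
  assumes "bounded_weight \<phi>" "bounded_weight \<psi>"
  shows "bounded_weight (\<lambda>x. \<phi> x * \<psi> x)"
proof -
  obtain C1 C2 where C: "\<And>x. \<bar>\<phi> x\<bar> \<le> C1" "\<And>x. \<bar>\<psi> x\<bar> \<le> C2"
    using assms by (auto simp: bounded_weight_def)
  have C1: "0 \<le> C1" using C(1)[of 0] by linarith
  show ?thesis
  proof (rule bounded_weightI[where C = "C1 * C2"])
    show "(\<lambda>x. \<phi> x * \<psi> x) \<in> borel_measurable borel"
      using assms by (auto simp: bounded_weight_def)
    show "\<bar>\<phi> x * \<psi> x\<bar> \<le> C1 * C2" for x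
      unfolding abs_mult by (intro mult_mono C C1) auto
  qed
qed

definition wmul :: "(real^2 \<Rightarrow> real) \<Rightarrow> l2 \<Rightarrow> l2" where
  "wmul \<phi> a = abs_l2 (\<lambda>\<xi>. \<phi> \<xi> *\<^sub>R rep_l2 a \<xi>)"

lemma weight_L2:
  assumes "bounded_weight \<phi>" "f \<in> L2"
  shows "(\<lambda>\<xi>. \<phi> \<xi> *\<^sub>R (f \<xi> :: complex)) \<in> L2"
proof -
  obtain C where C: "\<And>x. \<bar>\<phi> x\<bar> \<le> C" using assms by (auto simp: bounded_weight_def)
  have [measurable]: "f \<in> borel_measurable borel" "\<phi> \<in> borel_measurable borel"
    using assms by (auto simp: bounded_weight_def L2_measurable)
  show ?thesis
  proof (rule L2_bound[OF assms(2), where C = C])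
    show "AE x in lborel. norm (\<phi> x *\<^sub>R f x) \<le> C * norm (f x)"
      using C by (auto intro!: mult_right_mono)
  qed measurable
qed

lemma rep_wmul: "bounded_weight \<phi> \<Longrightarrow> AE \<xi> in lborel. rep_l2 (wmul \<phi> a) \<xi> = \<phi> \<xi> *\<^sub>R rep_l2 a \<xi>"
  unfolding wmul_def by (rule rep_abs_l2) (simp add: weight_L2)

lemma wmul_abs:
  assumes "bounded_weight \<phi>" "f \<in> L2"
  shows "wmul \<phi> (abs_l2 f) = abs_l2 (\<lambda>\<xi>. \<phi> \<xi> *\<^sub>R f \<xi>)"
  unfolding wmul_def using rep_abs_l2[OF assms(2)] assms
  by (subst abs_l2_eq_iff) (auto simp: weight_L2 elim: eventually_mono)

lemma norm_l2_mono:
  assumes "AE \<xi> in lborel. cmod (rep_l2 a \<xi>) \<le> C * cmod (rep_l2 b \<xi>)" "0 \<le> C"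
  shows "norm a \<le> C * norm b"
proof (rule power2_le_imp_le)
  have i: "integrable lborel (\<lambda>x. (cmod (rep_l2 a x))\<^sup>2)" for a
    using rep_l2_in[of a] by (simp add: L2_def)
  have "(norm a)\<^sup>2 \<le> (LINT x|lborel. C\<^sup>2 * (cmod (rep_l2 b x))\<^sup>2)"
    unfolding norm_l2_sq
  proof (intro integral_mono_AE integrable_mult_right i)
    show "AE x in lborel. (cmod (rep_l2 a x))\<^sup>2 \<le> C\<^sup>2 * (cmod (rep_l2 b x))\<^sup>2"
      using assms(1) by eventually_elim (metis norm_ge_zero power_mono power_mult_distrib)
  qed
  then show "(norm a)\<^sup>2 \<le> (C * norm b)\<^sup>2"
    by (simp add: power_mult_distrib norm_l2_sq)
  show "0 \<le> C * norm b" using assms by simp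
qed

lemma norm_wmul_le:
  assumes "bounded_weight \<phi>" "\<And>x. \<bar>\<phi> x\<bar> \<le> C"
  shows "norm (wmul \<phi> a) \<le> C * norm a"
proof (rule norm_l2_mono)
  show "0 \<le> C" using assms(2)[of 0] by linarith
  show "AE \<xi> in lborel. cmod (rep_l2 (wmul \<phi> a) \<xi>) \<le> C * cmod (rep_l2 a \<xi>)"
    using rep_wmul[OF assms(1), of a] by eventually_elim (auto intro!: mult_right_mono assms)
qed

lemma bounded_linear_wmul:
  assumes "bounded_weight \<phi>"
  shows "bounded_linear (wmul \<phi>)"
proof -
  obtain C where C: "\<And>x. \<bar>\<phi> x\<bar> \<le> C" using assms by (auto simp: bounded_weight_def)
  show ?thesis
  proof (rule bounded_linear_intro)
    fix a b :: l2 and r :: real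
    show "wmul \<phi> (a + b) = wmul \<phi> a + wmul \<phi> b"
      by (rule l2_eqI) (use rep_add_l2[of a b] rep_add_l2[of "wmul \<phi> a" "wmul \<phi> b"] rep_wmul[OF assms, of a]
        rep_wmul[OF assms, of b] rep_wmul[OF assms, of "a + b"] in \<open>eventually_elim, simp add: algebra_simps\<close>)
    show "wmul \<phi> (r *\<^sub>R a) = r *\<^sub>R wmul \<phi> a"
      by (rule l2_eqI) (use rep_scaleR_l2[of r a] rep_scaleR_l2[of r "wmul \<phi> a"] rep_wmul[OF assms, of a]
        rep_wmul[OF assms, of "r *\<^sub>R a"] in \<open>eventually_elim, simp\<close>)
    show "norm (wmul \<phi> a) \<le> norm a * C"
      using norm_wmul_le[OF assms C] by (simp add: mult.commute)
  qed
qed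

lemma wmul_wmul:
  assumes "bounded_weight \<phi>" "bounded_weight \<psi>"
  shows "wmul \<phi> (wmul \<psi> a) = wmul (\<lambda>x. \<phi> x * \<psi> x) a"
  by (rule l2_eqI) (use rep_wmul[OF assms(1), of "wmul \<psi> a"] rep_wmul[OF assms(2), of a]
    rep_wmul[OF bounded_weight_mult[OF assms], of a] in \<open>eventually_elim, simp\<close>)

lemma wmul_one: "wmul (\<lambda>_. 1) a = a"
  by (simp add: wmul_def)

lemma inner_wmul:
  assumes "bounded_weight \<phi>"
  shows "wmul \<phi> a \<bullet> b = a \<bullet> wmul \<phi> b"
  unfolding inner_l2_def
  by (rule integral_cong_AE) (measurable, use rep_wmul[OF assms, of a] rep_wmul[OF assms, of b] in \<open>eventually_elim, simp\<close>)

lemma wmul_diff_weight: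
  assumes "bounded_weight \<phi>" "bounded_weight \<psi>" "bounded_weight (\<lambda>x. \<phi> x - \<psi> x)"
  shows "wmul \<phi> a - wmul \<psi> a = wmul (\<lambda>x. \<phi> x - \<psi> x) a"
  by (rule l2_eqI) (use rep_wmul[OF assms(1), of a] rep_wmul[OF assms(2), of a] rep_wmul[OF assms(3), of a]
      rep_diff_l2[of "wmul \<phi> a" "wmul \<psi> a"] in \<open>eventually_elim, simp add: scaleR_diff_left\<close>)

lemma wmul_eq_0_imp:
  assumes "bounded_weight \<phi>" "\<And>x. \<phi> x \<noteq> 0" "wmul \<phi> a = 0"
  shows "a = 0"
proof (rule l2_eqI)
  have "AE x in lborel. rep_l2 0 x = \<phi> x *\<^sub>R rep_l2 a x"
    using rep_wmul[OF assms(1), of a] assms(3) by simp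
  then show "AE x in lborel. rep_l2 a x = rep_l2 0 x"
    using rep_zero_l2 by eventually_elim (simp add: assms(2))
qed

lemma wmul_tendsto_0:
  assumes \<phi>: "\<And>n. bounded_weight (\<phi> n)" "\<And>n x. \<bar>\<phi> n x\<bar> \<le> C"
    and lim: "\<And>x. (\<lambda>n. \<phi> n x) \<longlonglongrightarrow> 0"
  shows "(\<lambda>n. wmul (\<phi> n) a) \<longlonglongrightarrow> 0"
proof -
  have "(\<lambda>n. abs_l2 (\<lambda>\<xi>. \<phi> n \<xi> *\<^sub>R rep_l2 a \<xi>)) \<longlonglongrightarrow> abs_l2 (\<lambda>_. 0)"
  proof (rule L2_dominated_convergence)
    show "(\<lambda>\<xi>. \<phi> n \<xi> *\<^sub>R rep_l2 a \<xi>) \<in> L2" for n by (simp add: weight_L2 \<phi>)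
    show "(\<lambda>_. 0) \<in> L2" by (rule L2_zero)
    show "(\<lambda>\<xi>. C *\<^sub>R rep_l2 a \<xi>) \<in> L2" by (simp add: L2_scaleR)
    have "(\<lambda>n. \<phi> n x *\<^sub>R rep_l2 a x) \<longlonglongrightarrow> 0 *\<^sub>R rep_l2 a x" for x by (intro tendsto_intros lim)
    then show "AE x in lborel. (\<lambda>n. \<phi> n x *\<^sub>R rep_l2 a x) \<longlonglongrightarrow> 0" by simp
    have "0 \<le> C" using \<phi>(2)[of 0 0] by linarith
    then show "AE x in lborel. cmod (\<phi> n x *\<^sub>R rep_l2 a x - 0) \<le> norm (C *\<^sub>R rep_l2 a x)" for n
      using \<phi>(2) by (auto intro!: mult_right_mono)
  qed
  then show ?thesis by (simp add: wmul_def zero_l2_def)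
qed

subsection \<open>Hermitian functions\<close>

text \<open>On the Fourier side this is complex conjugation of the function
  (\<open>Four_cj\<close>), so its fixed points are the transforms of real-valued functions.\<close>

definition reflect :: "l2 \<Rightarrow> l2" where
  "reflect a = abs_l2 (\<lambda>\<xi>. cnj (rep_l2 a (- \<xi>)))"

lemma borel_measurable_cnj [measurable]: "cnj \<in> borel_measurable borel"
  by (intro borel_measurable_continuous_onI continuous_intros)

lemma L2_cnj: "f \<in> L2 \<Longrightarrow> (\<lambda>\<xi>. cnj (f \<xi>)) \<in> L2"
  by (rule L2_bound[of f, where C = 1])
     (auto intro: measurable_compose[OF L2_measurable borel_measurable_cnj])

lemma rep_reflect: "AE \<xi> in lborel. rep_l2 (reflect a) \<xi> = cnj (rep_l2 a (- \<xi>))"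
  unfolding reflect_def by (rule rep_abs_l2) (intro L2_cnj L2_uminus_arg rep_l2_in)

lemma AE_uminus: "AE x::real^2 in lborel. P x \<Longrightarrow> AE x in lborel. P (- x)"
  using AE_lborel_reflect[of P 0] by simp

lemma reflect_abs:
  assumes "f \<in> L2"
  shows "reflect (abs_l2 f) = abs_l2 (\<lambda>\<xi>. cnj (f (- \<xi>)))"
  unfolding reflect_def using AE_uminus[OF rep_abs_l2[OF assms]]
  by (subst abs_l2_eq_iff) (auto intro!: L2_cnj L2_uminus_arg assms elim: eventually_mono)

lemma reflect_add: "reflect (a + b) = reflect a + reflect b"
  by (rule l2_eqI) (use rep_reflect[of "a + b"] rep_reflect[of a] rep_reflect[of b] rep_add_l2[of "reflect a" "reflect b"]
      AE_uminus[OF rep_add_l2[of a b]] in \<open>eventually_elim, simp\<close>)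

lemma reflect_scaleR: "reflect (r *\<^sub>R a) = r *\<^sub>R reflect a"
  by (rule l2_eqI) (use rep_reflect[of "r *\<^sub>R a"] rep_reflect[of a] rep_scaleR_l2[of r "reflect a"]
      AE_uminus[OF rep_scaleR_l2[of r a]] in \<open>eventually_elim, simp\<close>)

lemma reflect_reflect [simp]: "reflect (reflect a) = a"
  by (rule l2_eqI) (use rep_reflect[of "reflect a"] AE_uminus[OF rep_reflect[of a]] in \<open>eventually_elim, simp\<close>)

lemma inner_reflect: "reflect a \<bullet> reflect b = a \<bullet> b"
proof -
  have "reflect a \<bullet> reflect b = (LINT \<xi>|lborel. cnj (rep_l2 a (- \<xi>)) \<bullet> cnj (rep_l2 b (- \<xi>)))"
    unfolding inner_l2_def
    by (rule integral_cong_AE) (measurable, use rep_reflect[of a] rep_reflect[of b] in \<open>eventually_elim, simp\<close>)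
  also have "\<dots> = (LINT \<xi>|lborel. rep_l2 a (0 - \<xi>) \<bullet> rep_l2 b (0 - \<xi>))"
    by (simp add: inner_complex_def)
  also have "\<dots> = a \<bullet> b"
    unfolding inner_l2_def by (rule integral_lborel_reflect[of "\<lambda>\<xi>. rep_l2 a \<xi> \<bullet> rep_l2 b \<xi>"]) measurable
  finally show ?thesis .
qed

lemma norm_reflect [simp]: "norm (reflect a) = norm a"
  by (simp add: norm_eq_sqrt_inner inner_reflect)

lemma bounded_linear_reflect: "bounded_linear reflect"
  by (rule bounded_linear_intro[where K = 1]) (auto simp: reflect_add reflect_scaleR)

lemma reflect_wmul:
  assumes "bounded_weight \<phi>" "\<And>x. \<phi> (- x) = \<phi> x"
  shows "reflect (wmul \<phi> a) = wmul \<phi> (reflect a)"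
  by (rule l2_eqI) (use rep_reflect[of "wmul \<phi> a"] rep_reflect[of a] rep_wmul[OF assms(1), of "reflect a"]
      AE_uminus[OF rep_wmul[OF assms(1), of a]] in \<open>eventually_elim, simp add: assms(2)\<close>)

definition hermitian :: "l2 set" where "hermitian = {a. reflect a = a}"

text \<open>The mean of the identity and the isometric involution \<open>reflect\<close> is a
  projection onto \<open>hermitian\<close>. It allows the Galerkin operators to be defined on all of
  \<open>l2\<close> and yet to take Hermitian values.\<close>

definition herm :: "l2 \<Rightarrow> l2" where "herm a = (1/2) *\<^sub>R (a + reflect a)"

lemma subspace_hermitian: "subspace hermitian"
  using bounded_linear.linear[OF bounded_linear_reflect]
  by (auto simp: hermitian_def subspace_def linear_0 reflect_add reflect_scaleR)

lemma closed_hermitian: "closed hermitian"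
  unfolding hermitian_def
  by (intro closed_Collect_eq linear_continuous_on bounded_linear_reflect continuous_on_id)

lemma bounded_linear_herm: "bounded_linear herm"
  unfolding herm_def
  by (intro bounded_linear_const_scaleR bounded_linear_add bounded_linear_ident bounded_linear_reflect)

lemma herm_in: "herm a \<in> hermitian"
  by (simp add: hermitian_def herm_def reflect_add reflect_scaleR add.commute)

lemma herm_id: "a \<in> hermitian \<Longrightarrow> herm a = a"
  by (simp add: hermitian_def herm_def scaleR_2[symmetric])

lemma norm_herm_le: "norm (herm a) \<le> norm a"
  using norm_triangle_ineq[of a "reflect a"] by (simp add: herm_def)

lemma herm_wmul:
  assumes "bounded_weight \<phi>" "\<And>x. \<phi> (- x) = \<phi> x"
  shows "herm (wmul \<phi> a) = wmul \<phi> (herm a)"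
proof -
  interpret bounded_linear "wmul \<phi>" by (rule bounded_linear_wmul[OF assms(1)])
  show ?thesis by (simp add: herm_def reflect_wmul[OF assms] add scaleR)
qed

lemma wmul_hermitian:
  assumes "bounded_weight \<phi>" "\<And>x. \<phi> (- x) = \<phi> x" "a \<in> hermitian"
  shows "wmul \<phi> a \<in> hermitian"
  using assms by (simp add: hermitian_def reflect_wmul)

text \<open>Averaging a representative with its reflection makes the symmetry hold at every point,
  so that it can be used inside double integrals without tracking null sets.\<close>

lemma hermitian_representative:
  assumes "a \<in> hermitian"
  obtains f where "f \<in> L2" "abs_l2 f = a" "\<And>\<xi>. f (- \<xi>) = cnj (f \<xi>)"
proof
  define f where "f \<xi> = (1/2) *\<^sub>R (rep_l2 a \<xi> + cnj (rep_l2 a (- \<xi>)))" for \<xi>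
  show f: "f \<in> L2"
    unfolding f_def by (intro L2_scaleR L2_add L2_cnj L2_uminus_arg rep_l2_in)
  have "abs_l2 f = abs_l2 (rep_l2 a)"
  proof (subst abs_l2_eq_iff[OF f])
    have "AE \<xi> in lborel. cnj (rep_l2 a (- \<xi>)) = rep_l2 a \<xi>"
      using rep_reflect[of a] assms by (simp add: hermitian_def) (auto elim: eventually_mono)
    then show "AE \<xi> in lborel. f \<xi> = rep_l2 a \<xi>"
      by eventually_elim (simp add: f_def)
  qed simp
  then show "abs_l2 f = a" by simp
  show "f (- \<xi>) = cnj (f \<xi>)" for \<xi> by (simp add: f_def add.commute)
qed

lemma hermitian_abs_iff:
  assumes "f \<in> L2"
  shows "abs_l2 f \<in> hermitian \<longleftrightarrow> (AE \<xi> in lborel. cnj (f (- \<xi>)) = f \<xi>)"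
  unfolding hermitian_def mem_Collect_eq reflect_abs[OF assms]
  by (intro abs_l2_eq_iff L2_cnj L2_uminus_arg assms)

subsection \<open>Convolution operators with a kernel\<close>

text \<open>Young's inequality for the convolution of L^1 with L^2, where the integrable factor is
  the product of \<open>p\<close> and \<open>g\<close> and its integral is bounded by
  Cauchy-Schwarz.\<close>

lemma nn_integral_weighted_convolution_le:
  fixes p f g :: "'a::euclidean_space \<Rightarrow> ennreal"
  assumes [measurable]: "p \<in> borel_measurable borel" "f \<in> borel_measurable borel" "g \<in> borel_measurable borel"
  shows "(\<integral>\<^sup>+\<xi>. (\<integral>\<^sup>+\<eta>. (p \<eta> * g \<eta>) * f (\<xi> - \<eta>) \<partial>lborel)\<^sup>2 \<partial>lborel)
     \<le> (\<integral>\<^sup>+x. (p x)\<^sup>2 \<partial>lborel) * ((\<integral>\<^sup>+x. (f x)\<^sup>2 \<partial>lborel) * (\<integral>\<^sup>+x. (g x)\<^sup>2 \<partial>lborel))"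
proof -
  define m where "m \<eta> = p \<eta> * g \<eta>" for \<eta>
  have [measurable]: "m \<in> borel_measurable borel" unfolding m_def by measurable
  define I where "I = (\<integral>\<^sup>+\<eta>. m \<eta> \<partial>lborel)"
  define F where "F = (\<integral>\<^sup>+x. (f x)\<^sup>2 \<partial>lborel)"
  \<comment> \<open>Cauchy-Schwarz is applied in the measure with density \<open>m\<close>; the
    square then falls on \<open>f\<close> alone, whose translates all have the same norm.\<close>
  have "(\<integral>\<^sup>+\<eta>. m \<eta> * f (\<xi> - \<eta>) \<partial>lborel)\<^sup>2 \<le> (\<integral>\<^sup>+\<eta>. m \<eta> * (f (\<xi> - \<eta>))\<^sup>2 \<partial>lborel) * I" for \<xi>
    using Cauchy_Schwarz_nn_integral[of "\<lambda>\<eta>. f (\<xi> - \<eta>)" "density lborel m" "\<lambda>_. 1"]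
    by (simp add: nn_integral_density emeasure_density I_def)
  then have "(\<integral>\<^sup>+\<xi>. (\<integral>\<^sup>+\<eta>. m \<eta> * f (\<xi> - \<eta>) \<partial>lborel)\<^sup>2 \<partial>lborel)
     \<le> (\<integral>\<^sup>+\<xi>. (\<integral>\<^sup>+\<eta>. m \<eta> * (f (\<xi> - \<eta>))\<^sup>2 \<partial>lborel) * I \<partial>lborel)"
    by (intro nn_integral_mono)
  also have "\<dots> = (\<integral>\<^sup>+\<xi>. \<integral>\<^sup>+\<eta>. m \<eta> * (f (\<xi> - \<eta>))\<^sup>2 \<partial>lborel \<partial>lborel) * I"
    by (rule nn_integral_multc) measurable
  also have "(\<integral>\<^sup>+\<xi>. \<integral>\<^sup>+\<eta>. m \<eta> * (f (\<xi> - \<eta>))\<^sup>2 \<partial>lborel \<partial>lborel)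
      = (\<integral>\<^sup>+\<eta>. \<integral>\<^sup>+\<xi>. m \<eta> * (f (\<xi> - \<eta>))\<^sup>2 \<partial>lborel \<partial>lborel)"
    by (rule lborel_pair.Fubini'[symmetric]) measurable
  also have "\<dots> = (\<integral>\<^sup>+\<eta>. m \<eta> * F \<partial>lborel)"
  proof (rule nn_integral_cong)
    fix \<eta>
    have "(\<integral>\<^sup>+\<xi>. m \<eta> * (f (\<xi> - \<eta>))\<^sup>2 \<partial>lborel) = m \<eta> * (\<integral>\<^sup>+\<xi>. (f (\<xi> - \<eta>))\<^sup>2 \<partial>lborel)"
      by (rule nn_integral_cmult) measurable
    also have "(\<integral>\<^sup>+\<xi>. (f (\<xi> - \<eta>))\<^sup>2 \<partial>lborel) = F"
      unfolding F_def by (rule nn_integral_lborel_translate[of "\<lambda>x. (f x)\<^sup>2"]) measurable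
    finally show "(\<integral>\<^sup>+\<xi>. m \<eta> * (f (\<xi> - \<eta>))\<^sup>2 \<partial>lborel) = m \<eta> * F" .
  qed
  also have "\<dots> = I * F"
    unfolding I_def by (rule nn_integral_multc) measurable
  also have "I * F * I = I\<^sup>2 * F" by (simp add: power2_eq_square mult_ac)
  also have "\<dots> \<le> ((\<integral>\<^sup>+x. (p x)\<^sup>2 \<partial>lborel) * (\<integral>\<^sup>+x. (g x)\<^sup>2 \<partial>lborel)) * F"
    unfolding I_def m_def by (intro mult_right_mono Cauchy_Schwarz_nn_integral) auto
  finally show ?thesis by (simp add: m_def F_def mult_ac)
qed

lemma ennreal_power2_add_le: "((x::ennreal) + y)\<^sup>2 \<le> 2 * (x\<^sup>2 + y\<^sup>2)"
proof (cases x; cases y)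
  fix a b assume ab: "x = ennreal a" "0 \<le> a" "y = ennreal b" "0 \<le> b"
  have "0 \<le> (a - b)\<^sup>2" by simp
  then have "(a + b)\<^sup>2 \<le> 2 * (a\<^sup>2 + b\<^sup>2)" by (simp add: power2_eq_square algebra_simps)
  then have "ennreal ((a + b)\<^sup>2) \<le> ennreal (2 * (a\<^sup>2 + b\<^sup>2))" by (rule ennreal_leI)
  also have "\<dots> = 2 * (x\<^sup>2 + y\<^sup>2)"
    using ab by (subst ennreal_mult) (auto simp: ennreal_power)
  finally show ?thesis using ab by (simp add: ennreal_power flip: ennreal_plus)
qed (auto simp: power2_eq_square ennreal_mult_top ennreal_top_mult)

text \<open>Either frequency may supply the decay \<open>p\<close> in L^2, while the other keeps
  only the bounded weight \<open>a\<close>. With \<open>a = 1\<close> this gives a bounded bilinear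
  operator; with a tail weight for \<open>a\<close>, one of the two arguments enters the estimate
  only through its tail.\<close>

definition kernel_bound :: "(real^2 \<Rightarrow> real) \<Rightarrow> (real^2 \<Rightarrow> real) \<Rightarrow> (real^2 \<Rightarrow> real^2 \<Rightarrow> real) \<Rightarrow> bool" where
  "kernel_bound a p k \<longleftrightarrow> bounded_weight a \<and> (\<forall>x. 0 \<le> a x) \<and> p \<in> L2 \<and> (\<forall>x. 0 \<le> p x) \<and>
     case_prod k \<in> borel_measurable (borel \<Otimes>\<^sub>M borel) \<and>
     (\<forall>\<xi> \<eta>. \<bar>k \<xi> \<eta>\<bar> \<le> a (\<xi> - \<eta>) * p \<eta> + p (\<xi> - \<eta>) * a \<eta>)"

definition kernel_norm :: "(real^2 \<Rightarrow> real) \<Rightarrow> real" where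
  "kernel_norm p = sqrt (LINT x|lborel. (p x)\<^sup>2)"

definition conv_fun :: "(real^2 \<Rightarrow> real^2 \<Rightarrow> real) \<Rightarrow> (real^2 \<Rightarrow> complex) \<Rightarrow> (real^2 \<Rightarrow> complex) \<Rightarrow> real^2 \<Rightarrow> complex" where
  "conv_fun k f g \<xi> = (LINT \<eta>|lborel. k \<xi> \<eta> *\<^sub>R (f (\<xi> - \<eta>) * g \<eta>))"

definition conv_op :: "(real^2 \<Rightarrow> real^2 \<Rightarrow> real) \<Rightarrow> l2 \<Rightarrow> l2 \<Rightarrow> l2" where
  "conv_op k y z = abs_l2 (conv_fun k (rep_l2 y) (rep_l2 z))"

lemma kernel_norm_nonneg [simp]: "0 \<le> kernel_norm p"
  by (simp add: kernel_norm_def)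

lemma nn_integral_kernel_norm: "p \<in> L2 \<Longrightarrow> (\<integral>\<^sup>+x. ennreal ((p x)\<^sup>2) \<partial>lborel) = ennreal ((kernel_norm p)\<^sup>2)"
  unfolding kernel_norm_def by (subst nn_integral_eq_integral) (auto simp: L2_def)

context
  fixes a p :: "real^2 \<Rightarrow> real" and k :: "real^2 \<Rightarrow> real^2 \<Rightarrow> real"
  assumes kb: "kernel_bound a p k"
begin

lemma kernel_measurable:
  shows "a \<in> borel_measurable borel" "p \<in> borel_measurable borel"
    "(\<lambda>(x, y). k x y) \<in> borel_measurable (borel \<Otimes>\<^sub>M borel)"
  using kb by (auto simp: kernel_bound_def bounded_weight_def L2_measurable)

lemma nn_integral_conv_le:
  assumes f: "f \<in> L2" and g: "g \<in> L2"
  shows "(\<integral>\<^sup>+\<xi>. (\<integral>\<^sup>+\<eta>. ennreal (norm (k \<xi> \<eta> *\<^sub>R (f (\<xi> - \<eta>) * g \<eta> :: complex))) \<partial>lborel)\<^sup>2 \<partial>lborel)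
    \<le> ennreal (2 * (kernel_norm p)\<^sup>2 * ((norm (wmul a (abs_l2 f)))\<^sup>2 * (norm (abs_l2 g))\<^sup>2
          + (norm (abs_l2 f))\<^sup>2 * (norm (wmul a (abs_l2 g)))\<^sup>2))"
proof -
  note [measurable] = kernel_measurable L2_measurable[OF f] L2_measurable[OF g]
  have a0: "0 \<le> a x" and p0: "0 \<le> p x" and kle: "\<bar>k x y\<bar> \<le> a (x - y) * p y + p (x - y) * a y" for x y
    using kb by (auto simp: kernel_bound_def)
  have aw: "bounded_weight a" and pL: "p \<in> L2" using kb by (auto simp: kernel_bound_def)
  define p' where "p' x = ennreal (p x)" for x
  define f' where "f' x = ennreal (cmod (f x))" for x
  define g' where "g' x = ennreal (cmod (g x))" for x
  define af where "af x = ennreal (cmod (a x *\<^sub>R f x))" for x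
  define ag where "ag x = ennreal (cmod (a x *\<^sub>R g x))" for x
  have [measurable]: "p' \<in> borel_measurable borel" "f' \<in> borel_measurable borel" "g' \<in> borel_measurable borel"
    "af \<in> borel_measurable borel" "ag \<in> borel_measurable borel"
    unfolding p'_def f'_def g'_def af_def ag_def by measurable
  define U1 where "U1 \<xi> = (\<integral>\<^sup>+\<eta>. (p' \<eta> * g' \<eta>) * af (\<xi> - \<eta>) \<partial>lborel)" for \<xi>
  define U2 where "U2 \<xi> = (\<integral>\<^sup>+\<eta>. (p' \<eta> * f' \<eta>) * ag (\<xi> - \<eta>) \<partial>lborel)" for \<xi>
  have [measurable]: "U1 \<in> borel_measurable borel" "U2 \<in> borel_measurable borel"
    unfolding U1_def U2_def by measurable
  have le: "(\<integral>\<^sup>+\<eta>. ennreal (norm (k \<xi> \<eta> *\<^sub>R (f (\<xi> - \<eta>) * g \<eta>))) \<partial>lborel) \<le> U1 \<xi> + U2 \<xi>" for \<xi>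
  proof -
    have "(\<integral>\<^sup>+\<eta>. ennreal (norm (k \<xi> \<eta> *\<^sub>R (f (\<xi> - \<eta>) * g \<eta>))) \<partial>lborel)
      \<le> (\<integral>\<^sup>+\<eta>. (p' \<eta> * g' \<eta>) * af (\<xi> - \<eta>) + (p' (\<xi> - \<eta>) * f' (\<xi> - \<eta>)) * ag \<eta> \<partial>lborel)"
    proof (rule nn_integral_mono)
      fix \<eta>
      have "norm (k \<xi> \<eta> *\<^sub>R (f (\<xi> - \<eta>) * g \<eta>)) \<le> (a (\<xi> - \<eta>) * p \<eta> + p (\<xi> - \<eta>) * a \<eta>) * (cmod (f (\<xi> - \<eta>)) * cmod (g \<eta>))"
        unfolding norm_scaleR norm_mult by (intro mult_right_mono kle) auto
      also have "\<dots> = (p \<eta> * cmod (g \<eta>)) * cmod (a (\<xi> - \<eta>) *\<^sub>R f (\<xi> - \<eta>))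
          + (p (\<xi> - \<eta>) * cmod (f (\<xi> - \<eta>))) * cmod (a \<eta> *\<^sub>R g \<eta>)"
        using a0 by (simp add: algebra_simps)
      finally have "ennreal (norm (k \<xi> \<eta> *\<^sub>R (f (\<xi> - \<eta>) * g \<eta>))) \<le> ennreal \<dots>" by (rule ennreal_leI)
      also have "\<dots> = (p' \<eta> * g' \<eta>) * af (\<xi> - \<eta>) + (p' (\<xi> - \<eta>) * f' (\<xi> - \<eta>)) * ag \<eta>"
        using p0 by (simp add: p'_def f'_def g'_def af_def ag_def ennreal_mult)
      finally show "ennreal (norm (k \<xi> \<eta> *\<^sub>R (f (\<xi> - \<eta>) * g \<eta>))) \<le> \<dots>" .
    qed
    also have "\<dots> = U1 \<xi> + (\<integral>\<^sup>+\<eta>. (p' (\<xi> - \<eta>) * f' (\<xi> - \<eta>)) * ag \<eta> \<partial>lborel)"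
      unfolding U1_def by (rule nn_integral_add) measurable
    \<comment> \<open>Substituting \<open>\<xi> - \<eta>\<close> for \<open>\<eta>\<close> brings
      the second term into the form of the first with \<open>f\<close> and \<open>g\<close>
      exchanged.\<close>
    also have "(\<integral>\<^sup>+\<eta>. (p' (\<xi> - \<eta>) * f' (\<xi> - \<eta>)) * ag \<eta> \<partial>lborel) = U2 \<xi>"
      unfolding U2_def
      using nn_integral_lborel_reflect[of "\<lambda>\<eta>. (p' \<eta> * f' \<eta>) * ag (\<xi> - \<eta>)" \<xi>] by simp
    finally show ?thesis .
  qed
  have N: "(\<integral>\<^sup>+x. (ennreal (cmod (h x)))\<^sup>2 \<partial>lborel) = ennreal ((norm (abs_l2 h))\<^sup>2)" if "h \<in> L2" for h
    using nn_integral_L2_abs[OF that] by (simp add: ennreal_power)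
  have Nf: "(\<integral>\<^sup>+x. (f' x)\<^sup>2 \<partial>lborel) = ennreal ((norm (abs_l2 f))\<^sup>2)"
    and Ng: "(\<integral>\<^sup>+x. (g' x)\<^sup>2 \<partial>lborel) = ennreal ((norm (abs_l2 g))\<^sup>2)"
    and Naf: "(\<integral>\<^sup>+x. (af x)\<^sup>2 \<partial>lborel) = ennreal ((norm (wmul a (abs_l2 f)))\<^sup>2)"
    and Nag: "(\<integral>\<^sup>+x. (ag x)\<^sup>2 \<partial>lborel) = ennreal ((norm (wmul a (abs_l2 g)))\<^sup>2)"
    unfolding f'_def g'_def af_def ag_def wmul_abs[OF aw f] wmul_abs[OF aw g]
    by (intro N f g weight_L2 aw)+
  have Np: "(\<integral>\<^sup>+x. (p' x)\<^sup>2 \<partial>lborel) = ennreal ((kernel_norm p)\<^sup>2)"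
    using nn_integral_kernel_norm[OF pL] p0 by (simp add: p'_def ennreal_power)
  have "(\<integral>\<^sup>+\<xi>. (\<integral>\<^sup>+\<eta>. ennreal (norm (k \<xi> \<eta> *\<^sub>R (f (\<xi> - \<eta>) * g \<eta> :: complex))) \<partial>lborel)\<^sup>2 \<partial>lborel)
     \<le> (\<integral>\<^sup>+\<xi>. 2 * ((U1 \<xi>)\<^sup>2 + (U2 \<xi>)\<^sup>2) \<partial>lborel)"
    by (intro nn_integral_mono order_trans[OF power_mono[OF le] ennreal_power2_add_le]) simp
  also have "\<dots> = 2 * ((\<integral>\<^sup>+\<xi>. (U1 \<xi>)\<^sup>2 \<partial>lborel) + (\<integral>\<^sup>+\<xi>. (U2 \<xi>)\<^sup>2 \<partial>lborel))"
    by (subst nn_integral_cmult) (measurable, subst nn_integral_add, measurable)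
  also have "\<dots> \<le> 2 * (ennreal ((kernel_norm p)\<^sup>2) * (ennreal ((norm (wmul a (abs_l2 f)))\<^sup>2) * ennreal ((norm (abs_l2 g))\<^sup>2))
      + ennreal ((kernel_norm p)\<^sup>2) * (ennreal ((norm (wmul a (abs_l2 g)))\<^sup>2) * ennreal ((norm (abs_l2 f))\<^sup>2)))"
    unfolding U1_def U2_def Nf[symmetric] Ng[symmetric] Naf[symmetric] Nag[symmetric] Np[symmetric]
    by (intro mult_left_mono add_mono nn_integral_weighted_convolution_le) auto
  also have "\<dots> = ennreal (2 * (kernel_norm p)\<^sup>2 * ((norm (wmul a (abs_l2 f)))\<^sup>2 * (norm (abs_l2 g))\<^sup>2
          + (norm (abs_l2 f))\<^sup>2 * (norm (wmul a (abs_l2 g)))\<^sup>2))"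
    by (simp add: ennreal_mult'[symmetric] ennreal_plus[symmetric] ennreal_numeral[symmetric] algebra_simps
        del: ennreal_plus ennreal_numeral)
  finally show ?thesis .
qed

lemma conv_integrable:
  assumes f: "f \<in> L2" and g: "g \<in> L2"
  shows "AE \<xi> in lborel. integrable lborel (\<lambda>\<eta>. k \<xi> \<eta> *\<^sub>R (f (\<xi> - \<eta>) * g \<eta> :: complex))"
proof -
  note [measurable] = kernel_measurable L2_measurable[OF f] L2_measurable[OF g]
  let ?U = "\<lambda>\<xi>. \<integral>\<^sup>+\<eta>. ennreal (norm (k \<xi> \<eta> *\<^sub>R (f (\<xi> - \<eta>) * g \<eta> :: complex))) \<partial>lborel"
  have "AE \<xi> in lborel. (?U \<xi>)\<^sup>2 \<noteq> \<infinity>"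
    by (rule nn_integral_noteq_infinite)
       (measurable, use le_less_trans[OF nn_integral_conv_le[OF f g] ennreal_less_top] in simp)
  then show ?thesis
  proof eventually_elim
    case (elim \<xi>)
    then have "?U \<xi> < \<infinity>" by (auto simp: power_eq_top_ennreal less_top)
    then show ?case
      unfolding integrable_iff_bounded by (intro conjI) measurable
  qed
qed

lemma conv_fun_L2:
  assumes f: "f \<in> L2" and g: "g \<in> L2"
  shows "conv_fun k f g \<in> L2"
    and "(norm (abs_l2 (conv_fun k f g)))\<^sup>2 \<le> 2 * (kernel_norm p)\<^sup>2 * ((norm (wmul a (abs_l2 f)))\<^sup>2 * (norm (abs_l2 g))\<^sup>2
          + (norm (abs_l2 f))\<^sup>2 * (norm (wmul a (abs_l2 g)))\<^sup>2)"
proof -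
  note [measurable] = kernel_measurable L2_measurable[OF f] L2_measurable[OF g]
  let ?U = "\<lambda>\<xi>. \<integral>\<^sup>+\<eta>. ennreal (norm (k \<xi> \<eta> *\<^sub>R (f (\<xi> - \<eta>) * g \<eta> :: complex))) \<partial>lborel"
  let ?R = "2 * (kernel_norm p)\<^sup>2 * ((norm (wmul a (abs_l2 f)))\<^sup>2 * (norm (abs_l2 g))\<^sup>2
          + (norm (abs_l2 f))\<^sup>2 * (norm (wmul a (abs_l2 g)))\<^sup>2)"
  have m: "conv_fun k f g \<in> borel_measurable borel"
    unfolding conv_fun_def by measurable
  have "ennreal ((norm (conv_fun k f g \<xi>))\<^sup>2) \<le> (?U \<xi>)\<^sup>2" for \<xi>
  proof -
    have "ennreal (norm (conv_fun k f g \<xi>)) \<le> ?U \<xi>"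
    proof (cases "integrable lborel (\<lambda>\<eta>. k \<xi> \<eta> *\<^sub>R (f (\<xi> - \<eta>) * g \<eta>))")
      case True
      then show ?thesis unfolding conv_fun_def by (rule integral_norm_bound_ennreal)
    next
      \<comment> \<open>Where the integral diverges, \<open>conv_fun\<close> takes the default value
        0 and the bound is trivial.\<close>
      case False
      then have "conv_fun k f g \<xi> = 0" unfolding conv_fun_def by (rule not_integrable_integral_eq)
      then show ?thesis by simp
    qed
    then have "(ennreal (norm (conv_fun k f g \<xi>)))\<^sup>2 \<le> (?U \<xi>)\<^sup>2" by (intro power_mono) auto
    then show ?thesis by (simp add: ennreal_power)
  qed
  then have "(\<integral>\<^sup>+\<xi>. ennreal ((norm (conv_fun k f g \<xi>))\<^sup>2) \<partial>lborel) \<le> (\<integral>\<^sup>+\<xi>. (?U \<xi>)\<^sup>2 \<partial>lborel)"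
    by (intro nn_integral_mono)
  also note nn_integral_conv_le[OF f g]
  finally have le: "(\<integral>\<^sup>+\<xi>. ennreal ((norm (conv_fun k f g \<xi>))\<^sup>2) \<partial>lborel) \<le> ennreal ?R" .
  then show L: "conv_fun k f g \<in> L2"
    using m by (auto simp: L2_iff_nn_integral intro: le_less_trans)
  show "(norm (abs_l2 (conv_fun k f g)))\<^sup>2 \<le> ?R"
    using le unfolding nn_integral_L2_abs[OF L] by (subst (asm) ennreal_le_iff) auto
qed

text \<open>Cauchy-Schwarz in the outer variable, against the square-integrable majorant of the
  convolution. This is the absolute integrability that Fubini's theorem asks for in
  \<open>conv_op_skew\<close>.\<close>

lemma conv_trilinear_integrable:
  assumes f: "f \<in> L2" and g: "g \<in> L2" and h: "h \<in> L2"
  shows "integrable (lborel \<Otimes>\<^sub>M lborel) (\<lambda>(\<xi>, \<eta>). h \<xi> \<bullet> (k \<xi> \<eta> *\<^sub>R (f (\<xi> - \<eta>) * g \<eta> :: complex)))"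
proof -
  note [measurable] = kernel_measurable L2_measurable[OF f] L2_measurable[OF g] L2_measurable[OF h]
  let ?U = "\<lambda>\<xi>. \<integral>\<^sup>+\<eta>. ennreal (norm (k \<xi> \<eta> *\<^sub>R (f (\<xi> - \<eta>) * g \<eta> :: complex))) \<partial>lborel"
  have "(\<integral>\<^sup>+x. ennreal (norm (case x of (\<xi>, \<eta>) \<Rightarrow> h \<xi> \<bullet> (k \<xi> \<eta> *\<^sub>R (f (\<xi> - \<eta>) * g \<eta>)))) \<partial>(lborel \<Otimes>\<^sub>M lborel))
    = (\<integral>\<^sup>+\<xi>. \<integral>\<^sup>+\<eta>. ennreal (norm (h \<xi> \<bullet> (k \<xi> \<eta> *\<^sub>R (f (\<xi> - \<eta>) * g \<eta>)))) \<partial>lborel \<partial>lborel)"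
    by (subst lborel.nn_integral_fst[symmetric]) measurable
  also have "\<dots> \<le> (\<integral>\<^sup>+\<xi>. ennreal (cmod (h \<xi>)) * ?U \<xi> \<partial>lborel)"
  proof (rule nn_integral_mono)
    fix \<xi>
    have "(\<integral>\<^sup>+\<eta>. ennreal (norm (h \<xi> \<bullet> (k \<xi> \<eta> *\<^sub>R (f (\<xi> - \<eta>) * g \<eta>)))) \<partial>lborel)
       \<le> (\<integral>\<^sup>+\<eta>. ennreal (cmod (h \<xi>)) * ennreal (norm (k \<xi> \<eta> *\<^sub>R (f (\<xi> - \<eta>) * g \<eta>))) \<partial>lborel)"
    proof (rule nn_integral_mono)
      fix \<eta>
      have "norm (h \<xi> \<bullet> (k \<xi> \<eta> *\<^sub>R (f (\<xi> - \<eta>) * g \<eta>))) \<le> cmod (h \<xi>) * norm (k \<xi> \<eta> *\<^sub>R (f (\<xi> - \<eta>) * g \<eta>))"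
        unfolding real_norm_def by (rule Cauchy_Schwarz_ineq2)
      then show "ennreal (norm (h \<xi> \<bullet> (k \<xi> \<eta> *\<^sub>R (f (\<xi> - \<eta>) * g \<eta>))))
          \<le> ennreal (cmod (h \<xi>)) * ennreal (norm (k \<xi> \<eta> *\<^sub>R (f (\<xi> - \<eta>) * g \<eta>)))"
        unfolding ennreal_mult''[symmetric, OF norm_ge_zero] by (rule ennreal_leI)
    qed
    also have "\<dots> = ennreal (cmod (h \<xi>)) * ?U \<xi>" by (rule nn_integral_cmult) measurable
    finally show "(\<integral>\<^sup>+\<eta>. ennreal (norm (h \<xi> \<bullet> (k \<xi> \<eta> *\<^sub>R (f (\<xi> - \<eta>) * g \<eta>)))) \<partial>lborel) \<le> \<dots>" .
  qed
  also have "\<dots> < \<infinity>"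
  proof -
    have "(\<integral>\<^sup>+\<xi>. ennreal (cmod (h \<xi>)) * ?U \<xi> \<partial>lborel)\<^sup>2
      \<le> (\<integral>\<^sup>+\<xi>. (ennreal (cmod (h \<xi>)))\<^sup>2 \<partial>lborel) * (\<integral>\<^sup>+\<xi>. (?U \<xi>)\<^sup>2 \<partial>lborel)"
      by (rule Cauchy_Schwarz_nn_integral) measurable
    also have "\<dots> < \<infinity>"
    proof -
      have "(\<integral>\<^sup>+\<xi>. (ennreal (cmod (h \<xi>)))\<^sup>2 \<partial>lborel) < \<infinity>"
        using h by (simp add: L2_iff_nn_integral ennreal_power)
      moreover have "(\<integral>\<^sup>+\<xi>. (?U \<xi>)\<^sup>2 \<partial>lborel) < \<infinity>"
        using le_less_trans[OF nn_integral_conv_le[OF f g] ennreal_less_top] by simp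
      ultimately show ?thesis by (simp add: ennreal_mult_less_top)
    qed
    finally show ?thesis by (simp add: power_less_top_ennreal)
  qed
  finally show ?thesis
    unfolding integrable_iff_bounded by (intro conjI) measurable
qed

lemma inner_conv_fun:
  assumes f: "f \<in> L2" and g: "g \<in> L2" and h: "h \<in> L2"
  shows "abs_l2 h \<bullet> abs_l2 (conv_fun k f g)
     = (LINT \<xi>|lborel. LINT \<eta>|lborel. h \<xi> \<bullet> (k \<xi> \<eta> *\<^sub>R (f (\<xi> - \<eta>) * g \<eta>)))"
  unfolding inner_abs_l2[OF h conv_fun_L2(1)[OF f g]]
proof (rule integral_cong_AE)
  note [measurable] = kernel_measurable L2_measurable[OF f] L2_measurable[OF g] L2_measurable[OF h]
    L2_measurable[OF conv_fun_L2(1)[OF f g]]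
  show "(\<lambda>\<xi>. h \<xi> \<bullet> conv_fun k f g \<xi>) \<in> borel_measurable lborel" by measurable
  show "(\<lambda>\<xi>. LINT \<eta>|lborel. h \<xi> \<bullet> (k \<xi> \<eta> *\<^sub>R (f (\<xi> - \<eta>) * g \<eta>))) \<in> borel_measurable lborel" by measurable
  show "AE \<xi> in lborel. h \<xi> \<bullet> conv_fun k f g \<xi> = (LINT \<eta>|lborel. h \<xi> \<bullet> (k \<xi> \<eta> *\<^sub>R (f (\<xi> - \<eta>) * g \<eta>)))"
    using conv_integrable[OF f g] unfolding conv_fun_def
    by eventually_elim (rule integral_inner_right[symmetric], simp)
qed

end

text \<open>Reflection preserves null sets, so the equality holds for every \<open>\<xi>\<close>; in
  particular \<open>conv_op\<close> does not depend on the choice of representatives.\<close>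

lemma conv_fun_cong_AE:
  assumes "AE x in lborel. f x = f' x" "AE x in lborel. g x = g' x"
    and [measurable]: "f \<in> borel_measurable borel" "g \<in> borel_measurable borel"
      "f' \<in> borel_measurable borel" "g' \<in> borel_measurable borel" "case_prod k \<in> borel_measurable (borel \<Otimes>\<^sub>M borel)"
  shows "conv_fun k f g \<xi> = conv_fun k f' g' \<xi>"
  unfolding conv_fun_def
  by (rule integral_cong_AE) (measurable, use AE_lborel_reflect[OF assms(1), of \<xi>] assms(2) in \<open>eventually_elim, simp\<close>)

lemma conv_op_abs:
  assumes "kernel_bound a p k" "f \<in> L2" "g \<in> L2"
  shows "conv_op k (abs_l2 f) (abs_l2 g) = abs_l2 (conv_fun k f g)"
proof -
  have "conv_fun k (rep_l2 (abs_l2 f)) (rep_l2 (abs_l2 g)) = conv_fun k f g"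
    by (rule ext, rule conv_fun_cong_AE)
       (use assms in \<open>auto intro: rep_abs_l2 L2_measurable simp: kernel_bound_def\<close>)
  then show ?thesis by (simp add: conv_op_def)
qed

lemma rep_conv_op:
  assumes "kernel_bound a p k"
  shows "AE \<xi> in lborel. rep_l2 (conv_op k y z) \<xi> = conv_fun k (rep_l2 y) (rep_l2 z) \<xi>"
  unfolding conv_op_def by (rule rep_abs_l2) (rule conv_fun_L2[OF assms rep_l2_in rep_l2_in])

lemma norm_conv_op_sq_le:
  assumes "kernel_bound a p k"
  shows "(norm (conv_op k y z))\<^sup>2 \<le> 2 * (kernel_norm p)\<^sup>2 * ((norm (wmul a y))\<^sup>2 * (norm z)\<^sup>2
          + (norm y)\<^sup>2 * (norm (wmul a z))\<^sup>2)"
  using conv_fun_L2(2)[OF assms rep_l2_in[of y] rep_l2_in[of z]] by (simp add: conv_op_def)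

lemma norm_conv_op_le:
  assumes "kernel_bound (\<lambda>_. 1) p k"
  shows "norm (conv_op k y z) \<le> 2 * kernel_norm p * norm y * norm z"
proof (rule power2_le_imp_le)
  show "(norm (conv_op k y z))\<^sup>2 \<le> (2 * kernel_norm p * norm y * norm z)\<^sup>2"
    using norm_conv_op_sq_le[OF assms, of y z] by (simp add: wmul_one power_mult_distrib algebra_simps)
qed simp

text \<open>On the diagonal the two terms of the bound coincide, each with the weight on exactly one
  factor. Paired with another weighted factor this yields the square of a tail norm in the energy
  estimate.\<close>

lemma norm_conv_op_diag_le:
  assumes "kernel_bound a p k"
  shows "norm (conv_op k y y) \<le> 2 * kernel_norm p * norm (wmul a y) * norm y"
proof (rule power2_le_imp_le)
  show "(norm (conv_op k y y))\<^sup>2 \<le> (2 * kernel_norm p * norm (wmul a y) * norm y)\<^sup>2"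
    using norm_conv_op_sq_le[OF assms, of y y] by (simp add: power_mult_distrib algebra_simps)
qed simp

lemma bounded_bilinear_conv_op:
  assumes kb: "kernel_bound (\<lambda>_. 1) p k"
  shows "bounded_bilinear (conv_op k)"
proof
  note [measurable] = kernel_measurable[OF kb]
  have i: "AE \<xi> in lborel. integrable lborel (\<lambda>\<eta>. k \<xi> \<eta> *\<^sub>R (rep_l2 a (\<xi> - \<eta>) * rep_l2 b \<eta>))" for a b
    by (rule conv_integrable[OF kb rep_l2_in rep_l2_in])
  fix a a' b b' :: l2 and r :: real
  show "conv_op k (a + a') b = conv_op k a b + conv_op k a' b"
  proof (rule l2_eqI)
    have eq: "conv_fun k (rep_l2 (a + a')) (rep_l2 b) \<xi> = conv_fun k (\<lambda>x. rep_l2 a x + rep_l2 a' x) (rep_l2 b) \<xi>" for \<xi>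
      by (rule conv_fun_cong_AE) (auto intro: rep_add_l2)
    show "AE \<xi> in lborel. rep_l2 (conv_op k (a + a') b) \<xi> = rep_l2 (conv_op k a b + conv_op k a' b) \<xi>"
      using rep_conv_op[OF kb, of "a + a'" b, unfolded eq] rep_conv_op[OF kb, of a b] rep_conv_op[OF kb, of a' b]
        rep_add_l2[of "conv_op k a b" "conv_op k a' b"] i[of a b] i[of a' b]
      by eventually_elim (simp add: conv_fun_def distrib_right scaleR_add_right)
  qed
  show "conv_op k a (b + b') = conv_op k a b + conv_op k a b'"
  proof (rule l2_eqI)
    have eq: "conv_fun k (rep_l2 a) (rep_l2 (b + b')) \<xi> = conv_fun k (rep_l2 a) (\<lambda>x. rep_l2 b x + rep_l2 b' x) \<xi>" for \<xi>
      by (rule conv_fun_cong_AE) (auto intro: rep_add_l2)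
    show "AE \<xi> in lborel. rep_l2 (conv_op k a (b + b')) \<xi> = rep_l2 (conv_op k a b + conv_op k a b') \<xi>"
      using rep_conv_op[OF kb, of a "b + b'", unfolded eq] rep_conv_op[OF kb, of a b] rep_conv_op[OF kb, of a b']
        rep_add_l2[of "conv_op k a b" "conv_op k a b'"] i[of a b] i[of a b']
      by eventually_elim (simp add: conv_fun_def distrib_left scaleR_add_right)
  qed
  show "conv_op k (r *\<^sub>R a) b = r *\<^sub>R conv_op k a b"
  proof (rule l2_eqI)
    have "conv_fun k (rep_l2 (r *\<^sub>R a)) (rep_l2 b) \<xi> = conv_fun k (\<lambda>x. r *\<^sub>R rep_l2 a x) (rep_l2 b) \<xi>" for \<xi>
      by (rule conv_fun_cong_AE) (auto intro: rep_scaleR_l2)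
    moreover have "conv_fun k (\<lambda>x. r *\<^sub>R rep_l2 a x) (rep_l2 b) \<xi> = r *\<^sub>R conv_fun k (rep_l2 a) (rep_l2 b) \<xi>" for \<xi>
      unfolding conv_fun_def by (subst integral_scaleR_right[symmetric]) (simp add: mult_ac)
    ultimately show "AE \<xi> in lborel. rep_l2 (conv_op k (r *\<^sub>R a) b) \<xi> = rep_l2 (r *\<^sub>R conv_op k a b) \<xi>"
      using rep_conv_op[OF kb, of "r *\<^sub>R a" b] rep_conv_op[OF kb, of a b] rep_scaleR_l2[of r "conv_op k a b"]
      by (auto elim!: eventually_elim2)
  qed
  show "conv_op k a (r *\<^sub>R b) = r *\<^sub>R conv_op k a b"
  proof (rule l2_eqI)
    have "conv_fun k (rep_l2 a) (rep_l2 (r *\<^sub>R b)) \<xi> = conv_fun k (rep_l2 a) (\<lambda>x. r *\<^sub>R rep_l2 b x) \<xi>" for \<xi>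
      by (rule conv_fun_cong_AE) (auto intro: rep_scaleR_l2)
    moreover have "conv_fun k (rep_l2 a) (\<lambda>x. r *\<^sub>R rep_l2 b x) \<xi> = r *\<^sub>R conv_fun k (rep_l2 a) (rep_l2 b) \<xi>" for \<xi>
      unfolding conv_fun_def by (subst integral_scaleR_right[symmetric]) (simp add: mult_ac)
    ultimately show "AE \<xi> in lborel. rep_l2 (conv_op k a (r *\<^sub>R b)) \<xi> = rep_l2 (r *\<^sub>R conv_op k a b) \<xi>"
      using rep_conv_op[OF kb, of a "r *\<^sub>R b"] rep_conv_op[OF kb, of a b] rep_scaleR_l2[of r "conv_op k a b"]
      by (auto elim!: eventually_elim2)
  qed
  show "\<exists>K. \<forall>a b. norm (conv_op k a b) \<le> norm a * norm b * K"
    by (rule exI[of _ "2 * kernel_norm p"]) (use norm_conv_op_le[OF kb] in \<open>simp add: mult_ac\<close>)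
qed

text \<open>Together with \<open>conv_op_wmul_left\<close> and \<open>conv_op_wmul_right\<close>
  this moves weights between the operator, its arguments and its kernel. The estimates for SQG are
  made of such moves.\<close>

lemma wmul_conv_op:
  assumes kb: "kernel_bound a p k" and \<phi>: "bounded_weight \<phi>"
  shows "wmul \<phi> (conv_op k y z) = conv_op (\<lambda>\<xi> \<eta>. \<phi> \<xi> * k \<xi> \<eta>) y z"
proof -
  have "wmul \<phi> (conv_op k y z) = abs_l2 (\<lambda>\<xi>. \<phi> \<xi> *\<^sub>R conv_fun k (rep_l2 y) (rep_l2 z) \<xi>)"
    unfolding conv_op_def by (rule wmul_abs[OF \<phi>]) (rule conv_fun_L2[OF kb rep_l2_in rep_l2_in])
  also have "(\<lambda>\<xi>. \<phi> \<xi> *\<^sub>R conv_fun k (rep_l2 y) (rep_l2 z) \<xi>) = conv_fun (\<lambda>\<xi> \<eta>. \<phi> \<xi> * k \<xi> \<eta>) (rep_l2 y) (rep_l2 z)"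
    unfolding conv_fun_def by (subst integral_scaleR_right[symmetric]) simp
  finally show ?thesis by (simp add: conv_op_def)
qed

lemma conv_op_wmul_left:
  assumes [measurable]: "case_prod k \<in> borel_measurable (borel \<Otimes>\<^sub>M borel)" and \<phi>: "bounded_weight \<phi>"
  shows "conv_op k (wmul \<phi> y) z = conv_op (\<lambda>\<xi> \<eta>. k \<xi> \<eta> * \<phi> (\<xi> - \<eta>)) y z"
proof -
  note [measurable] = bounded_weight_measurable[OF \<phi>]
  have "conv_fun k (rep_l2 (wmul \<phi> y)) (rep_l2 z) = conv_fun k (\<lambda>x. \<phi> x *\<^sub>R rep_l2 y x) (rep_l2 z)"
    by (rule ext, rule conv_fun_cong_AE) (auto intro: rep_wmul \<phi>)
  moreover have "conv_fun k (\<lambda>x. \<phi> x *\<^sub>R rep_l2 y x) (rep_l2 z) = conv_fun (\<lambda>\<xi> \<eta>. k \<xi> \<eta> * \<phi> (\<xi> - \<eta>)) (rep_l2 y) (rep_l2 z)"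
    unfolding conv_fun_def by (simp only: mult_scaleR_left mult_scaleR_right scaleR_scaleR)
  ultimately show ?thesis by (simp only: conv_op_def)
qed

lemma conv_op_wmul_right:
  assumes [measurable]: "case_prod k \<in> borel_measurable (borel \<Otimes>\<^sub>M borel)" and \<phi>: "bounded_weight \<phi>"
  shows "conv_op k y (wmul \<phi> z) = conv_op (\<lambda>\<xi> \<eta>. k \<xi> \<eta> * \<phi> \<eta>) y z"
proof -
  note [measurable] = bounded_weight_measurable[OF \<phi>]
  have "conv_fun k (rep_l2 y) (rep_l2 (wmul \<phi> z)) = conv_fun k (rep_l2 y) (\<lambda>x. \<phi> x *\<^sub>R rep_l2 z x)"
    by (rule ext, rule conv_fun_cong_AE) (auto intro: rep_wmul \<phi>)
  moreover have "conv_fun k (rep_l2 y) (\<lambda>x. \<phi> x *\<^sub>R rep_l2 z x) = conv_fun (\<lambda>\<xi> \<eta>. k \<xi> \<eta> * \<phi> \<eta>) (rep_l2 y) (rep_l2 z)"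
    unfolding conv_fun_def by (simp only: mult_scaleR_left mult_scaleR_right scaleR_scaleR)
  ultimately show ?thesis by (simp only: conv_op_def)
qed

lemma conv_op_add_kernel:
  assumes k: "kernel_bound a p k" and l: "kernel_bound b q l"
  shows "conv_op (\<lambda>\<xi> \<eta>. k \<xi> \<eta> + l \<xi> \<eta>) y z = conv_op k y z + conv_op l y z"
proof -
  note [measurable] = kernel_measurable[OF k] kernel_measurable[OF l]
  have kL: "conv_fun k (rep_l2 y) (rep_l2 z) \<in> L2" and lL: "conv_fun l (rep_l2 y) (rep_l2 z) \<in> L2"
    using conv_fun_L2(1)[OF k rep_l2_in rep_l2_in] conv_fun_L2(1)[OF l rep_l2_in rep_l2_in] by auto
  have eq: "AE \<xi> in lborel. conv_fun (\<lambda>\<xi> \<eta>. k \<xi> \<eta> + l \<xi> \<eta>) (rep_l2 y) (rep_l2 z) \<xi>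
     = conv_fun k (rep_l2 y) (rep_l2 z) \<xi> + conv_fun l (rep_l2 y) (rep_l2 z) \<xi>"
    using conv_integrable[OF k rep_l2_in[of y] rep_l2_in[of z]] conv_integrable[OF l rep_l2_in[of y] rep_l2_in[of z]]
    by eventually_elim (simp add: conv_fun_def scaleR_add_left)
  have "conv_fun (\<lambda>\<xi> \<eta>. k \<xi> \<eta> + l \<xi> \<eta>) (rep_l2 y) (rep_l2 z) \<in> borel_measurable borel"
    unfolding conv_fun_def by measurable
  moreover have "AE \<xi> in lborel. cmod (conv_fun (\<lambda>\<xi> \<eta>. k \<xi> \<eta> + l \<xi> \<eta>) (rep_l2 y) (rep_l2 z) \<xi>)
     \<le> 1 * cmod (conv_fun k (rep_l2 y) (rep_l2 z) \<xi> + conv_fun l (rep_l2 y) (rep_l2 z) \<xi>)"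
    using eq by eventually_elim simp
  ultimately have "conv_fun (\<lambda>\<xi> \<eta>. k \<xi> \<eta> + l \<xi> \<eta>) (rep_l2 y) (rep_l2 z) \<in> L2"
    by (rule L2_bound[OF L2_add[OF kL lL]])
  then show ?thesis
    unfolding conv_op_def abs_l2_add[OF kL lL, symmetric]
    using eq by (subst abs_l2_eq_iff) (auto intro: L2_add kL lL)
qed

text \<open>Exchanging \<open>\<xi>\<close> and \<open>\<eta>\<close> conjugates
  \<open>f (\<xi> - \<eta>)\<close>, which the real inner product absorbs, and flips the sign of
  \<open>k\<close>; so the double integral equals its own negative. In physical space this is the
  cancellation of the transport term for a real, divergence-free velocity.\<close>

lemma conv_op_skew:
  assumes kb: "kernel_bound a p k" and skew: "\<And>\<xi> \<eta>. k \<eta> \<xi> = - k \<xi> \<eta>" and z: "z \<in> hermitian"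
  shows "x \<bullet> conv_op k z x = 0"
proof -
  obtain f where f: "f \<in> L2" "abs_l2 f = z" "\<And>\<xi>. f (- \<xi>) = cnj (f \<xi>)"
    using hermitian_representative[OF z] by blast
  define g where "g = rep_l2 x"
  have g: "g \<in> L2" "abs_l2 g = x" by (auto simp: g_def)
  define h where "h \<xi> \<eta> = g \<xi> \<bullet> (k \<xi> \<eta> *\<^sub>R (f (\<xi> - \<eta>) * g \<eta>))" for \<xi> \<eta>
  have h: "h \<eta> \<xi> = - h \<xi> \<eta>" for \<xi> \<eta>
    using f(3)[of "\<xi> - \<eta>"] by (simp add: h_def skew[of \<eta> \<xi>] inner_complex_def algebra_simps)
  have i: "integrable (lborel \<Otimes>\<^sub>M lborel) (\<lambda>(\<xi>, \<eta>). h \<xi> \<eta>)"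
    unfolding h_def by (rule conv_trilinear_integrable[OF kb f(1) g(1) g(1)])
  have "x \<bullet> conv_op k z x = (LINT \<xi>|lborel. LINT \<eta>|lborel. h \<xi> \<eta>)"
    using inner_conv_fun[OF kb f(1) g(1) g(1)] conv_op_abs[OF kb f(1) g(1)] by (simp add: f g h_def)
  also have "\<dots> = (LINT \<eta>|lborel. LINT \<xi>|lborel. h \<xi> \<eta>)"
    by (rule lborel_pair.Fubini_integral[OF i, symmetric])
  also have "\<dots> = - (LINT \<eta>|lborel. LINT \<xi>|lborel. h \<eta> \<xi>)"
    by (subst h) simp
  also have "\<dots> = - (x \<bullet> conv_op k z x)"
    using inner_conv_fun[OF kb f(1) g(1) g(1)] conv_op_abs[OF kb f(1) g(1)] by (simp add: f g h_def)
  finally show ?thesis by simp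
qed

lemma conv_op_hermitian:
  assumes kb: "kernel_bound a p k" and even: "\<And>\<xi> \<eta>. k (- \<xi>) (- \<eta>) = k \<xi> \<eta>"
    and y: "y \<in> hermitian" and z: "z \<in> hermitian"
  shows "conv_op k y z \<in> hermitian"
proof -
  note [measurable] = kernel_measurable[OF kb]
  obtain f where f: "f \<in> L2" "abs_l2 f = y" "\<And>\<xi>. f (- \<xi>) = cnj (f \<xi>)"
    using hermitian_representative[OF y] by blast
  obtain g where g: "g \<in> L2" "abs_l2 g = z" "\<And>\<xi>. g (- \<xi>) = cnj (g \<xi>)"
    using hermitian_representative[OF z] by blast
  note [measurable] = L2_measurable[OF f(1)] L2_measurable[OF g(1)]
  have "cnj (conv_fun k f g (- \<xi>)) = conv_fun k f g \<xi>" for \<xi>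
  proof -
    have "conv_fun k f g (- \<xi>) = (LINT \<eta>|lborel. k (- \<xi>) (0 - \<eta>) *\<^sub>R (f (- \<xi> - (0 - \<eta>)) * g (0 - \<eta>)))"
      unfolding conv_fun_def
      by (rule integral_lborel_reflect[of "\<lambda>\<eta>. k (- \<xi>) \<eta> *\<^sub>R (f (- \<xi> - \<eta>) * g \<eta>)", symmetric]) measurable
    also have "\<dots> = (LINT \<eta>|lborel. cnj (k \<xi> \<eta> *\<^sub>R (f (\<xi> - \<eta>) * g \<eta>)))"
    proof (rule Bochner_Integration.integral_cong[OF refl])
      fix \<eta>
      have "f (\<eta> - \<xi>) = cnj (f (\<xi> - \<eta>))" using f(3)[of "\<xi> - \<eta>"] by simp
      then show "k (- \<xi>) (0 - \<eta>) *\<^sub>R (f (- \<xi> - (0 - \<eta>)) * g (0 - \<eta>)) = cnj (k \<xi> \<eta> *\<^sub>R (f (\<xi> - \<eta>) * g \<eta>))"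
        by (simp add: even g(3))
    qed
    also have "\<dots> = cnj (conv_fun k f g \<xi>)"
      unfolding conv_fun_def by (rule Bochner_Integration.integral_cnj)
    finally show ?thesis by simp
  qed
  then show ?thesis
    unfolding f(2)[symmetric] g(2)[symmetric] conv_op_abs[OF kb f(1) g(1)]
    by (subst hermitian_abs_iff[OF conv_fun_L2(1)[OF kb f(1) g(1)]]) simp
qed

subsection \<open>Differential equations in Banach spaces\<close>

text \<open>The factor \<open>exp (- 2 L t)\<close> makes the Picard map a contraction on the whole interval at once.\<close>

lemma lipschitz_ode_exists:
  fixes F :: "'a::banach \<Rightarrow> 'a"
  assumes lip: "\<And>x y. norm (F x - F y) \<le> L * norm (x - y)" and L: "0 < L" and T: "0 \<le> T"
  shows "\<exists>y. y 0 = y\<^sub>0 \<and> (\<forall>t\<in>{0..T}. (y has_vector_derivative F (y t)) (at t within {0..T}))"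
proof -
  \<comment> \<open>Clamping the time to \<open>{0..T}\<close> extends functions on the interval to
    the whole line, so that the complete space of bounded continuous functions can be used.\<close>
  define cl where "cl t = max 0 (min T t)" for t :: real
  have cl_in: "cl t \<in> {0..T}" for t using T by (auto simp: cl_def)
  have cl_id: "t \<in> {0..T} \<Longrightarrow> cl t = t" for t by (auto simp: cl_def)
  have cl_cont: "continuous_on UNIV cl" unfolding cl_def by (intro continuous_intros)
  have contF: "continuous_on UNIV F"
  proof -
    have "L-lipschitz_on UNIV F"
      by (rule lipschitz_onI) (use lip L in \<open>auto simp: dist_norm\<close>)
    then show ?thesis by (rule lipschitz_on_continuous_on)
  qed
  define W where "W g t = exp (-(2 * L * t)) *\<^sub>R (y\<^sub>0 + integral {0..t} (\<lambda>s. F (exp (2 * L * s) *\<^sub>R g s)))"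
    for g :: "real \<Rightarrow> 'a" and t
  have contFg: "continuous_on {0..T} (\<lambda>s. F (exp (2 * L * s) *\<^sub>R g s))" if "continuous_on {0..T} g" for g :: "real \<Rightarrow> 'a"
    by (rule continuous_on_compose2[OF contF]) (auto intro!: continuous_intros that)
  have contW: "continuous_on {0..T} (W g)" if "continuous_on {0..T} g" for g
    unfolding W_def using contFg[OF that]
    by (intro continuous_intros indefinite_integral_continuous_1 integrable_continuous_real)
  define \<Psi> where "\<Psi> g = Bcontfun (\<lambda>t. W (apply_bcontfun g) (cl t))" for g :: "real \<Rightarrow>\<^sub>C 'a"
  have \<Psi>: "apply_bcontfun (\<Psi> g) t = W (apply_bcontfun g) (cl t)" for g t
  proof -
    have c: "continuous_on {0..T} (W (apply_bcontfun g))" by (intro contW) simp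
    have "continuous_on UNIV (\<lambda>t. W (apply_bcontfun g) (cl t))"
      by (rule continuous_on_compose2[OF c cl_cont]) (use cl_in in auto)
    moreover have "bounded (range (\<lambda>t. W (apply_bcontfun g) (cl t)))"
      by (rule bounded_subset[OF compact_imp_bounded[OF compact_continuous_image[OF c compact_Icc]]])
         (use cl_in in auto)
    ultimately show ?thesis
      unfolding \<Psi>_def by (subst Bcontfun_inverse) (auto simp: bcontfun_def)
  qed
  have contr: "dist (\<Psi> g) (\<Psi> h) \<le> (1/2) * dist g h" for g h
  proof (rule dist_bound)
    fix u
    define t where "t = cl u"
    have t: "0 \<le> t" "t \<le> T" using cl_in[of u] by (auto simp: t_def)
    define I where "I g s = F (exp (2 * L * s) *\<^sub>R apply_bcontfun g s)" for g :: "real \<Rightarrow>\<^sub>C 'a" and s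
    have Ii: "I g integrable_on {0..t}" for g
      unfolding I_def using t
      by (intro integrable_continuous_real continuous_on_subset[OF contFg]) auto
    \<comment> \<open>An antiderivative is \<open>exp (2 * L * s) / 2 * dist g h\<close>; its
      denominator 2 becomes the contraction constant.\<close>
    let ?d = "\<lambda>s. L * exp (2 * L * s) * dist g h"
    have hi: "(?d has_integral (exp (2 * L * t) / 2 * dist g h - exp (2 * L * 0) / 2 * dist g h)) {0..t}"
      by (rule fundamental_theorem_of_calculus[OF t(1)])
         (auto intro!: derivative_eq_intros simp flip: has_real_derivative_iff_has_vector_derivative)
    have "norm (integral {0..t} (\<lambda>s. I g s - I h s)) \<le> integral {0..t} ?d"
    proof (rule Henstock_Kurzweil_Integration.integral_norm_bound_integral)
      show "(\<lambda>s. I g s - I h s) integrable_on {0..t}" by (intro integrable_diff Ii)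
      show "?d integrable_on {0..t}" using hi by blast
      fix s
      have "norm (I g s - I h s) \<le> L * norm (exp (2 * L * s) *\<^sub>R apply_bcontfun g s - exp (2 * L * s) *\<^sub>R apply_bcontfun h s)"
        unfolding I_def by (rule lip)
      also have "\<dots> = L * exp (2 * L * s) * dist (apply_bcontfun g s) (apply_bcontfun h s)"
        by (simp flip: scaleR_diff_right add: dist_norm)
      also have "\<dots> \<le> ?d s"
        using L by (intro mult_left_mono dist_bounded) auto
      finally show "norm (I g s - I h s) \<le> ?d s" .
    qed
    also have "integral {0..t} ?d \<le> exp (2 * L * t) / 2 * dist g h"
      using integral_unique[OF hi] by simp
    finally have le: "norm (integral {0..t} (\<lambda>s. I g s - I h s)) \<le> exp (2 * L * t) / 2 * dist g h" .
    have "dist (apply_bcontfun (\<Psi> g) u) (apply_bcontfun (\<Psi> h) u)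
        = exp (-(2 * L * t)) * norm (integral {0..t} (I g) - integral {0..t} (I h))"
      unfolding \<Psi> W_def t_def[symmetric] I_def[symmetric] dist_norm
      by (simp flip: scaleR_diff_right)
    also have "\<dots> = exp (-(2 * L * t)) * norm (integral {0..t} (\<lambda>s. I g s - I h s))"
      by (subst Henstock_Kurzweil_Integration.integral_diff) (auto intro: Ii)
    also have "\<dots> \<le> exp (-(2 * L * t)) * (exp (2 * L * t) / 2 * dist g h)"
      by (intro mult_left_mono le) auto
    also have "\<dots> = (1/2) * dist g h"
      by (simp add: exp_minus)
    finally show "dist (apply_bcontfun (\<Psi> g) u) (apply_bcontfun (\<Psi> h) u) \<le> (1/2) * dist g h" .
  qed
  obtain g where g: "\<Psi> g = g"
    using banach_fix_type[of "1/2" \<Psi>] contr by auto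
  define y where "y t = exp (2 * L * t) *\<^sub>R apply_bcontfun g t" for t
  have y: "y t = y\<^sub>0 + integral {0..t} (\<lambda>s. F (y s))" if "t \<in> {0..T}" for t
  proof -
    have "apply_bcontfun g t = W (apply_bcontfun g) t"
      using \<Psi>[of g t] g cl_id[OF that] by simp
    then show ?thesis by (simp add: y_def W_def exp_minus)
  qed
  have cy: "continuous_on {0..T} (\<lambda>s. F (y s))"
    unfolding y_def by (intro contFg) simp
  have "(y has_vector_derivative F (y t)) (at t within {0..T})" if "t \<in> {0..T}" for t
  proof (rule has_vector_derivative_transform[OF that])
    have "((\<lambda>t. integral {0..t} (\<lambda>s. F (y s))) has_vector_derivative F (y t)) (at t within {0..T})"
      by (rule integral_has_vector_derivative[OF cy that])
    then show "((\<lambda>t. y\<^sub>0 + integral {0..t} (\<lambda>s. F (y s))) has_vector_derivative F (y t)) (at t within {0..T})"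
      by (auto intro!: derivative_eq_intros)
  qed (use y in auto)
  moreover have "y 0 = y\<^sub>0" using y[of 0] T by simp
  ultimately show ?thesis by blast
qed

lemma nonpos_derivative_imp_le:
  fixes h :: "real \<Rightarrow> real"
  assumes "\<And>t. t \<in> {0..T} \<Longrightarrow> (h has_real_derivative h' t) (at t within {0..T})"
    and "\<And>t. t \<in> {0..T} \<Longrightarrow> h' t \<le> 0" and t: "t \<in> {0..T}"
  shows "h t \<le> h 0"
proof -
  have "\<exists>x\<in>{0..t}. h t - h 0 = (\<lambda>x. (*) (h' x)) x (t - 0)"
  proof (rule mvt_very_simple)
    fix x assume x: "0 \<le> x" "x \<le> t"
    then have "(h has_real_derivative h' x) (at x within {0..t})"
      using assms(1)[of x] t by (auto intro: has_field_derivative_subset)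
    then show "(h has_derivative (*) (h' x)) (at x within {0..t})"
      by (simp add: has_field_derivative_def)
  qed (use t in auto)
  then obtain x where "x \<in> {0..t}" "h t - h 0 = h' x * t" by auto
  moreover then have "h' x * t \<le> 0"
    using assms(2)[of x] t by (intro mult_nonpos_nonneg) auto
  ultimately show ?thesis by linarith
qed

text \<open>The integrating factor makes \<open>exp (-(a * t)) * E t - b * t\<close> nonincreasing.
  Bounding the factor by 1 in front of \<open>b\<close> gives the simple term \<open>b * t\<close>
  in place of an integral.\<close>

lemma gronwall:
  fixes E :: "real \<Rightarrow> real"
  assumes E: "\<And>t. t \<in> {0..T} \<Longrightarrow> (E has_real_derivative E' t) (at t within {0..T})"
    and le: "\<And>t. t \<in> {0..T} \<Longrightarrow> E' t \<le> a * E t + b"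
    and a: "0 \<le> a" and b: "0 \<le> b" and t: "t \<in> {0..T}"
  shows "E t \<le> exp (a * t) * (E 0 + b * t)"
proof -
  have "exp (-(a * t)) * E t - b * t \<le> exp (-(a * 0)) * E 0 - b * 0"
  proof (rule nonpos_derivative_imp_le[OF _ _ t])
    fix t assume t: "t \<in> {0..T}"
    show "((\<lambda>t. exp (-(a * t)) * E t - b * t) has_real_derivative
        (exp (-(a * t)) * (E' t - a * E t) - b)) (at t within {0..T})"
      by (auto intro!: derivative_eq_intros E t simp: algebra_simps)
    have "exp (-(a * t)) * (E' t - a * E t) \<le> exp (-(a * t)) * b"
      using le[OF t] by (intro mult_left_mono) auto
    also have "\<dots> \<le> 1 * b"
      using a b t by (intro mult_right_mono) auto
    finally show "exp (-(a * t)) * (E' t - a * E t) - b \<le> 0" by simp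
  qed
  then have "exp (-(a * t)) * E t \<le> E 0 + b * t" by simp
  then show ?thesis by (simp add: exp_minus field_simps)
qed

lemma has_real_derivative_norm_square:
  fixes u :: "real \<Rightarrow> 'a::real_inner"
  assumes "(u has_vector_derivative u') (at t within S)"
  shows "((\<lambda>t. (norm (u t))\<^sup>2) has_real_derivative 2 * (u t \<bullet> u')) (at t within S)"
proof -
  have "((\<lambda>t. u t \<bullet> u t) has_derivative (\<lambda>h. u t \<bullet> (h *\<^sub>R u') + (h *\<^sub>R u') \<bullet> u t)) (at t within S)"
    using assms unfolding has_vector_derivative_def by (intro has_derivative_inner)
  then show ?thesis
    unfolding has_field_derivative_def power2_norm_eq_inner
    by (rule has_derivative_eq_rhs) (auto simp: inner_commute)
qed

text \<open>The radial retraction onto a ball is Lipschitz with constant 2 in every normed space: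
  one unit accounts for the difference of the vectors, one for the difference of the scaling
  factors.\<close>

lemma norm_diff_max_le:
  fixes x y :: "'a::real_normed_vector"
  assumes r: "0 < r"
  shows "norm ((r / max r (norm x)) *\<^sub>R x - (r / max r (norm y)) *\<^sub>R y) \<le> 2 * norm (x - y)"
proof -
  define a b where "a = max r (norm x)" and "b = max r (norm y)"
  have ab: "a > 0" "b > 0" "r \<le> a" "norm y \<le> b" using r by (auto simp: a_def b_def)
  have d: "\<bar>b - a\<bar> \<le> norm (x - y)"
    using norm_triangle_ineq3[of x y] by (auto simp: a_def b_def)
  have "(r / a) *\<^sub>R x - (r / b) *\<^sub>R y = (r / a) *\<^sub>R (x - y) + (r / a - r / b) *\<^sub>R y"
    by (simp add: algebra_simps)
  then have "norm ((r / a) *\<^sub>R x - (r / b) *\<^sub>R y) \<le> \<bar>r / a\<bar> * norm (x - y) + \<bar>r / a - r / b\<bar> * norm y"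
    using norm_triangle_ineq[of "(r / a) *\<^sub>R (x - y)" "(r / a - r / b) *\<^sub>R y"] by simp
  also have "\<bar>r / a\<bar> * norm (x - y) \<le> 1 * norm (x - y)"
    using ab r by (intro mult_right_mono) auto
  also have "\<bar>r / a - r / b\<bar> * norm y \<le> norm (x - y)"
  proof -
    have "r / a - r / b = (r / a) * ((b - a) / b)"
      using ab by (simp add: field_simps)
    then have "\<bar>r / a - r / b\<bar> * norm y = (r / a) * (\<bar>b - a\<bar> * (norm y / b))"
      using ab r by (simp add: abs_mult)
    also have "\<dots> \<le> 1 * (\<bar>b - a\<bar> * 1)"
      using ab r by (intro mult_mono) auto
    finally show ?thesis using d by simp
  qed
  finally show ?thesis unfolding a_def b_def by simp
qed


subsection \<open>An abstract quasilinear evolution equation\<close>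

text \<open>
  The equation is \<open>J y' = - B y y\<close>, where \<open>J\<close> gains one derivative; \<open>norm (A y)\<close> is the low norm in which
  differences of solutions are controlled. \<open>P N\<close> is the Galerkin projection and \<open>G N\<close> stands for the
  unbounded operator \<open>P N \<circ> J\<^sup>-\<^sup>1\<close>. The weights \<open>Om R\<close> measure the part of \<open>y\<close> at frequencies above \<open>R\<close>;
  they replace the Bona-Smith argument, since a uniform bound of the tails turns convergence in the low norm
  into convergence in the norm of the space.
\<close>

locale quasilinear_equation =
  fixes B :: "'a::{real_inner, banach} \<Rightarrow> 'a \<Rightarrow> 'a"
    and A D J :: "'a \<Rightarrow> 'a" and Om :: "real \<Rightarrow> 'a \<Rightarrow> 'a"
    and P G :: "nat \<Rightarrow> 'a \<Rightarrow> 'a" and V :: "'a set" and C :: real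
    and \<epsilon> :: "nat \<Rightarrow> real" and K :: "real \<Rightarrow> real"
  assumes bilinear_B: "bounded_bilinear B"
    and linear_A: "bounded_linear A" and linear_D: "bounded_linear D" and linear_J: "bounded_linear J"
    and linear_Om: "bounded_linear (Om R)" and linear_P: "bounded_linear (P N)" and linear_G: "bounded_linear (G N)"
    and C_pos: "0 < C"
    and A_eq: "A y = D (J y)" and J_inj: "J y = 0 \<Longrightarrow> y = 0"
    and V_subspace: "subspace V" and V_closed: "closed V"
    and B_V: "y \<in> V \<Longrightarrow> B y y \<in> V"
    and P_V: "P N y \<in> V" and P_idem: "P N (P N y) = P N y" and P_G: "P N (G N y) = G N y"
    and P_le: "norm (P N y) \<le> norm y" and P_tendsto: "y \<in> V \<Longrightarrow> (\<lambda>N. P N y) \<longlonglongrightarrow> y"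
    and Om_P: "norm (Om R (P N y)) \<le> norm (Om R y)"
    and Om_le: "norm (Om R y) \<le> norm y" and Om_one: "Om 1 y = y"
    and Om_tendsto: "((\<lambda>R. norm (Om R y)) \<longlongrightarrow> 0) at_top"
    and energy: "\<And>R N y. 1 \<le> R \<Longrightarrow> P N y = y \<Longrightarrow>
          \<bar>Om R y \<bullet> Om R (G N (B y y))\<bar> \<le> C * norm y * (norm (Om R y))\<^sup>2"
    and skew: "y \<in> V \<Longrightarrow> d \<in> V \<Longrightarrow> A d \<bullet> D (B y d) = 0"
    and low: "norm (D (B d z)) \<le> C * norm (A d) * norm z"
    and interpolation: "1 \<le> R \<Longrightarrow> norm d \<le> K R * norm (A d) + norm (Om R d)" and K_nonneg: "0 \<le> K R"
    and \<epsilon>_nonneg: "0 \<le> \<epsilon> N" and \<epsilon>_tendsto: "\<epsilon> \<longlonglongrightarrow> 0"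
    and A_G: "z \<in> V \<Longrightarrow> norm (A (G N z) - D z) \<le> \<epsilon> N * norm z"
    and J_G: "J (G N z) = P N z" and J_P: "z \<in> V \<Longrightarrow> norm (J (P N z) - J z) \<le> \<epsilon> N * norm z"
begin

text \<open>For SQG, \<open>J\<close> is the embedding of H^s into H^(s-1) in encoded form. This is
  therefore the integral equation in H^(s-1), with an integrand that is continuous in the norm of
  the space.\<close>

definition solution :: "real \<Rightarrow> 'a \<Rightarrow> (real \<Rightarrow> 'a) \<Rightarrow> bool" where
  "solution T y\<^sub>0 y \<longleftrightarrow> continuous_on {0..T} y \<and> (\<forall>t\<in>{0..T}. y t \<in> V \<and>
     ((\<lambda>\<tau>. - B (y \<tau>) (y \<tau>)) has_integral (J (y t) - J y\<^sub>0)) {0..t})"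

lemmas V_diff = subspace_diff[OF V_subspace]

text \<open>With \<open>d = y - z\<close> the difference is the sum of \<open>B y d\<close> and
  \<open>B d z\<close>. The first term is skew, and in the second the derivative falls on
  \<open>z\<close>; hence only the norm of one of the two functions enters.\<close>

lemma D_B_difference:
  assumes "y \<in> V" "z \<in> V"
  shows "\<bar>A (y - z) \<bullet> (D (B y y) - D (B z z))\<bar> \<le> C * norm z * (norm (A (y - z)))\<^sup>2"
proof -
  interpret B: bounded_bilinear B by (rule bilinear_B)
  interpret D: bounded_linear D by (rule linear_D)
  have "D (B y y) - D (B z z) = D (B y (y - z)) + D (B (y - z) z)"
    by (simp add: B.diff_left B.diff_right D.diff)
  then have "A (y - z) \<bullet> (D (B y y) - D (B z z)) = A (y - z) \<bullet> D (B (y - z) z)"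
    using skew[OF assms(1) V_diff[OF assms]] by (simp add: inner_add_right)
  also have "\<bar>\<dots>\<bar> \<le> norm (A (y - z)) * norm (D (B (y - z) z))"
    by (rule Cauchy_Schwarz_ineq2)
  also have "\<dots> \<le> norm (A (y - z)) * (C * norm (A (y - z)) * norm z)"
    by (intro mult_left_mono low) auto
  finally show ?thesis by (simp add: power2_eq_square mult_ac)
qed

text \<open>A solution \<open>y\<close> need not be differentiable in this space. But
  \<open>J y\<close> is, as the primitive of a continuous function, and \<open>A\<close> factors
  through \<open>J\<close>.\<close>

lemma solution_A_derivative:
  assumes "solution T y\<^sub>0 y" "t \<in> {0..T}"
  shows "((\<lambda>t. A (y t)) has_vector_derivative - D (B (y t) (y t))) (at t within {0..T})"
proof (rule has_vector_derivative_transform[OF assms(2)])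
  interpret B: bounded_bilinear B by (rule bilinear_B)
  interpret D: bounded_linear D by (rule linear_D)
  let ?I = "\<lambda>t. integral {0..t} (\<lambda>\<tau>. - B (y \<tau>) (y \<tau>))"
  have c: "continuous_on {0..T} (\<lambda>\<tau>. - B (y \<tau>) (y \<tau>))"
    using assms(1) by (auto simp: solution_def intro!: continuous_intros B.continuous_on)
  have "(?I has_vector_derivative - B (y t) (y t)) (at t within {0..T})"
    by (rule integral_has_vector_derivative[OF c assms(2)])
  from has_vector_derivative_add[OF has_vector_derivative_const[of "J y\<^sub>0"] this]
  have "((\<lambda>t. J y\<^sub>0 + ?I t) has_vector_derivative - B (y t) (y t)) (at t within {0..T})"
    by simp
  from D.has_vector_derivative[OF this]
  show "((\<lambda>t. D (J y\<^sub>0 + ?I t)) has_vector_derivative - D (B (y t) (y t))) (at t within {0..T})"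
    by (simp add: D.neg)
  show "A (y t) = D (J y\<^sub>0 + ?I t)" if "t \<in> {0..T}" for t
  proof -
    have "?I t = J (y t) - J y\<^sub>0"
      using assms(1) that by (intro integral_unique) (auto simp: solution_def)
    then show ?thesis by (simp add: A_eq)
  qed
qed

text \<open>The asymmetry of \<open>D_B_difference\<close> persists: only \<open>z\<close> has to be
  bounded. Gronwall's lemma acts on the square of the norm, and the factor 2 in its exponent
  disappears with the root.\<close>

lemma solution_low_norm_stability:
  assumes y: "solution T y\<^sub>0 y" and z: "solution T z\<^sub>0 z" and t: "t \<in> {0..T}"
    and M: "\<And>t. t \<in> {0..T} \<Longrightarrow> norm (z t) \<le> M" and M0: "0 \<le> M"
  shows "norm (A (y t - z t)) \<le> exp (C * M * t) * norm (A (y 0 - z 0))"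
proof -
  interpret A: bounded_linear A by (rule linear_A)
  have "(norm (A (y t) - A (z t)))\<^sup>2 \<le> exp (2 * C * M * t) * ((norm (A (y 0) - A (z 0)))\<^sup>2 + 0 * t)"
  proof (rule gronwall[OF _ _ _ _ t])
    fix t assume t: "t \<in> {0..T}"
    have "((\<lambda>t. A (y t) - A (z t)) has_vector_derivative (- D (B (y t) (y t)) - (- D (B (z t) (z t))))) (at t within {0..T})"
      by (intro has_vector_derivative_diff solution_A_derivative[OF y t] solution_A_derivative[OF z t])
    from has_real_derivative_norm_square[OF this]
    show "((\<lambda>t. (norm (A (y t) - A (z t)))\<^sup>2) has_real_derivative
       2 * ((A (y t) - A (z t)) \<bullet> (- D (B (y t) (y t)) - (- D (B (z t) (z t)))))) (at t within {0..T})" .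
    have V: "y t \<in> V" "z t \<in> V" using y z t by (auto simp: solution_def)
    have "2 * ((A (y t) - A (z t)) \<bullet> (- D (B (y t) (y t)) - (- D (B (z t) (z t)))))
       = - (2 * (A (y t - z t) \<bullet> (D (B (y t) (y t)) - D (B (z t) (z t)))))"
      by (simp add: A.diff inner_diff_right)
    also have "\<dots> \<le> 2 * (C * norm (z t) * (norm (A (y t - z t)))\<^sup>2)"
      using D_B_difference[OF V] by linarith
    also have "\<dots> \<le> 2 * (C * M * (norm (A (y t - z t)))\<^sup>2)"
      using C_pos M[OF t] by (intro mult_left_mono mult_right_mono) auto
    finally show "2 * ((A (y t) - A (z t)) \<bullet> (- D (B (y t) (y t)) - (- D (B (z t) (z t)))))
      \<le> 2 * C * M * (norm (A (y t) - A (z t)))\<^sup>2 + 0"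
      by (simp add: A.diff)
  qed (use C_pos M0 in auto)
  also have "\<dots> = (exp (C * M * t) * norm (A (y 0) - A (z 0)))\<^sup>2"
    by (simp add: power_mult_distrib exp_double[symmetric] mult.assoc)
  finally show ?thesis
    unfolding A.diff by (rule power2_le_imp_le) simp
qed

lemma solution_initial:
  assumes "solution T y\<^sub>0 y" "0 \<le> T"
  shows "y 0 = y\<^sub>0"
proof -
  interpret J: bounded_linear J by (rule linear_J)
  have "((\<lambda>\<tau>. - B (y \<tau>) (y \<tau>)) has_integral (J (y 0) - J y\<^sub>0)) {0}"
    using assms unfolding solution_def by (elim conjE) (drule bspec[of _ _ 0], auto)
  then have "J (y 0) - J y\<^sub>0 = 0"
    using has_integral_refl(2) has_integral_unique by blast
  then have "J (y 0 - y\<^sub>0) = 0" by (simp add: J.diff)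
  from J_inj[OF this] show ?thesis by simp
qed

text \<open>Once the low norm of the difference vanishes, \<open>interpolation\<close> leaves only
  its tail norm, and this tends to 0 for large \<open>R\<close>. So \<open>interpolation\<close>
  also supplies the injectivity of \<open>A\<close>.\<close>

lemma solution_unique:
  assumes y: "solution T y\<^sub>0 y" and z: "solution T y\<^sub>0 z" and t: "t \<in> {0..T}"
  shows "y t = z t"
proof -
  interpret A: bounded_linear A by (rule linear_A)
  interpret D: bounded_linear D by (rule linear_D)
  have T: "0 \<le> T" using t by auto
  have "bounded (z ` {0..T})"
    using z by (intro compact_imp_bounded compact_continuous_image) (auto simp: solution_def)
  then obtain M where M: "0 < M" "\<And>t. t \<in> {0..T} \<Longrightarrow> norm (z t) \<le> M"
    by (auto simp: bounded_pos)
  have "norm (A (y t - z t)) \<le> exp (C * M * t) * norm (A (y 0 - z 0))"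
    by (rule solution_low_norm_stability[OF y z t]) (use M in auto)
  then have 0: "A (y t - z t) = 0"
    using solution_initial[OF y T] solution_initial[OF z T] by (simp add: A.zero)
  have "norm (y t - z t) \<le> norm (Om R (y t - z t))" if "1 \<le> R" for R
    using interpolation[OF that, of "y t - z t"] 0 by simp
  then have "\<forall>\<^sub>F R in at_top. norm (y t - z t) \<le> norm (Om R (y t - z t))"
    by (auto simp: eventually_at_top_linorder)
  from tendsto_lowerbound[OF Om_tendsto this] have "norm (y t - z t) \<le> 0" by simp
  then show ?thesis by simp
qed

text \<open>For \<open>n = sqrt (1 + (norm y)\<^sup>2)\<close> the energy estimate reads n' \<le> C
  n^2, so 1/n falls at a rate of at most \<open>C\<close>. It starts from at least
  \<open>2 / life_bound M\<close> and loses at most \<open>1 / life_bound M\<close> during the life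
  span, so \<open>n\<close> stays below \<open>life_bound M\<close>. The summand 1 keeps
  \<open>n\<close> away from 0.\<close>

definition life_bound :: "real \<Rightarrow> real" where "life_bound M = 2 * sqrt (1 + M\<^sup>2)"
definition life_span :: "real \<Rightarrow> real" where "life_span M = 1 / (C * life_bound M)"

lemma life_bound_pos: "0 < life_bound M" and life_span_pos: "0 < life_span M"
  using C_pos by (auto simp: life_bound_def life_span_def add_pos_nonneg)

text \<open>
  The quadratic field is made globally Lipschitz by the retraction \<open>\<rho>\<close> to a ball of radius \<open>r\<close>. The energy estimate
  survives the retraction, in the form that \<open>1 / sqrt (1 + (norm y)\<^sup>2) + C t\<close> increases, so the solution never leaves the ball.
\<close>

lemma galerkin:
  assumes y0: "norm y\<^sub>0 \<le> M"
  shows "\<exists>y. y 0 = P N y\<^sub>0 \<and> (\<forall>t\<in>{0..life_span M}.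
     (y has_vector_derivative - G N (B (y t) (y t))) (at t within {0..life_span M}) \<and>
     P N (y t) = y t \<and> norm (y t) \<le> life_bound M \<and>
     (\<forall>R\<ge>1. norm (Om R (y t)) \<le> exp (C * life_bound M * life_span M) * norm (Om R y\<^sub>0)))"
proof -
  interpret B: bounded_bilinear B by (rule bilinear_B)
  interpret G: bounded_linear "G N" by (rule linear_G)
  interpret P: bounded_linear "P N" by (rule linear_P)
  define r T where "r = life_bound M" and "T = life_span M"
  have r: "0 < r" and T: "0 < T" using life_bound_pos life_span_pos by (auto simp: r_def T_def)
  obtain KB where KB: "0 < KB" "\<And>x y. norm (B x y) \<le> norm x * norm y * KB"
    using B.pos_bounded by blast
  obtain KG where KG: "0 < KG" "\<And>x. norm (G N x) \<le> norm x * KG"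
    using G.pos_bounded by blast
  define \<rho> where "\<rho> x = (r / max r (norm x)) *\<^sub>R x" for x :: 'a
  have \<rho>_lip: "norm (\<rho> x - \<rho> y) \<le> 2 * norm (x - y)" for x y
    unfolding \<rho>_def by (rule norm_diff_max_le[OF r])
  have \<rho>_le: "norm (\<rho> x) \<le> r" for x
    using r by (auto simp: \<rho>_def field_simps max_def)
  have \<rho>_id: "norm x \<le> r \<Longrightarrow> \<rho> x = x" for x
    using r by (simp add: \<rho>_def max_def)
  define F where "F x = - G N (B (\<rho> (P N x)) (\<rho> (P N x)))" for x
  \<comment> \<open>This constant depends on \<open>N\<close> through the norm of
    \<open>G N\<close>, but the time of existence does not. The factor \<open>4 * r\<close> stems
    from the two terms of \<open>B u u - B v v\<close>, each with a factor of norm at most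
    \<open>r\<close> and the Lipschitz constant 2 of \<open>\<rho>\<close>.\<close>
  define L where "L = KG * KB * (4 * r)"
  have L: "0 < L" using KG KB r by (simp add: L_def)
  have lip: "norm (F x - F y) \<le> L * norm (x - y)" for x y
  proof -
    define u v where "u = \<rho> (P N x)" and "v = \<rho> (P N y)"
    have uv: "norm u \<le> r" "norm v \<le> r" by (auto simp: u_def v_def \<rho>_le)
    have "norm (u - v) \<le> 2 * norm (P N x - P N y)" unfolding u_def v_def by (rule \<rho>_lip)
    also have "\<dots> \<le> 2 * norm (x - y)" using P_le[of N "x - y"] by (simp add: P.diff)
    finally have d: "norm (u - v) \<le> 2 * norm (x - y)" .
    have "B u u - B v v = B u (u - v) + B (u - v) v" by (simp add: B.diff_left B.diff_right)
    then have "norm (B u u - B v v) \<le> norm u * norm (u - v) * KB + norm (u - v) * norm v * KB"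
      using norm_triangle_ineq[of "B u (u - v)" "B (u - v) v"] KB(2)[of u "u - v"] KB(2)[of "u - v" v] by simp
    also have "\<dots> \<le> r * (2 * norm (x - y)) * KB + (2 * norm (x - y)) * r * KB"
      using uv d KB r by (intro add_mono mult_right_mono mult_mono) auto
    finally have "norm (B u u - B v v) \<le> KB * (4 * r) * norm (x - y)" by (simp add: mult_ac)
    then have "norm (B u u - B v v) * KG \<le> KB * (4 * r) * norm (x - y) * KG"
      using KG by (intro mult_right_mono) auto
    moreover have "norm (F x - F y) = norm (G N (B u u - B v v))"
      by (simp add: F_def u_def v_def G.diff norm_minus_commute)
    ultimately show ?thesis
      using KG(2)[of "B u u - B v v"] by (simp add: L_def mult_ac)
  qed
  obtain y where y0': "y 0 = P N y\<^sub>0"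
    and y: "\<And>t. t \<in> {0..T} \<Longrightarrow> (y has_vector_derivative F (y t)) (at t within {0..T})"
    using lipschitz_ode_exists[of F L T "P N y\<^sub>0", OF lip L] T by auto
  have Py: "P N (y t) = y t" if "t \<in> {0..T}" for t
  proof -
    have "((\<lambda>t. y t - P N (y t)) has_vector_derivative 0) (at t within {0..T})" if "t \<in> {0..T}" for t
    proof -
      have "((\<lambda>t. y t - P N (y t)) has_vector_derivative (F (y t) - P N (F (y t)))) (at t within {0..T})"
        by (intro has_vector_derivative_diff P.has_vector_derivative y that)
      then show ?thesis by (simp add: F_def P.neg P_G)
    qed
    then obtain c where c: "\<And>t. t \<in> {0..T} \<Longrightarrow> y t - P N (y t) = c"
      using has_vector_derivative_zero_constant[of "{0..T}" "\<lambda>t. y t - P N (y t)"] by (metis convex_real_interval(5))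
    have "c = 0" using c[of 0] T by (simp add: y0' P_idem)
    then show ?thesis using c[OF that] by simp
  qed
  have bound: "norm (y t) \<le> r" if t: "t \<in> {0..T}" for t
  proof -
    define n where "n t = sqrt (1 + (norm (y t))\<^sup>2)" for t
    have n_pos: "0 < n t" for t by (simp add: n_def add_pos_nonneg)
    have n_sq: "(n t)\<^sup>2 = 1 + (norm (y t))\<^sup>2" for t by (simp add: n_def)
    have n_ge: "norm (y t) \<le> n t" for t
      unfolding n_def by (rule real_le_rsqrt) simp
    have "- inverse (n t) - C * t \<le> - inverse (n 0) - C * 0"
    proof (rule nonpos_derivative_imp_le[OF _ _ t])
      fix t assume t: "t \<in> {0..T}"
      let ?E' = "2 * (y t \<bullet> F (y t))"
      have dE: "((\<lambda>t. (norm (y t))\<^sup>2) has_real_derivative ?E') (at t within {0..T})"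
        by (rule has_real_derivative_norm_square[OF y[OF t]])
      have pos: "0 < 1 + (norm (y t))\<^sup>2" by (simp add: add_pos_nonneg)
      have "(n has_real_derivative (?E' * (inverse (n t) / 2))) (at t within {0..T})"
        unfolding n_def
        using DERIV_chain2[OF DERIV_real_sqrt[OF pos] DERIV_add[OF DERIV_const dE]]
        by (simp add: mult_ac)
      then show "((\<lambda>t. - inverse (n t) - C * t) has_real_derivative
          (?E' * (inverse (n t) / 2) * inverse ((n t)\<^sup>2) - C)) (at t within {0..T})"
        using n_pos[of t]
        by (auto intro!: derivative_eq_intros simp: power2_eq_square)
      define u where "u = \<rho> (y t)"
      \<comment> \<open>The retracted point is \<open>c\<close> times \<open>y t\<close>, so the
        energy estimate at \<open>u\<close> can be divided by \<open>c\<close> and becomes one for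
        \<open>y t\<close>, with the harmless factor \<open>c\<^sup>2\<close>.\<close>
      define c where "c = r / max r (norm (y t))"
      have c: "0 < c" "c \<le> 1" using r by (auto simp: c_def)
      have u: "u = c *\<^sub>R y t" by (simp add: u_def \<rho>_def c_def)
      have Pu: "P N u = u" by (simp add: u P.scaleR Py[OF t])
      have Fy: "F (y t) = - G N (B u u)" by (simp add: F_def Py[OF t] u_def)
      \<comment> \<open>For \<open>R = 1\<close> the tail operator is the identity, so the family of
        tail estimates contains the estimate of the full norm.\<close>
      have "\<bar>u \<bullet> G N (B u u)\<bar> \<le> C * norm u * (norm u)\<^sup>2"
        using energy[of 1 N u] Pu by (simp add: Om_one)
      then have "\<bar>y t \<bullet> G N (B u u)\<bar> * c \<le> (C * c\<^sup>2 * (norm (y t))^3) * c"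
        using c by (simp add: u abs_mult power2_eq_square power3_eq_cube mult_ac)
      then have "\<bar>y t \<bullet> G N (B u u)\<bar> \<le> C * c\<^sup>2 * (norm (y t))^3"
        using c by (simp only: mult_le_cancel_right_pos)
      also have "\<dots> \<le> C * 1 * (n t)^3"
        using c C_pos n_ge[of t] by (intro mult_mono power_mono) (auto simp: power_le_one)
      finally have "?E' \<le> 2 * C * (n t)^3" by (simp add: Fy)
      then have "?E' * (inverse (n t) / 2) * inverse ((n t)\<^sup>2) \<le> (2 * C * (n t)^3) * (inverse (n t) / 2) * inverse ((n t)\<^sup>2)"
        using n_pos[of t] by (intro mult_right_mono) auto
      also have "\<dots> = C" using n_pos[of t] by (simp add: field_simps power2_eq_square power3_eq_cube)
      finally show "?E' * (inverse (n t) / 2) * inverse ((n t)\<^sup>2) - C \<le> 0" by simp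
    qed
    then have ge: "inverse (n 0) - C * t \<le> inverse (n t)" by simp
    have "n 0 \<le> r / 2"
    proof -
      have "norm (y 0) \<le> M" using P_le[of N y\<^sub>0] y0 y0' by simp
      then show ?thesis by (simp add: n_def r_def life_bound_def power_mono)
    qed
    then have "inverse (r / 2) \<le> inverse (n 0)" using n_pos[of 0] by (intro le_imp_inverse_le)
    moreover have "C * t \<le> inverse r"
    proof -
      have "C * t \<le> C * T" using t C_pos by simp
      also have "\<dots> = inverse r" using C_pos r by (simp add: T_def life_span_def r_def[symmetric] field_simps)
      finally show ?thesis .
    qed
    ultimately have "inverse r \<le> inverse (n t)" using ge by (simp add: field_simps)
    then have "n t \<le> r" using r n_pos[of t] by (simp add: field_simps)
    then show ?thesis using n_ge[of t] by simp
  qed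
  have F_eq: "F (y t) = - G N (B (y t) (y t))" if "t \<in> {0..T}" for t
    using Py[OF that] bound[OF that] by (simp add: F_def \<rho>_id)
  have tail: "norm (Om R (y t)) \<le> exp (C * r * T) * norm (Om R y\<^sub>0)" if R: "1 \<le> R" and t: "t \<in> {0..T}" for R t
  proof -
    interpret Om: bounded_linear "Om R" by (rule linear_Om)
    have "(norm (Om R (y t)))\<^sup>2 \<le> exp (2 * C * r * t) * ((norm (Om R (y 0)))\<^sup>2 + 0 * t)"
    proof (rule gronwall[OF _ _ _ _ t])
      fix t assume t: "t \<in> {0..T}"
      have "((\<lambda>t. Om R (y t)) has_vector_derivative Om R (- G N (B (y t) (y t)))) (at t within {0..T})"
        using Om.has_vector_derivative[OF y[OF t]] F_eq[OF t] by simp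
      from has_real_derivative_norm_square[OF this]
      show "((\<lambda>t. (norm (Om R (y t)))\<^sup>2) has_real_derivative
         2 * (Om R (y t) \<bullet> Om R (- G N (B (y t) (y t))))) (at t within {0..T})" .
      have "2 * (Om R (y t) \<bullet> Om R (- G N (B (y t) (y t)))) \<le> 2 * (C * norm (y t) * (norm (Om R (y t)))\<^sup>2)"
        using energy[OF R Py[OF t]] by (simp add: Om.neg)
      also have "\<dots> \<le> 2 * (C * r * (norm (Om R (y t)))\<^sup>2)"
        using C_pos bound[OF t] by (intro mult_left_mono mult_right_mono) auto
      finally show "2 * (Om R (y t) \<bullet> Om R (- G N (B (y t) (y t)))) \<le> 2 * C * r * (norm (Om R (y t)))\<^sup>2 + 0"
        by simp
    qed (use C_pos r in auto)
    also have "\<dots> = (exp (C * r * t) * norm (Om R (y 0)))\<^sup>2"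
      by (simp add: power_mult_distrib exp_double[symmetric] mult.assoc)
    finally have "norm (Om R (y t)) \<le> exp (C * r * t) * norm (Om R (y 0))"
      by (rule power2_le_imp_le) simp
    also have "\<dots> \<le> exp (C * r * T) * norm (Om R y\<^sub>0)"
      using C_pos r t Om_P[of R N y\<^sub>0] y0' by (intro mult_mono) auto
    finally show ?thesis .
  qed
  show ?thesis
    by (rule exI[of _ y]) (use y0' y F_eq Py bound tail in \<open>auto simp flip: r_def T_def\<close>)
qed

text \<open>Strong convergence is reached without compactness. The approximations are Cauchy in the
  low norm, up to truncation errors, and their tails are uniformly small;
  \<open>interpolation\<close> combines both into convergence in the norm, uniformly in
  time.\<close>

lemma galerkin_limit:
  assumes y0: "norm y\<^sub>0 \<le> M" "y\<^sub>0 \<in> V"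
  shows "\<exists>y. solution (life_span M) y\<^sub>0 y \<and> (\<forall>t\<in>{0..life_span M}. norm (y t) \<le> life_bound M \<and>
     (\<forall>R\<ge>1. norm (Om R (y t)) \<le> exp (C * life_bound M * life_span M) * norm (Om R y\<^sub>0)))"
proof -
  interpret B: bounded_bilinear B by (rule bilinear_B)
  interpret A: bounded_linear A by (rule linear_A)
  interpret D: bounded_linear D by (rule linear_D)
  interpret J: bounded_linear J by (rule linear_J)
  define r T where "r = life_bound M" and "T = life_span M"
  define tail where "tail R = exp (C * r * T) * norm (Om R y\<^sub>0)" for R
  have r: "0 < r" and T: "0 < T" using life_bound_pos life_span_pos by (auto simp: r_def T_def)
  obtain KB where KB: "0 < KB" "\<And>x y. norm (B x y) \<le> norm x * norm y * KB"
    using B.pos_bounded by blast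
  obtain KJ where KJ: "0 < KJ" "\<And>x. norm (J x) \<le> norm x * KJ"
    using J.pos_bounded by blast
  have "\<forall>N. \<exists>y. y 0 = P N y\<^sub>0 \<and> (\<forall>t\<in>{0..T}.
     (y has_vector_derivative - G N (B (y t) (y t))) (at t within {0..T}) \<and>
     P N (y t) = y t \<and> norm (y t) \<le> r \<and> (\<forall>R\<ge>1. norm (Om R (y t)) \<le> tail R))"
    using galerkin[OF y0(1)] unfolding r_def T_def tail_def by blast
  from choice[OF this] obtain Y where
    Y0: "\<And>N. Y N 0 = P N y\<^sub>0" and
    dY: "\<And>N t. t \<in> {0..T} \<Longrightarrow> (Y N has_vector_derivative - G N (B (Y N t) (Y N t))) (at t within {0..T})" and
    PY: "\<And>N t. t \<in> {0..T} \<Longrightarrow> P N (Y N t) = Y N t" and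
    Y_le: "\<And>N t. t \<in> {0..T} \<Longrightarrow> norm (Y N t) \<le> r" and
    Y_tail: "\<And>N t R. t \<in> {0..T} \<Longrightarrow> 1 \<le> R \<Longrightarrow> norm (Om R (Y N t)) \<le> tail R"
    by blast
  have YV: "Y N t \<in> V" if "t \<in> {0..T}" for N t
    using P_V[of N "Y N t"] PY[OF that] by simp
  have Y_cont: "continuous_on {0..T} (Y N)" for N
    using dY by (meson continuous_on_eq_continuous_within has_vector_derivative_continuous)
  define \<beta> where "\<beta> = r * r * KB"
  have \<beta>: "0 \<le> \<beta>" using r KB by (simp add: \<beta>_def)
  have BY_le: "norm (B (Y N t) (Y N t)) \<le> \<beta>" if "t \<in> {0..T}" for N t
  proof -
    have "norm (Y N t) * norm (Y N t) * KB \<le> \<beta>"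
      unfolding \<beta>_def using Y_le[OF that, of N] KB r by (intro mult_right_mono mult_mono) auto
    then show ?thesis using KB(2)[of "Y N t" "Y N t"] by linarith
  qed
  \<comment> \<open>The two sources of error of the truncation: the initial value and the
    replacement of the inverse of \<open>J\<close> by \<open>G N\<close>.\<close>
  define \<delta> where "\<delta> N = norm (A (P N y\<^sub>0 - y\<^sub>0)) + \<epsilon> N" for N
  have \<delta>_nonneg: "0 \<le> \<delta> N" for N using \<epsilon>_nonneg by (simp add: \<delta>_def)
  have "(\<lambda>N. norm (A (P N y\<^sub>0 - y\<^sub>0))) \<longlonglongrightarrow> norm (A (y\<^sub>0 - y\<^sub>0))"
    by (intro tendsto_intros A.tendsto P_tendsto y0)
  then have \<delta>_tendsto: "\<delta> \<longlonglongrightarrow> 0"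
    unfolding \<delta>_def using tendsto_add[OF _ \<epsilon>_tendsto] by (fastforce simp: A.zero)
  \<comment> \<open>The constant of Gronwall's lemma. The extra 1 in the exponent comes from
    splitting \<open>2 * (norm w * q)\<close> into two squares, and
    \<open>\<beta>\<^sup>2 * T\<close> accounts for \<open>q\<^sup>2\<close>.\<close>
  define S where "S = sqrt (exp ((2 * C * r + 1) * T) * (1 + \<beta>\<^sup>2 * T))"
  have S: "0 \<le> S" using T by (simp add: S_def)
  have S_sq: "S\<^sup>2 = exp ((2 * C * r + 1) * T) * (1 + \<beta>\<^sup>2 * T)"
    unfolding S_def using T by (intro real_sqrt_pow2) auto
  have low_diff: "norm (A (Y N t - Y M t)) \<le> S * (\<delta> N + \<delta> M)" if t: "t \<in> {0..T}" for N M t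
  proof -
    define q where "q = \<beta> * (\<epsilon> N + \<epsilon> M)"
    have "(norm (A (Y N t) - A (Y M t)))\<^sup>2 \<le> exp ((2 * C * r + 1) * t) * ((norm (A (Y N 0) - A (Y M 0)))\<^sup>2 + q\<^sup>2 * t)"
    proof (rule gronwall[OF _ _ _ _ t])
      fix t assume t: "t \<in> {0..T}"
      define y z where "y = Y N t" and "z = Y M t"
      have V: "y \<in> V" "z \<in> V" using YV[OF t] by (auto simp: y_def z_def)
      let ?u' = "A (- G N (B y y)) - A (- G M (B z z))"
      have "((\<lambda>t. A (Y N t) - A (Y M t)) has_vector_derivative ?u') (at t within {0..T})"
        unfolding y_def z_def by (intro has_vector_derivative_diff A.has_vector_derivative dY t)
      from has_real_derivative_norm_square[OF this]
      show "((\<lambda>t. (norm (A (Y N t) - A (Y M t)))\<^sup>2) has_real_derivative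
          2 * ((A (Y N t) - A (Y M t)) \<bullet> ?u')) (at t within {0..T})" .
      define w where "w = A (y - z)"
      define e1 e2 where "e1 = A (G N (B y y)) - D (B y y)" and "e2 = A (G M (B z z)) - D (B z z)"
      have "norm e1 \<le> \<epsilon> N * norm (B y y)" "norm e2 \<le> \<epsilon> M * norm (B z z)"
        unfolding e1_def e2_def by (auto intro!: A_G B_V V)
      moreover have "\<epsilon> N * norm (B y y) \<le> \<epsilon> N * \<beta>" "\<epsilon> M * norm (B z z) \<le> \<epsilon> M * \<beta>"
        unfolding y_def z_def by (intro mult_left_mono BY_le t \<epsilon>_nonneg)+
      ultimately have e: "norm (e2 - e1) \<le> q"
        using norm_triangle_ineq4[of e2 e1] by (simp add: q_def algebra_simps)
      have u': "?u' = - (D (B y y) - D (B z z)) + (e2 - e1)"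
        by (simp add: e1_def e2_def A.neg)
      have "A (y - z) \<bullet> ?u' \<le> C * norm z * (norm w)\<^sup>2 + norm w * norm (e2 - e1)"
        using D_B_difference[OF V] Cauchy_Schwarz_ineq2[of w "e2 - e1"]
        unfolding u' w_def inner_add_right inner_minus_right by linarith
      also have "\<dots> \<le> C * r * (norm w)\<^sup>2 + norm w * q"
        using C_pos Y_le[OF t, of M] e by (intro add_mono mult_left_mono mult_right_mono) (auto simp: z_def)
      finally have "A (y - z) \<bullet> ?u' \<le> C * r * (norm w)\<^sup>2 + norm w * q" .
      moreover have "2 * (norm w * q) \<le> (norm w)\<^sup>2 + q\<^sup>2"
        using sum_squares_bound[of "norm w" q] by simp
      ultimately show "2 * ((A (Y N t) - A (Y M t)) \<bullet> ?u') \<le> (2 * C * r + 1) * (norm (A (Y N t) - A (Y M t)))\<^sup>2 + q\<^sup>2"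
        by (simp add: w_def y_def z_def A.diff algebra_simps)
    qed (use C_pos r in auto)
    also have "\<dots> \<le> exp ((2 * C * r + 1) * T) * ((\<delta> N + \<delta> M)\<^sup>2 + (\<beta> * (\<delta> N + \<delta> M))\<^sup>2 * T)"
    proof (intro mult_mono add_mono power_mono)
      have "norm (A (Y N 0) - A (Y M 0)) = norm (A (P N y\<^sub>0 - y\<^sub>0) - A (P M y\<^sub>0 - y\<^sub>0))"
        by (simp add: Y0 A.diff)
      also have "\<dots> \<le> norm (A (P N y\<^sub>0 - y\<^sub>0)) + norm (A (P M y\<^sub>0 - y\<^sub>0))"
        by (rule norm_triangle_ineq4)
      also have "\<dots> \<le> \<delta> N + \<delta> M" by (simp add: \<delta>_def \<epsilon>_nonneg add_mono)
      finally show "norm (A (Y N 0) - A (Y M 0)) \<le> \<delta> N + \<delta> M" .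
      show "q \<le> \<beta> * (\<delta> N + \<delta> M)"
        unfolding q_def using \<beta> by (intro mult_left_mono) (auto simp: \<delta>_def)
      show "exp ((2 * C * r + 1) * t) \<le> exp ((2 * C * r + 1) * T)"
        using C_pos r t by (auto intro!: mult_left_mono)
    qed (use t \<beta> \<epsilon>_nonneg in \<open>auto simp: q_def\<close>)
    also have "\<dots> = (S * (\<delta> N + \<delta> M))\<^sup>2"
      unfolding power_mult_distrib S_sq by (simp only: distrib_left distrib_right mult_1_left mult_1_right mult_ac)
    finally show ?thesis
      unfolding A.diff by (rule power2_le_imp_le) (use S \<delta>_nonneg in auto)
  qed
  have tail_small: "\<exists>R\<ge>1. tail R < e" if "0 < e" for e
  proof -
    have "((\<lambda>R. tail R) \<longlongrightarrow> exp (C * r * T) * 0) at_top"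
      unfolding tail_def by (intro tendsto_intros Om_tendsto)
    then have "\<forall>\<^sub>F R in at_top. tail R < e"
      using that by (intro order_tendstoD) auto
    then obtain R0 where "\<And>R. R \<ge> R0 \<Longrightarrow> tail R < e"
      by (auto simp: eventually_at_top_linorder)
    then show ?thesis by (intro exI[of _ "max 1 R0"]) auto
  qed
  have "uniformly_Cauchy_on {0..T} Y"
  proof (rule uniformly_Cauchy_onI)
    fix e :: real assume e: "0 < e"
    \<comment> \<open>Two tails cost at most \<open>e / 4\<close>, and \<open>\<eta>\<close> is
      chosen so that the low norm costs at most \<open>e / 2\<close>. The summand 1 in its
      denominator covers the case \<open>K R * S = 0\<close>.\<close>
    obtain R where R: "1 \<le> R" "tail R < e / 8" using tail_small[of "e / 8"] e by auto
    define \<eta> where "\<eta> = e / (4 * (K R * S + 1))"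
    have KS: "0 \<le> K R * S" using K_nonneg S by simp
    have \<eta>: "0 < \<eta>" using e KS by (simp add: \<eta>_def)
    obtain N0 where N0: "\<And>N. N0 \<le> N \<Longrightarrow> \<delta> N < \<eta>"
      using order_tendstoD(2)[OF \<delta>_tendsto \<eta>] by (auto simp: eventually_sequentially)
    have "dist (Y N t) (Y M t) < e" if t: "t \<in> {0..T}" and NM: "N0 \<le> N" "N0 \<le> M" for t N M
    proof -
      interpret Om: bounded_linear "Om R" by (rule linear_Om)
      have "norm (Y N t - Y M t) \<le> K R * norm (A (Y N t - Y M t)) + norm (Om R (Y N t - Y M t))"
        by (rule interpolation[OF R(1)])
      also have "K R * norm (A (Y N t - Y M t)) \<le> K R * (S * (\<delta> N + \<delta> M))"
        by (intro mult_left_mono low_diff t K_nonneg)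
      also have "\<dots> \<le> K R * (S * (\<eta> + \<eta>))"
        using N0[OF NM(1)] N0[OF NM(2)] by (intro mult_left_mono add_mono K_nonneg S) auto
      also have "\<dots> \<le> (K R * S + 1) * (2 * \<eta>)" using \<eta> by (simp add: algebra_simps)
      also have "\<dots> = e / 2" using KS by (simp add: \<eta>_def field_simps)
      also have "norm (Om R (Y N t - Y M t)) \<le> tail R + tail R"
        using norm_triangle_ineq4[of "Om R (Y N t)" "Om R (Y M t)"] Y_tail[OF t R(1), of N] Y_tail[OF t R(1), of M]
        unfolding Om.diff by linarith
      finally show ?thesis using R(2) e by (simp add: dist_norm)
    qed
    then show "\<exists>N0. \<forall>t\<in>{0..T}. \<forall>N\<ge>N0. \<forall>M\<ge>N0. dist (Y N t) (Y M t) < e" by blast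
  qed
  then obtain y where lim: "uniform_limit {0..T} Y y sequentially"
    using Cauchy_uniformly_convergent uniformly_convergent_on_def by blast
  have y_lim: "(\<lambda>N. Y N t) \<longlonglongrightarrow> y t" if "t \<in> {0..T}" for t
    using tendsto_uniform_limitI[OF lim that] .
  have y_cont: "continuous_on {0..T} y"
    by (rule uniform_limit_theorem[OF _ lim]) (auto simp: Y_cont)
  have yV: "y t \<in> V" if "t \<in> {0..T}" for t
    using closed_sequentially[OF V_closed _ y_lim[OF that]] YV[OF that] by blast
  have y_le: "norm (y t) \<le> r" if "t \<in> {0..T}" for t
    using Lim_bounded[OF tendsto_norm[OF y_lim[OF that]], of 0] Y_le[OF that] by blast
  have y_tail: "norm (Om R (y t)) \<le> tail R" if t: "t \<in> {0..T}" and R: "1 \<le> R" for t R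
  proof -
    interpret Om: bounded_linear "Om R" by (rule linear_Om)
    show ?thesis
      using Lim_bounded[OF tendsto_norm[OF Om.tendsto[OF y_lim[OF t]]], of 0] Y_tail[OF t R] by blast
  qed
  have y_int: "((\<lambda>\<tau>. - B (y \<tau>) (y \<tau>)) has_integral (J (y t) - J y\<^sub>0)) {0..t}" if t: "t \<in> {0..T}" for t
  proof -
    \<comment> \<open>The terms \<open>G N (B (Y N \<tau>) (Y N \<tau>))\<close> have no limit in
      the space. One \<open>J\<close> turns \<open>G N\<close> into \<open>P N\<close>, and a second
      one makes the convergence uniform in time by \<open>J_P\<close>. So the limit is taken in the
      equation for \<open>J (J (Y N t))\<close>, and the surplus \<open>J\<close> is removed at the
      end by injectivity.\<close>
    define f where "f N \<tau> = - J (P N (B (Y N \<tau>) (Y N \<tau>)))" for N \<tau>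
    define h where "h \<tau> = - J (B (y \<tau>) (y \<tau>))" for \<tau>
    have sub: "{0..t} \<subseteq> {0..T}" using t by auto
    have "uniform_limit {0..T} f h sequentially"
    proof (rule uniform_limitI)
      fix e :: real assume e: "0 < e"
      define \<eta> where "\<eta> = e / (2 * (2 * r * KB * KJ))"
      have \<eta>: "0 < \<eta>" using e r KB KJ by (simp add: \<eta>_def)
      have "(\<lambda>N. \<epsilon> N * \<beta>) \<longlonglongrightarrow> 0 * \<beta>" by (intro tendsto_intros \<epsilon>_tendsto)
      then have "\<forall>\<^sub>F N in sequentially. \<epsilon> N * \<beta> < e / 2"
        using e by (intro order_tendstoD) auto
      then show "\<forall>\<^sub>F N in sequentially. \<forall>\<tau>\<in>{0..T}. dist (f N \<tau>) (h \<tau>) < e"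
        using uniform_limitD[OF lim \<eta>]
      proof eventually_elim
        case (elim N)
        show ?case
        proof
          fix \<tau> assume \<tau>: "\<tau> \<in> {0..T}"
          define u v where "u = Y N \<tau>" and "v = y \<tau>"
          have uv: "norm u \<le> r" "norm v \<le> r" "norm (u - v) < \<eta>"
            using Y_le[OF \<tau>] y_le[OF \<tau>] elim(2) \<tau> by (auto simp: u_def v_def dist_norm)
          have "norm (J (P N (B u u)) - J (B u u)) \<le> \<epsilon> N * norm (B u u)"
            unfolding u_def by (intro J_P B_V YV \<tau>)
          also have "\<dots> \<le> \<epsilon> N * \<beta>" unfolding u_def by (intro mult_left_mono BY_le \<tau> \<epsilon>_nonneg)
          finally have 1: "norm (J (P N (B u u)) - J (B u u)) < e / 2" using elim(1) by simp
          have "B u u - B v v = B u (u - v) + B (u - v) v" by (simp add: B.diff_left B.diff_right)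
          then have "norm (B u u - B v v) \<le> norm u * norm (u - v) * KB + norm (u - v) * norm v * KB"
            using norm_triangle_ineq[of "B u (u - v)" "B (u - v) v"] KB(2)[of u "u - v"] KB(2)[of "u - v" v] by simp
          also have "\<dots> \<le> r * \<eta> * KB + \<eta> * r * KB"
            using uv KB r \<eta> by (intro add_mono mult_right_mono mult_mono) auto
          finally have "norm (B u u - B v v) * KJ \<le> (r * \<eta> * KB + \<eta> * r * KB) * KJ"
            using KJ by (intro mult_right_mono) auto
          also have "\<dots> = e / 2" using r KB KJ by (simp add: \<eta>_def field_simps)
          finally have 2: "norm (J (B u u) - J (B v v)) \<le> e / 2"
            using KJ(2)[of "B u u - B v v"] by (simp add: J.diff)
          have "dist (f N \<tau>) (h \<tau>) = norm ((J (P N (B u u)) - J (B u u)) + (J (B u u) - J (B v v)))"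
            by (simp add: f_def h_def u_def v_def dist_norm norm_minus_commute)
          also have "\<dots> < e" using norm_triangle_ineq[of "J (P N (B u u)) - J (B u u)" "J (B u u) - J (B v v)"] 1 2 by linarith
          finally show "dist (f N \<tau>) (h \<tau>) < e" .
        qed
      qed
    qed
    then have lim_f: "uniform_limit {0..t} f h sequentially"
      by (rule uniform_limit_on_subset[OF _ sub])
    have f_int: "(f N has_integral (J (J (Y N t)) - J (J (Y N 0)))) {0..t}" for N
    proof (rule fundamental_theorem_of_calculus)
      fix \<tau> assume "\<tau> \<in> {0..t}"
      then have "(Y N has_vector_derivative - G N (B (Y N \<tau>) (Y N \<tau>))) (at \<tau> within {0..t})"
        using dY[of \<tau> N] sub by (auto intro: has_vector_derivative_within_subset)
      from J.has_vector_derivative[OF J.has_vector_derivative[OF this]]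
      show "((\<lambda>t. J (J (Y N t))) has_vector_derivative f N \<tau>) (at \<tau> within {0..t})"
        by (simp add: f_def J.neg J_G)
    qed (use t in auto)
    have f_cont: "continuous_on {0..t} (f N)" for N
    proof -
      interpret P: bounded_linear "P N" by (rule linear_P)
      show ?thesis
        unfolding f_def
        by (intro continuous_intros J.continuous_on P.continuous_on B.continuous_on continuous_on_subset[OF Y_cont sub])
    qed
    obtain I I' where I: "\<And>N. (f N has_integral I N) {0..t}" "(h has_integral I') {0..t}" "I \<longlonglongrightarrow> I'"
      using uniform_limit_integral[OF lim_f f_cont] by auto
    have "I = (\<lambda>N. J (J (Y N t)) - J (J (Y N 0)))"
      using I(1) f_int has_integral_unique by blast
    moreover have "(\<lambda>N. J (J (Y N t)) - J (J (Y N 0))) \<longlonglongrightarrow> J (J (y t)) - J (J y\<^sub>0)"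
      unfolding Y0 by (intro tendsto_intros J.tendsto y_lim t P_tendsto y0)
    ultimately have I': "I' = J (J (y t)) - J (J y\<^sub>0)"
      using I(3) LIMSEQ_unique by blast
    have "continuous_on {0..t} (\<lambda>\<tau>. - B (y \<tau>) (y \<tau>))"
      by (intro continuous_intros B.continuous_on continuous_on_subset[OF y_cont sub])
    then obtain X where X: "((\<lambda>\<tau>. - B (y \<tau>) (y \<tau>)) has_integral X) {0..t}"
      using integrable_continuous_real by blast
    have "h = J \<circ> (\<lambda>\<tau>. - B (y \<tau>) (y \<tau>))" by (rule ext) (simp add: h_def J.neg)
    then have "(h has_integral J X) {0..t}"
      using has_integral_linear[OF X linear_J] by simp
    then have "J X = I'" using I(2) has_integral_unique by blast
    then have "J (X - (J (y t) - J y\<^sub>0)) = 0" unfolding I' by (simp add: J.diff)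
    from J_inj[OF this] show ?thesis using X by simp
  qed
  show ?thesis
    by (rule exI[of _ y])
       (use y_cont yV y_int y_le y_tail in \<open>auto simp: solution_def tail_def simp flip: r_def T_def\<close>)
qed

text \<open>Near \<open>f\<close> the tails of the initial values, hence those of the solutions, are
  controlled by the tail of \<open>f\<close>, while the low norm depends on the initial value in a
  Lipschitz way. The threshold \<open>R\<close> depends on how fast the tail of \<open>f\<close>
  decays, so the modulus of continuity obtained is not uniform in \<open>f\<close>.\<close>

theorem local_well_posedness:
  "\<exists>\<Phi>. (\<forall>f\<in>V. norm f \<le> M \<longrightarrow> solution (life_span M) f (\<Phi> f)) \<and>
     (\<forall>f\<in>V. norm f \<le> M \<longrightarrow> (\<forall>e>0. \<exists>\<delta>>0. \<forall>g\<in>V. norm g \<le> M \<and> norm (g - f) < \<delta> \<longrightarrow>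
        (\<forall>t\<in>{0..life_span M}. norm (\<Phi> g t - \<Phi> f t) < e)))"
proof -
  interpret A: bounded_linear A by (rule linear_A)
  define r T where "r = life_bound M" and "T = life_span M"
  define q where "q = exp (C * r * T)"
  have r: "0 < r" and T: "0 < T" using life_bound_pos life_span_pos by (auto simp: r_def T_def)
  have q: "0 < q" by (simp add: q_def)
  obtain KA where KA: "0 < KA" "\<And>x. norm (A x) \<le> norm x * KA"
    using A.pos_bounded by blast
  have "\<forall>f. \<exists>y. norm f \<le> M \<and> f \<in> V \<longrightarrow> (solution T f y \<and> (\<forall>t\<in>{0..T}. norm (y t) \<le> r \<and>
     (\<forall>R\<ge>1. norm (Om R (y t)) \<le> q * norm (Om R f))))"
    using galerkin_limit[of _ M] unfolding r_def T_def q_def by blast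
  from choice[OF this] obtain \<Phi> where
    sol: "\<And>f. norm f \<le> M \<Longrightarrow> f \<in> V \<Longrightarrow> solution T f (\<Phi> f)" and
    \<Phi>_le: "\<And>f t. norm f \<le> M \<Longrightarrow> f \<in> V \<Longrightarrow> t \<in> {0..T} \<Longrightarrow> norm (\<Phi> f t) \<le> r" and
    \<Phi>_tail: "\<And>f t R. norm f \<le> M \<Longrightarrow> f \<in> V \<Longrightarrow> t \<in> {0..T} \<Longrightarrow> 1 \<le> R \<Longrightarrow> norm (Om R (\<Phi> f t)) \<le> q * norm (Om R f)"
    by blast
  have "\<exists>\<delta>>0. \<forall>g\<in>V. norm g \<le> M \<and> norm (g - f) < \<delta> \<longrightarrow> (\<forall>t\<in>{0..T}. norm (\<Phi> g t - \<Phi> f t) < e)"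
    if f: "f \<in> V" "norm f \<le> M" and e: "0 < e" for f e
  proof -
    have "((\<lambda>R. q * norm (Om R f)) \<longlongrightarrow> q * 0) at_top" by (intro tendsto_intros Om_tendsto)
    then have "\<forall>\<^sub>F R in at_top. q * norm (Om R f) < e / 6"
      using e by (intro order_tendstoD) auto
    then obtain R0 where "\<And>R. R \<ge> R0 \<Longrightarrow> q * norm (Om R f) < e / 6"
      by (auto simp: eventually_at_top_linorder)
    then obtain R where R: "1 \<le> R" "q * norm (Om R f) < e / 6"
      by (metis max.cobounded1 max.cobounded2)
    interpret Om: bounded_linear "Om R" by (rule linear_Om)
    \<comment> \<open>The tail of \<open>f\<close> enters twice, for \<open>g\<close> and for
      \<open>f\<close>, and costs at most \<open>e / 3\<close> in total. This
      \<open>\<delta>\<close> limits to \<open>e / 3\<close> the sum of the low norm and of what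
      moving from \<open>f\<close> to \<open>g\<close> adds to the tail.\<close>
    define \<delta> where "\<delta> = e / (3 * (K R * (q * KA) + q))"
    have den: "0 < K R * (q * KA) + q" using q KA K_nonneg[of R] by (auto intro: add_nonneg_pos)
    have \<delta>: "0 < \<delta>" using e den by (simp add: \<delta>_def)
    have "norm (\<Phi> g t - \<Phi> f t) < e" if g: "g \<in> V" "norm g \<le> M" "norm (g - f) < \<delta>" and t: "t \<in> {0..T}" for g t
    proof -
      have "norm (A (\<Phi> g t - \<Phi> f t)) \<le> exp (C * r * t) * norm (A (\<Phi> g 0 - \<Phi> f 0))"
        by (rule solution_low_norm_stability[OF sol[OF g(2,1)] sol[OF f(2,1)] t]) (use \<Phi>_le[OF f(2,1)] r in auto)
      also have "\<dots> = exp (C * r * t) * norm (A (g - f))"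
        using solution_initial[OF sol[OF g(2,1)]] solution_initial[OF sol[OF f(2,1)]] T by simp
      also have "\<dots> \<le> q * (\<delta> * KA)"
      proof (rule mult_mono)
        show "exp (C * r * t) \<le> q" using t C_pos r by (simp add: q_def)
        have "norm (g - f) * KA \<le> \<delta> * KA" using g KA by (intro mult_right_mono) auto
        then show "norm (A (g - f)) \<le> \<delta> * KA" using KA(2)[of "g - f"] by linarith
      qed (use q in auto)
      finally have 1: "K R * norm (A (\<Phi> g t - \<Phi> f t)) \<le> K R * (q * (\<delta> * KA))"
        by (intro mult_left_mono K_nonneg)
      have "norm (Om R g) \<le> norm (Om R f) + norm (g - f)"
        using norm_triangle_ineq[of "Om R f" "Om R (g - f)"] Om_le[of R "g - f"] by (simp add: Om.diff)
      then have "q * norm (Om R g) \<le> q * (norm (Om R f) + \<delta>)"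
        using q g(3) by (intro mult_left_mono) auto
      then have 2: "norm (Om R (\<Phi> g t)) \<le> q * norm (Om R f) + q * \<delta>"
        using \<Phi>_tail[OF g(2,1) t R(1)] by (simp add: algebra_simps)
      have "norm (\<Phi> g t - \<Phi> f t) \<le> K R * norm (A (\<Phi> g t - \<Phi> f t)) + norm (Om R (\<Phi> g t - \<Phi> f t))"
        by (rule interpolation[OF R(1)])
      also have "norm (Om R (\<Phi> g t - \<Phi> f t)) \<le> norm (Om R (\<Phi> g t)) + norm (Om R (\<Phi> f t))"
        unfolding Om.diff by (rule norm_triangle_ineq4)
      finally have "norm (\<Phi> g t - \<Phi> f t) \<le> (K R * (q * KA) + q) * \<delta> + 2 * (q * norm (Om R f))"
        using 1 2 \<Phi>_tail[OF f(2,1) t R(1)] by (simp add: algebra_simps)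
      also have "(K R * (q * KA) + q) * \<delta> = e / 3" using den by (simp add: \<delta>_def field_simps)
      finally show ?thesis using R(2) e by simp
    qed
    then show ?thesis using \<delta> by blast
  qed
  then show ?thesis using sol unfolding T_def by blast
qed

end

subsection \<open>Weights\<close>

definition japanese :: "real^2 \<Rightarrow> real" where "japanese \<xi> = sqrt (1 + (norm \<xi>)\<^sup>2)"

definition pw :: "real \<Rightarrow> real^2 \<Rightarrow> real" where "pw \<sigma> \<xi> = japanese \<xi> powr \<sigma>"

lemma japanese_ge_1 [simp]: "1 \<le> japanese \<xi>" and japanese_pos [simp]: "0 < japanese \<xi>"
proof -
  show "1 \<le> japanese \<xi>" by (simp add: japanese_def)
  then show "0 < japanese \<xi>" by linarith
qed

lemma norm_le_japanese: "norm \<xi> \<le> japanese \<xi>"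
  unfolding japanese_def by (rule real_le_rsqrt) simp

lemma japanese_le: "japanese \<xi> \<le> 1 + norm \<xi>"
  unfolding japanese_def by (rule real_le_lsqrt) (auto simp: power2_sum)

lemma japanese_uminus [simp]: "japanese (- \<xi>) = japanese \<xi>"
  by (simp add: japanese_def)

lemma japanese_measurable [measurable]: "japanese \<in> borel_measurable borel"
  unfolding japanese_def by measurable

text \<open>The value \<open>japanese x\<close> is the norm of the pair \<open>(1, x)\<close>, so
  this is the reverse triangle inequality.\<close>

lemma japanese_diff_le: "\<bar>japanese \<xi> - japanese \<eta>\<bar> \<le> norm (\<xi> - \<eta>)"
proof -
  have e: "japanese x = norm (1::real, x)" for x
    by (simp add: japanese_def norm_prod_def)
  have "\<bar>norm (1::real, \<xi>) - norm (1::real, \<eta>)\<bar> \<le> norm ((1::real, \<xi>) - (1, \<eta>))"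
    by (rule norm_triangle_ineq3)
  then show ?thesis by (simp add: e)
qed

lemma japanese_triangle: "japanese \<xi> \<le> japanese (\<xi> - \<eta>) + japanese \<eta>"
  using japanese_diff_le[of \<xi> \<eta>] norm_le_japanese[of "\<xi> - \<eta>"] by linarith

lemma pw_pos [simp]: "0 < pw \<sigma> \<xi>" and pw_nonneg [simp]: "0 \<le> pw \<sigma> \<xi>"
  and pw_uminus [simp]: "pw \<sigma> (- \<xi>) = pw \<sigma> \<xi>"
  using japanese_pos[of \<xi>] by (auto simp: pw_def simp del: japanese_pos)

lemma pw_measurable [measurable]: "pw \<sigma> \<in> borel_measurable borel"
  unfolding pw_def by measurable

lemma pw_add: "pw \<sigma> \<xi> * pw \<tau> \<xi> = pw (\<sigma> + \<tau>) \<xi>"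
  by (simp add: pw_def powr_add)

lemma pw_0 [simp]: "pw 0 \<xi> = 1" and pw_1: "pw 1 \<xi> = japanese \<xi>"
  using japanese_pos[of \<xi>] by (auto simp: pw_def simp del: japanese_pos)

lemma pw_mono: "\<sigma> \<le> \<tau> \<Longrightarrow> pw \<sigma> \<xi> \<le> pw \<tau> \<xi>"
  unfolding pw_def by (intro powr_mono) auto

lemma pw_le_1: "\<sigma> \<le> 0 \<Longrightarrow> pw \<sigma> \<xi> \<le> 1"
  using pw_mono[of \<sigma> 0 \<xi>] by simp

lemma bounded_weight_pw: "\<sigma> \<le> 0 \<Longrightarrow> bounded_weight (pw \<sigma>)"
  by (rule bounded_weightI[where C = 1]) (auto simp: pw_le_1)

lemma pw_sq: "(pw \<sigma> \<xi>)\<^sup>2 = (1 + (norm \<xi>)\<^sup>2) powr \<sigma>"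
proof -
  have "(pw \<sigma> \<xi>)\<^sup>2 = (japanese \<xi> powr 2) powr \<sigma>"
    by (simp add: pw_def powr_powr power2_eq_square powr_add[symmetric])
  also have "japanese \<xi> powr 2 = 1 + (norm \<xi>)\<^sup>2"
    by (simp add: japanese_def add_nonneg_nonneg)
  finally show ?thesis .
qed

text \<open>On the dyadic shell with index \<open>n\<close> the squared weight is at most
  \<open>(2 powr (2 * \<sigma>))^n\<close>, and the area grows like \<open>4^n\<close>. The ratio
  \<open>q\<close> of the geometric series is below 1 exactly for
  \<open>\<sigma> < - 1\<close>.\<close>

lemma pw_L2:
  assumes "\<sigma> < - 1"
  shows "pw \<sigma> \<in> L2"
proof -
  define c where "c = unit_ball_vol 2"
  define q where "q = 4 * 2 powr (2 * \<sigma>)"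
  have c: "0 \<le> c" by (simp add: c_def)
  have "q = 2 powr (2 + 2 * \<sigma>)" by (simp add: q_def powr_add)
  also have "\<dots> < 2 powr 0" using assms by (intro powr_less_mono) auto
  finally have q: "0 \<le> q" "q < 1" by (auto simp: q_def)
  define h where "h n x = ennreal ((2 powr (2 * \<sigma>))^n) * indicator (ball 0 (2^(Suc n))) x" for n and x :: "real^2"
  have le: "ennreal ((norm (pw \<sigma> x))\<^sup>2) \<le> (\<Sum>n. h n x)" for x
  proof -
    obtain m where "japanese x < 2^m" using real_arch_pow[of 2 "japanese x"] by auto
    \<comment> \<open>Since \<open>japanese x \<ge> 1\<close>, this index is positive. Its
      predecessor is the index of the shell containing \<open>x\<close>, and that single term of the
      series dominates.\<close>
    define l where "l = (LEAST m. japanese x < 2^m)"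
    have l: "japanese x < 2^l" unfolding l_def by (rule LeastI[of _ m]) fact
    have "l \<noteq> 0"
    proof
      assume "l = 0"
      then show False using l japanese_ge_1[of x] by simp
    qed
    then obtain n where n: "l = Suc n" using not0_implies_Suc by blast
    have "\<not> japanese x < 2^n" using not_less_Least[of n "\<lambda>m. japanese x < 2^m"] n by (simp add: l_def)
    then have n1: "2^n \<le> japanese x" by simp
    have "(pw \<sigma> x)\<^sup>2 = japanese x powr (2 * \<sigma>)"
      by (simp add: pw_def power2_eq_square powr_add[symmetric])
    also have "\<dots> \<le> (2^n) powr (2 * \<sigma>)"
      using assms n1 by (intro powr_mono2') auto
    also have "\<dots> = (2 powr (2 * \<sigma>))^n"
      by (simp add: powr_realpow[symmetric] powr_powr mult_ac)
    finally have "ennreal ((norm (pw \<sigma> x))\<^sup>2) \<le> ennreal ((2 powr (2 * \<sigma>))^n)"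
      by (intro ennreal_leI) simp
    also have "\<dots> = h n x"
      using l n norm_le_japanese[of x] by (auto simp: h_def dist_norm indicator_def)
    also have "\<dots> = (\<Sum>n\<in>{n}. h n x)" by simp
    also have "\<dots> \<le> (\<Sum>n. h n x)" by (rule sum_le_suminf) auto
    finally show ?thesis .
  qed
  have h: "h n \<in> borel_measurable lborel" for n
    unfolding h_def by (intro borel_measurable_times_ennreal borel_measurable_const borel_measurable_indicator) simp
  have "(\<integral>\<^sup>+x. ennreal ((norm (pw \<sigma> x))\<^sup>2) \<partial>lborel) \<le> (\<integral>\<^sup>+x. (\<Sum>n. h n x) \<partial>lborel)"
    by (rule nn_integral_mono) (rule le)
  also have "\<dots> = (\<Sum>n. \<integral>\<^sup>+x. h n x \<partial>lborel)"
    by (rule nn_integral_suminf) (rule h)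
  also have "\<dots> = (\<Sum>n. ennreal (4 * c * q^n))"
  proof (rule suminf_cong)
    fix n
    have "(\<integral>\<^sup>+x. h n x \<partial>lborel) = ennreal ((2 powr (2 * \<sigma>))^n) * emeasure lborel (ball 0 (2^(Suc n)) :: (real^2) set)"
      unfolding h_def by (rule nn_integral_cmult_indicator) simp
    also have "emeasure lborel (ball 0 (2^(Suc n)) :: (real^2) set) = ennreal (c * (2^(Suc n))^2)"
      using emeasure_ball[of "2^(Suc n)" "0::real^2"] by (simp only: c_def) simp
    also have "ennreal ((2 powr (2 * \<sigma>))^n) * ennreal (c * (2^(Suc n))^2) = ennreal (4 * c * q^n)"
    proof -
      have e: "(2 powr (2 * \<sigma>))^n * (c * (2^(Suc n))^2) = 4 * c * q^n"
      proof -
        have "(2^(Suc n))\<^sup>2 = ((2::real)\<^sup>2)^(Suc n)"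
          by (metis mult.commute power_mult)
        also have "\<dots> = 4 * 4^n" by simp
        finally show ?thesis by (simp add: q_def power_mult_distrib)
      qed
      show ?thesis by (subst ennreal_mult[symmetric], simp, use c in simp, simp only: e)
    qed
    finally show "(\<integral>\<^sup>+x. h n x \<partial>lborel) = ennreal (4 * c * q^n)" .
  qed
  also have "\<dots> < \<infinity>"
    using q c by (subst suminf_ennreal2) (auto intro!: summable_mult summable_geometric)
  finally show ?thesis by (simp add: L2_iff_nn_integral)
qed

section \<open>Truncated weights and their commutators\<close>

lemma powr_diff_le:
  fixes r1 r2 s :: real
  assumes "0 < r2" "r2 \<le> r1" "1 \<le> s"
  shows "r1 powr s - r2 powr s \<le> s * (r1 - r2) * r1 powr (s - 1)"
proof (cases "r2 = r1")
  case False
  then have lt: "r2 < r1" using assms by simp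
  have "\<exists>z>r2. z < r1 \<and> r1 powr s - r2 powr s = (r1 - r2) * (s * z powr (s - 1))"
    using assms by (intro MVT2[OF lt]) (auto intro!: derivative_eq_intros)
  then obtain z where z: "z > r2" "z < r1" "r1 powr s - r2 powr s = (r1 - r2) * (s * z powr (s - 1))"
    by blast
  have "(r1 - r2) * (s * z powr (s - 1)) \<le> (r1 - r2) * (s * r1 powr (s - 1))"
    using z assms by (intro mult_left_mono powr_mono2) auto
  then show ?thesis using z by (simp add: mult_ac)
qed simp

text \<open>The maximum keeps the denominator positive for every real \<open>R\<close>, and makes
  the weight equal to 1 on \<open>r \<ge> 1\<close> when \<open>R = 1\<close>.\<close>

definition trunc :: "real \<Rightarrow> real \<Rightarrow> real" where "trunc R r = min 1 (r / max 1 R)"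

lemma trunc_bounds: "0 \<le> r \<Longrightarrow> 0 \<le> trunc R r" "trunc R r \<le> 1"
  by (auto simp: trunc_def)

lemma trunc_mono: "r \<le> r' \<Longrightarrow> trunc R r \<le> trunc R r'"
  unfolding trunc_def by (intro min.mono divide_right_mono) auto

lemma trunc_double: "0 \<le> r \<Longrightarrow> trunc R (2 * r) \<le> 2 * trunc R r"
  by (auto simp: trunc_def min_def)

text \<open>The quotient of \<open>trunc R r\<close> by \<open>r\<close> is nonincreasing. This
  expresses growth of at most first order without differentiating at the kink.\<close>

lemma trunc_ratio:
  assumes "0 < r2" "r2 \<le> r1"
  shows "r2 * trunc R r1 \<le> r1 * trunc R r2"
proof -
  have m: "0 < max 1 R" by simp
  have "r2 * min 1 (r1 / max 1 R) \<le> r1" "r2 * min 1 (r1 / max 1 R) \<le> r1 * (r2 / max 1 R)"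
  proof -
    have "r2 * min 1 (r1 / max 1 R) \<le> r2 * 1" using assms by (intro mult_left_mono) auto
    then show "r2 * min 1 (r1 / max 1 R) \<le> r1" using assms by linarith
    have "r2 * min 1 (r1 / max 1 R) \<le> r2 * (r1 / max 1 R)" using assms by (intro mult_left_mono) auto
    then show "r2 * min 1 (r1 / max 1 R) \<le> r1 * (r2 / max 1 R)" by (simp add: mult_ac)
  qed
  then show ?thesis by (auto simp: trunc_def min_def)
qed

text \<open>A product rule for differences. By \<open>trunc_ratio\<close> the increment of
  \<open>trunc\<close> is at most \<open>trunc R r1 * (r1 - r2) / r1\<close>, as for a linear
  function. The truncation thus raises the constant from \<open>s\<close> to \<open>s + 1\<close>,
  whatever \<open>R\<close> is.\<close>

lemma trunc_weight_diff_le: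
  assumes "1 \<le> r2" "r2 \<le> r1" "1 \<le> s"
  shows "r1 powr s * trunc R r1 - r2 powr s * trunc R r2 \<le> (s + 1) * (r1 - r2) * (r1 powr (s - 1) * trunc R r1)"
proof -
  have t: "0 \<le> trunc R r1" using assms by (intro trunc_bounds) auto
  have "r1 powr s * trunc R r1 - r2 powr s * trunc R r2
      = (r1 powr s - r2 powr s) * trunc R r1 + r2 powr (s - 1) * (r2 * trunc R r1 - r2 * trunc R r2)"
    using assms by (simp add: powr_diff field_simps)
  also have "(r1 powr s - r2 powr s) * trunc R r1 \<le> (s * (r1 - r2) * r1 powr (s - 1)) * trunc R r1"
    using powr_diff_le[of r2 r1 s] assms t by (intro mult_right_mono) auto
  also have "r2 powr (s - 1) * (r2 * trunc R r1 - r2 * trunc R r2) \<le> r1 powr (s - 1) * ((r1 - r2) * trunc R r1)"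
  proof -
    have a: "r2 * trunc R r1 - r2 * trunc R r2 \<le> (r1 - r2) * trunc R r1"
    proof -
      have "trunc R r1 * r2 / r1 \<le> trunc R r2"
        using trunc_ratio[of r2 r1 R] assms by (simp add: field_simps)
      then have "r2 * (trunc R r1 - trunc R r2) \<le> r2 * (trunc R r1 - trunc R r1 * r2 / r1)"
        using assms by (intro mult_left_mono) auto
      also have "\<dots> = (r2 / r1) * ((r1 - r2) * trunc R r1)"
        using assms by (simp add: field_simps)
      also have "\<dots> \<le> 1 * ((r1 - r2) * trunc R r1)"
        using assms t by (intro mult_right_mono) auto
      finally show ?thesis by (simp add: algebra_simps)
    qed
    have "r2 powr (s - 1) * (r2 * trunc R r1 - r2 * trunc R r2) \<le> r2 powr (s - 1) * ((r1 - r2) * trunc R r1)"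
      using a by (intro mult_left_mono) auto
    also have "\<dots> \<le> r1 powr (s - 1) * ((r1 - r2) * trunc R r1)"
      using assms t by (intro mult_right_mono powr_mono2) auto
    finally show ?thesis .
  qed
  finally show ?thesis by (simp add: algebra_simps)
qed

text \<open>That the constant does not depend on \<open>R\<close> is what makes the estimate of the tails uniform.\<close>

lemma trunc_weight_commutator:
  fixes r1 r2 r3 s R :: real
  assumes r: "1 \<le> r1" "1 \<le> r2" "1 \<le> r3" and tri: "r1 \<le> r2 + r3" and s: "1 \<le> s"
  shows "\<bar>r1 powr s * trunc R r1 - r2 powr s * trunc R r2\<bar>
     \<le> (s + 1) * 2 powr s * \<bar>r1 - r2\<bar> * (r2 powr (s - 1) * trunc R r2 + r3 powr (s - 1) * trunc R r3)"
proof -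
  define M where "M = max r1 r2"
  define m where "m = max r2 r3"
  have mono: "r powr s * trunc R r \<le> r' powr s * trunc R r'" if "1 \<le> r" "r \<le> r'" for r r'
    using that s by (intro mult_mono powr_mono2 trunc_mono trunc_bounds) auto
  have 1: "\<bar>r1 powr s * trunc R r1 - r2 powr s * trunc R r2\<bar> \<le> (s + 1) * \<bar>r1 - r2\<bar> * (M powr (s - 1) * trunc R M)"
  proof (cases "r2 \<le> r1")
    case True
    then show ?thesis
      using trunc_weight_diff_le[OF r(2) True s, of R] mono[OF r(2) True] by (simp add: M_def)
  next
    case False
    then have le: "r1 \<le> r2" by simp
    then show ?thesis
      using trunc_weight_diff_le[OF r(1) le s, of R] mono[OF r(1) le] by (simp add: M_def)
  qed
  have nn: "0 \<le> r2 powr (s - 1) * trunc R r2" "0 \<le> r3 powr (s - 1) * trunc R r3"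
    using r by (auto intro!: mult_nonneg_nonneg trunc_bounds)
  \<comment> \<open>The largest frequency is at most twice the larger of \<open>r2\<close> and
    \<open>r3\<close>. The doubling costs \<open>2 powr (s - 1)\<close> in the power and a factor 2
    in \<open>trunc\<close>, together \<open>2 powr s\<close>.\<close>
  have Mm: "M \<le> 2 * m" "1 \<le> m" using r tri by (auto simp: M_def m_def)
  have "M powr (s - 1) * trunc R M \<le> (2 * m) powr (s - 1) * trunc R (2 * m)"
    using Mm r s by (intro mult_mono powr_mono2 trunc_mono trunc_bounds) (auto simp: M_def)
  also have "\<dots> \<le> (2 * m) powr (s - 1) * (2 * trunc R m)"
    using Mm by (intro mult_left_mono trunc_double) auto
  also have "\<dots> = 2 powr s * (m powr (s - 1) * trunc R m)"
    using Mm by (simp add: powr_mult powr_diff)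
  also have "\<dots> \<le> 2 powr s * (r2 powr (s - 1) * trunc R r2 + r3 powr (s - 1) * trunc R r3)"
    using nn by (intro mult_left_mono) (auto simp: m_def max_def)
  finally have 2: "M powr (s - 1) * trunc R M \<le> 2 powr s * (r2 powr (s - 1) * trunc R r2 + r3 powr (s - 1) * trunc R r3)" .
  have "(s + 1) * \<bar>r1 - r2\<bar> * (M powr (s - 1) * trunc R M) \<le>
    (s + 1) * \<bar>r1 - r2\<bar> * (2 powr s * (r2 powr (s - 1) * trunc R r2 + r3 powr (s - 1) * trunc R r3))"
    using s by (intro mult_left_mono 2) auto
  with 1 show ?thesis by (simp add: mult_ac)
qed

lemma powr_add_le:
  fixes a b s :: real
  assumes "0 \<le> a" "0 \<le> b" "0 \<le> s"
  shows "(a + b) powr s \<le> 2 powr s * (a powr s + b powr s)"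
proof -
  have "(a + b) powr s \<le> (2 * max a b) powr s" using assms by (intro powr_mono2) auto
  also have "\<dots> = 2 powr s * (max a b) powr s" using assms by (simp add: powr_mult)
  also have "\<dots> \<le> 2 powr s * (a powr s + b powr s)" by (intro mult_left_mono) (auto simp: max_def)
  finally show ?thesis .
qed

subsection \<open>The SQG nonlinearity in Fourier variables\<close>

text \<open>Here \<open>\<zeta>\<close> is the frequency of the velocity and \<open>\<eta>\<close>
  that of the gradient. The two imaginary units of the Riesz transform and of the derivative produce
  the sign, and \<open>2 * pi\<close> comes from the convolution theorem for the unitary transform
  in the plane. At \<open>\<zeta> = 0\<close> the value is 0 by the convention for division.\<close>

definition sqg_symbol :: "real^2 \<Rightarrow> real^2 \<Rightarrow> real" where
  "sqg_symbol \<zeta> \<eta> = (\<zeta> $ 2 * \<eta> $ 1 - \<zeta> $ 1 * \<eta> $ 2) / (2 * pi * norm \<zeta>)"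

text \<open>Both inputs are decoded by the weight of order \<open>- s\<close>, and the product is
  encoded as an element of H^(s-1).\<close>

definition sqg_kernel :: "real \<Rightarrow> real^2 \<Rightarrow> real^2 \<Rightarrow> real" where
  "sqg_kernel s \<xi> \<eta> = pw (s - 1) \<xi> * (sqg_symbol (\<xi> - \<eta>) \<eta> * pw (- s) (\<xi> - \<eta>) * pw (- s) \<eta>)"

text \<open>Lagrange's identity for the determinant. Since the velocity is of order 0 in the scalar,
  only the gradient frequency remains.\<close>

lemma sqg_symbol_le: "\<bar>sqg_symbol \<zeta> \<eta>\<bar> \<le> norm \<eta>"
proof (cases "\<zeta> = 0")
  case False
  have "(\<zeta> $ 2 * \<eta> $ 1 - \<zeta> $ 1 * \<eta> $ 2)\<^sup>2 \<le> ((\<zeta> $ 1)\<^sup>2 + (\<zeta> $ 2)\<^sup>2) * ((\<eta> $ 1)\<^sup>2 + (\<eta> $ 2)\<^sup>2)"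
  proof -
    have "((\<zeta> $ 1)\<^sup>2 + (\<zeta> $ 2)\<^sup>2) * ((\<eta> $ 1)\<^sup>2 + (\<eta> $ 2)\<^sup>2) - (\<zeta> $ 2 * \<eta> $ 1 - \<zeta> $ 1 * \<eta> $ 2)\<^sup>2
       = (\<zeta> $ 1 * \<eta> $ 1 + \<zeta> $ 2 * \<eta> $ 2)\<^sup>2" by (simp add: power2_eq_square algebra_simps)
    then show ?thesis by (metis diff_ge_0_iff_ge zero_le_power2)
  qed
  also have "\<dots> = (norm \<zeta> * norm \<eta>)\<^sup>2"
    by (simp add: norm_vec_def L2_set_def sum_2 power_mult_distrib)
  finally have "\<bar>\<zeta> $ 2 * \<eta> $ 1 - \<zeta> $ 1 * \<eta> $ 2\<bar> \<le> \<bar>norm \<zeta> * norm \<eta>\<bar>"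
    by (simp only: abs_le_square_iff)
  moreover have "norm \<zeta> * norm \<eta> * 1 \<le> norm \<zeta> * norm \<eta> * (2 * pi)"
    using pi_ge_two by (intro mult_left_mono) auto
  ultimately have "\<bar>\<zeta> $ 2 * \<eta> $ 1 - \<zeta> $ 1 * \<eta> $ 2\<bar> \<le> norm \<eta> * (2 * pi * norm \<zeta>)"
    by (simp add: mult_ac)
  then show ?thesis
    using False by (simp add: sqg_symbol_def divide_le_eq)
qed (simp add: sqg_symbol_def)

text \<open>The determinant of \<open>\<xi> - \<eta>\<close> and \<open>\<eta>\<close> equals that
  of \<open>\<xi>\<close> and \<open>\<eta>\<close>, hence is antisymmetric, whereas the norm of
  \<open>\<xi> - \<eta>\<close> is symmetric. This is how the vanishing divergence shows in
  frequency.\<close>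

lemma sqg_symbol_skew: "sqg_symbol (\<eta> - \<xi>) \<xi> = - sqg_symbol (\<xi> - \<eta>) \<eta>"
  by (simp add: sqg_symbol_def norm_minus_commute[of \<eta> \<xi>] minus_divide_left algebra_simps)

lemma sqg_symbol_uminus: "sqg_symbol (- \<zeta>) (- \<eta>) = sqg_symbol \<zeta> \<eta>"
  by (simp add: sqg_symbol_def)

lemma sqg_symbol_measurable [measurable]:
  "(\<lambda>(\<xi>, \<eta>). sqg_symbol (\<xi> - \<eta>) \<eta>) \<in> borel_measurable (borel \<Otimes>\<^sub>M borel)"
proof -
  have [measurable]: "(\<lambda>x::real^2. x $ i) \<in> borel_measurable borel" for i
    by (intro borel_measurable_continuous_onI continuous_intros)
  show ?thesis unfolding sqg_symbol_def by measurable
qed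

lemma sqg_symbol_pw_le: "\<bar>sqg_symbol \<zeta> \<eta> * pw (- s) \<eta>\<bar> \<le> pw (1 - s) \<eta>"
proof -
  have "\<bar>sqg_symbol \<zeta> \<eta> * pw (- s) \<eta>\<bar> \<le> japanese \<eta> * pw (- s) \<eta>"
    unfolding abs_mult using sqg_symbol_le[of \<zeta> \<eta>] norm_le_japanese[of \<eta>]
    by (intro mult_mono) auto
  also have "\<dots> = pw (1 - s) \<eta>" using pw_add[of 1 \<eta> "- s"] by (simp add: pw_1)
  finally show ?thesis .
qed

section \<open>Frequency cutoffs and tail weights\<close>

definition cutoff :: "nat \<Rightarrow> real^2 \<Rightarrow> real" where "cutoff N = indicator (cball 0 (real N))"

lemma cutoff_simps: "cutoff N (- \<xi>) = cutoff N \<xi>" "0 \<le> cutoff N \<xi>" "cutoff N \<xi> \<le> 1" "cutoff N \<xi> * cutoff N \<xi> = cutoff N \<xi>"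
  by (auto simp: cutoff_def indicator_def)

lemma cutoff_measurable [measurable]: "cutoff N \<in> borel_measurable borel"
  unfolding cutoff_def by (intro borel_measurable_indicator borel_closed closed_cball)

lemma bounded_weight_cutoff: "bounded_weight (cutoff N)"
  by (rule bounded_weightI[OF cutoff_measurable, where C = 1]) (auto simp: cutoff_def indicator_def)

definition tail_weight :: "real \<Rightarrow> real^2 \<Rightarrow> real" where "tail_weight R \<xi> = trunc R (japanese \<xi>)"

lemma tail_weight_bounds: "0 \<le> tail_weight R \<xi>" "tail_weight R \<xi> \<le> 1"
  using japanese_pos[of \<xi>] by (auto simp: tail_weight_def intro!: trunc_bounds simp del: japanese_pos)

lemma tail_weight_uminus: "tail_weight R (- \<xi>) = tail_weight R \<xi>"
  by (simp add: tail_weight_def)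

lemma tail_weight_measurable [measurable]: "tail_weight R \<in> borel_measurable borel"
  unfolding tail_weight_def trunc_def by measurable

lemma bounded_weight_tail: "bounded_weight (tail_weight R)"
  by (rule bounded_weightI[where C = 1]) (auto simp: tail_weight_bounds)

lemma bounded_weight_japanese_cutoff: "bounded_weight (\<lambda>\<xi>. japanese \<xi> * cutoff N \<xi>)"
proof (rule bounded_weightI[where C = "1 + real N"])
  show "\<bar>japanese \<xi> * cutoff N \<xi>\<bar> \<le> 1 + real N" for \<xi>
    using japanese_le[of \<xi>] japanese_pos[of \<xi>] by (auto simp: cutoff_def indicator_def simp del: japanese_pos)
qed measurable

text \<open>Outside the cutoff the bracket exceeds \<open>real N\<close> and is at least 1, hence at
  least half of \<open>real (Suc N)\<close>. This form is meaningful for \<open>N = 0\<close> as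
  well.\<close>

definition galerkin_error :: "nat \<Rightarrow> real" where "galerkin_error N = 2 * inverse (real (Suc N))"

lemma outside_cutoff_le:
  assumes "\<sigma> \<le> - 1"
  shows "\<bar>(cutoff N \<xi> - 1) * pw \<sigma> \<xi>\<bar> \<le> galerkin_error N"
proof (cases "norm \<xi> \<le> real N")
  case True
  then show ?thesis by (simp add: cutoff_def galerkin_error_def)
next
  case False
  then have "real (Suc N) \<le> 2 * japanese \<xi>"
    using norm_le_japanese[of \<xi>] japanese_ge_1[of \<xi>] unfolding of_nat_Suc by linarith
  then have "inverse (japanese \<xi>) \<le> galerkin_error N"
    using japanese_pos[of \<xi>] by (simp add: galerkin_error_def field_simps)
  moreover have "pw \<sigma> \<xi> \<le> inverse (japanese \<xi>)"
    using pw_mono[OF assms, of \<xi>] by (simp add: pw_def powr_minus abs_of_pos[OF japanese_pos])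
  ultimately show ?thesis using False by (simp add: cutoff_def)
qed

lemma bounded_weight_outside_cutoff: "\<sigma> \<le> - 1 \<Longrightarrow> bounded_weight (\<lambda>\<xi>. (cutoff N \<xi> - 1) * pw \<sigma> \<xi>)"
  by (rule bounded_weightI[where C = "galerkin_error N"]) (measurable, rule outside_cutoff_le)

lemma kernel_bound_one_iff:
  "kernel_bound (\<lambda>_. 1) p k \<longleftrightarrow> p \<in> L2 \<and> (\<forall>x. 0 \<le> p x) \<and>
     case_prod k \<in> borel_measurable (borel \<Otimes>\<^sub>M borel) \<and> (\<forall>\<xi> \<eta>. \<bar>k \<xi> \<eta>\<bar> \<le> p \<eta> + p (\<xi> - \<eta>))"
  by (auto simp: kernel_bound_def intro!: bounded_weightI[where C = 1])

section \<open>Bounds and symmetries of the SQG kernels\<close>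

context
  fixes s :: real
  assumes s: "2 < s"
begin

abbreviation "\<BB> \<equiv> conv_op (sqg_kernel s)"
text \<open>The kernel of the transform of the nonlinearity itself, with decoded inputs and no
  weight on the output.\<close>

abbreviation "lowkernel \<equiv> \<lambda>\<xi> \<eta>. sqg_symbol (\<xi> - \<eta>) \<eta> * pw (- s) (\<xi> - \<eta>) * pw (- s) \<eta>"

lemma decay_L2: "pw (1 - s) \<in> L2"
  by (rule pw_L2) (use s in simp)

lemma scaled_decay_L2: "(\<lambda>x. c * pw (1 - s) x) \<in> L2"
  using L2_scaleR[OF decay_L2, of c] by simp

text \<open>The output weight of order \<open>s - 1\<close> is split between the two input
  frequencies. Whichever input absorbs it, the other one retains a decay of order
  \<open>1 - s\<close>, which is square-integrable.\<close>

lemma kernel_bound_sqg: "kernel_bound (\<lambda>_. 1) (\<lambda>x. 2 powr (s - 1) * pw (1 - s) x) (sqg_kernel s)"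
  unfolding kernel_bound_one_iff
proof (intro conjI allI scaled_decay_L2)
  show "case_prod (sqg_kernel s) \<in> borel_measurable (borel \<Otimes>\<^sub>M borel)"
    unfolding sqg_kernel_def by measurable
  fix \<xi> \<eta> :: "real^2"
  define \<zeta> where "\<zeta> = \<xi> - \<eta>"
  have "pw (s - 1) \<xi> \<le> (japanese \<zeta> + japanese \<eta>) powr (s - 1)"
    unfolding pw_def \<zeta>_def using japanese_triangle[of \<xi> \<eta>] s
    by (intro powr_mono2) (auto simp: less_imp_le)
  also have "\<dots> \<le> 2 powr (s - 1) * (pw (s - 1) \<zeta> + pw (s - 1) \<eta>)"
    unfolding pw_def using s by (intro powr_add_le) (auto simp: less_imp_le)
  finally have 1: "pw (s - 1) \<xi> \<le> 2 powr (s - 1) * (pw (s - 1) \<zeta> + pw (s - 1) \<eta>)" .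
  have 2: "\<bar>sqg_symbol \<zeta> \<eta> * pw (- s) \<zeta> * pw (- s) \<eta>\<bar> \<le> pw (1 - s) \<eta> * pw (- s) \<zeta>"
    using mult_right_mono[OF sqg_symbol_pw_le[of \<zeta> \<eta> s], of "pw (- s) \<zeta>"]
    by (simp add: abs_mult mult_ac)
  have "\<bar>sqg_kernel s \<xi> \<eta>\<bar> \<le> (2 powr (s - 1) * (pw (s - 1) \<zeta> + pw (s - 1) \<eta>)) * (pw (1 - s) \<eta> * pw (- s) \<zeta>)"
    unfolding sqg_kernel_def \<zeta>_def[symmetric] abs_mult[of "pw (s - 1) \<xi>"]
    using 1 2 by (intro mult_mono) (auto intro: add_nonneg_nonneg)
  also have "\<dots> = 2 powr (s - 1) * ((pw (s - 1) \<zeta> * pw (- s) \<zeta>) * pw (1 - s) \<eta> + (pw (s - 1) \<eta> * pw (1 - s) \<eta>) * pw (- s) \<zeta>)"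
    by (simp add: algebra_simps)
  also have "\<dots> = 2 powr (s - 1) * (pw (- 1) \<zeta> * pw (1 - s) \<eta> + pw (- s) \<zeta>)"
    unfolding pw_add by simp
  also have "\<dots> \<le> 2 powr (s - 1) * (1 * pw (1 - s) \<eta> + pw (1 - s) \<zeta>)"
    by (intro mult_left_mono add_mono mult_right_mono pw_le_1 pw_mono) auto
  finally show "\<bar>sqg_kernel s \<xi> \<eta>\<bar> \<le> 2 powr (s - 1) * pw (1 - s) \<eta> + 2 powr (s - 1) * pw (1 - s) (\<xi> - \<eta>)"
    by (simp add: \<zeta>_def algebra_simps)
qed auto

lemma wmul_sqg: "wmul (pw (1 - s)) (\<BB> y z) = conv_op lowkernel y z"
proof -
  have "pw (1 - s) \<xi> * sqg_kernel s \<xi> \<eta> = lowkernel \<xi> \<eta>" for \<xi> \<eta>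
  proof -
    have "pw (1 - s) \<xi> * sqg_kernel s \<xi> \<eta> = (pw (1 - s) \<xi> * pw (s - 1) \<xi>) * lowkernel \<xi> \<eta>"
      by (simp add: sqg_kernel_def mult_ac)
    then show ?thesis unfolding pw_add by simp
  qed
  then show ?thesis
    using wmul_conv_op[OF kernel_bound_sqg bounded_weight_pw[of "1 - s"], of y z] s by simp
qed

lemma kernel_bound_low: "kernel_bound (\<lambda>_. 1) (pw (1 - s)) lowkernel"
  unfolding kernel_bound_one_iff
proof (intro conjI allI decay_L2)
  fix \<xi> \<eta> :: "real^2"
  have "\<bar>lowkernel \<xi> \<eta>\<bar> = \<bar>sqg_symbol (\<xi> - \<eta>) \<eta> * pw (- s) \<eta>\<bar> * pw (- s) (\<xi> - \<eta>)"
    by (simp add: abs_mult mult_ac)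
  also have "\<dots> \<le> pw (1 - s) \<eta> * 1"
    using s by (intro mult_mono sqg_symbol_pw_le pw_le_1) auto
  finally show "\<bar>lowkernel \<xi> \<eta>\<bar> \<le> pw (1 - s) \<eta> + pw (1 - s) (\<xi> - \<eta>)"
    by (simp add: add_increasing2)
qed auto

text \<open>The decay in the velocity frequency is moved from the kernel into the argument
  \<open>d\<close>. The remaining kernel is bounded by the decay in \<open>\<eta>\<close> alone,
  because \<open>d\<close> enters through a velocity of order 0 and the derivative acts on
  \<open>z\<close>.\<close>

lemma norm_low_le: "norm (wmul (pw (1 - s)) (\<BB> d z)) \<le> 2 * kernel_norm (pw (1 - s)) * norm (wmul (pw (- s)) d) * norm z"
proof -
  let ?k = "\<lambda>\<xi> \<eta>. sqg_symbol (\<xi> - \<eta>) \<eta> * pw (- s) \<eta>"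
  have kb: "kernel_bound (\<lambda>_. 1) (pw (1 - s)) ?k"
    unfolding kernel_bound_one_iff
    by (auto intro!: decay_L2 add_increasing2 sqg_symbol_pw_le)
  have "conv_op lowkernel d z = conv_op (\<lambda>\<xi> \<eta>. ?k \<xi> \<eta> * pw (- s) (\<xi> - \<eta>)) d z"
    by (simp add: mult_ac)
  also have "\<dots> = conv_op ?k (wmul (pw (- s)) d) z"
    using kb s by (intro conv_op_wmul_left[symmetric] bounded_weight_pw) (auto simp: kernel_bound_def)
  finally show ?thesis
    unfolding wmul_sqg using norm_conv_op_le[OF kb] by simp
qed

text \<open>Moving the self-adjoint weight to the other side puts the same factor of order
  \<open>- s\<close> on \<open>\<xi>\<close> and on \<open>\<eta>\<close>, so that the kernel
  inherits the skewness of the symbol. This symmetry is why differences are measured in L^2.\<close>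

lemma sqg_skew:
  assumes "y \<in> hermitian"
  shows "wmul (pw (- s)) d \<bullet> wmul (pw (1 - s)) (\<BB> y d) = 0"
proof -
  let ?k = "\<lambda>\<xi> \<eta>. pw (- s) \<xi> * lowkernel \<xi> \<eta>"
  have w: "bounded_weight (pw (- s))" using s by (intro bounded_weight_pw) simp
  have kb: "kernel_bound (\<lambda>_. 1) (pw (1 - s)) ?k"
    unfolding kernel_bound_one_iff
  proof (intro conjI allI decay_L2)
    fix \<xi> \<eta> :: "real^2"
    have "\<bar>?k \<xi> \<eta>\<bar> \<le> 1 * \<bar>lowkernel \<xi> \<eta>\<bar>"
      unfolding abs_mult[of "pw (- s) \<xi>"] using s by (intro mult_right_mono) (auto simp: pw_le_1)
    also have "\<dots> \<le> pw (1 - s) \<eta> + pw (1 - s) (\<xi> - \<eta>)"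
      using kernel_bound_low by (simp add: kernel_bound_one_iff)
    finally show "\<bar>?k \<xi> \<eta>\<bar> \<le> pw (1 - s) \<eta> + pw (1 - s) (\<xi> - \<eta>)" .
  qed auto
  have "wmul (pw (- s)) d \<bullet> conv_op lowkernel y d = d \<bullet> conv_op ?k y d"
    unfolding inner_wmul[OF w] wmul_conv_op[OF kernel_bound_low w] ..
  also have "\<dots> = 0"
  proof (rule conv_op_skew[OF kb _ assms])
    fix \<xi> \<eta> :: "real^2"
    have "pw (- s) (\<eta> - \<xi>) = pw (- s) (\<xi> - \<eta>)" using pw_uminus[of "- s" "\<xi> - \<eta>"] by simp
    then show "?k \<eta> \<xi> = - ?k \<xi> \<eta>" by (simp add: sqg_symbol_skew[of \<eta> \<xi>] mult_ac)
  qed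
  finally show ?thesis unfolding wmul_sqg .
qed

lemma sqg_hermitian:
  assumes "y \<in> hermitian" "z \<in> hermitian"
  shows "\<BB> y z \<in> hermitian"
proof (rule conv_op_hermitian[OF kernel_bound_sqg _ assms])
  fix \<xi> \<eta> :: "real^2"
  have e: "- \<xi> - - \<eta> = - (\<xi> - \<eta>)" by simp
  show "sqg_kernel s (- \<xi>) (- \<eta>) = sqg_kernel s \<xi> \<eta>"
    unfolding sqg_kernel_def e by (simp only: pw_uminus sqg_symbol_uminus)
qed

definition commutator_const :: real where "commutator_const = (s + 1) * 2 powr s"

lemma commutator_const_nonneg: "0 \<le> commutator_const"
  using s by (simp add: commutator_const_def)

text \<open>The difference of the weights gains a factor \<open>japanese \<zeta>\<close> in place of
  one order in the output frequency. If the remaining weight sits on \<open>\<eta>\<close>, it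
  cancels the decay there and \<open>\<zeta>\<close> keeps order \<open>1 - s\<close>; if it sits on
  \<open>\<zeta>\<close>, all powers of \<open>\<zeta>\<close> cancel and \<open>\<eta>\<close>
  keeps order \<open>1 - s\<close>. In both cases the tail weight stays on the frequency that lost
  its decay.\<close>

lemma commutator_kernel_bound:
  "kernel_bound (tail_weight R) (\<lambda>x. commutator_const * pw (1 - s) x)
     (\<lambda>\<xi> \<eta>. cutoff N \<xi> * cutoff N \<eta> * ((pw s \<xi> * tail_weight R \<xi> - pw s \<eta> * tail_weight R \<eta>) * lowkernel \<xi> \<eta>))"
  unfolding kernel_bound_def
proof (intro conjI allI scaled_decay_L2 bounded_weight_tail tail_weight_bounds)
  show "0 \<le> commutator_const * pw (1 - s) x" for x using commutator_const_nonneg by simp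
  fix \<xi> \<eta> :: "real^2"
  define \<zeta> where "\<zeta> = \<xi> - \<eta>"
  let ?W = "\<lambda>\<xi>. pw s \<xi> * tail_weight R \<xi>"
  let ?M = "pw (s - 1) \<eta> * tail_weight R \<eta> + pw (s - 1) \<zeta> * tail_weight R \<zeta>"
  have M: "0 \<le> ?M" by (intro add_nonneg_nonneg mult_nonneg_nonneg tail_weight_bounds) auto
  have "\<bar>?W \<xi> - ?W \<eta>\<bar> \<le> commutator_const * \<bar>japanese \<xi> - japanese \<eta>\<bar> * ?M"
    unfolding pw_def tail_weight_def \<zeta>_def commutator_const_def
    using japanese_triangle[of \<xi> \<eta>] s by (intro trunc_weight_commutator) auto
  also have "\<dots> \<le> commutator_const * japanese \<zeta> * ?M"
    using japanese_diff_le[of \<xi> \<eta>] norm_le_japanese[of \<zeta>] M commutator_const_nonneg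
    by (intro mult_right_mono mult_left_mono) (auto simp: \<zeta>_def)
  finally have 1: "\<bar>?W \<xi> - ?W \<eta>\<bar> \<le> commutator_const * japanese \<zeta> * ?M" .
  have 2: "\<bar>lowkernel \<xi> \<eta>\<bar> \<le> pw (1 - s) \<eta> * pw (- s) \<zeta>"
    using mult_right_mono[OF sqg_symbol_pw_le[of \<zeta> \<eta> s], of "pw (- s) \<zeta>"]
    by (simp add: abs_mult mult_ac \<zeta>_def)
  have "\<bar>cutoff N \<xi> * cutoff N \<eta> * ((?W \<xi> - ?W \<eta>) * lowkernel \<xi> \<eta>)\<bar> \<le> 1 * (\<bar>?W \<xi> - ?W \<eta>\<bar> * \<bar>lowkernel \<xi> \<eta>\<bar>)"
    unfolding abs_mult[of "cutoff N \<xi> * cutoff N \<eta>"] abs_mult[of "?W \<xi> - ?W \<eta>"]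
    by (intro mult_right_mono) (auto simp: cutoff_def indicator_def)
  also have "\<dots> \<le> 1 * ((commutator_const * japanese \<zeta> * ?M) * (pw (1 - s) \<eta> * pw (- s) \<zeta>))"
    using 1 2 M commutator_const_nonneg japanese_pos[of \<zeta>]
    by (intro mult_left_mono mult_mono) (auto simp del: japanese_pos)
  also have "\<dots> = commutator_const * ((pw 1 \<zeta> * pw (- s) \<zeta>) * (pw (s - 1) \<eta> * pw (1 - s) \<eta>) * tail_weight R \<eta>
      + (pw 1 \<zeta> * (pw (s - 1) \<zeta> * pw (- s) \<zeta>)) * tail_weight R \<zeta> * pw (1 - s) \<eta>)"
    unfolding pw_1[symmetric] by (simp only: distrib_left distrib_right mult_1_left mult_ac)
  also have "\<dots> = tail_weight R \<zeta> * (commutator_const * pw (1 - s) \<eta>) + commutator_const * pw (1 - s) \<zeta> * tail_weight R \<eta>"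
    unfolding pw_add by (simp add: algebra_simps)
  finally show "\<bar>cutoff N \<xi> * cutoff N \<eta> * ((?W \<xi> - ?W \<eta>) * lowkernel \<xi> \<eta>)\<bar>
     \<le> tail_weight R (\<xi> - \<eta>) * (commutator_const * pw (1 - s) \<eta>) + commutator_const * pw (1 - s) (\<xi> - \<eta>) * tail_weight R \<eta>"
    by (simp add: \<zeta>_def)
qed measurable

text \<open>One constant for both the tail estimate and the low-norm estimate; the summand 1 makes
  it positive.\<close>

definition energy_const :: real where
  "energy_const = 2 * kernel_norm (\<lambda>x. commutator_const * pw (1 - s) x) + 2 * kernel_norm (pw (1 - s)) + 1"

text \<open>
  The kernel is the sum of a skew part, which is bounded only thanks to the cutoff but does not contribute, and of
  the commutator kernel, whose bound does not depend on the cutoff.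
\<close>

lemma sqg_energy:
  assumes y: "y \<in> hermitian" and cut: "wmul (cutoff N) y = y"
  shows "\<bar>wmul (tail_weight R) y \<bullet> wmul (tail_weight R) (wmul (\<lambda>\<xi>. japanese \<xi> * cutoff N \<xi>) (\<BB> y y))\<bar>
     \<le> energy_const * norm y * (norm (wmul (tail_weight R) y))\<^sup>2"
proof -
  let ?W = "\<lambda>\<xi>. pw s \<xi> * tail_weight R \<xi>"
  let ?\<kappa> = "\<lambda>\<xi> \<eta>. cutoff N \<xi> * cutoff N \<eta> * ((?W \<xi> - ?W \<eta>) * lowkernel \<xi> \<eta>)"
  let ?sk = "\<lambda>\<xi> \<eta>. cutoff N \<xi> * cutoff N \<eta> * (sqg_symbol (\<xi> - \<eta>) \<eta> * pw (- s) (\<xi> - \<eta>))"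
  let ?p = "\<lambda>x. commutator_const * pw (1 - s) x"
  define b where "b = wmul (tail_weight R) y"
  note tw = bounded_weight_tail[of R]
  note jc = bounded_weight_japanese_cutoff[of N]
  have \<phi>: "bounded_weight (\<lambda>\<xi>. tail_weight R \<xi> * (japanese \<xi> * cutoff N \<xi>))"
    by (rule bounded_weight_mult[OF tw jc])
  have diag: "norm (conv_op ?\<kappa> y y) \<le> 2 * kernel_norm ?p * norm b * norm y"
    unfolding b_def by (rule norm_conv_op_diag_le[OF commutator_kernel_bound])
  \<comment> \<open>The cutoff bounds the frequency \<open>\<eta>\<close> by \<open>N\<close>. The
    resulting constant depends on \<open>N\<close>, but it serves only to make the skew-symmetric
    integral absolutely convergent.\<close>
  have kb_sk: "kernel_bound (\<lambda>_. 1) (\<lambda>x. (1 + real N) * pw (1 - s) x) ?sk"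
    unfolding kernel_bound_one_iff
  proof (intro conjI allI scaled_decay_L2)
    fix \<xi> \<eta> :: "real^2"
    have "\<bar>?sk \<xi> \<eta>\<bar> \<le> (1 * (cutoff N \<eta> * \<bar>sqg_symbol (\<xi> - \<eta>) \<eta>\<bar>)) * pw (- s) (\<xi> - \<eta>)"
      unfolding abs_mult mult.assoc by (intro mult_mono) (auto simp: cutoff_def indicator_def)
    also have "\<dots> \<le> (1 + real N) * pw (1 - s) (\<xi> - \<eta>)"
    proof (intro mult_mono pw_mono)
      show "1 * (cutoff N \<eta> * \<bar>sqg_symbol (\<xi> - \<eta>) \<eta>\<bar>) \<le> 1 + real N"
        using sqg_symbol_le[of "\<xi> - \<eta>" \<eta>] by (auto simp: cutoff_def indicator_def)
    qed auto
    finally show "\<bar>?sk \<xi> \<eta>\<bar> \<le> (1 + real N) * pw (1 - s) \<eta> + (1 + real N) * pw (1 - s) (\<xi> - \<eta>)"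
      by (simp add: add_increasing)
  qed auto
  have kb_skt: "kernel_bound (\<lambda>_. 1) (\<lambda>x. (1 + real N) * pw (1 - s) x) (\<lambda>\<xi> \<eta>. ?sk \<xi> \<eta> * tail_weight R \<eta>)"
    unfolding kernel_bound_one_iff
  proof (intro conjI allI scaled_decay_L2)
    fix \<xi> \<eta> :: "real^2"
    have "\<bar>?sk \<xi> \<eta> * tail_weight R \<eta>\<bar> \<le> \<bar>?sk \<xi> \<eta>\<bar> * 1"
      unfolding abs_mult[of _ "tail_weight R \<eta>"] by (intro mult_left_mono) (auto simp: tail_weight_bounds)
    also have "\<dots> \<le> (1 + real N) * pw (1 - s) \<eta> + (1 + real N) * pw (1 - s) (\<xi> - \<eta>)"
      using kb_sk by (simp add: kernel_bound_one_iff)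
    finally show "\<bar>?sk \<xi> \<eta> * tail_weight R \<eta>\<bar> \<le> (1 + real N) * pw (1 - s) \<eta> + (1 + real N) * pw (1 - s) (\<xi> - \<eta>)" .
  qed auto
  have "b \<bullet> conv_op ?sk y b = 0"
  proof (rule conv_op_skew[OF kb_sk _ y])
    fix \<xi> \<eta> :: "real^2"
    have "pw (- s) (\<eta> - \<xi>) = pw (- s) (\<xi> - \<eta>)" using pw_uminus[of "- s" "\<xi> - \<eta>"] by simp
    then show "?sk \<eta> \<xi> = - ?sk \<xi> \<eta>" by (simp add: sqg_symbol_skew[of \<eta> \<xi>] mult_ac)
  qed
  moreover have "conv_op ?sk y b = conv_op (\<lambda>\<xi> \<eta>. ?sk \<xi> \<eta> * tail_weight R \<eta>) y y"
    unfolding b_def by (rule conv_op_wmul_right[OF _ tw]) measurable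
  ultimately have 0: "b \<bullet> conv_op (\<lambda>\<xi> \<eta>. ?sk \<xi> \<eta> * tail_weight R \<eta>) y y = 0" by simp
  \<comment> \<open>By \<open>cut\<close> the second argument may be replaced by its truncation.
    This supplies the factor \<open>cutoff N \<eta>\<close>, and with the symmetric product of
    cutoffs the skew part remains skew.\<close>
  have "wmul (tail_weight R) (wmul (\<lambda>\<xi>. japanese \<xi> * cutoff N \<xi>) (\<BB> y y))
      = conv_op (\<lambda>\<xi> \<eta>. (tail_weight R \<xi> * (japanese \<xi> * cutoff N \<xi>)) * sqg_kernel s \<xi> \<eta>) y (wmul (cutoff N) y)"
    unfolding wmul_wmul[OF tw jc] wmul_conv_op[OF kernel_bound_sqg \<phi>] cut ..
  also have "\<dots> = conv_op (\<lambda>\<xi> \<eta>. ((tail_weight R \<xi> * (japanese \<xi> * cutoff N \<xi>)) * sqg_kernel s \<xi> \<eta>) * cutoff N \<eta>) y y"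
  proof (rule conv_op_wmul_right[OF _ bounded_weight_cutoff])
    note [measurable] = kernel_measurable(3)[OF kernel_bound_sqg]
    show "(\<lambda>(\<xi>, \<eta>). tail_weight R \<xi> * (japanese \<xi> * cutoff N \<xi>) * sqg_kernel s \<xi> \<eta>) \<in> borel_measurable (borel \<Otimes>\<^sub>M borel)"
      by measurable
  qed
  also have "(\<lambda>\<xi> \<eta>. ((tail_weight R \<xi> * (japanese \<xi> * cutoff N \<xi>)) * sqg_kernel s \<xi> \<eta>) * cutoff N \<eta>)
      = (\<lambda>\<xi> \<eta>. ?\<kappa> \<xi> \<eta> + ?sk \<xi> \<eta> * tail_weight R \<eta>)"
  proof (intro ext)
    fix \<xi> \<eta> :: "real^2"
    have a: "japanese \<xi> * pw (s - 1) \<xi> = pw s \<xi>" using pw_add[of 1 \<xi> "s - 1"] by (simp add: pw_1)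
    have b: "pw s \<eta> * pw (- s) \<eta> = 1" using pw_add[of s \<eta> "- s"] by simp
    have "((tail_weight R \<xi> * (japanese \<xi> * cutoff N \<xi>)) * sqg_kernel s \<xi> \<eta>) * cutoff N \<eta>
       = cutoff N \<xi> * cutoff N \<eta> * (((japanese \<xi> * pw (s - 1) \<xi>) * tail_weight R \<xi>) * lowkernel \<xi> \<eta>)"
      by (simp add: sqg_kernel_def mult_ac)
    \<comment> \<open>The weight at \<open>\<eta>\<close> is subtracted and added. In the added term
      its power cancels the decay in \<open>\<eta>\<close>, and the tail weight left over is
      absorbed by the second argument, which turns \<open>y\<close> into \<open>b\<close>.\<close>
    also have "\<dots> = ?\<kappa> \<xi> \<eta> + ?sk \<xi> \<eta> * tail_weight R \<eta> * (pw s \<eta> * pw (- s) \<eta>)"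
    proof -
      have c: "?sk \<xi> \<eta> * tail_weight R \<eta> * (pw s \<eta> * pw (- s) \<eta>) = cutoff N \<xi> * cutoff N \<eta> * (?W \<eta> * lowkernel \<xi> \<eta>)"
        by (simp only: mult_ac)
      have d: "x * (u * l) = x * ((u - v) * l) + x * (v * l)" for x u v l :: real
        by (simp add: algebra_simps)
      show ?thesis unfolding a c by (rule d)
    qed
    finally show "((tail_weight R \<xi> * (japanese \<xi> * cutoff N \<xi>)) * sqg_kernel s \<xi> \<eta>) * cutoff N \<eta>
        = ?\<kappa> \<xi> \<eta> + ?sk \<xi> \<eta> * tail_weight R \<eta>" unfolding b by simp
  qed
  also have "conv_op \<dots> y y = conv_op ?\<kappa> y y + conv_op (\<lambda>\<xi> \<eta>. ?sk \<xi> \<eta> * tail_weight R \<eta>) y y"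
    by (rule conv_op_add_kernel[OF commutator_kernel_bound kb_skt])
  finally have eq: "b \<bullet> wmul (tail_weight R) (wmul (\<lambda>\<xi>. japanese \<xi> * cutoff N \<xi>) (\<BB> y y)) = b \<bullet> conv_op ?\<kappa> y y"
    using 0 by (simp add: inner_add_right)
  have "\<bar>b \<bullet> conv_op ?\<kappa> y y\<bar> \<le> norm b * norm (conv_op ?\<kappa> y y)" by (rule Cauchy_Schwarz_ineq2)
  also have "\<dots> \<le> norm b * (2 * kernel_norm ?p * norm b * norm y)"
    by (rule mult_left_mono[OF diag norm_ge_zero])
  also have "\<dots> = 2 * kernel_norm ?p * (norm y * (norm b)\<^sup>2)" by (simp add: power2_eq_square)
  also have "\<dots> \<le> energy_const * (norm y * (norm b)\<^sup>2)"
    by (rule mult_right_mono) (simp_all add: energy_const_def)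
  finally show ?thesis unfolding b_def[symmetric] eq by (simp only: mult.assoc)
qed

end

section \<open>The SQG equation as an instance of the abstract equation\<close>

text \<open>The frequencies are split where the bracket equals \<open>R\<close>. Below, the weight
  of order \<open>- s\<close> is at least \<open>R powr (- s)\<close>; above, the tail weight equals
  1.\<close>

lemma interpolation_tail:
  assumes "1 \<le> R" "0 \<le> s"
  shows "norm d \<le> R powr s * norm (wmul (pw (- s)) d) + norm (wmul (tail_weight R) d)"
proof -
  define \<phi> :: "real^2 \<Rightarrow> real" where "\<phi> = indicator {\<xi>. japanese \<xi> < R}"
  have m: "\<phi> \<in> borel_measurable borel"
    unfolding \<phi>_def by (intro borel_measurable_indicator) measurable
  have \<phi>: "bounded_weight \<phi>" "bounded_weight (\<lambda>x. 1 - \<phi> x)"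
    using m by (auto intro!: bounded_weightI[where C = 1] simp: \<phi>_def indicator_def)
  have w: "bounded_weight (pw (- s))" using assms by (intro bounded_weight_pw) simp
  have "d = wmul \<phi> d + wmul (\<lambda>x. 1 - \<phi> x) d"
    by (rule l2_eqI) (use rep_wmul[OF \<phi>(1), of d] rep_wmul[OF \<phi>(2), of d]
        rep_add_l2[of "wmul \<phi> d" "wmul (\<lambda>x. 1 - \<phi> x) d"] in \<open>eventually_elim, simp add: scaleR_diff_left\<close>)
  then have "norm d \<le> norm (wmul \<phi> d) + norm (wmul (\<lambda>x. 1 - \<phi> x) d)"
    by (metis norm_triangle_ineq)
  also have "norm (wmul \<phi> d) \<le> R powr s * norm (wmul (pw (- s)) d)"
  proof (rule norm_l2_mono)
    show "AE \<xi> in lborel. cmod (rep_l2 (wmul \<phi> d) \<xi>) \<le> R powr s * cmod (rep_l2 (wmul (pw (- s)) d) \<xi>)"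
      using rep_wmul[OF \<phi>(1), of d] rep_wmul[OF w, of d]
    proof eventually_elim
      case (elim \<xi>)
      have "\<bar>\<phi> \<xi>\<bar> \<le> R powr s * pw (- s) \<xi>"
      proof (cases "japanese \<xi> < R")
        case True
        have "japanese \<xi> powr s \<le> R powr s" using True assms by (intro powr_mono2) (auto simp: less_imp_le)
        then show ?thesis using True japanese_pos[of \<xi>] by (simp add: \<phi>_def pw_def powr_minus field_simps del: japanese_pos)
      qed (simp add: \<phi>_def)
      then have "\<bar>\<phi> \<xi>\<bar> * cmod (rep_l2 d \<xi>) \<le> (R powr s * pw (- s) \<xi>) * cmod (rep_l2 d \<xi>)"
        by (rule mult_right_mono) simp
      then show ?case using elim by (simp add: mult.assoc)
    qed
  qed simp
  also have "norm (wmul (\<lambda>x. 1 - \<phi> x) d) \<le> 1 * norm (wmul (tail_weight R) d)"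
  proof (rule norm_l2_mono)
    show "AE \<xi> in lborel. cmod (rep_l2 (wmul (\<lambda>x. 1 - \<phi> x) d) \<xi>) \<le> 1 * cmod (rep_l2 (wmul (tail_weight R) d) \<xi>)"
      using rep_wmul[OF \<phi>(2), of d] rep_wmul[OF bounded_weight_tail, of R d]
    proof eventually_elim
      case (elim \<xi>)
      have "\<bar>1 - \<phi> \<xi>\<bar> \<le> \<bar>tail_weight R \<xi>\<bar>"
        using assms by (auto simp: \<phi>_def tail_weight_def trunc_def indicator_def)
      then have "\<bar>1 - \<phi> \<xi>\<bar> * cmod (rep_l2 d \<xi>) \<le> \<bar>tail_weight R \<xi>\<bar> * cmod (rep_l2 d \<xi>)"
        by (rule mult_right_mono) simp
      then show ?case using elim by simp
    qed
  qed simp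
  finally show ?thesis by simp
qed

lemma tail_weight_tendsto_0: "((\<lambda>R. norm (wmul (tail_weight R) y)) \<longlongrightarrow> 0) at_top"
proof (rule tendsto_at_topI_sequentially)
  fix X :: "nat \<Rightarrow> real" assume X: "filterlim X at_top sequentially"
  have "(\<lambda>n. wmul (tail_weight (X n)) y) \<longlonglongrightarrow> 0"
  proof (rule wmul_tendsto_0[where C = 1])
    show "\<bar>tail_weight (X n) \<xi>\<bar> \<le> 1" for n \<xi> by (auto simp: tail_weight_bounds)
    fix \<xi> :: "real^2"
    have "filterlim (\<lambda>n. max 1 (X n)) at_top sequentially"
      by (rule filterlim_at_top_mono[OF X]) (auto intro: always_eventually)
    then have "(\<lambda>n. japanese \<xi> / max 1 (X n)) \<longlonglongrightarrow> 0"
      by (intro tendsto_divide_0[OF tendsto_const] filterlim_at_top_imp_at_infinity)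
    from tendsto_min[OF tendsto_const this, of 1]
    show "(\<lambda>n. tail_weight (X n) \<xi>) \<longlonglongrightarrow> 0" by (simp add: tail_weight_def trunc_def)
  qed (rule bounded_weight_tail)
  then show "(\<lambda>n. norm (wmul (tail_weight (X n)) y)) \<longlonglongrightarrow> 0" by (rule tendsto_norm_zero)
qed

lemma cutoff_tendsto: "(\<lambda>N. wmul (cutoff N) y) \<longlonglongrightarrow> y"
proof -
  have w: "bounded_weight (\<lambda>\<xi>. cutoff N \<xi> - 1)" for N
    by (rule bounded_weightI[where C = 1]) (measurable, auto simp: cutoff_def indicator_def)
  have one: "bounded_weight (\<lambda>_. 1)" by (rule bounded_weightI[where C = 1]) auto
  have "(\<lambda>N. wmul (\<lambda>\<xi>. cutoff N \<xi> - 1) y) \<longlonglongrightarrow> 0"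
  proof (rule wmul_tendsto_0[OF w, where C = 1])
    show "\<bar>cutoff N \<xi> - 1\<bar> \<le> 1" for N \<xi> by (auto simp: cutoff_def indicator_def)
    fix \<xi> :: "real^2"
    have "\<forall>\<^sub>F N in sequentially. norm \<xi> \<le> real N"
      using eventually_ge_at_top[of "nat \<lceil>norm \<xi>\<rceil>"] by eventually_elim linarith
    then have "\<forall>\<^sub>F N in sequentially. cutoff N \<xi> - 1 = 0"
      by eventually_elim (simp add: cutoff_def)
    then show "(\<lambda>N. cutoff N \<xi> - 1) \<longlonglongrightarrow> 0" by (rule tendsto_eventually)
  qed
  moreover have "wmul (cutoff N) y - y = wmul (\<lambda>\<xi>. cutoff N \<xi> - 1) y" for N
    using wmul_diff_weight[OF bounded_weight_cutoff one w, of N y] by (simp add: wmul_one)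
  ultimately have "(\<lambda>N. wmul (cutoff N) y - y) \<longlonglongrightarrow> 0" by simp
  then show ?thesis by (rule LIM_zero_cancel)
qed

lemma galerkin_error_tendsto: "galerkin_error \<longlonglongrightarrow> 0"
  unfolding galerkin_error_def using tendsto_mult_left[OF LIMSEQ_inverse_real_of_nat, of 2] by simp

text \<open>The two consistency errors of the Galerkin scheme agree: the factor
  \<open>japanese \<xi>\<close> cancels one order of the weight, and what remains is a decaying
  weight outside the cutoff.\<close>

lemma wmul_pw_cutoff:
  assumes "\<sigma> \<le> - 1"
  shows "norm (wmul (pw (\<sigma> - 1)) (wmul (\<lambda>\<xi>. japanese \<xi> * cutoff N \<xi>) z) - wmul (pw \<sigma>) z) \<le> galerkin_error N * norm z"
    and "norm (wmul (pw \<sigma>) (wmul (cutoff N) z) - wmul (pw \<sigma>) z) \<le> galerkin_error N * norm z"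
proof -
  have w: "bounded_weight (pw \<sigma>)" "bounded_weight (pw (\<sigma> - 1))" using assms by (auto intro: bounded_weight_pw)
  have v: "bounded_weight (\<lambda>\<xi>. cutoff N \<xi> * pw \<sigma> \<xi>)" by (rule bounded_weight_mult[OF bounded_weight_cutoff w(1)])
  have e: "(\<lambda>\<xi>. cutoff N \<xi> * pw \<sigma> \<xi> - pw \<sigma> \<xi>) = (\<lambda>\<xi>. (cutoff N \<xi> - 1) * pw \<sigma> \<xi>)" by (simp add: algebra_simps)
  have "norm (wmul (\<lambda>\<xi>. cutoff N \<xi> * pw \<sigma> \<xi>) z - wmul (pw \<sigma>) z) \<le> galerkin_error N * norm z"
    using wmul_diff_weight[OF v w(1), of z] bounded_weight_outside_cutoff[OF assms, of N]
      norm_wmul_le[OF bounded_weight_outside_cutoff[OF assms, of N] outside_cutoff_le[OF assms], of z]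
    unfolding e by simp
  moreover have "wmul (pw (\<sigma> - 1)) (wmul (\<lambda>\<xi>. japanese \<xi> * cutoff N \<xi>) z) = wmul (\<lambda>\<xi>. cutoff N \<xi> * pw \<sigma> \<xi>) z"
  proof -
    have e2: "pw (\<sigma> - 1) \<xi> * (japanese \<xi> * cutoff N \<xi>) = cutoff N \<xi> * pw \<sigma> \<xi>" for \<xi>
      using pw_add[of 1 \<xi> "\<sigma> - 1"] by (simp add: pw_1 mult_ac)
    show ?thesis unfolding wmul_wmul[OF w(2) bounded_weight_japanese_cutoff] e2 ..
  qed
  moreover have "wmul (pw \<sigma>) (wmul (cutoff N) z) = wmul (\<lambda>\<xi>. cutoff N \<xi> * pw \<sigma> \<xi>) z"
    by (simp add: wmul_wmul[OF w(1) bounded_weight_cutoff] mult.commute)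
  ultimately show "norm (wmul (pw (\<sigma> - 1)) (wmul (\<lambda>\<xi>. japanese \<xi> * cutoff N \<xi>) z) - wmul (pw \<sigma>) z) \<le> galerkin_error N * norm z"
    and "norm (wmul (pw \<sigma>) (wmul (cutoff N) z) - wmul (pw \<sigma>) z) \<le> galerkin_error N * norm z"
    by simp_all
qed

text \<open>In the encoding of H^s, the weight of order \<open>- s\<close> recovers the L^2 norm of
  the function, \<open>1 - s\<close> the L^2 norm of an element of H^(s-1), and \<open>- 1\<close>
  is the embedding of H^s into H^(s-1). Composition with \<open>herm\<close> gives operators that
  are linear on all of \<open>l2\<close> and have Hermitian values.\<close>

lemma sqg_quasilinear_equation:
  assumes s: "2 < s"
  shows "quasilinear_equation (conv_op (sqg_kernel s)) (wmul (pw (- s))) (wmul (pw (1 - s))) (wmul (pw (- 1)))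
     (\<lambda>R. wmul (tail_weight R)) (\<lambda>N y. wmul (cutoff N) (herm y))
     (\<lambda>N y. wmul (\<lambda>\<xi>. japanese \<xi> * cutoff N \<xi>) (herm y)) hermitian (energy_const s) galerkin_error (\<lambda>R. R powr s)"
proof (rule quasilinear_equation.intro)
  note cut = bounded_weight_cutoff
  note jc = bounded_weight_japanese_cutoff
  have w: "bounded_weight (pw (- s))" "bounded_weight (pw (1 - s))" "bounded_weight (pw (- 1))"
    using s by (auto intro: bounded_weight_pw)
  have even_jc: "japanese (- x) * cutoff N (- x) = japanese x * cutoff N x" for N x by (simp add: cutoff_simps)
  have herm_cut: "herm (wmul (cutoff N) (herm y)) = wmul (cutoff N) (herm y)" for N y
    by (intro herm_id wmul_hermitian[OF cut] herm_in) (simp add: cutoff_simps)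
  have herm_jc: "herm (wmul (\<lambda>\<xi>. japanese \<xi> * cutoff N \<xi>) (herm y)) = wmul (\<lambda>\<xi>. japanese \<xi> * cutoff N \<xi>) (herm y)" for N y
    by (intro herm_id wmul_hermitian[OF jc] herm_in) (simp add: cutoff_simps)
  fix y d z :: l2 and R :: real and N :: nat
  show "bounded_bilinear (conv_op (sqg_kernel s))"
    by (rule bounded_bilinear_conv_op[OF kernel_bound_sqg[OF s]])
  show "bounded_linear (wmul (pw (- s)))" "bounded_linear (wmul (pw (1 - s)))" "bounded_linear (wmul (pw (- 1)))"
    "bounded_linear (wmul (tail_weight R))"
    by (intro bounded_linear_wmul w bounded_weight_tail)+
  show "bounded_linear (\<lambda>y. wmul (cutoff N) (herm y))"
    by (rule bounded_linear_compose[OF bounded_linear_wmul[OF cut] bounded_linear_herm])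
  show "bounded_linear (\<lambda>y. wmul (\<lambda>\<xi>. japanese \<xi> * cutoff N \<xi>) (herm y))"
    by (rule bounded_linear_compose[OF bounded_linear_wmul[OF jc] bounded_linear_herm])
  show "0 < energy_const s"
    using commutator_const_nonneg[OF s] by (simp add: energy_const_def[OF s] add_nonneg_pos)
  show "wmul (pw (- s)) y = wmul (pw (1 - s)) (wmul (pw (- 1)) y)"
    by (simp add: wmul_wmul[OF w(2,3)] pw_add)
  show "wmul (pw (- 1)) y = 0 \<Longrightarrow> y = 0"
    by (rule wmul_eq_0_imp[OF w(3)]) (auto simp: less_imp_neq[symmetric])
  show "subspace hermitian" "closed hermitian" by (rule subspace_hermitian closed_hermitian)+
  show "y \<in> hermitian \<Longrightarrow> conv_op (sqg_kernel s) y y \<in> hermitian" by (intro sqg_hermitian[OF s])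
  show "wmul (cutoff N) (herm y) \<in> hermitian"
    by (intro wmul_hermitian[OF cut] herm_in) (simp add: cutoff_simps)
  show "wmul (cutoff N) (herm (wmul (cutoff N) (herm y))) = wmul (cutoff N) (herm y)"
    unfolding herm_cut wmul_wmul[OF cut cut] by (simp add: cutoff_simps)
  show "wmul (cutoff N) (herm (wmul (\<lambda>\<xi>. japanese \<xi> * cutoff N \<xi>) (herm y))) = wmul (\<lambda>\<xi>. japanese \<xi> * cutoff N \<xi>) (herm y)"
  proof -
    have e: "cutoff N \<xi> * (japanese \<xi> * cutoff N \<xi>) = japanese \<xi> * cutoff N \<xi>" for \<xi>
      using cutoff_simps(4)[of N \<xi>] by (simp only: mult.left_commute)
    show ?thesis unfolding herm_jc wmul_wmul[OF cut jc] e ..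
  qed
  have norm_cut: "norm (wmul (cutoff N) u) \<le> norm u" for u
    using norm_wmul_le[OF cut, of N 1 u] by (auto simp: cutoff_simps)
  show "norm (wmul (cutoff N) (herm y)) \<le> norm y"
    by (rule order_trans[OF norm_cut norm_herm_le])
  show "y \<in> hermitian \<Longrightarrow> (\<lambda>N. wmul (cutoff N) (herm y)) \<longlonglongrightarrow> y"
    using cutoff_tendsto[of y] by (simp add: herm_id)
  show "norm (wmul (tail_weight R) (wmul (cutoff N) (herm y))) \<le> norm (wmul (tail_weight R) y)"
  proof -
    have "wmul (tail_weight R) (wmul (cutoff N) (herm y)) = wmul (cutoff N) (herm (wmul (tail_weight R) y))"
      unfolding herm_wmul[OF bounded_weight_tail tail_weight_uminus] wmul_wmul[OF bounded_weight_tail cut]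
        wmul_wmul[OF cut bounded_weight_tail] by (simp only: mult.commute)
    then show ?thesis using order_trans[OF norm_cut norm_herm_le] by simp
  qed
  show "norm (wmul (tail_weight R) y) \<le> norm y"
    using norm_wmul_le[OF bounded_weight_tail, of R 1 y] by (auto simp: tail_weight_bounds)
  show "wmul (tail_weight 1) y = y"
  proof -
    have "tail_weight 1 = (\<lambda>_. 1)" by (rule ext) (simp add: tail_weight_def trunc_def)
    then show ?thesis by (simp add: wmul_one)
  qed
  show "((\<lambda>R. norm (wmul (tail_weight R) y)) \<longlongrightarrow> 0) at_top" by (rule tail_weight_tendsto_0)
  show "\<bar>wmul (tail_weight R) y \<bullet> wmul (tail_weight R) (wmul (\<lambda>\<xi>. japanese \<xi> * cutoff N \<xi>) (herm (conv_op (sqg_kernel s) y y)))\<bar>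
     \<le> energy_const s * norm y * (norm (wmul (tail_weight R) y))\<^sup>2"
    if "1 \<le> R" "wmul (cutoff N) (herm y) = y" for R N y
  proof -
    have h: "y \<in> hermitian"
      using that(2) wmul_hermitian[OF cut _ herm_in, of N y] by (simp add: cutoff_simps)
    have c: "wmul (cutoff N) y = y" using that(2) by (simp add: herm_id[OF h])
    show ?thesis
      unfolding herm_id[OF sqg_hermitian[OF s h h]] by (rule sqg_energy[OF s h c])
  qed
  show "y \<in> hermitian \<Longrightarrow> wmul (pw (- s)) d \<bullet> wmul (pw (1 - s)) (conv_op (sqg_kernel s) y d) = 0"
    by (rule sqg_skew[OF s])
  show "norm (wmul (pw (1 - s)) (conv_op (sqg_kernel s) d z)) \<le> energy_const s * norm (wmul (pw (- s)) d) * norm z"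
    using norm_low_le[OF s, of d z]
  proof (rule order_trans)
    show "2 * kernel_norm (pw (1 - s)) * norm (wmul (pw (- s)) d) * norm z \<le> energy_const s * norm (wmul (pw (- s)) d) * norm z"
      by (intro mult_right_mono) (auto simp: energy_const_def[OF s])
  qed
  show "1 \<le> R \<Longrightarrow> norm d \<le> R powr s * norm (wmul (pw (- s)) d) + norm (wmul (tail_weight R) d)"
    using s by (intro interpolation_tail) auto
  show "0 \<le> R powr s" by simp
  show "0 \<le> galerkin_error N" by (simp add: galerkin_error_def)
  show "galerkin_error \<longlonglongrightarrow> 0" by (rule galerkin_error_tendsto)
  show "norm (wmul (pw (- s)) (wmul (\<lambda>\<xi>. japanese \<xi> * cutoff N \<xi>) (herm z)) - wmul (pw (1 - s)) z) \<le> galerkin_error N * norm z"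
    if "z \<in> hermitian" for z
    using wmul_pw_cutoff(1)[of "1 - s" N z] s by (simp add: herm_id[OF that])
  show "wmul (pw (- 1)) (wmul (\<lambda>\<xi>. japanese \<xi> * cutoff N \<xi>) (herm z)) = wmul (cutoff N) (herm z)"
  proof -
    have e: "pw (- 1) \<xi> * (japanese \<xi> * cutoff N \<xi>) = cutoff N \<xi>" for \<xi>
      using pw_add[of "- 1" \<xi> 1] by (simp add: pw_1 mult.assoc[symmetric])
    show ?thesis unfolding wmul_wmul[OF w(3) jc] e ..
  qed
  show "norm (wmul (pw (- 1)) (wmul (cutoff N) (herm z)) - wmul (pw (- 1)) z) \<le> galerkin_error N * norm z"
    if "z \<in> hermitian" for z
    using wmul_pw_cutoff(2)[of "- 1" N z] by (simp add: herm_id[OF that])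
qed

subsection \<open>The Gaussian\<close>

lemma integral_lborel_prod_Basis:
  fixes f :: "'a::euclidean_space \<Rightarrow> real \<Rightarrow> complex"
  assumes f: "\<And>b. b \<in> Basis \<Longrightarrow> integrable lborel (f b)"
  shows "(LINT x|lborel. (\<Prod>b\<in>Basis. f b (x \<bullet> b))) = (\<Prod>b\<in>Basis. (LINT x|lborel. f b x))"
    and "integrable lborel (\<lambda>x. \<Prod>b\<in>Basis. f b (x \<bullet> b))"
proof -
  interpret product_sigma_finite "\<lambda>_::'a. lborel :: real measure" by standard
  have [measurable]: "f b \<in> borel_measurable borel" if "b \<in> Basis" for b
    using borel_measurable_integrable[OF f[OF that]] by simp
  let ?T = "\<lambda>g::'a \<Rightarrow> real. \<Sum>b\<in>Basis. g b *\<^sub>R b"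
  have T: "?T \<in> measurable (\<Pi>\<^sub>M b\<in>Basis. lborel) borel"
    by measurable
  have m: "(\<lambda>x. \<Prod>b\<in>Basis. f b (x \<bullet> b)) \<in> borel_measurable borel"
    by (intro borel_measurable_prod) measurable
  have e: "(\<Prod>b\<in>Basis. f b (?T g \<bullet> b)) = (\<Prod>b\<in>Basis. f b (g b))" for g
    by (intro prod.cong refl) (simp add: inner_sum_left inner_Basis if_distrib cong: if_cong)
  have "(LINT x|lborel. (\<Prod>b\<in>Basis. f b (x \<bullet> b))) = (LINT g|(\<Pi>\<^sub>M b\<in>Basis. lborel). (\<Prod>b\<in>Basis. f b (?T g \<bullet> b)))"
    by (subst lborel_eq) (rule integral_distr[OF T m])
  also have "\<dots> = (LINT g|(\<Pi>\<^sub>M b\<in>Basis. lborel). (\<Prod>b\<in>Basis. f b (g b)))"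
    by (simp only: e)
  also have "\<dots> = (\<Prod>b\<in>Basis. (LINT x|lborel. f b x))"
    by (rule product_integral_prod[OF finite_Basis, of f]) (rule f)
  finally show "(LINT x|lborel. (\<Prod>b\<in>Basis. f b (x \<bullet> b))) = (\<Prod>b\<in>Basis. (LINT x|lborel. f b x))" .
  have "integrable (\<Pi>\<^sub>M b\<in>Basis. lborel) (\<lambda>g. \<Prod>b\<in>Basis. f b (?T g \<bullet> b))"
    unfolding e by (rule product_integrable_prod[OF finite_Basis, of f]) (rule f)
  then show "integrable lborel (\<lambda>x. \<Prod>b\<in>Basis. f b (x \<bullet> b))"
    by (subst lborel_eq, subst integrable_distr_eq[OF T m])
qed

definition gaussian :: "'a::euclidean_space \<Rightarrow> real" where "gaussian x = exp (- (norm x)\<^sup>2 / 2)"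

lemma gaussian_measurable [measurable]: "gaussian \<in> borel_measurable borel"
  unfolding gaussian_def by measurable

lemma gaussian_nonneg [simp]: "0 \<le> gaussian x" and gaussian_le_1: "gaussian x \<le> 1"
  by (auto simp: gaussian_def)

text \<open>Up to the normalization \<open>sqrt (2 * pi)\<close> this is the characteristic function
  of the standard normal distribution.\<close>

lemma gaussian_fourier_1:
  fixes t :: real
  shows "integrable lborel (\<lambda>x::real. cis (t * x) * complex_of_real (exp (- x\<^sup>2 / 2)))"
    and "(LINT x|lborel. cis (t * x) * complex_of_real (exp (- x\<^sup>2 / 2))) = complex_of_real (sqrt (2 * pi) * exp (- t\<^sup>2 / 2))"
proof -
  have e: "complex_of_real (exp (- x\<^sup>2 / 2)) = complex_of_real (sqrt (2 * pi)) * complex_of_real (std_normal_density x)" for x :: real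
  proof -
    have "exp (- x\<^sup>2 / 2) = sqrt (2 * pi) * std_normal_density x" by (simp add: std_normal_density_def)
    then show ?thesis by (simp only: of_real_mult)
  qed
  have "integrable lborel (\<lambda>x::real. complex_of_real (std_normal_density x))"
    using integrable_normal_density[of 1 0] by (intro integrable_of_real) simp
  then have i: "integrable lborel (\<lambda>x::real. complex_of_real (exp (- x\<^sup>2 / 2)))"
    unfolding e by (rule integrable_mult_right)
  show "integrable lborel (\<lambda>x::real. cis (t * x) * complex_of_real (exp (- x\<^sup>2 / 2)))"
    by (rule Bochner_Integration.integrable_bound[OF i]) (auto simp: norm_mult cis_conv_exp)
  have "complex_of_real (exp (- t\<^sup>2 / 2)) = char std_normal_distribution t"
    by (simp add: char_std_normal_distribution)
  also have "\<dots> = (LINT x|lborel. std_normal_density x *\<^sub>R cis (t * x))"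
    unfolding char_def by (subst integral_density) (auto simp: cis_conv_exp)
  finally have c: "complex_of_real (exp (- t\<^sup>2 / 2)) = (LINT x|lborel. std_normal_density x *\<^sub>R cis (t * x))" .
  have "(LINT x|lborel. cis (t * x) * complex_of_real (exp (- x\<^sup>2 / 2)))
     = (LINT x|lborel. complex_of_real (sqrt (2 * pi)) * (std_normal_density x *\<^sub>R cis (t * x)))"
    unfolding e by (simp add: scaleR_conv_of_real mult_ac)
  also have "\<dots> = complex_of_real (sqrt (2 * pi)) * (LINT x|lborel. std_normal_density x *\<^sub>R cis (t * x))"
    by (rule integral_mult_right_zero)
  finally show "(LINT x|lborel. cis (t * x) * complex_of_real (exp (- x\<^sup>2 / 2))) = complex_of_real (sqrt (2 * pi) * exp (- t\<^sup>2 / 2))"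
    unfolding c[symmetric] by simp
qed

lemma cis_sum: "finite A \<Longrightarrow> cis (sum f A) = (\<Prod>i\<in>A. cis (f i))"
  by (induction rule: finite_induct) (auto simp: cis_mult[symmetric])

text \<open>Gaussian and exponential are products over the coordinates, so the integral is a product
  of two one-dimensional ones; the two roots multiply to \<open>2 * pi\<close>.\<close>

lemma gaussian_fourier:
  fixes t :: "real^2"
  shows "integrable lborel (\<lambda>x::real^2. cis (t \<bullet> x) * complex_of_real (gaussian x))"
    and "(LINT x|lborel. cis (t \<bullet> x) * complex_of_real (gaussian x)) = complex_of_real (2 * pi * gaussian t)"
proof -
  have g: "gaussian x = (\<Prod>b\<in>Basis. exp (- (x \<bullet> b)\<^sup>2 / 2))" for x :: "real^2"
  proof -
    have "(norm x)\<^sup>2 = (\<Sum>b\<in>Basis. (x \<bullet> b)\<^sup>2)"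
      unfolding power2_norm_eq_inner by (subst euclidean_inner) (simp add: power2_eq_square)
    then show ?thesis by (simp add: gaussian_def sum_negf sum_divide_distrib exp_sum[symmetric])
  qed
  have e: "cis (t \<bullet> x) * complex_of_real (gaussian x)
      = (\<Prod>b\<in>Basis. cis ((t \<bullet> b) * (x \<bullet> b)) * complex_of_real (exp (- (x \<bullet> b)\<^sup>2 / 2)))" for x
    unfolding g by (subst euclidean_inner) (simp add: cis_sum prod.distrib)
  show "integrable lborel (\<lambda>x::real^2. cis (t \<bullet> x) * complex_of_real (gaussian x))"
    unfolding e by (rule integral_lborel_prod_Basis(2)[of "\<lambda>b x. cis ((t \<bullet> b) * x) * complex_of_real (exp (- x\<^sup>2 / 2))"])
      (rule gaussian_fourier_1)
  have "(LINT x|lborel. cis (t \<bullet> x) * complex_of_real (gaussian x))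
     = (\<Prod>b\<in>Basis. complex_of_real (sqrt (2 * pi) * exp (- (t \<bullet> b)\<^sup>2 / 2)))"
    unfolding e gaussian_fourier_1(2)[symmetric]
    by (rule integral_lborel_prod_Basis(1)[of "\<lambda>b x. cis ((t \<bullet> b) * x) * complex_of_real (exp (- x\<^sup>2 / 2))"])
      (rule gaussian_fourier_1)
  also have "\<dots> = complex_of_real (\<Prod>b\<in>Basis. sqrt (2 * pi) * exp (- (t \<bullet> b)\<^sup>2 / 2))"
    by (simp only: of_real_prod)
  also have "(\<Prod>b\<in>Basis. sqrt (2 * pi) * exp (- (t \<bullet> b)\<^sup>2 / 2)) = 2 * pi * gaussian t"
    unfolding g prod.distrib prod_constant by simp
  finally show "(LINT x|lborel. cis (t \<bullet> x) * complex_of_real (gaussian x)) = complex_of_real (2 * pi * gaussian t)" .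
qed

lemma integrable_gaussian: "integrable lborel (gaussian :: real^2 \<Rightarrow> real)"
proof -
  have "integrable lborel (\<lambda>x::real^2. Re (cis (0 \<bullet> x) * complex_of_real (gaussian x)))"
    by (intro integrable_Re gaussian_fourier)
  then show ?thesis by simp
qed

lemma integral_gaussian: "(LINT x|lborel. gaussian (x::real^2)) = 2 * pi"
proof -
  have "gaussian (0::real^2) = 1" by (simp add: gaussian_def)
  then have "complex_of_real (LINT x|lborel. gaussian (x::real^2)) = complex_of_real (2 * pi)"
    using gaussian_fourier(2)[of 0] by simp
  then show ?thesis by (simp only: of_real_eq_iff)
qed

lemma lborel_scale: "0 < \<delta> \<Longrightarrow> lborel = density (distr lborel borel (\<lambda>x. 0 + \<delta> *\<^sub>R x)) (\<lambda>_::real^2. ennreal (\<delta>\<^sup>2))"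
proof -
  assume d: "0 < \<delta>"
  have c: "\<bar>\<delta>\<bar>^DIM(real^2) = \<delta>\<^sup>2" using d by simp
  have "\<delta> \<noteq> 0" using d by simp
  from lborel_affine[OF this, of "0::real^2"] show ?thesis unfolding c .
qed

lemma integral_lborel_scale:
  fixes h :: "real^2 \<Rightarrow> 'b::{banach, second_countable_topology}"
  assumes [measurable]: "h \<in> borel_measurable borel" and d: "0 < \<delta>"
  shows "(LINT x|lborel. h x) = \<delta>\<^sup>2 *\<^sub>R (LINT x|lborel. h (\<delta> *\<^sub>R x))"
proof -
  have "(LINT x|lborel. h x) = (LINT x|density (distr lborel borel (\<lambda>x. 0 + \<delta> *\<^sub>R x)) (\<lambda>_. \<delta>\<^sup>2). h x)"
    by (rule arg_cong[OF lborel_scale[OF d], of "\<lambda>M. integral\<^sup>L M h"])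
  also have "\<dots> = (LINT x|distr lborel borel (\<lambda>x. 0 + \<delta> *\<^sub>R x). \<delta>\<^sup>2 *\<^sub>R h x)"
    by (rule integral_density) auto
  also have "\<dots> = (LINT x|lborel. \<delta>\<^sup>2 *\<^sub>R h (0 + \<delta> *\<^sub>R x))"
    by (rule integral_distr) measurable
  finally show ?thesis by simp
qed

lemma integrable_lborel_scale:
  fixes h :: "real^2 \<Rightarrow> 'b::{banach, second_countable_topology}"
  assumes [measurable]: "h \<in> borel_measurable borel" and d: "0 < \<delta>"
  shows "integrable lborel h \<longleftrightarrow> integrable lborel (\<lambda>x. h (\<delta> *\<^sub>R x))"
proof -
  have "integrable lborel h \<longleftrightarrow> integrable (density (distr lborel borel (\<lambda>x. 0 + \<delta> *\<^sub>R x)) (\<lambda>_. \<delta>\<^sup>2)) h"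
    by (rule arg_cong[OF lborel_scale[OF d], of "\<lambda>M. integrable M h"])
  also have "\<dots> \<longleftrightarrow> integrable (distr lborel borel (\<lambda>x. 0 + \<delta> *\<^sub>R x)) (\<lambda>x. \<delta>\<^sup>2 *\<^sub>R h x)"
    by (rule integrable_density) auto
  also have "\<dots> \<longleftrightarrow> integrable lborel (\<lambda>x. \<delta>\<^sup>2 *\<^sub>R h (0 + \<delta> *\<^sub>R x))"
    by (rule integrable_distr_eq) measurable
  also have "\<dots> \<longleftrightarrow> integrable lborel (\<lambda>x. h (\<delta> *\<^sub>R x))"
  proof
    assume "integrable lborel (\<lambda>x. \<delta>\<^sup>2 *\<^sub>R h (0 + \<delta> *\<^sub>R x))"
    then have "integrable lborel (\<lambda>x. inverse (\<delta>\<^sup>2) *\<^sub>R (\<delta>\<^sup>2 *\<^sub>R h (0 + \<delta> *\<^sub>R x)))"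
      by (rule integrable_scaleR_right)
    then show "integrable lborel (\<lambda>x. h (\<delta> *\<^sub>R x))" using d by simp
  qed simp
  finally show ?thesis .
qed

subsection \<open>Translations act continuously\<close>

definition shift :: "real^2 \<Rightarrow> l2 \<Rightarrow> l2" where "shift z a = abs_l2 (\<lambda>x. rep_l2 a (x - z))"

lemma AE_lborel_translate:
  fixes z :: "'a::euclidean_space"
  assumes "AE x in lborel. P x"
  shows "AE x in lborel. P (x - z)"
proof (rule AE_distrD[where f = "\<lambda>x. x - z" and M' = borel])
  have "(\<lambda>x. x - z) = (+) (- z)" by auto
  then have "distr lborel borel (\<lambda>x. x - z) = lborel"
    using lborel_distr_plus[of "- z"] by (simp only:)
  then show "AE x in distr lborel borel (\<lambda>x. x - z). P x" by (simp only: assms)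
qed simp

lemma integral_lborel_translate:
  fixes f :: "'a::euclidean_space \<Rightarrow> 'b::{banach, second_countable_topology}"
  assumes "f \<in> borel_measurable borel"
  shows "(LINT x|lborel. f (x - z)) = (LINT x|lborel. f x)"
  by (subst (2) lborel_distr_plus[of "- z", symmetric], subst integral_distr) (use assms in auto)

lemma L2_translate:
  fixes f :: "real^2 \<Rightarrow> 'b::{real_normed_vector, second_countable_topology}"
  assumes "f \<in> L2"
  shows "(\<lambda>x. f (x - z)) \<in> L2"
proof -
  have [measurable]: "f \<in> borel_measurable borel" by (rule L2_measurable[OF assms])
  have "(\<integral>\<^sup>+x. ennreal ((norm (f (x - z)))\<^sup>2) \<partial>lborel) = (\<integral>\<^sup>+x. ennreal ((norm (f x))\<^sup>2) \<partial>lborel)"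
    by (rule nn_integral_lborel_translate[of "\<lambda>x. ennreal ((norm (f x))\<^sup>2)"]) measurable
  then show ?thesis using assms by (simp add: L2_iff_nn_integral)
qed

lemma shift_abs:
  assumes "f \<in> L2"
  shows "shift z (abs_l2 f) = abs_l2 (\<lambda>x. f (x - z))"
  unfolding shift_def using AE_lborel_translate[OF rep_abs_l2[OF assms], of z]
  by (subst abs_l2_eq_iff) (auto intro!: L2_translate assms)

lemma rep_shift: "AE x in lborel. rep_l2 (shift z a) x = rep_l2 a (x - z)"
  unfolding shift_def by (rule rep_abs_l2) (intro L2_translate rep_l2_in)

lemma shift_add: "shift z (a + b) = shift z a + shift z b"
  by (rule l2_eqI) (use rep_shift[of z "a + b"] rep_shift[of z a] rep_shift[of z b] rep_add_l2[of "shift z a" "shift z b"]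
      AE_lborel_translate[OF rep_add_l2[of a b], of z] in \<open>eventually_elim, simp\<close>)

lemma shift_diff: "shift z (a - b) = shift z a - shift z b"
  by (rule l2_eqI) (use rep_shift[of z "a - b"] rep_shift[of z a] rep_shift[of z b] rep_diff_l2[of "shift z a" "shift z b"]
      AE_lborel_translate[OF rep_diff_l2[of a b], of z] in \<open>eventually_elim, simp\<close>)

lemma norm_shift [simp]: "norm (shift z a) = norm a"
proof -
  have "(norm (shift z a))\<^sup>2 = (norm a)\<^sup>2"
    unfolding norm_l2_sq shift_def norm_abs_l2_sq[OF L2_translate[OF rep_l2_in]]
    unfolding norm_l2_sq[symmetric]
    by (subst norm_abs_l2_sq[OF L2_translate[OF rep_l2_in]], subst norm_l2_sq)
       (rule integral_lborel_translate[of "\<lambda>x. (cmod (rep_l2 a x))\<^sup>2"], measurable)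
  then show ?thesis by simp
qed

text \<open>A set that is closed and stable under finite sums. It contains the indicators of open
  sets of finite measure, then those of Borel sets by outer regularity, then simple functions, and
  thereby everything.\<close>

definition shift_continuous :: "l2 set" where
  "shift_continuous = {a. \<forall>z. z \<longlonglongrightarrow> 0 \<longrightarrow> (\<lambda>n. shift (z n) a) \<longlonglongrightarrow> a}"

lemma shift_continuous_closed:
  assumes "\<And>e. 0 < e \<Longrightarrow> \<exists>b\<in>shift_continuous. norm (a - b) \<le> e"
  shows "a \<in> shift_continuous"
  unfolding shift_continuous_def mem_Collect_eq
proof (intro allI impI LIMSEQ_I)
  fix z :: "nat \<Rightarrow> real^2" and e :: real assume z: "z \<longlonglongrightarrow> 0" and e: "0 < e"
  obtain b where b: "b \<in> shift_continuous" "norm (a - b) \<le> e / 3" using assms[of "e / 3"] e by auto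
  have "(\<lambda>n. shift (z n) b) \<longlonglongrightarrow> b" using b z by (auto simp: shift_continuous_def)
  then obtain N where N: "\<And>n. N \<le> n \<Longrightarrow> norm (shift (z n) b - b) < e / 3"
    using LIMSEQ_D[of _ b "e / 3"] e by fastforce
  have "norm (shift (z n) a - a) < e" if "N \<le> n" for n
  proof -
    have "shift (z n) a - a = shift (z n) (a - b) + (shift (z n) b - b) + (b - a)"
      by (simp add: shift_diff)
    also have "norm \<dots> \<le> norm (shift (z n) (a - b)) + norm (shift (z n) b - b) + norm (b - a)"
      by (meson norm_triangle_le norm_triangle_ineq add_right_mono order_trans)
    finally show ?thesis using N[OF that] b(2) by (simp add: norm_minus_commute)
  qed
  then show "\<exists>N. \<forall>n\<ge>N. norm (shift (z n) a - a) < e" by blast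
qed

lemma shift_continuous_sum:
  assumes "finite I" "\<And>i. i \<in> I \<Longrightarrow> a i \<in> shift_continuous"
  shows "(\<Sum>i\<in>I. a i) \<in> shift_continuous"
  using assms
proof (induction rule: finite_induct)
  case empty
  have "shift z 0 = 0" for z using shift_diff[of z 0 0] by simp
  then show ?case by (simp add: shift_continuous_def)
next
  case (insert i I)
  then show ?case by (auto simp: shift_continuous_def shift_add intro!: tendsto_add)
qed

lemma indicator_L2:
  assumes "A \<in> sets borel" "emeasure lborel A < \<infinity>"
  shows "(\<lambda>x. indicator A x *\<^sub>R (c::complex)) \<in> L2"
    and "(norm (abs_l2 (\<lambda>x. indicator A x *\<^sub>R c)))\<^sup>2 = (cmod c)\<^sup>2 * measure lborel A"
proof -
  have e: "(cmod (indicator A x *\<^sub>R c))\<^sup>2 = (cmod c)\<^sup>2 * indicator A x" for x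
    by (auto simp: indicator_def)
  show L: "(\<lambda>x. indicator A x *\<^sub>R c) \<in> L2"
    unfolding L2_def mem_Collect_eq e using assms by auto
  show "(norm (abs_l2 (\<lambda>x. indicator A x *\<^sub>R c)))\<^sup>2 = (cmod c)\<^sup>2 * measure lborel A"
    unfolding norm_abs_l2_sq[OF L] e using assms by simp
qed

text \<open>At a point of \<open>U\<close> the shifted indicator is eventually 1, and the points
  outside \<open>U\<close> do not contribute to the inner product with the unshifted one. This inner
  product therefore tends to the squared norm, and equality of norms turns that into convergence in
  norm.\<close>

lemma shift_continuous_open:
  assumes U: "open U" "emeasure lborel U < \<infinity>"
  shows "abs_l2 (\<lambda>x. indicator U x *\<^sub>R c) \<in> shift_continuous"
  unfolding shift_continuous_def mem_Collect_eq
proof (intro allI impI)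
  fix z :: "nat \<Rightarrow> real^2" assume z: "z \<longlonglongrightarrow> 0"
  let ?f = "\<lambda>x. indicator U x *\<^sub>R c"
  define a where "a = abs_l2 ?f"
  have Ub [measurable]: "U \<in> sets borel" using U by simp
  have L: "?f \<in> L2" by (rule indicator_L2[OF Ub U(2)])
  have in_eq: "shift (z n) a \<bullet> a = (cmod c)\<^sup>2 * (LINT x|lborel. indicator U (x - z n) * indicator U x)" for n
    unfolding a_def shift_abs[OF L] inner_abs_l2[OF L2_translate[OF L] L]
    by (subst integral_mult_right_zero[symmetric]) (rule Bochner_Integration.integral_cong, auto simp: indicator_def power2_norm_eq_inner)
  have "(\<lambda>n. LINT x|lborel. indicator U (x - z n) * indicator U x) \<longlonglongrightarrow> (LINT x|lborel. indicator U x :: real)"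
  proof (rule integral_dominated_convergence)
    show "integrable lborel (indicator U :: real^2 \<Rightarrow> real)" using U by simp
    show "AE x in lborel. (\<lambda>n. indicator U (x - z n) * indicator U x) \<longlonglongrightarrow> (indicator U x :: real)"
    proof (rule AE_I2)
      fix x
      show "(\<lambda>n. indicator U (x - z n) * indicator U x) \<longlonglongrightarrow> (indicator U x :: real)"
      proof (cases "x \<in> U")
        case True
        have "(\<lambda>n. x - z n) \<longlonglongrightarrow> x - 0" by (intro tendsto_intros z)
        then have "\<forall>\<^sub>F n in sequentially. x - z n \<in> U"
          using topological_tendstoD[of _ x _ U] U(1) True by simp
        then have "\<forall>\<^sub>F n in sequentially. indicator U (x - z n) * indicator U x = (indicator U x :: real)"
          by eventually_elim (simp add: True)
        then show ?thesis by (rule tendsto_eventually)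
      qed simp
    qed
    show "AE x in lborel. norm (indicator U (x - z n) * indicator U x :: real) \<le> indicator U x" for n
      by (auto simp: indicator_def)
  qed measurable
  then have "(\<lambda>n. shift (z n) a \<bullet> a) \<longlonglongrightarrow> (cmod c)\<^sup>2 * (LINT x|lborel. indicator U x)"
    unfolding in_eq by (intro tendsto_intros)
  also have "(cmod c)\<^sup>2 * (LINT x|lborel. indicator U x) = (norm a)\<^sup>2"
    unfolding a_def indicator_L2(2)[OF Ub U(2)] by simp
  finally have l: "(\<lambda>n. shift (z n) a \<bullet> a) \<longlonglongrightarrow> (norm a)\<^sup>2" .
  have "(\<lambda>n. 2 * (norm a)\<^sup>2 - 2 * (shift (z n) a \<bullet> a)) \<longlonglongrightarrow> 2 * (norm a)\<^sup>2 - 2 * (norm a)\<^sup>2"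
    by (intro tendsto_intros l)
  moreover have "(norm (shift (z n) a - a))\<^sup>2 = 2 * (norm a)\<^sup>2 - 2 * (shift (z n) a \<bullet> a)" for n
    using dot_norm_neg[of "shift (z n) a" a] by simp
  ultimately have "(\<lambda>n. (norm (shift (z n) a - a))\<^sup>2) \<longlonglongrightarrow> 0" by simp
  then have "(\<lambda>n. sqrt ((norm (shift (z n) a - a))\<^sup>2)) \<longlonglongrightarrow> sqrt 0" by (rule tendsto_real_sqrt)
  then show "(\<lambda>n. shift (z n) (abs_l2 ?f)) \<longlonglongrightarrow> abs_l2 ?f"
    unfolding a_def[symmetric] by (simp add: tendsto_norm_zero_iff LIM_zero_iff)
qed

lemma shift_continuous_indicator:
  assumes A: "A \<in> sets borel" "emeasure lborel A < \<infinity>"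
  shows "abs_l2 (\<lambda>x. indicator A x *\<^sub>R c) \<in> shift_continuous"
proof (rule shift_continuous_closed)
  fix e :: real assume e: "0 < e"
  \<comment> \<open>Chosen so that \<open>(cmod c)\<^sup>2 * \<eta>\<close> is at most
    \<open>e\<^sup>2\<close>; the summand 1 covers \<open>c = 0\<close>.\<close>
  define \<eta> where "\<eta> = e\<^sup>2 / ((cmod c)\<^sup>2 + 1)"
  have \<eta>: "0 < \<eta>" unfolding \<eta>_def using e by (intro divide_pos_pos add_nonneg_pos) auto
  obtain U where U: "open U" "A \<subseteq> U" "emeasure lborel (U - A) < \<eta>"
    using outer_regular_lborel[OF A(1) \<eta>] by blast
  have Ub: "U \<in> sets borel" "U - A \<in> sets borel" using U A by auto
  have fin: "emeasure lborel (U - A) < \<infinity>" using U(3) by (auto intro: less_trans)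
  have "emeasure lborel U \<le> emeasure lborel A + emeasure lborel (U - A)"
    using emeasure_subadditive[of A lborel "U - A"] U(2) A Ub by (simp add: Un_absorb1 Un_Diff_cancel)
  also have "\<dots> < \<infinity>" using A fin by simp
  finally have finU: "emeasure lborel U < \<infinity>" .
  have "abs_l2 (\<lambda>x. indicator U x *\<^sub>R c) - abs_l2 (\<lambda>x. indicator A x *\<^sub>R c)
      = abs_l2 (\<lambda>x. indicator (U - A) x *\<^sub>R c)"
    using U(2) unfolding abs_l2_diff[OF indicator_L2(1)[OF Ub(1) finU] indicator_L2(1)[OF A], symmetric]
    by (intro arg_cong[where f = abs_l2] ext) (auto simp: indicator_def)
  then have "(norm (abs_l2 (\<lambda>x. indicator A x *\<^sub>R c) - abs_l2 (\<lambda>x. indicator U x *\<^sub>R c)))\<^sup>2 = (cmod c)\<^sup>2 * measure lborel (U - A)"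
    unfolding norm_minus_commute[of "abs_l2 (\<lambda>x. indicator A x *\<^sub>R c)"] by (simp add: indicator_L2(2)[OF Ub(2) fin])
  also have "\<dots> \<le> ((cmod c)\<^sup>2 + 1) * \<eta>"
  proof (rule mult_mono)
    show "measure lborel (U - A) \<le> \<eta>"
      unfolding measure_def by (rule enn2real_leI) (use U(3) \<eta> in auto)
  qed auto
  also have "\<dots> = e\<^sup>2"
  proof -
    have "(cmod c)\<^sup>2 + 1 \<noteq> 0" using zero_le_power2[of "cmod c"] by linarith
    then show ?thesis by (simp add: \<eta>_def)
  qed
  finally have "norm (abs_l2 (\<lambda>x. indicator A x *\<^sub>R c) - abs_l2 (\<lambda>x. indicator U x *\<^sub>R c)) \<le> e"
    by (rule power2_le_imp_le) (use e in simp)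
  then show "\<exists>b\<in>shift_continuous. norm (abs_l2 (\<lambda>x. indicator A x *\<^sub>R c) - b) \<le> e"
    using shift_continuous_open[OF U(1) finU, of c] by blast
qed

lemma all_shift_continuous: "a \<in> shift_continuous"
proof -
  define f where "f = rep_l2 a"
  have f: "f \<in> L2" "f \<in> borel_measurable lborel" by (auto simp: f_def)
  obtain F where F: "\<And>i. simple_function lborel (F i)" "\<And>x. (\<lambda>i. F i x) \<longlonglongrightarrow> f x" "\<And>i x. dist (F i x) 0 \<le> 2 * dist (f x) 0"
    using borel_measurable_implies_sequence_metric[OF f(2), of 0] by auto
  have Fm: "F i \<in> borel_measurable borel" for i using borel_measurable_simple_function[OF F(1)] by simp
  have FL: "F i \<in> L2" for i
    by (rule L2_bound[OF f(1) Fm, where C = 2]) (use F(3) in auto)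
  have lim: "(\<lambda>i. abs_l2 (F i)) \<longlonglongrightarrow> a"
  proof -
    have "(\<lambda>i. abs_l2 (F i)) \<longlonglongrightarrow> abs_l2 f"
    proof (rule L2_dominated_convergence[OF FL f(1)])
      \<comment> \<open>The approximants are bounded by twice the norm of \<open>f x\<close>, so
        their distance to \<open>f x\<close> is at most three times that norm.\<close>
      show "(\<lambda>x. 3 *\<^sub>R f x) \<in> L2" by (rule L2_scaleR[OF f(1)])
      show "AE x in lborel. (\<lambda>n. F n x) \<longlonglongrightarrow> f x" using F(2) by simp
      show "AE x in lborel. cmod (F n x - f x) \<le> norm (3 *\<^sub>R f x)" for n
      proof (rule AE_I2)
        fix x
        show "cmod (F n x - f x) \<le> norm (3 *\<^sub>R f x)"
          using norm_triangle_ineq4[of "F n x" "f x"] F(3)[of n x] by simp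
      qed
    qed
    then show ?thesis by (simp add: f_def)
  qed
  have good: "abs_l2 (F i) \<in> shift_continuous" for i
  proof -
    \<comment> \<open>The value 0 is left out because its level set may have infinite measure; for
      the others square-integrability gives finite measure.\<close>
    define S where "S = range (F i) - {0}"
    have fin: "finite S" using simple_functionD(1)[OF F(1)[of i]] by (simp add: S_def)
    define A where "A y = F i -` {y}" for y
    have A: "A y \<in> sets borel" for y
      using simple_functionD(2)[OF F(1)[of i], of "{y}"] by (simp add: A_def)
    have Afin: "emeasure lborel (A y) < \<infinity>" if "y \<in> S" for y
    proof -
      have y: "0 < (cmod y)\<^sup>2" using that by (simp add: S_def)
      have "ennreal ((cmod y)\<^sup>2) * emeasure lborel (A y) = (\<integral>\<^sup>+x. ennreal ((cmod y)\<^sup>2) * indicator (A y) x \<partial>lborel)"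
        using A by (subst nn_integral_cmult_indicator) auto
      also have "\<dots> \<le> (\<integral>\<^sup>+x. ennreal ((cmod (F i x))\<^sup>2) \<partial>lborel)"
        by (intro nn_integral_mono) (auto simp: A_def indicator_def)
      also have "\<dots> < \<infinity>" using FL[of i] by (simp add: L2_iff_nn_integral)
      finally show ?thesis
        using y by (auto simp: ennreal_mult_less_top)
    qed
    have dec: "F i = (\<lambda>x. \<Sum>y\<in>S. indicator (A y) x *\<^sub>R y)"
    proof
      fix x
      show "F i x = (\<Sum>y\<in>S. indicator (A y) x *\<^sub>R y)"
      proof (cases "F i x = 0")
        case True
        then have "(\<Sum>y\<in>S. indicator (A y) x *\<^sub>R y) = (\<Sum>y\<in>S. 0)"
          by (intro sum.cong) (auto simp: A_def S_def indicator_def)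
        then show ?thesis using True by simp
      next
        case False
        then have "F i x \<in> S" by (auto simp: S_def)
        then have "(\<Sum>y\<in>S. indicator (A y) x *\<^sub>R y) = (\<Sum>y\<in>{F i x}. indicator (A y) x *\<^sub>R y)"
          using fin by (intro sum.mono_neutral_right) (auto simp: A_def indicator_def)
        then show ?thesis by (simp add: A_def)
      qed
    qed
    have "abs_l2 (F i) = (\<Sum>y\<in>S. abs_l2 (\<lambda>x. indicator (A y) x *\<^sub>R y))"
      by (subst dec) (use abs_l2_sum[OF fin, of "\<lambda>y x. indicator (A y) x *\<^sub>R y"] indicator_L2(1)[OF A Afin] in auto)
    then show ?thesis
      by (simp add: shift_continuous_sum[OF fin] shift_continuous_indicator[OF A Afin])
  qed
  show ?thesis
  proof (rule shift_continuous_closed)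
    fix e :: real assume "0 < e"
    then obtain i where "norm (abs_l2 (F i) - a) < e" using LIMSEQ_D[OF lim, of e] by auto
    then show "\<exists>b\<in>shift_continuous. norm (a - b) \<le> e"
      using good[of i] by (auto simp: norm_minus_commute intro!: bexI[of _ "abs_l2 (F i)"])
  qed
qed

lemma shift_tendsto: "z \<longlonglongrightarrow> 0 \<Longrightarrow> (\<lambda>n. shift (z n) a) \<longlonglongrightarrow> a"
  using all_shift_continuous[of a] by (simp add: shift_continuous_def)

subsection \<open>The Fourier transform of square-integrable functions\<close>

definition ft :: "(real^2 \<Rightarrow> complex) \<Rightarrow> real^2 \<Rightarrow> complex" where
  "ft f \<xi> = (LINT x|lborel. cis (- (x \<bullet> \<xi>)) * f x) / complex_of_real (2 * pi)"

text \<open>On this class the Fourier integral converges absolutely and the L^2 norm is finite;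
  truncation to balls makes it dense.\<close>

definition L12 :: "(real^2 \<Rightarrow> complex) set" where "L12 = {f \<in> L2. integrable lborel f}"

lemma cis_measurable [measurable]: "cis \<in> borel_measurable borel"
  by (intro borel_measurable_continuous_onI) (auto simp: cis_conv_exp intro!: continuous_intros)

lemma integrable_bounded_mult:
  fixes f g :: "'a::euclidean_space \<Rightarrow> complex"
  assumes f: "integrable lborel f" and [measurable]: "g \<in> borel_measurable borel" and g: "\<And>x. cmod (g x) \<le> C"
  shows "integrable lborel (\<lambda>x. g x * f x)"
proof (rule Bochner_Integration.integrable_bound)
  show "integrable lborel (\<lambda>x. C * norm (f x))" using f by simp
  note [measurable] = borel_measurable_integrable[OF f]
  show "(\<lambda>x. g x * f x) \<in> borel_measurable lborel" by measurable
  have "0 \<le> C" using g[of 0] norm_ge_zero[of "g 0"] by linarith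
  then show "AE x in lborel. norm (g x * f x) \<le> norm (C * norm (f x))"
    using g by (auto simp: norm_mult abs_mult intro!: mult_right_mono)
qed

lemma integrable_cis_mult:
  assumes "integrable lborel (f :: real^2 \<Rightarrow> complex)"
  shows "integrable lborel (\<lambda>x. cis (c * (x \<bullet> \<xi>)) * f x)"
  by (rule integrable_bounded_mult[OF assms, where C = 1]) auto

lemma ft_measurable [measurable]:
  assumes [measurable]: "f \<in> borel_measurable borel"
  shows "ft f \<in> borel_measurable borel"
  unfolding ft_def by measurable

lemma norm_ft_le:
  assumes "integrable lborel f"
  shows "cmod (ft f \<xi>) \<le> (LINT x|lborel. cmod (f x))"
proof -
  have "cmod (LINT x|lborel. cis (- (x \<bullet> \<xi>)) * f x) \<le> (LINT x|lborel. cmod (cis (- (x \<bullet> \<xi>)) * f x))"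
    by (rule integral_norm_bound)
  also have "\<dots> = (LINT x|lborel. cmod (f x))" by (simp add: norm_mult)
  finally have 1: "cmod (LINT x|lborel. cis (- (x \<bullet> \<xi>)) * f x) \<le> (LINT x|lborel. cmod (f x))" .
  have "cmod (ft f \<xi>) = cmod (LINT x|lborel. cis (- (x \<bullet> \<xi>)) * f x) / (2 * pi)"
    by (simp add: ft_def norm_divide)
  also have "\<dots> \<le> cmod (LINT x|lborel. cis (- (x \<bullet> \<xi>)) * f x) / 1"
    using pi_ge_two by (intro divide_left_mono) auto
  finally show ?thesis using 1 by simp
qed

text \<open>The parameter \<open>c\<close> covers both signs of the exponent, so that the same
  exchange of integrals serves the transform and its inverse.\<close>

lemma Fubini_cis:
  fixes f g :: "real^2 \<Rightarrow> complex"
  assumes f: "integrable lborel f" and g: "integrable lborel g"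
  shows "(LINT \<xi>|lborel. g \<xi> * (LINT x|lborel. cis (c * (x \<bullet> \<xi>)) * f x))
      = (LINT x|lborel. f x * (LINT \<xi>|lborel. cis (c * (x \<bullet> \<xi>)) * g \<xi>))"
proof -
  note [measurable] = borel_measurable_integrable[OF f] borel_measurable_integrable[OF g]
  let ?h = "\<lambda>\<xi> x. g \<xi> * (cis (c * (x \<bullet> \<xi>)) * f x)"
  have i: "integrable (lborel \<Otimes>\<^sub>M lborel) (case_prod ?h)"
  proof (rule lborel_pair.Fubini_integrable)
    show "case_prod ?h \<in> borel_measurable (lborel \<Otimes>\<^sub>M lborel)" by measurable
    have "integrable lborel (\<lambda>\<xi>. cmod (g \<xi>) * (LINT x|lborel. cmod (f x)))" using g by simp
    then show "integrable lborel (\<lambda>\<xi>. LINT x|lborel. norm (case (\<xi>, x) of (\<xi>, x) \<Rightarrow> ?h \<xi> x))"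
      by (simp add: norm_mult)
    show "AE \<xi> in lborel. integrable lborel (\<lambda>x. case (\<xi>, x) of (\<xi>, x) \<Rightarrow> ?h \<xi> x)"
      using integrable_cis_mult[OF f] by auto
  qed
  have "(LINT \<xi>|lborel. g \<xi> * (LINT x|lborel. cis (c * (x \<bullet> \<xi>)) * f x)) = (LINT \<xi>|lborel. LINT x|lborel. ?h \<xi> x)"
    by simp
  also have "\<dots> = (LINT x|lborel. LINT \<xi>|lborel. ?h \<xi> x)"
    by (rule lborel_pair.Fubini_integral[OF i, symmetric])
  also have "\<dots> = (LINT x|lborel. LINT \<xi>|lborel. f x * (cis (c * (x \<bullet> \<xi>)) * g \<xi>))"
    by (simp add: mult_ac)
  finally show ?thesis by simp
qed

lemma ft_mult_formula:
  assumes f: "integrable lborel f" and g: "integrable lborel g"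
  shows "(LINT \<xi>|lborel. g \<xi> * ft f \<xi>) = (LINT x|lborel. f x * ft g x)"
  using Fubini_cis[OF f g, of "- 1"] by (simp add: ft_def inner_commute)

lemma gaussian_scaled_fourier:
  fixes t :: "real^2"
  assumes d: "0 < \<delta>"
  shows "(LINT \<xi>|lborel. cis (t \<bullet> \<xi>) * complex_of_real (gaussian (\<delta> *\<^sub>R \<xi>)))
     = complex_of_real (2 * pi / \<delta>\<^sup>2 * gaussian (t /\<^sub>R \<delta>))"
proof -
  let ?h = "\<lambda>\<xi>. cis ((t /\<^sub>R \<delta>) \<bullet> \<xi>) * complex_of_real (gaussian \<xi>)"
  have "?h \<in> borel_measurable borel" by measurable
  from integral_lborel_scale[OF this d]
  have "complex_of_real (2 * pi * gaussian (t /\<^sub>R \<delta>)) = \<delta>\<^sup>2 *\<^sub>R (LINT \<xi>|lborel. ?h (\<delta> *\<^sub>R \<xi>))"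
    unfolding gaussian_fourier(2) .
  also have "(\<lambda>\<xi>. ?h (\<delta> *\<^sub>R \<xi>)) = (\<lambda>\<xi>. cis (t \<bullet> \<xi>) * complex_of_real (gaussian (\<delta> *\<^sub>R \<xi>)))"
    using d by (simp add: mult.assoc[symmetric])
  finally show ?thesis using d by (simp add: scaleR_conv_of_real field_simps)
qed

lemma integrable_gaussian_scaled: "0 < \<delta> \<Longrightarrow> integrable lborel (\<lambda>\<xi>::real^2. gaussian (\<delta> *\<^sub>R \<xi>))"
  using integrable_lborel_scale[of gaussian \<delta>] integrable_gaussian by simp

lemma gaussian_uminus [simp]: "gaussian (- x) = gaussian x"
  by (simp add: gaussian_def)

lemma inner_shift:
  assumes f: "f \<in> L2"
  shows "abs_l2 f \<bullet> shift z (abs_l2 f) = (LINT x|lborel. f x \<bullet> f (x - z))"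
  unfolding shift_abs[OF f] by (rule inner_abs_l2[OF f L2_translate[OF f]])

text \<open>A Gaussian mean of the energy density in frequency is a Gaussian mean of the autocorrelation of \<open>f\<close>.\<close>

lemma gaussian_mean_ft:
  assumes f: "f \<in> L12" and d: "0 < \<delta>"
  shows "(LINT \<xi>|lborel. gaussian (\<delta> *\<^sub>R \<xi>) * (cmod (ft f \<xi>))\<^sup>2)
     = (LINT w|lborel. gaussian w * (abs_l2 f \<bullet> shift (\<delta> *\<^sub>R w) (abs_l2 f))) / (2 * pi)"
proof -
  have fL: "f \<in> L2" and fi: "integrable lborel f" using f by (auto simp: L12_def)
  note [measurable] = L2_measurable[OF fL]
  \<comment> \<open>With this \<open>g\<close> the Gaussian mean is the integral of \<open>g\<close>
    times \<open>ft f\<close>. The multiplication formula moves the transform onto \<open>g\<close>,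
    whose transform is a Gaussian average of the conjugates of translates of
    \<open>f\<close>.\<close>
  define g where "g \<xi> = cnj (ft f \<xi>) * complex_of_real (gaussian (\<delta> *\<^sub>R \<xi>))" for \<xi>
  have gi: "integrable lborel g"
    unfolding g_def
    by (rule integrable_bounded_mult[where C = "LINT x|lborel. cmod (f x)"])
       (auto intro: integrable_of_real integrable_gaussian_scaled[OF d] norm_ft_le[OF fi])
  have ftg: "ft g x = (LINT w|lborel. complex_of_real (gaussian w) * cnj (f (x - \<delta> *\<^sub>R w))) / complex_of_real (2 * pi)" for x
  proof -
    let ?h = "\<lambda>\<xi>. cis (- (x \<bullet> \<xi>)) * complex_of_real (gaussian (\<delta> *\<^sub>R \<xi>))"
    have hi: "integrable lborel ?h"
      by (rule integrable_bounded_mult[where C = 1]) (auto intro: integrable_of_real integrable_gaussian_scaled[OF d])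
    have cf: "integrable lborel (\<lambda>y. cnj (f y))" using fi by simp
    have cnjft: "cnj (ft f \<xi>) = (LINT y|lborel. cis (1 * (y \<bullet> \<xi>)) * cnj (f y)) / complex_of_real (2 * pi)" for \<xi>
      unfolding ft_def by (simp add: cis_cnj flip: Bochner_Integration.integral_cnj)
    have "(LINT \<xi>|lborel. cis (- (x \<bullet> \<xi>)) * g \<xi>)
       = (LINT \<xi>|lborel. ?h \<xi> * (LINT y|lborel. cis (1 * (y \<bullet> \<xi>)) * cnj (f y))) / complex_of_real (2 * pi)"
      unfolding g_def cnjft by (simp add: mult_ac)
    also have "(LINT \<xi>|lborel. ?h \<xi> * (LINT y|lborel. cis (1 * (y \<bullet> \<xi>)) * cnj (f y)))
       = (LINT y|lborel. cnj (f y) * (LINT \<xi>|lborel. cis (1 * (y \<bullet> \<xi>)) * ?h \<xi>))"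
      by (rule Fubini_cis[OF cf hi])
    also have "\<dots> = (LINT y|lborel. cnj (f y) * complex_of_real (2 * pi / \<delta>\<^sup>2 * gaussian ((y - x) /\<^sub>R \<delta>)))"
    proof (rule Bochner_Integration.integral_cong[OF refl])
      fix y
      have "(LINT \<xi>|lborel. cis (1 * (y \<bullet> \<xi>)) * ?h \<xi>) = (LINT \<xi>|lborel. cis ((y - x) \<bullet> \<xi>) * complex_of_real (gaussian (\<delta> *\<^sub>R \<xi>)))"
        by (simp add: mult.assoc[symmetric] cis_mult inner_diff_left)
      then show "cnj (f y) * (LINT \<xi>|lborel. cis (1 * (y \<bullet> \<xi>)) * ?h \<xi>) = cnj (f y) * complex_of_real (2 * pi / \<delta>\<^sup>2 * gaussian ((y - x) /\<^sub>R \<delta>))"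
        unfolding gaussian_scaled_fourier[OF d] by simp
    qed
    also have "\<dots> = (LINT y|lborel. cnj (f (x - y)) * complex_of_real (2 * pi / \<delta>\<^sup>2 * gaussian ((x - y - x) /\<^sub>R \<delta>)))"
      by (rule integral_lborel_reflect[symmetric]) measurable
    \<comment> \<open>The Jacobian of the rescaling cancels the normalization
      \<open>1 / \<delta>\<^sup>2\<close>, and the Gaussian no longer depends on
      \<open>\<delta>\<close>: only the translation lengths shrink with it.\<close>
    also have "\<dots> = \<delta>\<^sup>2 *\<^sub>R (LINT w|lborel. cnj (f (x - \<delta> *\<^sub>R w)) * complex_of_real (2 * pi / \<delta>\<^sup>2 * gaussian ((x - \<delta> *\<^sub>R w - x) /\<^sub>R \<delta>)))"
      by (rule integral_lborel_scale[OF _ d]) measurable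
    also have "\<dots> = (LINT w|lborel. \<delta>\<^sup>2 *\<^sub>R (cnj (f (x - \<delta> *\<^sub>R w)) * complex_of_real (2 * pi / \<delta>\<^sup>2 * gaussian ((x - \<delta> *\<^sub>R w - x) /\<^sub>R \<delta>))))"
      by (rule integral_scaleR_right[symmetric])
    also have "\<dots> = (LINT w|lborel. complex_of_real (2 * pi) * (complex_of_real (gaussian w) * cnj (f (x - \<delta> *\<^sub>R w))))"
    proof (rule Bochner_Integration.integral_cong[OF refl])
      fix w
      have e: "(x - \<delta> *\<^sub>R w - x) /\<^sub>R \<delta> = - w" using d by simp
      show "\<delta>\<^sup>2 *\<^sub>R (cnj (f (x - \<delta> *\<^sub>R w)) * complex_of_real (2 * pi / \<delta>\<^sup>2 * gaussian ((x - \<delta> *\<^sub>R w - x) /\<^sub>R \<delta>)))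
         = complex_of_real (2 * pi) * (complex_of_real (gaussian w) * cnj (f (x - \<delta> *\<^sub>R w)))"
        unfolding e gaussian_uminus using d by (simp add: scaleR_conv_of_real)
    qed
    also have "\<dots> = complex_of_real (2 * pi) * (LINT w|lborel. complex_of_real (gaussian w) * cnj (f (x - \<delta> *\<^sub>R w)))"
      by (rule integral_mult_right_zero)
    finally show ?thesis unfolding ft_def[of g] by (simp add: inner_commute)
  qed
  let ?k = "\<lambda>w x. complex_of_real (gaussian w) * (f x * cnj (f (x - \<delta> *\<^sub>R w)))"
  have kx: "integrable lborel (\<lambda>x. f x * cnj (f (x - z)))" for z
    using L2_mult_integrable[OF fL L2_translate[OF fL, of z]]
    by (rule Bochner_Integration.integrable_bound) (auto simp: norm_mult)
  have ki: "integrable (lborel \<Otimes>\<^sub>M lborel) (case_prod ?k)"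
  proof (rule lborel_pair.Fubini_integrable)
    show "case_prod ?k \<in> borel_measurable (lborel \<Otimes>\<^sub>M lborel)" by measurable
    show "AE w in lborel. integrable lborel (\<lambda>x. case (w, x) of (w, x) \<Rightarrow> ?k w x)"
      using kx by simp
    have "integrable lborel (\<lambda>w::real^2. gaussian w * (2 * (norm (abs_l2 f))\<^sup>2))"
      using integrable_gaussian by simp
    then show "integrable lborel (\<lambda>w. LINT x|lborel. norm (case (w, x) of (w, x) \<Rightarrow> ?k w x))"
    proof (rule Bochner_Integration.integrable_bound)
      show "AE w in lborel. norm (LINT x|lborel. norm (case (w, x) of (w, x) \<Rightarrow> ?k w x)) \<le> norm (gaussian w * (2 * (norm (abs_l2 f))\<^sup>2))"
      proof (rule AE_I2)
        fix w :: "real^2"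
        have I: "integrable lborel (\<lambda>x. (cmod (f x))\<^sup>2)" "integrable lborel (\<lambda>x. (cmod (f (x - \<delta> *\<^sub>R w)))\<^sup>2)"
          using fL L2_translate[OF fL, of "\<delta> *\<^sub>R w"] by (auto simp: L2_def)
        have "(LINT x|lborel. cmod (f x) * cmod (f (x - \<delta> *\<^sub>R w))) \<le> (LINT x|lborel. (cmod (f x))\<^sup>2 + (cmod (f (x - \<delta> *\<^sub>R w)))\<^sup>2)"
        proof (rule integral_mono)
          show "integrable lborel (\<lambda>x. cmod (f x) * cmod (f (x - \<delta> *\<^sub>R w)))"
            by (rule L2_mult_integrable[OF fL L2_translate[OF fL]])
          show "integrable lborel (\<lambda>x. (cmod (f x))\<^sup>2 + (cmod (f (x - \<delta> *\<^sub>R w)))\<^sup>2)" using I by simp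
          fix x
          have "2 * cmod (f x) * cmod (f (x - \<delta> *\<^sub>R w)) \<le> (cmod (f x))\<^sup>2 + (cmod (f (x - \<delta> *\<^sub>R w)))\<^sup>2"
            by (rule sum_squares_bound)
          moreover have "0 \<le> cmod (f x) * cmod (f (x - \<delta> *\<^sub>R w))" by simp
          ultimately show "cmod (f x) * cmod (f (x - \<delta> *\<^sub>R w)) \<le> (cmod (f x))\<^sup>2 + (cmod (f (x - \<delta> *\<^sub>R w)))\<^sup>2" by linarith
        qed
        also have "\<dots> = (norm (abs_l2 f))\<^sup>2 + (norm (shift (\<delta> *\<^sub>R w) (abs_l2 f)))\<^sup>2"
          unfolding shift_abs[OF fL] norm_abs_l2_sq[OF fL] norm_abs_l2_sq[OF L2_translate[OF fL]]
          by (rule Bochner_Integration.integral_add[OF I])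
        finally have "(LINT x|lborel. cmod (f x) * cmod (f (x - \<delta> *\<^sub>R w))) \<le> 2 * (norm (abs_l2 f))\<^sup>2" by simp
        then have "gaussian w * (LINT x|lborel. cmod (f x) * cmod (f (x - \<delta> *\<^sub>R w))) \<le> gaussian w * (2 * (norm (abs_l2 f))\<^sup>2)"
          by (rule mult_left_mono) simp
        then show "norm (LINT x|lborel. norm (case (w, x) of (w, x) \<Rightarrow> ?k w x)) \<le> norm (gaussian w * (2 * (norm (abs_l2 f))\<^sup>2))"
          by (simp add: norm_mult)
      qed
    qed measurable
  qed
  have "complex_of_real (LINT \<xi>|lborel. gaussian (\<delta> *\<^sub>R \<xi>) * (cmod (ft f \<xi>))\<^sup>2) = (LINT \<xi>|lborel. g \<xi> * ft f \<xi>)"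
  proof -
    have "g \<xi> * ft f \<xi> = complex_of_real (gaussian (\<delta> *\<^sub>R \<xi>) * (cmod (ft f \<xi>))\<^sup>2)" for \<xi>
      using complex_norm_square[of "ft f \<xi>"] by (simp add: g_def mult_ac)
    then show ?thesis by (simp only: integral_complex_of_real)
  qed
  also have "\<dots> = (LINT x|lborel. f x * ft g x)" by (rule ft_mult_formula[OF fi gi])
  also have "\<dots> = (LINT x|lborel. LINT w|lborel. ?k w x) / complex_of_real (2 * pi)"
  proof -
    have "f x * ft g x = (LINT w|lborel. ?k w x) / complex_of_real (2 * pi)" for x
      unfolding ftg times_divide_eq_right integral_mult_right_zero[symmetric] by (simp only: mult.left_commute)
    then show ?thesis by (simp only: integral_divide_zero)
  qed
  also have "(LINT x|lborel. LINT w|lborel. ?k w x) = (LINT w|lborel. LINT x|lborel. ?k w x)"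
    by (rule lborel_pair.Fubini_integral[OF ki])
  finally have main: "(LINT \<xi>|lborel. gaussian (\<delta> *\<^sub>R \<xi>) * (cmod (ft f \<xi>))\<^sup>2) = Re ((LINT w|lborel. LINT x|lborel. ?k w x) / complex_of_real (2 * pi))"
    by (metis Re_complex_of_real)
  have "integrable lborel (\<lambda>w. LINT x|lborel. ?k w x)"
    by (rule lborel_pair.integrable_fst[OF ki])
  then have "Re (LINT w|lborel. LINT x|lborel. ?k w x) = (LINT w|lborel. Re (LINT x|lborel. ?k w x))"
    by (rule integral_Re[symmetric])
  also have "\<dots> = (LINT w|lborel. gaussian w * (abs_l2 f \<bullet> shift (\<delta> *\<^sub>R w) (abs_l2 f)))"
  proof (rule Bochner_Integration.integral_cong[OF refl])
    fix w
    have "Re (LINT x|lborel. ?k w x) = gaussian w * Re (LINT x|lborel. f x * cnj (f (x - \<delta> *\<^sub>R w)))"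
      by simp
    also have "Re (LINT x|lborel. f x * cnj (f (x - \<delta> *\<^sub>R w))) = (LINT x|lborel. Re (f x * cnj (f (x - \<delta> *\<^sub>R w))))"
      by (rule integral_Re[OF kx, symmetric])
    also have "\<dots> = abs_l2 f \<bullet> shift (\<delta> *\<^sub>R w) (abs_l2 f)"
      unfolding inner_shift[OF fL] by (simp add: inner_complex_def)
    finally show "Re (LINT x|lborel. ?k w x) = gaussian w * (abs_l2 f \<bullet> shift (\<delta> *\<^sub>R w) (abs_l2 f))" .
  qed
  finally show ?thesis unfolding main by simp
qed

text \<open>As \<open>\<delta>\<close> tends to 0, the autocorrelation side of
  \<open>gaussian_mean_ft\<close> converges by continuity of translations and dominated convergence.
  The frequency side is treated by monotone convergence of nonnegative integrals, because finiteness
  of the limit is part of the claim.\<close>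

theorem plancherel_L12:
  assumes f: "f \<in> L12"
  shows "ft f \<in> L2" and "norm (abs_l2 (ft f)) = norm (abs_l2 f)"
proof -
  have fL: "f \<in> L2" and fi: "integrable lborel f" using f by (auto simp: L12_def)
  note [measurable] = L2_measurable[OF fL]
  define a where "a = abs_l2 f"
  define \<delta> where "\<delta> n = inverse (real (Suc n))" for n
  have \<delta>: "0 < \<delta> n" for n by (simp add: \<delta>_def)
  have \<delta>0: "\<delta> \<longlonglongrightarrow> 0" unfolding \<delta>_def by (rule LIMSEQ_inverse_real_of_nat)
  define I where "I n = (LINT \<xi>|lborel. gaussian (\<delta> n *\<^sub>R \<xi>) * (cmod (ft f \<xi>))\<^sup>2)" for n
  have "(\<lambda>n. LINT w|lborel. gaussian w * (a \<bullet> shift (\<delta> n *\<^sub>R w) a)) \<longlonglongrightarrow> (LINT w|lborel. gaussian (w::real^2) * (a \<bullet> a))"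
  proof (rule integral_dominated_convergence)
    show "integrable lborel (\<lambda>w::real^2. gaussian w * (norm a * norm a))" using integrable_gaussian by simp
    show "AE w in lborel. (\<lambda>n. gaussian w * (a \<bullet> shift (\<delta> n *\<^sub>R w) a)) \<longlonglongrightarrow> gaussian w * (a \<bullet> a)"
    proof (rule AE_I2)
      fix w :: "real^2"
      have "(\<lambda>n. \<delta> n *\<^sub>R w) \<longlonglongrightarrow> 0 *\<^sub>R w" by (intro tendsto_intros \<delta>0)
      then show "(\<lambda>n. gaussian w * (a \<bullet> shift (\<delta> n *\<^sub>R w) a)) \<longlonglongrightarrow> gaussian w * (a \<bullet> a)"
        by (intro tendsto_intros shift_tendsto) simp
    qed
    show "AE w in lborel. norm (gaussian w * (a \<bullet> shift (\<delta> n *\<^sub>R w) a)) \<le> gaussian w * (norm a * norm a)" for n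
    proof (rule AE_I2)
      fix w :: "real^2"
      have "\<bar>a \<bullet> shift (\<delta> n *\<^sub>R w) a\<bar> \<le> norm a * norm a"
        using Cauchy_Schwarz_ineq2[of a "shift (\<delta> n *\<^sub>R w) a"] by simp
      then show "norm (gaussian w * (a \<bullet> shift (\<delta> n *\<^sub>R w) a)) \<le> gaussian w * (norm a * norm a)"
        by (simp add: abs_mult mult_left_mono)
    qed
    show "(\<lambda>w. gaussian w * (a \<bullet> shift (\<delta> n *\<^sub>R w) a)) \<in> borel_measurable lborel" for n
      unfolding a_def inner_shift[OF fL] by measurable
  qed simp
  then have "(\<lambda>n. (LINT w|lborel. gaussian w * (a \<bullet> shift (\<delta> n *\<^sub>R w) a)) / (2 * pi)) \<longlonglongrightarrow> (LINT w|lborel. gaussian (w::real^2) * (a \<bullet> a)) / (2 * pi)"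
    by (intro tendsto_intros) simp_all
  then have lim1: "I \<longlonglongrightarrow> (norm a)\<^sup>2"
    unfolding I_def gaussian_mean_ft[OF f \<delta>] a_def[symmetric] by (simp add: integral_gaussian power2_norm_eq_inner)
  define u where "u n \<xi> = ennreal (gaussian (\<delta> n *\<^sub>R \<xi>) * (cmod (ft f \<xi>))\<^sup>2)" for n \<xi>
  have lim2: "(\<lambda>n. \<integral>\<^sup>+\<xi>. u n \<xi> \<partial>lborel) \<longlonglongrightarrow> (\<integral>\<^sup>+\<xi>. ennreal ((cmod (ft f \<xi>))\<^sup>2) \<partial>lborel)"
  proof (rule nn_integral_LIMSEQ)
    show "incseq u"
    proof (intro incseq_SucI le_funI)
      fix n and \<xi> :: "real^2"
      have "\<delta> (Suc n) \<le> \<delta> n" by (simp add: \<delta>_def)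
      then have "norm (\<delta> (Suc n) *\<^sub>R \<xi>) \<le> norm (\<delta> n *\<^sub>R \<xi>)"
        using \<delta>[of n] \<delta>[of "Suc n"] by (auto intro!: mult_right_mono)
      then have "gaussian (\<delta> n *\<^sub>R \<xi>) \<le> gaussian (\<delta> (Suc n) *\<^sub>R \<xi>)"
        unfolding gaussian_def exp_le_cancel_iff by (intro divide_right_mono) (auto intro: power_mono)
      then show "u n \<xi> \<le> u (Suc n) \<xi>"
        unfolding u_def by (intro ennreal_leI mult_right_mono) auto
    qed
    show "u n \<in> borel_measurable lborel" for n unfolding u_def by measurable
    fix \<xi> :: "real^2"
    have "(\<lambda>n. gaussian (\<delta> n *\<^sub>R \<xi>) * (cmod (ft f \<xi>))\<^sup>2) \<longlonglongrightarrow> exp (- (norm (0 *\<^sub>R \<xi>))\<^sup>2 / 2) * (cmod (ft f \<xi>))\<^sup>2"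
      unfolding gaussian_def by (intro tendsto_intros \<delta>0) simp
    then show "(\<lambda>n. u n \<xi>) \<longlonglongrightarrow> ennreal ((cmod (ft f \<xi>))\<^sup>2)"
      unfolding u_def by (intro tendsto_ennrealI) simp
  qed
  have int_u: "(\<integral>\<^sup>+\<xi>. u n \<xi> \<partial>lborel) = ennreal (I n)" for n
    unfolding u_def I_def
  proof (rule nn_integral_eq_integral)
    define C where "C = (LINT x|lborel. cmod (f x))"
    show "integrable lborel (\<lambda>\<xi>. gaussian (\<delta> n *\<^sub>R \<xi>) * (cmod (ft f \<xi>))\<^sup>2)"
    proof (rule Bochner_Integration.integrable_bound)
      show "integrable lborel (\<lambda>\<xi>::real^2. gaussian (\<delta> n *\<^sub>R \<xi>) * C\<^sup>2)" using integrable_gaussian_scaled[OF \<delta>] by simp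
      show "AE \<xi> in lborel. norm (gaussian (\<delta> n *\<^sub>R \<xi>) * (cmod (ft f \<xi>))\<^sup>2) \<le> norm (gaussian (\<delta> n *\<^sub>R \<xi>) * C\<^sup>2)"
        using norm_ft_le[OF fi] by (auto simp: C_def abs_mult intro!: mult_left_mono power_mono)
    qed measurable
  qed simp
  have eq: "(\<integral>\<^sup>+\<xi>. ennreal ((cmod (ft f \<xi>))\<^sup>2) \<partial>lborel) = ennreal ((norm a)\<^sup>2)"
    by (rule LIMSEQ_unique[OF lim2[unfolded int_u] tendsto_ennrealI[OF lim1]])
  then show L: "ft f \<in> L2" by (simp add: L2_iff_nn_integral)
  from eq have "(norm (abs_l2 (ft f)))\<^sup>2 = (norm a)\<^sup>2"
    by (simp add: nn_integral_L2_abs[OF L])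
  then show "norm (abs_l2 (ft f)) = norm (abs_l2 f)" by (simp add: a_def)
qed

section \<open>Extension of the Fourier transform to square-integrable functions\<close>

lemma L12_L2: "f \<in> L12 \<Longrightarrow> f \<in> L2" and L12_integrable: "f \<in> L12 \<Longrightarrow> integrable lborel f"
  by (auto simp: L12_def)

definition cut :: "real \<Rightarrow> (real^2 \<Rightarrow> complex) \<Rightarrow> real^2 \<Rightarrow> complex" where
  "cut R f x = indicator (cball 0 R) x *\<^sub>R f x"

lemma indicator_cball_L2: "(indicator (cball 0 R) :: real^2 \<Rightarrow> real) \<in> L2"
proof -
  have "emeasure lborel (cball (0::real^2) R) < \<infinity>" by (rule emeasure_lborel_cball_finite)
  moreover have "(norm (indicator (cball 0 R) x :: real))\<^sup>2 = indicator (cball 0 R) x" for x :: "real^2"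
    by (simp add: indicator_def)
  moreover have "(indicator (cball 0 R) :: real^2 \<Rightarrow> real) \<in> borel_measurable borel"
    by (intro borel_measurable_indicator borel_closed closed_cball)
  ultimately show ?thesis by (simp add: L2_def)
qed

lemma cut_L12:
  assumes "f \<in> L2"
  shows "cut R f \<in> L12"
proof -
  have m: "cut R f \<in> borel_measurable borel"
    unfolding cut_def using L2_measurable[OF assms] by (intro borel_measurable_scaleR borel_measurable_indicator) auto
  have "cut R f \<in> L2"
    by (rule L2_bound[OF assms m, where C = 1]) (auto simp: cut_def indicator_def)
  moreover have "integrable lborel (cut R f)"
    by (rule Bochner_Integration.integrable_bound[OF L2_mult_integrable[OF indicator_cball_L2[of R] assms]])
       (use m in \<open>auto simp: cut_def\<close>)
  ultimately show ?thesis by (simp add: L12_def)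
qed

lemma cut_pointwise_tendsto:
  assumes "filterlim X at_top sequentially"
  shows "(\<lambda>n. cut (X n) f x) \<longlonglongrightarrow> f x"
proof -
  have "\<forall>\<^sub>F n in sequentially. norm x \<le> X n"
    using assms by (auto simp: filterlim_at_top)
  then have "\<forall>\<^sub>F n in sequentially. cut (X n) f x = f x"
    by eventually_elim (simp add: cut_def)
  then show ?thesis by (rule tendsto_eventually)
qed

lemma cut_tendsto:
  assumes f: "f \<in> L2" and X: "filterlim X at_top sequentially"
  shows "(\<lambda>n. abs_l2 (cut (X n) f)) \<longlonglongrightarrow> abs_l2 f"
proof (rule L2_dominated_convergence[OF L12_L2[OF cut_L12[OF f]] f f])
  show "AE x in lborel. (\<lambda>n. cut (X n) f x) \<longlonglongrightarrow> f x" using cut_pointwise_tendsto[OF X] by auto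
  show "AE x in lborel. cmod (cut (X n) f x - f x) \<le> norm (f x)" for n
    by (auto simp: cut_def indicator_def)
qed

lemma L12_diff: "f \<in> L12 \<Longrightarrow> g \<in> L12 \<Longrightarrow> (\<lambda>x. f x - g x) \<in> L12"
  and L12_add: "f \<in> L12 \<Longrightarrow> g \<in> L12 \<Longrightarrow> (\<lambda>x. f x + g x) \<in> L12"
  and L12_scaleR: "f \<in> L12 \<Longrightarrow> (\<lambda>x. r *\<^sub>R f x) \<in> L12"
  by (auto simp: L12_def L2_diff L2_add L2_scaleR)

lemma L12_cnj: "f \<in> L12 \<Longrightarrow> (\<lambda>x. cnj (f x)) \<in> L12"
  by (auto simp: L12_def L2_cnj)

lemma integrable_cis_neg: "integrable lborel (f :: real^2 \<Rightarrow> complex) \<Longrightarrow> integrable lborel (\<lambda>x. cis (- (x \<bullet> \<xi>)) * f x)"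
  using integrable_cis_mult[of f "- 1" \<xi>] by simp

lemma ft_add: "f \<in> L12 \<Longrightarrow> g \<in> L12 \<Longrightarrow> ft (\<lambda>x. f x + g x) = (\<lambda>\<xi>. ft f \<xi> + ft g \<xi>)"
  using integrable_cis_neg[OF L12_integrable] by (intro ext) (simp add: ft_def distrib_left add_divide_distrib)

lemma ft_diff: "f \<in> L12 \<Longrightarrow> g \<in> L12 \<Longrightarrow> ft (\<lambda>x. f x - g x) = (\<lambda>\<xi>. ft f \<xi> - ft g \<xi>)"
  using integrable_cis_neg[OF L12_integrable] by (intro ext) (simp add: ft_def right_diff_distrib diff_divide_distrib)

lemma ft_scaleR: "ft (\<lambda>x. r *\<^sub>R f x) = (\<lambda>\<xi>. r *\<^sub>R ft f \<xi>)"
  by (intro ext) (simp add: ft_def scaleR_conv_of_real mult.left_commute)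

lemma norm_ft_diff:
  assumes "f \<in> L12" "g \<in> L12"
  shows "norm (abs_l2 (ft f) - abs_l2 (ft g)) = norm (abs_l2 f - abs_l2 g)"
  using plancherel_L12(2)[OF L12_diff[OF assms]] assms
  by (simp add: ft_diff abs_l2_diff plancherel_L12(1) L12_L2)

text \<open>The truncations are Cauchy, and so are their transforms by the isometry on
  \<open>L12\<close>; by \<open>Four_tendsto\<close> every other approximation from
  \<open>L12\<close> leads to the same limit. Truncation to balls agrees with the limit used in
  \<open>is_fourier\<close>.\<close>

definition Four :: "l2 \<Rightarrow> l2" where "Four a = lim (\<lambda>n. abs_l2 (ft (cut (real n) (rep_l2 a))))"

lemma Four_limit: "(\<lambda>n. abs_l2 (ft (cut (real n) (rep_l2 a)))) \<longlonglongrightarrow> Four a"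
proof -
  have c: "cut (real n) (rep_l2 a) \<in> L12" for n by (simp add: cut_L12)
  have "(\<lambda>n. abs_l2 (cut (real n) (rep_l2 a))) \<longlonglongrightarrow> abs_l2 (rep_l2 a)"
    by (rule cut_tendsto[OF rep_l2_in filterlim_real_sequentially])
  then have "Cauchy (\<lambda>n. abs_l2 (cut (real n) (rep_l2 a)))" by (rule LIMSEQ_imp_Cauchy)
  then have "Cauchy (\<lambda>n. abs_l2 (ft (cut (real n) (rep_l2 a))))"
    unfolding Cauchy_iff norm_ft_diff[OF c c] .
  then have "convergent (\<lambda>n. abs_l2 (ft (cut (real n) (rep_l2 a))))" by (rule Cauchy_convergent)
  then show ?thesis unfolding Four_def by (simp add: convergent_LIMSEQ_iff)
qed

lemma Four_tendsto:
  assumes F: "\<And>n. F n \<in> L12" and lim: "(\<lambda>n. abs_l2 (F n)) \<longlonglongrightarrow> a"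
  shows "(\<lambda>n. abs_l2 (ft (F n))) \<longlonglongrightarrow> Four a"
proof -
  have c: "cut (real n) (rep_l2 a) \<in> L12" for n by (simp add: cut_L12)
  have "(\<lambda>n. abs_l2 (F n) - abs_l2 (cut (real n) (rep_l2 a))) \<longlonglongrightarrow> a - abs_l2 (rep_l2 a)"
    by (intro tendsto_diff lim cut_tendsto[OF rep_l2_in filterlim_real_sequentially])
  then have "(\<lambda>n. norm (abs_l2 (ft (F n)) - abs_l2 (ft (cut (real n) (rep_l2 a))))) \<longlonglongrightarrow> 0"
    unfolding norm_ft_diff[OF F c] by (simp add: tendsto_norm_zero)
  then have "(\<lambda>n. abs_l2 (ft (F n)) - abs_l2 (ft (cut (real n) (rep_l2 a)))) \<longlonglongrightarrow> 0"
    by (rule tendsto_norm_zero_cancel)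
  from tendsto_add[OF this Four_limit[of a]] show ?thesis by simp
qed

lemma Four_abs:
  assumes "f \<in> L12"
  shows "Four (abs_l2 f) = abs_l2 (ft f)"
  using Four_tendsto[of "\<lambda>_. f" "abs_l2 f"] assms by (simp add: LIMSEQ_const_iff)

lemma L12_approximation:
  obtains F where "\<And>n. F n \<in> L12" "(\<lambda>n. abs_l2 (F n)) \<longlonglongrightarrow> a"
proof
  show "cut (real n) (rep_l2 a) \<in> L12" for n by (simp add: cut_L12)
  show "(\<lambda>n. abs_l2 (cut (real n) (rep_l2 a))) \<longlonglongrightarrow> a"
    using cut_tendsto[OF rep_l2_in filterlim_real_sequentially, of a] by simp
qed

lemma Four_add: "Four (a + b) = Four a + Four b"
proof -
  obtain F where F: "\<And>n. F n \<in> L12" "(\<lambda>n. abs_l2 (F n)) \<longlonglongrightarrow> a" using L12_approximation[of a] by blast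
  obtain G where G: "\<And>n. G n \<in> L12" "(\<lambda>n. abs_l2 (G n)) \<longlonglongrightarrow> b" using L12_approximation[of b] by blast
  have "(\<lambda>n. abs_l2 (\<lambda>x. F n x + G n x)) \<longlonglongrightarrow> a + b"
    using tendsto_add[OF F(2) G(2)] by (simp add: abs_l2_add L12_L2 F G)
  from Four_tendsto[OF L12_add[OF F(1) G(1)] this]
  have "(\<lambda>n. abs_l2 (ft (F n)) + abs_l2 (ft (G n))) \<longlonglongrightarrow> Four (a + b)"
    by (simp add: ft_add F G abs_l2_add plancherel_L12)
  moreover have "(\<lambda>n. abs_l2 (ft (F n)) + abs_l2 (ft (G n))) \<longlonglongrightarrow> Four a + Four b"
    by (intro tendsto_add Four_tendsto F G)
  ultimately show ?thesis by (rule LIMSEQ_unique)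
qed

lemma Four_scaleR: "Four (r *\<^sub>R a) = r *\<^sub>R Four a"
proof -
  obtain F where F: "\<And>n. F n \<in> L12" "(\<lambda>n. abs_l2 (F n)) \<longlonglongrightarrow> a" using L12_approximation[of a] by blast
  have "(\<lambda>n. abs_l2 (\<lambda>x. r *\<^sub>R F n x)) \<longlonglongrightarrow> r *\<^sub>R a"
    using tendsto_scaleR[OF tendsto_const F(2)] by (simp add: abs_l2_scaleR L12_L2 F)
  from Four_tendsto[OF L12_scaleR[OF F(1)] this]
  have "(\<lambda>n. r *\<^sub>R abs_l2 (ft (F n))) \<longlonglongrightarrow> Four (r *\<^sub>R a)"
    by (simp add: ft_scaleR F abs_l2_scaleR plancherel_L12)
  moreover have "(\<lambda>n. r *\<^sub>R abs_l2 (ft (F n))) \<longlonglongrightarrow> r *\<^sub>R Four a"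
    by (intro tendsto_scaleR tendsto_const Four_tendsto F)
  ultimately show ?thesis by (rule LIMSEQ_unique)
qed

lemma norm_Four [simp]: "norm (Four a) = norm a"
proof -
  obtain F where F: "\<And>n. F n \<in> L12" "(\<lambda>n. abs_l2 (F n)) \<longlonglongrightarrow> a" using L12_approximation[of a] by blast
  have "(\<lambda>n. norm (abs_l2 (ft (F n)))) \<longlonglongrightarrow> norm (Four a)"
    by (intro tendsto_norm Four_tendsto F)
  moreover have "(\<lambda>n. norm (abs_l2 (ft (F n)))) \<longlonglongrightarrow> norm a"
    unfolding plancherel_L12(2)[OF F(1)] by (intro tendsto_norm F)
  ultimately show ?thesis by (rule LIMSEQ_unique)
qed

lemma bounded_linear_Four: "bounded_linear Four"
  by (rule bounded_linear_intro[where K = 1]) (auto simp: Four_add Four_scaleR)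

lemma inner_Four: "Four a \<bullet> Four b = a \<bullet> b"
  using norm_Four[of "a + b"] by (simp add: dot_norm Four_add)

section \<open>Conjugation and Fourier inversion\<close>

definition cj :: "l2 \<Rightarrow> l2" where "cj a = abs_l2 (\<lambda>x. cnj (rep_l2 a x))"

lemma cj_abs:
  assumes "f \<in> L2"
  shows "cj (abs_l2 f) = abs_l2 (\<lambda>x. cnj (f x))"
  unfolding cj_def using rep_abs_l2[OF assms]
  by (subst abs_l2_eq_iff) (auto intro!: L2_cnj assms elim: eventually_mono)

lemma rep_cj: "AE x in lborel. rep_l2 (cj a) x = cnj (rep_l2 a x)"
  unfolding cj_def by (rule rep_abs_l2) (intro L2_cnj rep_l2_in)

lemma cj_cj [simp]: "cj (cj a) = a"
  by (rule l2_eqI) (use rep_cj[of "cj a"] rep_cj[of a] in \<open>eventually_elim, simp\<close>)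

lemma cj_add: "cj (a + b) = cj a + cj b"
  by (rule l2_eqI) (use rep_cj[of "a + b"] rep_cj[of a] rep_cj[of b] rep_add_l2[of "cj a" "cj b"]
      rep_add_l2[of a b] in \<open>eventually_elim, simp\<close>)

lemma cj_scaleR: "cj (r *\<^sub>R a) = r *\<^sub>R cj a"
  by (rule l2_eqI) (use rep_cj[of "r *\<^sub>R a"] rep_cj[of a] rep_scaleR_l2[of r "cj a"]
      rep_scaleR_l2[of r a] in \<open>eventually_elim, simp\<close>)

lemma inner_cj: "cj a \<bullet> cj b = a \<bullet> b"
  unfolding inner_l2_def
  by (rule integral_cong_AE) (measurable, use rep_cj[of a] rep_cj[of b] in \<open>eventually_elim, simp add: inner_complex_def\<close>)

lemma norm_cj [simp]: "norm (cj a) = norm a"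
  by (simp add: norm_eq_sqrt_inner inner_cj)

lemma bounded_linear_cj: "bounded_linear cj"
  by (rule bounded_linear_intro[where K = 1]) (auto simp: cj_add cj_scaleR)

lemma tendsto_cj: "(f \<longlongrightarrow> a) F \<Longrightarrow> ((\<lambda>x. cj (f x)) \<longlongrightarrow> cj a) F"
  by (rule bounded_linear.tendsto[OF bounded_linear_cj])

lemma Four_cj: "Four (cj a) = reflect (Four a)"
proof -
  obtain F where F: "\<And>n. F n \<in> L12" "(\<lambda>n. abs_l2 (F n)) \<longlonglongrightarrow> a" using L12_approximation[of a] by blast
  have e: "ft (\<lambda>x. cnj (f x)) = (\<lambda>\<xi>. cnj (ft f (- \<xi>)))" for f
    unfolding ft_def by (intro ext) (simp add: cis_cnj flip: Bochner_Integration.integral_cnj)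
  have "(\<lambda>n. abs_l2 (\<lambda>x. cnj (F n x))) \<longlonglongrightarrow> cj a"
    using tendsto_cj[OF F(2)] by (simp add: cj_abs L12_L2 F)
  from Four_tendsto[OF L12_cnj[OF F(1)] this]
  have "(\<lambda>n. reflect (abs_l2 (ft (F n)))) \<longlonglongrightarrow> Four (cj a)"
    by (simp add: e reflect_abs[OF plancherel_L12(1)[OF F(1)]])
  moreover have "(\<lambda>n. reflect (abs_l2 (ft (F n)))) \<longlonglongrightarrow> reflect (Four a)"
    by (intro bounded_linear.tendsto[OF bounded_linear_reflect] Four_tendsto F)
  ultimately show ?thesis by (rule LIMSEQ_unique)
qed

text \<open>Pairing with a conjugate is the real part of the bilinear integral of a product, and the
  multiplication formula says that the transform is symmetric for it.\<close>

lemma Four_inner_cj: "Four a \<bullet> cj b = a \<bullet> cj (Four b)"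
proof -
  obtain F where F: "\<And>n. F n \<in> L12" "(\<lambda>n. abs_l2 (F n)) \<longlonglongrightarrow> a" using L12_approximation[of a] by blast
  obtain G where G: "\<And>n. G n \<in> L12" "(\<lambda>n. abs_l2 (G n)) \<longlonglongrightarrow> b" using L12_approximation[of b] by blast
  have e: "abs_l2 (ft (F n)) \<bullet> cj (abs_l2 (G n)) = abs_l2 (F n) \<bullet> cj (abs_l2 (ft (G n)))" for n
  proof -
    note Fn = L12_L2[OF F(1)[of n]] L12_integrable[OF F(1)[of n]] plancherel_L12(1)[OF F(1)[of n]]
    note Gn = L12_L2[OF G(1)[of n]] L12_integrable[OF G(1)[of n]] plancherel_L12(1)[OF G(1)[of n]]
    have r: "(LINT x|lborel. u x \<bullet> cnj (v x)) = Re (LINT x|lborel. v x * u x)" if "u \<in> L2" "v \<in> L2" for u v :: "real^2 \<Rightarrow> complex"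
    proof -
      note [measurable] = L2_measurable[OF that(1)] L2_measurable[OF that(2)]
      have "integrable lborel (\<lambda>x. v x * u x)"
        by (rule Bochner_Integration.integrable_bound[OF L2_mult_integrable[OF that(2,1)]]) (auto simp: norm_mult)
      then have "Re (LINT x|lborel. v x * u x) = (LINT x|lborel. Re (v x * u x))"
        by (rule integral_Re[symmetric])
      then show ?thesis by (simp add: inner_complex_def mult.commute)
    qed
    have "abs_l2 (ft (F n)) \<bullet> cj (abs_l2 (G n)) = Re (LINT x|lborel. G n x * ft (F n) x)"
      unfolding cj_abs[OF Gn(1)] inner_abs_l2[OF Fn(3) L2_cnj[OF Gn(1)]] by (rule r[OF Fn(3) Gn(1)])
    also have "\<dots> = Re (LINT x|lborel. ft (G n) x * F n x)"
      unfolding ft_mult_formula[OF Fn(2) Gn(2)] by (simp add: mult.commute)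
    also have "\<dots> = abs_l2 (F n) \<bullet> cj (abs_l2 (ft (G n)))"
      unfolding cj_abs[OF Gn(3)] inner_abs_l2[OF Fn(1) L2_cnj[OF Gn(3)]] by (rule r[OF Fn(1) Gn(3), symmetric])
    finally show ?thesis .
  qed
  have "(\<lambda>n. abs_l2 (ft (F n)) \<bullet> cj (abs_l2 (G n))) \<longlonglongrightarrow> Four a \<bullet> cj b"
    by (intro tendsto_inner tendsto_cj Four_tendsto F G)
  moreover have "(\<lambda>n. abs_l2 (ft (F n)) \<bullet> cj (abs_l2 (G n))) \<longlonglongrightarrow> a \<bullet> cj (Four b)"
    unfolding e by (intro tendsto_inner tendsto_cj Four_tendsto F G)
  ultimately show ?thesis by (rule LIMSEQ_unique)
qed

text \<open>Conjugating before and after reverses the sign of the exponent. By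
  \<open>Four_inner_cj\<close> this operator is the adjoint of \<open>Four\<close>, and the adjoint
  of an isometry is a left inverse; conjugating once more shows that it is a right inverse as
  well.\<close>

definition InvFour :: "l2 \<Rightarrow> l2" where "InvFour a = cj (Four (cj a))"

lemma InvFour_Four [simp]: "InvFour (Four a) = a"
proof (rule vector_eq_ldot[THEN iffD1], intro allI)
  fix g
  have "g \<bullet> InvFour (Four a) = InvFour (Four a) \<bullet> g" by (rule inner_commute)
  also have "\<dots> = Four (cj (Four a)) \<bullet> cj g"
    using inner_cj[of "Four (cj (Four a))" "cj g"] by (simp add: InvFour_def)
  also have "\<dots> = cj (Four a) \<bullet> cj (Four g)" by (rule Four_inner_cj)
  also have "\<dots> = a \<bullet> g" by (simp add: inner_cj inner_Four)
  finally show "g \<bullet> InvFour (Four a) = g \<bullet> a" by (simp add: inner_commute)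
qed

lemma Four_InvFour [simp]: "Four (InvFour a) = a"
proof -
  have "cj (InvFour (Four (cj a))) = a" by simp
  then show ?thesis by (simp add: InvFour_def)
qed

lemma Four_inject: "Four a = Four b \<longleftrightarrow> a = b"
  by (metis InvFour_Four)

lemma Four_hermitian_iff: "Four a \<in> hermitian \<longleftrightarrow> cj a = a"
  unfolding hermitian_def mem_Collect_eq Four_cj[symmetric] by (rule Four_inject)

text \<open>The convolution theorem for a factor \<open>g\<close> with integrable transform.
  Integrability is expressed by writing the transform as \<open>q\<close> times an element of
  \<open>l2\<close> with \<open>q\<close> in L^2; this also exposes the kernel to which
  \<open>conv_op\<close> applies.\<close>

lemma Four_product:
  assumes f: "f \<in> L2" and g: "g \<in> L2" and q: "bounded_weight q" "q \<in> L2" "\<And>x. 0 \<le> q x"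
    and gY: "Four (abs_l2 g) = wmul q Y"
  shows "(\<lambda>x. g x * f x) \<in> L2"
    and "Four (abs_l2 (\<lambda>x. g x * f x)) = (1 / (2 * pi)) *\<^sub>R conv_op (\<lambda>\<xi> \<eta>. q (\<xi> - \<eta>)) Y (Four (abs_l2 f))"
proof -
  define G where "G \<xi> = q \<xi> *\<^sub>R rep_l2 Y \<xi>" for \<xi>
  \<comment> \<open>The bounded representative of \<open>g\<close>, given by the absolutely
    convergent inverse integral of \<open>G\<close>.\<close>
  define ig where "ig x = cnj (ft (\<lambda>\<xi>. cnj (G \<xi>)) x)" for x
  let ?k = "\<lambda>\<xi> \<eta>. q (\<xi> - \<eta>)"
  note [measurable] = L2_measurable[OF f] L2_measurable[OF g] bounded_weight_measurable[OF q(1)]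
  have kb: "kernel_bound (\<lambda>_. 1) q ?k"
    unfolding kernel_bound_one_iff using q by (auto simp: add_increasing)
  have Gm [measurable]: "G \<in> borel_measurable borel" unfolding G_def by measurable
  have GL: "G \<in> L2" unfolding G_def by (simp add: weight_L2 q(1))
  have Gi: "integrable lborel G"
    by (rule Bochner_Integration.integrable_bound[OF L2_mult_integrable[OF q(2) rep_l2_in[of Y]]])
       (auto simp: G_def)
  have G12: "G \<in> L12" using GL Gi by (simp add: L12_def)
  have wG: "wmul q Y = abs_l2 G" by (simp add: wmul_def G_def[abs_def])
  have "abs_l2 g = InvFour (Four (abs_l2 g))" by simp
  also have "\<dots> = InvFour (abs_l2 G)" by (simp only: gY wG)
  also have "\<dots> = abs_l2 ig"
    unfolding InvFour_def cj_abs[OF GL] Four_abs[OF L12_cnj[OF G12]] cj_abs[OF plancherel_L12(1)[OF L12_cnj[OF G12]]] ig_def ..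
  finally have gig: "abs_l2 g = abs_l2 ig" .
  have igL: "ig \<in> L2" unfolding ig_def by (intro L2_cnj plancherel_L12(1) L12_cnj G12)
  have AEg: "AE x in lborel. g x = ig x" using gig by (simp add: abs_l2_eq_iff g igL)
  define C where "C = (LINT x|lborel. cmod (cnj (G x)))"
  have igC: "cmod (ig x) \<le> C" for x
    unfolding ig_def C_def complex_mod_cnj using norm_ft_le[of "\<lambda>\<xi>. cnj (G \<xi>)"] Gi by simp
  note [measurable] = L2_measurable[OF igL]
  have prodL: "(\<lambda>x. ig x * h x) \<in> L2" if "h \<in> L2" for h
  proof (rule L2_bound[OF that, where C = C])
    note [measurable] = L2_measurable[OF that]
    show "(\<lambda>x. ig x * h x) \<in> borel_measurable borel" by measurable
    show "AE x in lborel. cmod (ig x * h x) \<le> C * cmod (h x)"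
      using igC by (auto simp: norm_mult intro!: mult_right_mono)
  qed
  have AEp: "AE x in lborel. g x * f x = ig x * f x" using AEg by eventually_elim simp
  show L: "(\<lambda>x. g x * f x) \<in> L2"
    by (rule L2_bound[OF prodL[OF f], where C = 1]) (measurable, use AEp in \<open>eventually_elim, auto\<close>)
  have ig_eq: "ig x = (LINT \<eta>|lborel. cis (1 * (\<eta> \<bullet> x)) * G \<eta>) / complex_of_real (2 * pi)" for x
    unfolding ig_def ft_def by (simp add: cis_cnj flip: Bochner_Integration.integral_cnj)
  \<comment> \<open>For \<open>h\<close> in \<open>L12\<close> all integrals converge absolutely and
    Fubini's theorem applies. The general case follows by truncating \<open>f\<close>, since both
    sides depend continuously on it.\<close>
  have base: "Four (abs_l2 (\<lambda>x. ig x * h x)) = (1 / (2 * pi)) *\<^sub>R conv_op ?k Y (abs_l2 (ft h))" if h: "h \<in> L12" for h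
  proof -
    note hi = L12_integrable[OF h] and hL = L12_L2[OF h]
    note [measurable] = L2_measurable[OF hL]
    have p12: "(\<lambda>x. ig x * h x) \<in> L12"
      unfolding L12_def using prodL[OF hL] integrable_bounded_mult[OF hi L2_measurable[OF igL] igC] by simp
    have "ft (\<lambda>x. ig x * h x) = (\<lambda>\<xi>. (1 / (2 * pi)) *\<^sub>R conv_fun ?k (rep_l2 Y) (ft h) \<xi>)"
    proof
      fix \<xi> :: "real^2"
      let ?h = "\<lambda>x. cis (- (x \<bullet> \<xi>)) * h x"
      have "(LINT x|lborel. cis (- (x \<bullet> \<xi>)) * (ig x * h x))
         = (LINT x|lborel. ?h x * (LINT \<eta>|lborel. cis (1 * (\<eta> \<bullet> x)) * G \<eta>) / complex_of_real (2 * pi))"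
        unfolding ig_eq by (simp add: mult_ac)
      also have "\<dots> = (LINT x|lborel. ?h x * (LINT \<eta>|lborel. cis (1 * (\<eta> \<bullet> x)) * G \<eta>)) / complex_of_real (2 * pi)"
        by (rule integral_divide_zero)
      also have "(LINT x|lborel. ?h x * (LINT \<eta>|lborel. cis (1 * (\<eta> \<bullet> x)) * G \<eta>))
         = (LINT \<eta>|lborel. G \<eta> * (LINT x|lborel. cis (1 * (\<eta> \<bullet> x)) * ?h x))"
        by (rule Fubini_cis[OF Gi integrable_cis_neg[OF hi]])
      also have "\<dots> = (LINT \<eta>|lborel. G \<eta> * (complex_of_real (2 * pi) * ft h (\<xi> - \<eta>)))"
      proof (rule Bochner_Integration.integral_cong[OF refl])
        fix \<eta>
        have "(LINT x|lborel. cis (1 * (\<eta> \<bullet> x)) * ?h x) = (LINT x|lborel. cis (- (x \<bullet> (\<xi> - \<eta>))) * h x)"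
          by (simp add: mult.assoc[symmetric] cis_mult inner_diff_right inner_commute)
        then show "G \<eta> * (LINT x|lborel. cis (1 * (\<eta> \<bullet> x)) * ?h x) = G \<eta> * (complex_of_real (2 * pi) * ft h (\<xi> - \<eta>))"
          by (simp add: ft_def)
      qed
      also have "\<dots> = (LINT \<eta>|lborel. G (\<xi> - \<eta>) * (complex_of_real (2 * pi) * ft h (\<xi> - (\<xi> - \<eta>))))"
        by (rule integral_lborel_reflect[symmetric]) measurable
      also have "\<dots> = (LINT \<eta>|lborel. complex_of_real (2 * pi) * (?k \<xi> \<eta> *\<^sub>R (rep_l2 Y (\<xi> - \<eta>) * ft h \<eta>)))"
        by (simp add: G_def mult_ac)
      also have "\<dots> = complex_of_real (2 * pi) * conv_fun ?k (rep_l2 Y) (ft h) \<xi>"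
        unfolding conv_fun_def by (rule integral_mult_right_zero)
      finally show "ft (\<lambda>x. ig x * h x) \<xi> = (1 / (2 * pi)) *\<^sub>R conv_fun ?k (rep_l2 Y) (ft h) \<xi>"
        unfolding ft_def[of "\<lambda>x. ig x * h x"] by (simp add: scaleR_conv_of_real)
    qed
    then show ?thesis
      using conv_op_abs[OF kb rep_l2_in[of Y] plancherel_L12(1)[OF h]] conv_fun_L2(1)[OF kb rep_l2_in[of Y] plancherel_L12(1)[OF h]]
      by (simp add: Four_abs[OF p12] abs_l2_scaleR)
  qed
  interpret bb: bounded_bilinear "conv_op ?k" by (rule bounded_bilinear_conv_op[OF kb])
  define F where "F n = cut (real n) f" for n
  have F12: "F n \<in> L12" for n unfolding F_def by (rule cut_L12[OF f])
  have Flim: "(\<lambda>n. abs_l2 (F n)) \<longlonglongrightarrow> abs_l2 f"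
    unfolding F_def by (rule cut_tendsto[OF f filterlim_real_sequentially])
  have "(\<lambda>n. abs_l2 (\<lambda>x. ig x * F n x)) \<longlonglongrightarrow> abs_l2 (\<lambda>x. ig x * f x)"
  proof (rule L2_dominated_convergence[OF prodL[OF L12_L2[OF F12]] prodL[OF f] L2_scaleR[OF f, of C]])
    show "AE x in lborel. (\<lambda>n. ig x * F n x) \<longlonglongrightarrow> ig x * f x"
      unfolding F_def by (intro AE_I2 tendsto_mult tendsto_const cut_pointwise_tendsto filterlim_real_sequentially)
    show "AE x in lborel. cmod (ig x * F n x - ig x * f x) \<le> norm (C *\<^sub>R f x)" for n
    proof (rule AE_I2)
      fix x
      have C0: "0 \<le> C" using igC[of 0] norm_ge_zero order_trans by blast
      have "cmod (ig x * F n x - ig x * f x) = cmod (ig x) * cmod (F n x - f x)"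
        by (simp flip: right_diff_distrib add: norm_mult)
      also have "\<dots> \<le> C * cmod (f x)"
        using igC[of x] C0 by (intro mult_mono) (auto simp: F_def cut_def indicator_def)
      finally show "cmod (ig x * F n x - ig x * f x) \<le> norm (C *\<^sub>R f x)" using C0 by simp
    qed
  qed
  from bounded_linear.tendsto[OF bounded_linear_Four this]
  have l1: "(\<lambda>n. (1 / (2 * pi)) *\<^sub>R conv_op ?k Y (abs_l2 (ft (F n)))) \<longlonglongrightarrow> Four (abs_l2 (\<lambda>x. ig x * f x))"
    unfolding base[OF F12] .
  have l2: "(\<lambda>n. (1 / (2 * pi)) *\<^sub>R conv_op ?k Y (abs_l2 (ft (F n)))) \<longlonglongrightarrow> (1 / (2 * pi)) *\<^sub>R conv_op ?k Y (Four (abs_l2 f))"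
    by (intro tendsto_scaleR tendsto_const bb.tendsto Four_tendsto F12 Flim)
  have "abs_l2 (\<lambda>x. g x * f x) = abs_l2 (\<lambda>x. ig x * f x)"
    using AEp by (simp add: abs_l2_eq_iff L prodL[OF f])
  then show "Four (abs_l2 (\<lambda>x. g x * f x)) = (1 / (2 * pi)) *\<^sub>R conv_op ?k Y (Four (abs_l2 f))"
    using LIMSEQ_unique[OF l1 l2] by simp
qed

subsection \<open>Sobolev spaces as weighted Hilbert spaces\<close>

definition real_l2 :: "(real^2 \<Rightarrow> real) \<Rightarrow> l2" where "real_l2 f = abs_l2 (\<lambda>x. complex_of_real (f x))"

lemma L2_of_real:
  assumes "f \<in> L2"
  shows "(\<lambda>x. complex_of_real (f x)) \<in> L2"
proof (rule L2_bound[OF assms, where C = 1])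
  note [measurable] = L2_measurable[OF assms]
  show "(\<lambda>x. complex_of_real (f x)) \<in> borel_measurable borel" by measurable
qed simp

lemma real_l2_add: "f \<in> L2 \<Longrightarrow> g \<in> L2 \<Longrightarrow> real_l2 (\<lambda>x. f x + g x) = real_l2 f + real_l2 g"
  unfolding real_l2_def by (simp add: abs_l2_add[symmetric] L2_of_real)

lemma real_l2_scaleR: "f \<in> L2 \<Longrightarrow> real_l2 (\<lambda>x. r * f x) = r *\<^sub>R real_l2 f"
  unfolding real_l2_def by (simp add: abs_l2_scaleR[symmetric] L2_of_real scaleR_conv_of_real)

lemma real_l2_eq_iff: "f \<in> L2 \<Longrightarrow> g \<in> L2 \<Longrightarrow> real_l2 f = real_l2 g \<longleftrightarrow> ae_eq f g"
  unfolding real_l2_def by (simp add: abs_l2_eq_iff L2_of_real ae_eq_def)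

lemma cj_real_l2: "f \<in> L2 \<Longrightarrow> cj (real_l2 f) = real_l2 f"
  unfolding real_l2_def by (simp add: cj_abs L2_of_real)

lemma real_l2_surj:
  assumes "cj a = a"
  shows "\<exists>f\<in>L2. real_l2 f = a"
proof -
  define f where "f x = Re (rep_l2 a x)" for x
  have m: "f \<in> borel_measurable borel" unfolding f_def by measurable
  have f: "f \<in> L2"
    by (rule L2_bound[OF rep_l2_in[of a] m, where C = 1]) (auto simp: f_def abs_Re_le_cmod)
  have "AE x in lborel. cnj (rep_l2 a x) = rep_l2 a x" using rep_cj[of a] assms by simp (auto elim: eventually_mono)
  then have "AE x in lborel. complex_of_real (f x) = rep_l2 a x"
    by eventually_elim (auto simp: f_def complex_eq_iff)
  then have "real_l2 f = abs_l2 (rep_l2 a)"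
    unfolding real_l2_def by (subst abs_l2_eq_iff) (auto intro: L2_of_real f)
  then show ?thesis using f by auto
qed

text \<open>The truncated Fourier integral is \<open>ft\<close> of a truncation, which converges to
  \<open>Four\<close>. By uniqueness of limits the choice in \<open>fourier\<close> is a
  representative of that class, determined almost everywhere.\<close>

lemma is_fourier_iff:
  assumes f: "f \<in> L2"
  shows "is_fourier f F \<longleftrightarrow> F \<in> L2 \<and> abs_l2 F = Four (real_l2 f)"
proof (cases "F \<in> L2")
  case True
  define h where "h x = complex_of_real (f x)" for x
  have h: "h \<in> L2" unfolding h_def by (rule L2_of_real[OF f])
  have tr: "truncated_fourier R f = ft (cut R h)" for R
    by (rule ext) (simp add: truncated_fourier_def ft_def set_lebesgue_integral_def cut_def h_def)
  have L: "ft (cut R h) \<in> L2" for R by (rule plancherel_L12(1)[OF cut_L12[OF h]])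
  have n: "(\<integral>\<^sup>+\<xi>. ennreal ((cmod (truncated_fourier R f \<xi> - F \<xi>))\<^sup>2) \<partial>lborel) = ennreal ((norm (abs_l2 (ft (cut R h)) - abs_l2 F))\<^sup>2)" for R
    unfolding tr nn_integral_L2_abs[OF L2_diff[OF L True]] abs_l2_diff[OF L True] ..
  have lim: "((\<lambda>R. abs_l2 (ft (cut R h))) \<longlongrightarrow> Four (real_l2 f)) at_top"
    unfolding real_l2_def h_def[symmetric]
    by (intro tendsto_at_topI_sequentially Four_tendsto cut_L12[OF h] cut_tendsto[OF h])
  have "((\<lambda>R. ennreal ((norm (abs_l2 (ft (cut R h)) - abs_l2 F))\<^sup>2)) \<longlongrightarrow> ennreal 0) at_top
      \<longleftrightarrow> ((\<lambda>R. (norm (abs_l2 (ft (cut R h)) - abs_l2 F))\<^sup>2) \<longlongrightarrow> 0) at_top"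
    by (rule tendsto_ennreal_iff) auto
  then have "is_fourier f F \<longleftrightarrow> ((\<lambda>R. (norm (abs_l2 (ft (cut R h)) - abs_l2 F))\<^sup>2) \<longlongrightarrow> 0) at_top"
    unfolding is_fourier_def n using True by simp
  also have "\<dots> \<longleftrightarrow> ((\<lambda>R. abs_l2 (ft (cut R h))) \<longlongrightarrow> abs_l2 F) at_top"
  proof
    assume "((\<lambda>R. (norm (abs_l2 (ft (cut R h)) - abs_l2 F))\<^sup>2) \<longlongrightarrow> 0) at_top"
    then have "((\<lambda>R. sqrt ((norm (abs_l2 (ft (cut R h)) - abs_l2 F))\<^sup>2)) \<longlongrightarrow> sqrt 0) at_top"
      by (rule tendsto_real_sqrt)
    then show "((\<lambda>R. abs_l2 (ft (cut R h))) \<longlongrightarrow> abs_l2 F) at_top"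
      by (simp add: tendsto_norm_zero_iff LIM_zero_iff)
  next
    assume "((\<lambda>R. abs_l2 (ft (cut R h))) \<longlongrightarrow> abs_l2 F) at_top"
    then have "((\<lambda>R. (norm (abs_l2 (ft (cut R h)) - abs_l2 F))\<^sup>2) \<longlongrightarrow> (norm (abs_l2 F - abs_l2 F))\<^sup>2) at_top"
      by (intro tendsto_intros)
    then show "((\<lambda>R. (norm (abs_l2 (ft (cut R h)) - abs_l2 F))\<^sup>2) \<longlongrightarrow> 0) at_top" by simp
  qed
  also have "\<dots> \<longleftrightarrow> abs_l2 F = Four (real_l2 f)"
  proof
    assume "((\<lambda>R. abs_l2 (ft (cut R h))) \<longlongrightarrow> abs_l2 F) at_top"
    then show "abs_l2 F = Four (real_l2 f)"
      by (rule tendsto_unique[OF trivial_limit_at_top_linorder _ lim])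
  qed (use lim in simp)
  finally show ?thesis using True by simp
qed (simp add: is_fourier_def)

lemma fourier_L2:
  assumes "f \<in> L2"
  shows "fourier f \<in> L2" "abs_l2 (fourier f) = Four (real_l2 f)"
proof -
  have "is_fourier f (rep_l2 (Four (real_l2 f)))" by (simp add: is_fourier_iff[OF assms])
  then have "is_fourier f (fourier f)" unfolding fourier_def by (rule someI[of "is_fourier f"])
  then show "fourier f \<in> L2" "abs_l2 (fourier f) = Four (real_l2 f)" by (auto simp: is_fourier_iff[OF assms])
qed

lemma sobolev_iff: "f \<in> sobolev \<sigma> \<longleftrightarrow> f \<in> L2 \<and> (\<lambda>\<xi>. pw \<sigma> \<xi> *\<^sub>R fourier f \<xi>) \<in> L2"
proof (cases "f \<in> L2")
  case True
  note [measurable] = L2_measurable[OF fourier_L2(1)[OF True]]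
  have "(norm (pw \<sigma> \<xi> *\<^sub>R fourier f \<xi>))\<^sup>2 = (1 + (norm \<xi>)\<^sup>2) powr \<sigma> * (cmod (fourier f \<xi>))\<^sup>2" for \<xi>
    by (simp add: power_mult_distrib pw_sq[symmetric])
  moreover have "(\<lambda>\<xi>. pw \<sigma> \<xi> *\<^sub>R fourier f \<xi>) \<in> borel_measurable borel" by measurable
  ultimately show ?thesis using True by (simp add: sobolev_def L2_def)
qed (simp add: sobolev_def)

definition SH :: "real \<Rightarrow> (real^2 \<Rightarrow> real) \<Rightarrow> l2" where
  "SH \<sigma> f = abs_l2 (\<lambda>\<xi>. pw \<sigma> \<xi> *\<^sub>R fourier f \<xi>)"

lemma sobolev_norm_eq:
  assumes "f \<in> sobolev \<sigma>"
  shows "sobolev_norm \<sigma> f = norm (SH \<sigma> f)"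
proof -
  have L: "(\<lambda>\<xi>. pw \<sigma> \<xi> *\<^sub>R fourier f \<xi>) \<in> L2" using assms by (simp add: sobolev_iff)
  have "(norm (SH \<sigma> f))\<^sup>2 = (LINT \<xi>|lborel. (1 + (norm \<xi>)\<^sup>2) powr \<sigma> * (cmod (fourier f \<xi>))\<^sup>2)"
    unfolding SH_def norm_abs_l2_sq[OF L] by (simp add: power_mult_distrib pw_sq)
  from this[symmetric] show ?thesis unfolding sobolev_norm_def by simp
qed

text \<open>Multiplying by the inverse weight, which is bounded for \<open>\<sigma> \<ge> 0\<close>,
  gives a single equation that decides membership and encoding together. Linearity and the change of
  exponent then reduce to facts about bounded operators.\<close>

lemma sobolev_characterization:
  assumes \<sigma>: "0 \<le> \<sigma>"
  shows "f \<in> sobolev \<sigma> \<and> SH \<sigma> f = Y \<longleftrightarrow> f \<in> L2 \<and> wmul (pw (- \<sigma>)) Y = Four (real_l2 f)"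
proof (cases "f \<in> L2")
  case True
  have w: "bounded_weight (pw (- \<sigma>))" using \<sigma> by (intro bounded_weight_pw) simp
  note F = fourier_L2[OF True]
  have inv: "pw (- \<sigma>) \<xi> *\<^sub>R pw \<sigma> \<xi> *\<^sub>R z = z" "pw \<sigma> \<xi> *\<^sub>R pw (- \<sigma>) \<xi> *\<^sub>R z = z" for \<xi> and z :: complex
    using pw_add[of "- \<sigma>" \<xi> \<sigma>] pw_add[of \<sigma> \<xi> "- \<sigma>"] by simp_all
  show ?thesis
  proof
    assume a: "f \<in> sobolev \<sigma> \<and> SH \<sigma> f = Y"
    then have L: "(\<lambda>\<xi>. pw \<sigma> \<xi> *\<^sub>R fourier f \<xi>) \<in> L2" by (simp add: sobolev_iff)
    have "wmul (pw (- \<sigma>)) (SH \<sigma> f) = Four (real_l2 f)"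
      unfolding SH_def wmul_abs[OF w L] inv by (rule F)
    then show "f \<in> L2 \<and> wmul (pw (- \<sigma>)) Y = Four (real_l2 f)" using True a by simp
  next
    assume "f \<in> L2 \<and> wmul (pw (- \<sigma>)) Y = Four (real_l2 f)"
    then have "abs_l2 (fourier f) = wmul (pw (- \<sigma>)) Y" using F by simp
    then have "AE \<xi> in lborel. fourier f \<xi> = pw (- \<sigma>) \<xi> *\<^sub>R rep_l2 Y \<xi>"
      unfolding wmul_def using F weight_L2[OF w rep_l2_in] by (simp add: abs_l2_eq_iff)
    then have e: "AE \<xi> in lborel. pw \<sigma> \<xi> *\<^sub>R fourier f \<xi> = rep_l2 Y \<xi>"
      by eventually_elim (simp only: inv)
    note [measurable] = L2_measurable[OF F(1)]
    have L: "(\<lambda>\<xi>. pw \<sigma> \<xi> *\<^sub>R fourier f \<xi>) \<in> L2"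
      by (rule L2_bound[OF rep_l2_in[of Y], where C = 1]) (measurable, use e in \<open>eventually_elim, simp\<close>)
    have "SH \<sigma> f = abs_l2 (rep_l2 Y)"
      unfolding SH_def by (subst abs_l2_eq_iff[OF L rep_l2_in]) (rule e)
    then show "f \<in> sobolev \<sigma> \<and> SH \<sigma> f = Y" using True L by (simp add: sobolev_iff)
  qed
qed (simp add: sobolev_def)

lemma sobolev_L2: "f \<in> sobolev \<sigma> \<Longrightarrow> f \<in> L2"
  by (simp add: sobolev_def)

lemma wmul_SH: "0 \<le> \<sigma> \<Longrightarrow> f \<in> sobolev \<sigma> \<Longrightarrow> wmul (pw (- \<sigma>)) (SH \<sigma> f) = Four (real_l2 f)"
  using sobolev_characterization by blast

lemma sobolev_add:
  assumes \<sigma>: "0 \<le> \<sigma>" and f: "f \<in> sobolev \<sigma>" and g: "g \<in> sobolev \<sigma>"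
  shows "(\<lambda>x. f x + g x) \<in> sobolev \<sigma>" "SH \<sigma> (\<lambda>x. f x + g x) = SH \<sigma> f + SH \<sigma> g"
proof -
  interpret w: bounded_linear "wmul (pw (- \<sigma>))" using \<sigma> by (intro bounded_linear_wmul bounded_weight_pw) simp
  note L = sobolev_L2[OF f] sobolev_L2[OF g]
  have "wmul (pw (- \<sigma>)) (SH \<sigma> f + SH \<sigma> g) = Four (real_l2 (\<lambda>x. f x + g x))"
    by (simp add: w.add wmul_SH[OF \<sigma>] f g real_l2_add L Four_add)
  then have "(\<lambda>x. f x + g x) \<in> sobolev \<sigma> \<and> SH \<sigma> (\<lambda>x. f x + g x) = SH \<sigma> f + SH \<sigma> g"
    using L by (subst sobolev_characterization[OF \<sigma>]) (simp add: L2_add)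
  then show "(\<lambda>x. f x + g x) \<in> sobolev \<sigma>" "SH \<sigma> (\<lambda>x. f x + g x) = SH \<sigma> f + SH \<sigma> g" by auto
qed

lemma sobolev_scale:
  assumes \<sigma>: "0 \<le> \<sigma>" and f: "f \<in> sobolev \<sigma>"
  shows "(\<lambda>x. r * f x) \<in> sobolev \<sigma>" "SH \<sigma> (\<lambda>x. r * f x) = r *\<^sub>R SH \<sigma> f"
proof -
  interpret w: bounded_linear "wmul (pw (- \<sigma>))" using \<sigma> by (intro bounded_linear_wmul bounded_weight_pw) simp
  note L = sobolev_L2[OF f]
  have "wmul (pw (- \<sigma>)) (r *\<^sub>R SH \<sigma> f) = Four (real_l2 (\<lambda>x. r * f x))"
    by (simp add: w.scaleR wmul_SH[OF \<sigma>] f real_l2_scaleR L Four_scaleR)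
  then have "(\<lambda>x. r * f x) \<in> sobolev \<sigma> \<and> SH \<sigma> (\<lambda>x. r * f x) = r *\<^sub>R SH \<sigma> f"
    using L2_scaleR[OF L, of r] by (subst sobolev_characterization[OF \<sigma>]) simp
  then show "(\<lambda>x. r * f x) \<in> sobolev \<sigma>" "SH \<sigma> (\<lambda>x. r * f x) = r *\<^sub>R SH \<sigma> f" by auto
qed

lemma sobolev_uminus:
  assumes "0 \<le> \<sigma>" "f \<in> sobolev \<sigma>"
  shows "(\<lambda>x. - f x) \<in> sobolev \<sigma>" "SH \<sigma> (\<lambda>x. - f x) = - SH \<sigma> f"
  using sobolev_scale[OF assms, of "- 1"] by simp_all

lemma sobolev_diff:
  assumes \<sigma>: "0 \<le> \<sigma>" and f: "f \<in> sobolev \<sigma>" and g: "g \<in> sobolev \<sigma>"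
  shows "(\<lambda>x. f x - g x) \<in> sobolev \<sigma>" "SH \<sigma> (\<lambda>x. f x - g x) = SH \<sigma> f - SH \<sigma> g"
  using sobolev_add[OF \<sigma> f sobolev_uminus(1)[OF \<sigma> g]] sobolev_uminus(2)[OF \<sigma> g] by simp_all

lemma sobolev_norm_diff:
  assumes "0 \<le> \<sigma>" "f \<in> sobolev \<sigma>" "g \<in> sobolev \<sigma>"
  shows "sobolev_norm \<sigma> (\<lambda>x. f x - g x) = norm (SH \<sigma> f - SH \<sigma> g)"
  using sobolev_diff[OF assms] by (simp add: sobolev_norm_eq)

lemma sobolev_sum:
  assumes \<sigma>: "0 \<le> \<sigma>" and "finite A" "\<And>i. i \<in> A \<Longrightarrow> f i \<in> sobolev \<sigma>"
  shows "(\<lambda>x. \<Sum>i\<in>A. c i * f i x) \<in> sobolev \<sigma> \<and> SH \<sigma> (\<lambda>x. \<Sum>i\<in>A. c i * f i x) = (\<Sum>i\<in>A. c i *\<^sub>R SH \<sigma> (f i))"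
  using assms(2,3)
proof (induction rule: finite_induct)
  case empty
  have "real_l2 (\<lambda>_. 0) = 0" by (simp add: real_l2_def zero_l2_def)
  moreover have "Four 0 = 0" "wmul (pw (- \<sigma>)) 0 = 0"
    using \<sigma> bounded_linear_Four bounded_linear_wmul[OF bounded_weight_pw[of "- \<sigma>"]] by (auto dest: bounded_linear.linear simp: linear_0)
  ultimately show ?case
    using sobolev_characterization[OF \<sigma>, of "\<lambda>_. 0" 0] by (simp add: L2_zero)
next
  case (insert i A)
  then show ?case
    using sobolev_add[OF \<sigma> sobolev_scale(1)[OF \<sigma>, of "f i" "c i"], of "\<lambda>x. \<Sum>i\<in>A. c i * f i x"] sobolev_scale(2)[OF \<sigma>, of "f i" "c i"]
    by auto
qed

lemma SH_eq_imp_ae_eq: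
  assumes "0 \<le> \<sigma>" "f \<in> sobolev \<sigma>" "g \<in> sobolev \<sigma>" "SH \<sigma> f = SH \<sigma> g"
  shows "ae_eq f g"
proof -
  have "Four (real_l2 f) = Four (real_l2 g)"
    using wmul_SH[of \<sigma> f] wmul_SH[of \<sigma> g] assms by simp
  then show ?thesis using assms by (simp add: Four_inject real_l2_eq_iff sobolev_L2)
qed

lemma SH_ae_cong:
  assumes "0 \<le> \<sigma>" "f \<in> sobolev \<sigma>" "g \<in> sobolev \<sigma>" "ae_eq f g"
  shows "SH \<sigma> f = SH \<sigma> g"
proof -
  have "real_l2 f = real_l2 g" using assms by (simp add: real_l2_eq_iff sobolev_L2)
  then show ?thesis
    using sobolev_characterization[OF assms(1), of g "SH \<sigma> f"] wmul_SH[OF assms(1,2)] assms by (simp add: sobolev_L2)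
qed

lemma SH_hermitian:
  assumes "0 \<le> \<sigma>" "f \<in> sobolev \<sigma>"
  shows "SH \<sigma> f \<in> hermitian"
proof -
  have w: "bounded_weight (pw (- \<sigma>))" using assms by (intro bounded_weight_pw) simp
  interpret w: bounded_linear "wmul (pw (- \<sigma>))" by (rule bounded_linear_wmul[OF w])
  have "Four (real_l2 f) \<in> hermitian"
    using assms by (simp add: Four_hermitian_iff cj_real_l2 sobolev_L2)
  then have "wmul (pw (- \<sigma>)) (reflect (SH \<sigma> f)) = wmul (pw (- \<sigma>)) (SH \<sigma> f)"
    by (simp add: reflect_wmul[OF w pw_uminus, symmetric] wmul_SH[OF assms] hermitian_def)
  then have "wmul (pw (- \<sigma>)) (reflect (SH \<sigma> f) - SH \<sigma> f) = 0" by (simp add: w.diff)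
  then have "reflect (SH \<sigma> f) - SH \<sigma> f = 0"
    by (rule wmul_eq_0_imp[OF w, rotated]) (auto simp: less_imp_neq[symmetric])
  then show ?thesis by (simp add: hermitian_def)
qed

text \<open>Hermitian symmetry makes the inverse transform real-valued. So H^\<sigma> modulo almost
  everywhere equality is isometric to the real Hilbert space \<open>hermitian\<close>.\<close>

lemma SH_surj:
  assumes \<sigma>: "0 \<le> \<sigma>" and Y: "Y \<in> hermitian"
  shows "\<exists>f\<in>sobolev \<sigma>. SH \<sigma> f = Y"
proof -
  have w: "bounded_weight (pw (- \<sigma>))" using \<sigma> by (intro bounded_weight_pw) simp
  define a where "a = InvFour (wmul (pw (- \<sigma>)) Y)"
  have "Four a \<in> hermitian" unfolding a_def using wmul_hermitian[OF w pw_uminus Y] by simp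
  then have "cj a = a" by (simp add: Four_hermitian_iff)
  then obtain f where f: "f \<in> L2" "real_l2 f = a" using real_l2_surj by blast
  then have "wmul (pw (- \<sigma>)) Y = Four (real_l2 f)" by (simp add: a_def)
  then show ?thesis using sobolev_characterization[OF \<sigma>, of f Y] f by auto
qed

lemma sobolev_mono:
  assumes "1 \<le> \<sigma>" and f: "f \<in> sobolev \<sigma>"
  shows "f \<in> sobolev (\<sigma> - 1)" "SH (\<sigma> - 1) f = wmul (pw (- 1)) (SH \<sigma> f)"
proof -
  have "wmul (pw (- (\<sigma> - 1))) (wmul (pw (- 1)) (SH \<sigma> f)) = Four (real_l2 f)"
    using assms wmul_SH[of \<sigma> f] by (simp add: wmul_wmul bounded_weight_pw pw_add)
  then have "f \<in> sobolev (\<sigma> - 1) \<and> SH (\<sigma> - 1) f = wmul (pw (- 1)) (SH \<sigma> f)"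
    using assms sobolev_L2[OF f] by (subst sobolev_characterization) auto
  then show "f \<in> sobolev (\<sigma> - 1)" "SH (\<sigma> - 1) f = wmul (pw (- 1)) (SH \<sigma> f)" by auto
qed

subsection \<open>The nonlinearity\<close>

text \<open>A Hermitian symbol keeps the transform of a real function Hermitian, so a real function
  with the prescribed transform exists; the choice made by \<open>SOME\<close> has that
  transform.\<close>

lemma fourier_multiplier_L2:
  assumes f: "f \<in> L2" and mF: "(\<lambda>\<xi>. m \<xi> * fourier f \<xi>) \<in> L2" and m: "\<And>\<xi>. m (- \<xi>) = cnj (m \<xi>)"
  shows "fourier_multiplier m f \<in> L2" "Four (real_l2 (fourier_multiplier m f)) = abs_l2 (\<lambda>\<xi>. m \<xi> * fourier f \<xi>)"
proof -
  let ?M = "\<lambda>\<xi>. m \<xi> * fourier f \<xi>"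
  have "abs_l2 (fourier f) \<in> hermitian"
    using f by (simp add: fourier_L2 Four_hermitian_iff cj_real_l2)
  then have "AE \<xi> in lborel. cnj (fourier f (- \<xi>)) = fourier f \<xi>"
    using hermitian_abs_iff[OF fourier_L2(1)[OF f]] by blast
  then have "AE \<xi> in lborel. cnj (?M (- \<xi>)) = ?M \<xi>" by eventually_elim (simp add: m)
  then have "Four (InvFour (abs_l2 ?M)) \<in> hermitian" by (simp add: hermitian_abs_iff mF)
  then have "cj (InvFour (abs_l2 ?M)) = InvFour (abs_l2 ?M)" by (simp only: Four_hermitian_iff)
  then obtain g where g: "g \<in> L2" "real_l2 g = InvFour (abs_l2 ?M)" using real_l2_surj by blast
  have iff: "ae_eq (fourier h) ?M \<longleftrightarrow> Four (real_l2 h) = abs_l2 ?M" if "h \<in> L2" for h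
    unfolding ae_eq_def fourier_L2(2)[OF that, symmetric] by (rule abs_l2_eq_iff[OF fourier_L2(1)[OF that] mF, symmetric])
  have "g \<in> L2 \<and> ae_eq (fourier g) ?M" using g iff by simp
  then have "fourier_multiplier m f \<in> L2 \<and> ae_eq (fourier (fourier_multiplier m f)) ?M"
    unfolding fourier_multiplier_def by (rule someI[of "\<lambda>g. g \<in> L2 \<and> ae_eq (fourier g) ?M"])
  then show "fourier_multiplier m f \<in> L2" "Four (real_l2 (fourier_multiplier m f)) = abs_l2 ?M"
    using iff by auto
qed

lemma component_measurable [measurable]: "(\<lambda>x::real^2. x $ i) \<in> borel_measurable borel"
  by (intro borel_measurable_continuous_onI continuous_intros)

text \<open>Each product of a velocity component and a derivative is in L^2 by
  \<open>Four_product\<close>. Only the sum of the two products is compared with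
  \<open>sqg_kernel\<close>: their kernels add up to the determinant in \<open>sqg_symbol\<close>,
  and \<open>wmul_sqg\<close> restores the output weight.\<close>

lemma advection_sobolev:
  assumes s: "2 < s" and \<theta>: "\<theta> \<in> sobolev s"
  shows "advection (sqg_velocity \<theta>) \<theta> \<in> sobolev (s - 1)"
    and "SH (s - 1) (advection (sqg_velocity \<theta>) \<theta>) = conv_op (sqg_kernel s) (SH s \<theta>) (SH s \<theta>)"
proof -
  define y where "y = SH s \<theta>"
  define Y where "Y = rep_l2 y"
  have [measurable]: "Y \<in> borel_measurable borel" by (simp add: Y_def)
  have YL: "Y \<in> L2" "abs_l2 Y = y" by (auto simp: Y_def)
  have L: "\<theta> \<in> L2" by (rule sobolev_L2[OF \<theta>])
  note F = fourier_L2[OF L]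
  note [measurable] = L2_measurable[OF F(1)]
  have w: "bounded_weight (pw (- s))" "bounded_weight (pw (1 - s))" using s by (auto intro: bounded_weight_pw)
  have "abs_l2 (fourier \<theta>) = wmul (pw (- s)) y"
    using wmul_SH[of s \<theta>] s \<theta> by (simp add: F y_def)
  then have FY: "AE \<xi> in lborel. fourier \<theta> \<xi> = pw (- s) \<xi> *\<^sub>R Y \<xi>"
    unfolding wmul_def Y_def[symmetric] using F weight_L2[OF w(1) YL(1)] by (simp add: abs_l2_eq_iff)
  \<comment> \<open>At \<open>\<xi> = 0\<close> the quotient is 0 by the convention for division, so
    the bound by 1 and the Hermitian symmetry hold at every point.\<close>
  define mr where "mr k \<xi> = \<i> * complex_of_real (\<xi> $ k / norm \<xi>)" for k :: 2 and \<xi> :: "real^2"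
  define mp where "mp k \<xi> = \<i> * complex_of_real (\<xi> $ k)" for k :: 2 and \<xi> :: "real^2"
  have [measurable]: "mr k \<in> borel_measurable borel" "mp k \<in> borel_measurable borel" for k
    unfolding mr_def mp_def by measurable
  have mr_le: "cmod (mr k \<xi>) \<le> 1" for k \<xi>
  proof -
    have "\<bar>\<xi> $ k / norm \<xi>\<bar> \<le> 1" using component_le_norm_cart[of \<xi> k] by (auto simp: divide_le_eq_1)
    then show ?thesis by (simp only: mr_def norm_mult norm_ii norm_of_real mult_1_left)
  qed
  have mp_le: "cmod (mp k \<xi>) \<le> japanese \<xi>" for k \<xi>
    using component_le_norm_cart[of \<xi> k] norm_le_japanese[of \<xi>] by (simp add: mp_def norm_mult)
  have mrY: "(\<lambda>\<xi>. mr k \<xi> * Y \<xi>) \<in> L2" for k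
  proof (rule L2_bound[OF YL(1), where C = 1])
    show "AE \<xi> in lborel. cmod (mr k \<xi> * Y \<xi>) \<le> 1 * cmod (Y \<xi>)"
      using mr_le by (auto simp: norm_mult intro!: mult_right_mono mult_left_le_one_le)
  qed measurable
  have mpY: "(\<lambda>\<xi>. mp k \<xi> * (pw (- s) \<xi> *\<^sub>R Y \<xi>)) \<in> L2" for k
  proof (rule L2_bound[OF weight_L2[OF w(2) YL(1)], where C = 1])
    show "AE \<xi> in lborel. cmod (mp k \<xi> * (pw (- s) \<xi> *\<^sub>R Y \<xi>)) \<le> 1 * cmod (pw (1 - s) \<xi> *\<^sub>R Y \<xi>)"
    proof (rule AE_I2)
      fix \<xi>
      have "cmod (mp k \<xi> * (pw (- s) \<xi> *\<^sub>R Y \<xi>)) = (cmod (mp k \<xi>) * pw (- s) \<xi>) * cmod (Y \<xi>)"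
        by (simp add: norm_mult)
      also have "\<dots> \<le> (japanese \<xi> * pw (- s) \<xi>) * cmod (Y \<xi>)"
        using mp_le by (intro mult_right_mono) auto
      also have "japanese \<xi> * pw (- s) \<xi> = pw (1 - s) \<xi>" using pw_add[of 1 \<xi> "- s"] by (simp add: pw_1)
      finally show "cmod (mp k \<xi> * (pw (- s) \<xi> *\<^sub>R Y \<xi>)) \<le> 1 * cmod (pw (1 - s) \<xi> *\<^sub>R Y \<xi>)" by simp
    qed
  qed measurable
  have mrF: "(\<lambda>\<xi>. mr k \<xi> * fourier \<theta> \<xi>) \<in> L2" for k
  proof (rule L2_bound[OF F(1), where C = 1])
    show "AE \<xi> in lborel. cmod (mr k \<xi> * fourier \<theta> \<xi>) \<le> 1 * cmod (fourier \<theta> \<xi>)"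
      using mr_le by (auto simp: norm_mult intro!: mult_right_mono mult_left_le_one_le)
  qed measurable
  have AEp: "AE \<xi> in lborel. mp k \<xi> * fourier \<theta> \<xi> = mp k \<xi> * (pw (- s) \<xi> *\<^sub>R Y \<xi>)" for k
    using FY by eventually_elim simp
  have AEr: "AE \<xi> in lborel. mr k \<xi> * fourier \<theta> \<xi> = pw (- s) \<xi> *\<^sub>R (mr k \<xi> * Y \<xi>)" for k
    using FY by eventually_elim simp
  have mpF: "(\<lambda>\<xi>. mp k \<xi> * fourier \<theta> \<xi>) \<in> L2" for k
    by (rule L2_bound[OF mpY[of k], where C = 1]) (measurable, use AEp[of k] in \<open>eventually_elim, simp\<close>)
  have herm: "mr k (- \<xi>) = cnj (mr k \<xi>)" "mp k (- \<xi>) = cnj (mp k \<xi>)" for k \<xi>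
    by (auto simp: mr_def mp_def)
  have riesz: "riesz k \<theta> \<in> L2" "Four (real_l2 (riesz k \<theta>)) = wmul (pw (- s)) (abs_l2 (\<lambda>\<xi>. mr k \<xi> * Y \<xi>))" for k
  proof -
    have e: "riesz k = fourier_multiplier (mr k)" unfolding riesz_def mr_def ..
    show "riesz k \<theta> \<in> L2" unfolding e by (rule fourier_multiplier_L2(1)[OF L mrF herm(1)])
    show "Four (real_l2 (riesz k \<theta>)) = wmul (pw (- s)) (abs_l2 (\<lambda>\<xi>. mr k \<xi> * Y \<xi>))"
      unfolding e fourier_multiplier_L2(2)[OF L mrF herm(1)] wmul_abs[OF w(1) mrY]
      by (subst abs_l2_eq_iff[OF mrF weight_L2[OF w(1) mrY]]) (rule AEr)
  qed
  have partial: "partial k \<theta> \<in> L2" "Four (real_l2 (partial k \<theta>)) = abs_l2 (\<lambda>\<xi>. mp k \<xi> * (pw (- s) \<xi> *\<^sub>R Y \<xi>))" for k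
  proof -
    have e: "partial k = fourier_multiplier (mp k)" unfolding partial_def mp_def ..
    show "partial k \<theta> \<in> L2" unfolding e by (rule fourier_multiplier_L2(1)[OF L mpF herm(2)])
    show "Four (real_l2 (partial k \<theta>)) = abs_l2 (\<lambda>\<xi>. mp k \<xi> * (pw (- s) \<xi> *\<^sub>R Y \<xi>))"
      unfolding e fourier_multiplier_L2(2)[OF L mpF herm(2)]
      by (subst abs_l2_eq_iff[OF mpF mpY]) (rule AEp)
  qed
  have q: "pw (- s) \<in> L2" using s by (intro pw_L2) simp
  \<comment> \<open>The kernel of one product of a Riesz transform and a derivative. The imaginary
    units of the two symbols multiply to -1, which is why \<open>prod\<close> pairs the coefficient
    \<open>c\<close> with the kernel for \<open>- c\<close>.\<close>
  define \<kappa> where "\<kappa> k j c \<xi> \<eta> = c * ((\<xi> - \<eta>) $ k / norm (\<xi> - \<eta>) * \<eta> $ j / (2 * pi)) * (pw (- s) (\<xi> - \<eta>) * pw (- s) \<eta>)"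
    for k j :: 2 and c :: real and \<xi> \<eta> :: "real^2"
  have kbk: "kernel_bound (\<lambda>_. 1) (pw (1 - s)) (\<kappa> k j c)" if "\<bar>c\<bar> = 1" for k j c
    unfolding kernel_bound_one_iff
  proof (intro conjI allI decay_L2[OF s])
    show "case_prod (\<kappa> k j c) \<in> borel_measurable (borel \<Otimes>\<^sub>M borel)" unfolding \<kappa>_def by measurable
    fix \<xi> \<eta> :: "real^2"
    have a: "\<bar>(\<xi> - \<eta>) $ k / norm (\<xi> - \<eta>)\<bar> \<le> 1" using component_le_norm_cart[of "\<xi> - \<eta>" k] by (auto simp: divide_le_eq_1)
    have b: "\<bar>\<eta> $ j / (2 * pi)\<bar> \<le> japanese \<eta>"
    proof -
      have "\<bar>\<eta> $ j\<bar> / (2 * pi) \<le> \<bar>\<eta> $ j\<bar> / 1" using pi_ge_two by (intro divide_left_mono) auto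
      then show ?thesis using component_le_norm_cart[of \<eta> j] norm_le_japanese[of \<eta>] by simp
    qed
    have "\<bar>\<kappa> k j c \<xi> \<eta>\<bar> = \<bar>c\<bar> * (\<bar>(\<xi> - \<eta>) $ k / norm (\<xi> - \<eta>)\<bar> * \<bar>\<eta> $ j / (2 * pi)\<bar>) * (pw (- s) (\<xi> - \<eta>) * pw (- s) \<eta>)"
      by (simp add: \<kappa>_def abs_mult)
    also have "\<dots> \<le> 1 * (1 * japanese \<eta>) * (1 * pw (- s) \<eta>)"
      using a b s that by (intro mult_mono pw_le_1) (auto simp: less_imp_le)
    also have "\<dots> = pw (1 - s) \<eta>" using pw_add[of 1 \<eta> "- s"] by (simp add: pw_1)
    finally show "\<bar>\<kappa> k j c \<xi> \<eta>\<bar> \<le> pw (1 - s) \<eta> + pw (1 - s) (\<xi> - \<eta>)" by (simp add: add_increasing2)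
  qed auto
  have prod: "(\<lambda>x. c * (riesz k \<theta> x * partial j \<theta> x)) \<in> L2" "Four (real_l2 (\<lambda>x. c * (riesz k \<theta> x * partial j \<theta> x))) = conv_op (\<kappa> k j (- c)) y y"
    if c: "\<bar>c\<bar> = 1" for k j c
  proof -
    let ?q = "\<lambda>\<xi> \<eta>. pw (- s) (\<xi> - \<eta>)"
    have kbq: "kernel_bound (\<lambda>_. 1) (pw (- s)) ?q"
      unfolding kernel_bound_one_iff using q by (auto simp: add_increasing)
    let ?g = "\<lambda>x. complex_of_real (riesz k \<theta> x)" and ?f = "\<lambda>x. complex_of_real (partial j \<theta> x)"
    have p: "(\<lambda>x. ?g x * ?f x) \<in> L2"
      "Four (abs_l2 (\<lambda>x. ?g x * ?f x)) = (1 / (2 * pi)) *\<^sub>R conv_op ?q (abs_l2 (\<lambda>\<xi>. mr k \<xi> * Y \<xi>)) (Four (abs_l2 ?f))"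
      using Four_product[OF L2_of_real[OF partial(1)] L2_of_real[OF riesz(1)] w(1) q _ riesz(2)[unfolded real_l2_def]] by auto
    have rp: "(\<lambda>x. riesz k \<theta> x * partial j \<theta> x) \<in> L2"
    proof (rule L2_bound[OF p(1), where C = 1])
      note [measurable] = L2_measurable[OF riesz(1)] L2_measurable[OF partial(1)]
      show "(\<lambda>x. riesz k \<theta> x * partial j \<theta> x) \<in> borel_measurable borel" by measurable
    qed (simp add: norm_mult abs_mult)
    show "(\<lambda>x. c * (riesz k \<theta> x * partial j \<theta> x)) \<in> L2" using L2_scaleR[OF rp, of c] by simp
    have "Four (real_l2 (\<lambda>x. c * (riesz k \<theta> x * partial j \<theta> x))) = c *\<^sub>R Four (abs_l2 (\<lambda>x. ?g x * ?f x))"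
      unfolding real_l2_scaleR[OF rp] Four_scaleR by (simp add: real_l2_def)
    also have "\<dots> = c *\<^sub>R ((1 / (2 * pi)) *\<^sub>R abs_l2 (conv_fun ?q (\<lambda>\<xi>. mr k \<xi> * Y \<xi>) (\<lambda>\<xi>. mp j \<xi> * (pw (- s) \<xi> *\<^sub>R Y \<xi>))))"
      unfolding p(2) real_l2_def[symmetric] partial(2) conv_op_abs[OF kbq mrY mpY] ..
    also have "\<dots> = abs_l2 (\<lambda>\<xi>. c *\<^sub>R ((1 / (2 * pi)) *\<^sub>R conv_fun ?q (\<lambda>\<xi>. mr k \<xi> * Y \<xi>) (\<lambda>\<xi>. mp j \<xi> * (pw (- s) \<xi> *\<^sub>R Y \<xi>)) \<xi>))"
      using conv_fun_L2(1)[OF kbq mrY mpY] by (simp only: abs_l2_scaleR L2_scaleR)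
    also have "(\<lambda>\<xi>. c *\<^sub>R ((1 / (2 * pi)) *\<^sub>R conv_fun ?q (\<lambda>\<xi>. mr k \<xi> * Y \<xi>) (\<lambda>\<xi>. mp j \<xi> * (pw (- s) \<xi> *\<^sub>R Y \<xi>)) \<xi>)) = conv_fun (\<kappa> k j (- c)) Y Y"
    proof
      fix \<xi>
      have "pw (- s) (\<xi> - \<eta>) *\<^sub>R (mr k (\<xi> - \<eta>) * Y (\<xi> - \<eta>) * (mp j \<eta> * (pw (- s) \<eta> *\<^sub>R Y \<eta>)))
         = (- ((\<xi> - \<eta>) $ k / norm (\<xi> - \<eta>) * \<eta> $ j) * (pw (- s) (\<xi> - \<eta>) * pw (- s) \<eta>)) *\<^sub>R (Y (\<xi> - \<eta>) * Y \<eta>)" for \<eta>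
        unfolding mr_def mp_def scaleR_conv_of_real by (simp add: mult_ac)
      then show "c *\<^sub>R ((1 / (2 * pi)) *\<^sub>R conv_fun ?q (\<lambda>\<xi>. mr k \<xi> * Y \<xi>) (\<lambda>\<xi>. mp j \<xi> * (pw (- s) \<xi> *\<^sub>R Y \<xi>)) \<xi>) = conv_fun (\<kappa> k j (- c)) Y Y \<xi>"
        unfolding conv_fun_def \<kappa>_def integral_scaleR_right[symmetric] by (simp add: mult_ac)
    qed
    finally show "Four (real_l2 (\<lambda>x. c * (riesz k \<theta> x * partial j \<theta> x))) = conv_op (\<kappa> k j (- c)) y y"
      using conv_op_abs[OF kbk YL(1) YL(1), of "- c" k j] c by (simp add: YL)
  qed
  have adv: "advection (sqg_velocity \<theta>) \<theta> = (\<lambda>x. (- 1) * (riesz 2 \<theta> x * partial 1 \<theta> x) + 1 * (riesz 1 \<theta> x * partial 2 \<theta> x))"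
    by (rule ext) (simp add: advection_def sqg_velocity_def sum_2 vector_2)
  have advL: "advection (sqg_velocity \<theta>) \<theta> \<in> L2"
    unfolding adv by (intro L2_add prod) auto
  have "Four (real_l2 (advection (sqg_velocity \<theta>) \<theta>)) = conv_op (\<kappa> 2 1 1) y y + conv_op (\<kappa> 1 2 (- 1)) y y"
  proof -
    have c: "\<bar>- 1::real\<bar> = 1" "\<bar>1::real\<bar> = 1" by auto
    note p1 = prod[OF c(1), of 2 1] and p2 = prod[OF c(2), of 1 2]
    show ?thesis unfolding adv real_l2_add[OF p1(1) p2(1)] Four_add p1(2) p2(2) by simp
  qed
  also have "\<dots> = conv_op (\<lambda>\<xi> \<eta>. \<kappa> 2 1 1 \<xi> \<eta> + \<kappa> 1 2 (- 1) \<xi> \<eta>) y y"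
    by (rule conv_op_add_kernel[OF kbk kbk, symmetric]) auto
  also have "(\<lambda>\<xi> \<eta>. \<kappa> 2 1 1 \<xi> \<eta> + \<kappa> 1 2 (- 1) \<xi> \<eta>) = (\<lambda>\<xi> \<eta>. sqg_symbol (\<xi> - \<eta>) \<eta> * pw (- s) (\<xi> - \<eta>) * pw (- s) \<eta>)"
    by (intro ext) (simp add: \<kappa>_def sqg_symbol_def diff_divide_distrib algebra_simps)
  finally have "Four (real_l2 (advection (sqg_velocity \<theta>) \<theta>)) = wmul (pw (- (s - 1))) (conv_op (sqg_kernel s) y y)"
    by (simp add: wmul_sqg[OF s])
  then have "advection (sqg_velocity \<theta>) \<theta> \<in> sobolev (s - 1) \<and> SH (s - 1) (advection (sqg_velocity \<theta>) \<theta>) = conv_op (sqg_kernel s) y y"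
    using s advL by (subst sobolev_characterization) auto
  then show "advection (sqg_velocity \<theta>) \<theta> \<in> sobolev (s - 1)"
    and "SH (s - 1) (advection (sqg_velocity \<theta>) \<theta>) = conv_op (sqg_kernel s) (SH s \<theta>) (SH s \<theta>)"
    by (auto simp: y_def)
qed

subsection \<open>Local well-posedness\<close>

lemma sobolev_continuous_on_iff:
  assumes "0 \<le> s"
  shows "sobolev_continuous_on s I \<theta> \<longleftrightarrow> (\<forall>t\<in>I. \<theta> t \<in> sobolev s) \<and> continuous_on I (\<lambda>t. SH s (\<theta> t))"
proof -
  have "((\<lambda>\<tau>. sobolev_norm s (\<lambda>x. \<theta> \<tau> x - \<theta> t x)) \<longlongrightarrow> 0) (at t within I) \<longleftrightarrow> ((\<lambda>\<tau>. SH s (\<theta> \<tau>)) \<longlongrightarrow> SH s (\<theta> t)) (at t within I)"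
    if "\<forall>t\<in>I. \<theta> t \<in> sobolev s" "t \<in> I" for t
  proof -
    have "((\<lambda>\<tau>. sobolev_norm s (\<lambda>x. \<theta> \<tau> x - \<theta> t x)) \<longlongrightarrow> 0) (at t within I) \<longleftrightarrow> ((\<lambda>\<tau>. norm (SH s (\<theta> \<tau>) - SH s (\<theta> t))) \<longlongrightarrow> 0) (at t within I)"
    proof (rule tendsto_cong)
      show "\<forall>\<^sub>F \<tau> in at t within I. sobolev_norm s (\<lambda>x. \<theta> \<tau> x - \<theta> t x) = norm (SH s (\<theta> \<tau>) - SH s (\<theta> t))"
        unfolding eventually_at_filter using that assms by (intro always_eventually) (auto simp: sobolev_norm_diff)
    qed
    then show ?thesis by (simp add: tendsto_norm_zero_iff LIM_zero_iff)
  qed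
  then show ?thesis unfolding sobolev_continuous_on_def continuous_on_def by blast
qed

text \<open>The encoding is linear and isometric, so it carries Riemann sums to Riemann sums and
  distances to distances; both integrals are then the same limit along the same filter.\<close>

lemma has_sobolev_integral_iff:
  assumes \<sigma>: "0 \<le> \<sigma>" and F: "\<And>\<tau>. \<tau> \<in> {a..b} \<Longrightarrow> F \<tau> \<in> sobolev \<sigma>" and v: "v \<in> sobolev \<sigma>"
  shows "has_sobolev_integral \<sigma> F v a b \<longleftrightarrow> ((\<lambda>\<tau>. SH \<sigma> (F \<tau>)) has_integral SH \<sigma> v) {a..b}"
proof -
  have "((\<lambda>p. sobolev_norm \<sigma> (\<lambda>x. (\<Sum>(\<tau>, k)\<in>p. measure lborel k * F \<tau> x) - v x)) \<longlongrightarrow> 0) (division_filter {a..b})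
     \<longleftrightarrow> ((\<lambda>p. norm ((\<Sum>(\<tau>, k)\<in>p. measure lborel k *\<^sub>R SH \<sigma> (F \<tau>)) - SH \<sigma> v)) \<longlongrightarrow> 0) (division_filter {a..b})"
  proof (rule tendsto_cong)
    show "\<forall>\<^sub>F p in division_filter {a..b}. sobolev_norm \<sigma> (\<lambda>x. (\<Sum>(\<tau>, k)\<in>p. measure lborel k * F \<tau> x) - v x)
        = norm ((\<Sum>(\<tau>, k)\<in>p. measure lborel k *\<^sub>R SH \<sigma> (F \<tau>)) - SH \<sigma> v)"
      using eventually_division_filter_tagged_division[of "{a..b}"]
    proof eventually_elim
      case (elim p)
      have fin: "finite p" using elim by (rule tagged_division_of_finite)
      \<comment> \<open>Tags of a tagged division lie in the interval, the only place where
        \<open>F\<close> is known to take values in \<open>sobolev \<sigma>\<close>.\<close>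
      have tags: "F (fst i) \<in> sobolev \<sigma>" if "i \<in> p" for i
        using tag_in_interval[OF elim, of "fst i" "snd i"] that F by auto
      have "(\<lambda>x. \<Sum>i\<in>p. measure lborel (snd i) * F (fst i) x) \<in> sobolev \<sigma> \<and>
        SH \<sigma> (\<lambda>x. \<Sum>i\<in>p. measure lborel (snd i) * F (fst i) x) = (\<Sum>i\<in>p. measure lborel (snd i) *\<^sub>R SH \<sigma> (F (fst i)))"
        by (rule sobolev_sum[OF \<sigma> fin]) (rule tags)
      then show ?case
        using sobolev_norm_diff[OF \<sigma> _ v] by (simp add: case_prod_unfold)
    qed
  qed
  also have "\<dots> \<longleftrightarrow> ((\<lambda>\<tau>. SH \<sigma> (F \<tau>)) has_integral SH \<sigma> v) {a..b}"
    using has_integral_cbox[of "\<lambda>\<tau>. SH \<sigma> (F \<tau>)" "SH \<sigma> v" a b]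
    by (simp add: tendsto_norm_zero_iff LIM_zero_iff)
  finally show ?thesis using F v by (simp add: has_sobolev_integral_def)
qed

text \<open>Lifting a solution to functions and encoding it again recovers it only for times in
  \<open>{0..T}\<close>, which are the only ones that \<open>solution\<close> refers to.\<close>

lemma (in quasilinear_equation) solution_cong:
  assumes y: "solution T y\<^sub>0 y" and eq: "\<And>t. t \<in> {0..T} \<Longrightarrow> z t = y t"
  shows "solution T y\<^sub>0 z"
  unfolding solution_def
proof (intro conjI ballI)
  show "continuous_on {0..T} z"
    using y continuous_on_cong[of "{0..T}" "{0..T}" z y] eq by (simp add: solution_def)
  fix t assume t: "t \<in> {0..T}"
  have "((\<lambda>\<tau>. - B (z \<tau>) (z \<tau>)) has_integral (J (y t) - J y\<^sub>0)) {0..t}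
      \<longleftrightarrow> ((\<lambda>\<tau>. - B (y \<tau>) (y \<tau>)) has_integral (J (y t) - J y\<^sub>0)) {0..t}"
    using t by (intro has_integral_cong) (simp add: eq)
  then show "z t \<in> V" "((\<lambda>\<tau>. - B (z \<tau>) (z \<tau>)) has_integral (J (z t) - J y\<^sub>0)) {0..t}"
    using y t by (simp_all add: solution_def eq)
qed

theorem theorem1p1:
  fixes s :: real
  assumes "s > 2"
  shows "sqg_locally_well_posed s"
proof -
  interpret Q: quasilinear_equation "conv_op (sqg_kernel s)" "wmul (pw (- s))" "wmul (pw (1 - s))" "wmul (pw (- 1))"
     "\<lambda>R. wmul (tail_weight R)" "\<lambda>N y. wmul (cutoff N) (herm y)"
     "\<lambda>N y. wmul (\<lambda>\<xi>. japanese \<xi> * cutoff N \<xi>) (herm y)" hermitian "energy_const s" galerkin_error "\<lambda>R. R powr s"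
    by (rule sqg_quasilinear_equation[OF assms])
  have s0: "0 \<le> s" "0 \<le> s - 1" "1 \<le> s" using assms by auto
  let ?F = "\<lambda>\<theta> \<tau> x. - advection (sqg_velocity (\<theta> \<tau>)) (\<theta> \<tau>) x"
  have adv: "(\<lambda>x. - advection (sqg_velocity h) h x) \<in> sobolev (s - 1)"
      "SH (s - 1) (\<lambda>x. - advection (sqg_velocity h) h x) = - conv_op (sqg_kernel s) (SH s h) (SH s h)"
    if "h \<in> sobolev s" for h
    using sobolev_uminus[OF s0(2) advection_sobolev(1)[OF assms that]] advection_sobolev(2)[OF assms that] by auto
  \<comment> \<open>In \<open>sqg_solution\<close> the function \<open>v\<close> is forced to be the
    difference of \<open>\<theta> t\<close> and \<open>\<theta>\<^sub>0\<close> almost everywhere,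
    so the existential statement reduces to an integral identity for the encodings.\<close>
  have sol_iff: "sqg_solution s T \<theta>\<^sub>0 \<theta> \<longleftrightarrow> \<theta>\<^sub>0 \<in> sobolev s \<and> (\<forall>t\<in>{0..T}. \<theta> t \<in> sobolev s) \<and> Q.solution T (SH s \<theta>\<^sub>0) (\<lambda>t. SH s (\<theta> t))"
    for T \<theta>\<^sub>0 \<theta>
  proof (cases "\<theta>\<^sub>0 \<in> sobolev s \<and> (\<forall>t\<in>{0..T}. \<theta> t \<in> sobolev s)")
    case True
    have "(\<exists>v. has_sobolev_integral (s - 1) (?F \<theta>) v 0 t \<and> ae_eq (\<theta> t) (\<lambda>x. \<theta>\<^sub>0 x + v x)) \<longleftrightarrow>
       ((\<lambda>\<tau>. - conv_op (sqg_kernel s) (SH s (\<theta> \<tau>)) (SH s (\<theta> \<tau>))) has_integral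
          (wmul (pw (- 1)) (SH s (\<theta> t)) - wmul (pw (- 1)) (SH s \<theta>\<^sub>0))) {0..t}" (is "?L \<longleftrightarrow> ?R") if t: "t \<in> {0..T}" for t
    proof -
      have \<theta>: "\<theta> \<tau> \<in> sobolev s" if "\<tau> \<in> {0..t}" for \<tau> using True t that by auto
      have F: "?F \<theta> \<tau> \<in> sobolev (s - 1)" if "\<tau> \<in> {0..t}" for \<tau> by (rule adv(1)[OF \<theta>[OF that]])
      note m0 = sobolev_mono[OF s0(3), of \<theta>\<^sub>0] and mt = sobolev_mono[OF s0(3), of "\<theta> t"]
      have int: "has_sobolev_integral (s - 1) (?F \<theta>) v 0 t \<longleftrightarrow>
          ((\<lambda>\<tau>. - conv_op (sqg_kernel s) (SH s (\<theta> \<tau>)) (SH s (\<theta> \<tau>))) has_integral SH (s - 1) v) {0..t}"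
        if "v \<in> sobolev (s - 1)" for v
      proof -
        have "has_sobolev_integral (s - 1) (?F \<theta>) v 0 t \<longleftrightarrow> ((\<lambda>\<tau>. SH (s - 1) (?F \<theta> \<tau>)) has_integral SH (s - 1) v) {0..t}"
          by (rule has_sobolev_integral_iff[OF s0(2) _ that]) (rule F)
        also have "\<dots> \<longleftrightarrow> ((\<lambda>\<tau>. - conv_op (sqg_kernel s) (SH s (\<theta> \<tau>)) (SH s (\<theta> \<tau>))) has_integral SH (s - 1) v) {0..t}"
          by (rule has_integral_cong) (rule adv(2)[OF \<theta>])
        finally show ?thesis .
      qed
      show ?thesis
      proof
        assume ?L
        then obtain v where v: "has_sobolev_integral (s - 1) (?F \<theta>) v 0 t" "ae_eq (\<theta> t) (\<lambda>x. \<theta>\<^sub>0 x + v x)" by blast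
        then have vs: "v \<in> sobolev (s - 1)" by (simp add: has_sobolev_integral_def)
        have \<theta>0: "\<theta>\<^sub>0 \<in> sobolev (s - 1)" and \<theta>t: "\<theta> t \<in> sobolev (s - 1)" using m0(1) mt(1) True t by auto
        have "SH (s - 1) (\<theta> t) = SH (s - 1) \<theta>\<^sub>0 + SH (s - 1) v"
          using SH_ae_cong[OF s0(2) \<theta>t sobolev_add(1)[OF s0(2) \<theta>0 vs] v(2)] sobolev_add(2)[OF s0(2) \<theta>0 vs] by simp
        then have "SH (s - 1) v = wmul (pw (- 1)) (SH s (\<theta> t)) - wmul (pw (- 1)) (SH s \<theta>\<^sub>0)"
          using m0(2) mt(2) True t by (simp add: eq_diff_eq add.commute)
        then show ?R using v(1) int[OF vs] by simp
      next
        assume r: ?R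
        define v where "v x = \<theta> t x - \<theta>\<^sub>0 x" for x
        have v: "v \<in> sobolev (s - 1)" "SH (s - 1) v = wmul (pw (- 1)) (SH s (\<theta> t)) - wmul (pw (- 1)) (SH s \<theta>\<^sub>0)"
          unfolding v_def using sobolev_diff[OF s0(2), of "\<theta> t" \<theta>\<^sub>0] m0 mt True t by auto
        have "has_sobolev_integral (s - 1) (?F \<theta>) v 0 t" using int[OF v(1)] r v(2) by simp
        moreover have "ae_eq (\<theta> t) (\<lambda>x. \<theta>\<^sub>0 x + v x)" by (simp add: ae_eq_def v_def)
        ultimately show ?L by blast
      qed
    qed
    moreover have "\<forall>t\<in>{0..T}. SH s (\<theta> t) \<in> hermitian" using True SH_hermitian[OF s0(1)] by blast
    ultimately show ?thesis
      using True unfolding sqg_solution_def Q.solution_def sobolev_continuous_on_iff[OF s0(1)] by auto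
  next
    case False
    then show ?thesis by (auto simp: sqg_solution_def sobolev_continuous_on_def)
  qed
  have exist: "\<exists>T>0. \<exists>W \<Phi>. sobolev_neighbourhood s \<theta>s W \<and> (\<forall>\<theta>\<^sub>0\<in>W. sqg_solution s T \<theta>\<^sub>0 (\<Phi> \<theta>\<^sub>0)) \<and> continuous_solution_map s T W \<Phi>"
    if \<theta>s: "\<theta>s \<in> sobolev s" for \<theta>s
  proof -
    define M where "M = norm (SH s \<theta>s) + 1"
    define T where "T = Q.life_span M"
    \<comment> \<open>A ball around 0 rather than around \<open>\<theta>s\<close>, because the life
      span is a function of a norm bound. By the choice of \<open>M\<close> it contains the unit
      ball around \<open>\<theta>s\<close>.\<close>
    define W where "W = {g \<in> sobolev s. norm (SH s g) \<le> M}"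
    obtain \<Phi> where sol: "\<And>f. f \<in> hermitian \<Longrightarrow> norm f \<le> M \<Longrightarrow> Q.solution T f (\<Phi> f)"
      and cont: "\<And>f e. f \<in> hermitian \<Longrightarrow> norm f \<le> M \<Longrightarrow> 0 < e \<Longrightarrow> \<exists>\<delta>>0. \<forall>g\<in>hermitian. norm g \<le> M \<and> norm (g - f) < \<delta> \<longrightarrow>
        (\<forall>t\<in>{0..T}. norm (\<Phi> g t - \<Phi> f t) < e)"
      using Q.local_well_posedness[of M] unfolding T_def by blast
    \<comment> \<open>Chooses a real function for each encoding. It is meaningful for Hermitian
      arguments, such as the values of \<open>\<Phi>\<close> at times in
      \<open>{0..T}\<close>.\<close>
    define lift where "lift Y = (SOME f. f \<in> sobolev s \<and> SH s f = Y)" for Y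
    have lift: "lift Y \<in> sobolev s" "SH s (lift Y) = Y" if Y: "Y \<in> hermitian" for Y
    proof -
      obtain f where "f \<in> sobolev s \<and> SH s f = Y" using SH_surj[OF s0(1) Y] by blast
      then have "lift Y \<in> sobolev s \<and> SH s (lift Y) = Y" unfolding lift_def by (rule someI[of "\<lambda>f. f \<in> sobolev s \<and> SH s f = Y"])
      then show "lift Y \<in> sobolev s" "SH s (lift Y) = Y" by auto
    qed
    define \<Psi> where "\<Psi> \<theta>\<^sub>0 t = lift (\<Phi> (SH s \<theta>\<^sub>0) t)" for \<theta>\<^sub>0 t
    have Wh: "SH s g \<in> hermitian" "norm (SH s g) \<le> M" "g \<in> sobolev s" if "g \<in> W" for g
      using that SH_hermitian[OF s0(1)] by (auto simp: W_def)
    have \<Phi>h: "\<Phi> (SH s g) t \<in> hermitian" if "g \<in> W" "t \<in> {0..T}" for g t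
      using sol[OF Wh(1,2)[OF that(1)]] that(2) by (auto simp: Q.solution_def)
    have \<Psi>: "\<Psi> g t \<in> sobolev s" "SH s (\<Psi> g t) = \<Phi> (SH s g) t" if "g \<in> W" "t \<in> {0..T}" for g t
      unfolding \<Psi>_def using lift[OF \<Phi>h[OF that]] by auto
    have "sobolev_neighbourhood s \<theta>s W"
      unfolding sobolev_neighbourhood_def
    proof (intro conjI exI[of _ 1])
      show "W \<subseteq> sobolev s" by (auto simp: W_def)
      show "{g \<in> sobolev s. sobolev_norm s (\<lambda>x. g x - \<theta>s x) < 1} \<subseteq> W"
      proof
        fix g assume "g \<in> {g \<in> sobolev s. sobolev_norm s (\<lambda>x. g x - \<theta>s x) < 1}"
        then have g: "g \<in> sobolev s" "norm (SH s g - SH s \<theta>s) < 1"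
          by (auto simp: sobolev_norm_diff[OF s0(1) _ \<theta>s])
        then show "g \<in> W" using norm_triangle_sub[of "SH s g" "SH s \<theta>s"] by (simp add: W_def M_def)
      qed
    qed simp
    moreover have "sqg_solution s T \<theta>\<^sub>0 (\<Psi> \<theta>\<^sub>0)" if "\<theta>\<^sub>0 \<in> W" for \<theta>\<^sub>0
    proof -
      have "Q.solution T (SH s \<theta>\<^sub>0) (\<lambda>t. SH s (\<Psi> \<theta>\<^sub>0 t))"
        by (rule Q.solution_cong[OF sol[OF Wh(1,2)[OF that]]]) (rule \<Psi>(2)[OF that])
      then show ?thesis using Wh(3)[OF that] \<Psi>(1)[OF that] by (simp add: sol_iff)
    qed
    moreover have "continuous_solution_map s T W \<Psi>"
      unfolding continuous_solution_map_def
    proof (intro ballI allI impI)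
      fix f and \<epsilon> :: real assume f: "f \<in> W" and "0 < \<epsilon>"
      then obtain \<delta> where \<delta>: "0 < \<delta>" "\<And>g t. g \<in> hermitian \<Longrightarrow> norm g \<le> M \<Longrightarrow> norm (g - SH s f) < \<delta> \<Longrightarrow> t \<in> {0..T} \<Longrightarrow>
           norm (\<Phi> g t - \<Phi> (SH s f) t) < \<epsilon>"
        using cont[OF Wh(1,2)[OF f] \<open>0 < \<epsilon>\<close>] by blast
      have "sobolev_norm s (\<lambda>x. \<Psi> g t x - \<Psi> f t x) < \<epsilon>"
        if "g \<in> W" "sobolev_norm s (\<lambda>x. g x - f x) < \<delta>" "t \<in> {0..T}" for g t
        using \<delta>(2)[OF Wh(1,2)[OF that(1)] _ that(3)] that
        by (simp add: sobolev_norm_diff[OF s0(1)] Wh(3) f \<Psi>)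
      then show "\<exists>\<delta>>0. \<forall>g\<in>W. sobolev_norm s (\<lambda>x. g x - f x) < \<delta> \<longrightarrow> (\<forall>t\<in>{0..T}. sobolev_norm s (\<lambda>x. \<Psi> g t x - \<Psi> f t x) < \<epsilon>)"
        using \<delta>(1) by blast
    qed
    moreover have "0 < T" unfolding T_def by (rule Q.life_span_pos)
    ultimately show ?thesis by blast
  qed
  have unique: "ae_eq (\<theta> t) (\<theta>' t)" if "sqg_solution s T \<theta>\<^sub>0 \<theta>" "sqg_solution s T \<theta>\<^sub>0 \<theta>'" "t \<in> {0..T}" for T \<theta>\<^sub>0 \<theta> \<theta>' t
  proof (rule SH_eq_imp_ae_eq[OF s0(1)])
    show "\<theta> t \<in> sobolev s" "\<theta>' t \<in> sobolev s" using that by (auto simp: sol_iff)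
    show "SH s (\<theta> t) = SH s (\<theta>' t)"
      using Q.solution_unique[of T "SH s \<theta>\<^sub>0" "\<lambda>t. SH s (\<theta> t)" "\<lambda>t. SH s (\<theta>' t)" t] that by (simp add: sol_iff)
  qed
  show ?thesis
    unfolding sqg_locally_well_posed_def using exist unique by blast
qed

end
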